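(* Let $V\in C^\infty(\mathbb R^n;\mathbb R)$ be $\mathbb Z^n$-periodic, i.e. $V(x+\gamma)=V(x)$ for all $\gamma\in\mathbb Z^n$, and suppose that there exists a fundamental domain $F$ of $\mathbb Z^n$ such that $V|_{\partial F}>\min V$. For $h>0$ let $P_{\rm d}(h)$ be the selfadjoint operator on $\ell^2(\mathbb Z^n)$ $$(P_{\rm d}(h)v)(\gamma):=\sum_{j=1}^n\big(2v(\gamma)-v(\gamma+e_j)-v(\gamma-e_j)\big)+V(h\gamma)v(\gamma),\quad \gamma\in\mathbb Z^n,$$ and let $P_{\rm c}(h)$ be the selfadjoint operator on $L^2(\mathbb R^n)$ with domain $H^2(\mathbb R^n)$ $$P_{\rm c}(h)u(x):=-\Delta u(x)+V(hx)u(x),\quad x\in\mathbb R^n.$$ Then, as $h\to0^+$, $$d(h):=\frac{\min\operatorname{Spec}(P_{\rm d}(h))}{\min\operatorname{Spec}(P_{\rm c}(h))}=1+\mathcal O(h).$$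
   Context: Here $e_1,\dots,e_n$ is the standard basis of $\mathbb Z^n$, and a fundamental domain of $\mathbb Z^n$ is a fundamental domain for the action of $\mathbb Z^n$ on $\mathbb R^n$ by translations. The notation $d(h)=1+\mathcal O(h)$ means that there are constants $C,h_0>0$ (depending on $V$) such that $|d(h)-1|\le Ch$ for $0<h<h_0$. *)

theory Defs
  imports "HOL-Analysis.Analysis"
begin

section \<open>Smooth functions\<close>

primrec C_k :: "nat \<Rightarrow> (real^'n \<Rightarrow> 'b::real_normed_vector) \<Rightarrow> bool" where
  "C_k 0 f \<longleftrightarrow> continuous_on UNIV f"
| "C_k (Suc k) f \<longleftrightarrow> (\<forall>x. f differentiable (at x)) \<and>
     (\<forall>i. C_k k (\<lambda>x. frechet_derivative f (at x) (axis i 1)))"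

definition smooth :: "(real^'n \<Rightarrow> 'b::real_normed_vector) \<Rightarrow> bool" where
  "smooth f \<longleftrightarrow> (\<forall>k. C_k k f)"

definition test_function :: "(real^'n \<Rightarrow> complex) \<Rightarrow> bool" where
  "test_function \<phi> \<longleftrightarrow> smooth \<phi> \<and> compact (closure {x. \<phi> x \<noteq> 0})"

section \<open>The lattice\<close>

definition lattice_vec :: "int^'n \<Rightarrow> real^'n" where
  "lattice_vec \<gamma> = (\<chi> i. of_int (\<gamma> $ i))"

definition lattice_periodic :: "(real^'n \<Rightarrow> real) \<Rightarrow> bool" where
  "lattice_periodic V \<longleftrightarrow> (\<forall>x \<gamma>. V (x + lattice_vec \<gamma>) = V x)"

text \<open>Conventions for fundamental domains differ: a set with exactly one point in each orbit,
  a closed set whose translates cover and have disjoint interiors, or an open set whose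
  translates are disjoint while their closures cover. The definition below is satisfied by
  all of these.\<close>

definition fundamental_domain :: "(real^'n) set \<Rightarrow> bool" where
  "fundamental_domain F \<longleftrightarrow>
     (\<Union>\<gamma>. (+) (lattice_vec \<gamma>) ` closure F) = UNIV \<and>
     (\<forall>\<gamma> \<delta>. \<gamma> \<noteq> \<delta> \<longrightarrow>
        (+) (lattice_vec \<gamma>) ` interior F \<inter> (+) (lattice_vec \<delta>) ` interior F = {})"

section \<open>Spectra of operators on \<open>L\<^sup>2\<close>\<close>

text \<open>Elements of \<open>L\<^sup>2(M)\<close> are represented by functions, with equality almost everywhere
  in place of passing to the quotient.\<close>

definition L2 :: "'a measure \<Rightarrow> ('a \<Rightarrow> complex) set" where
  "L2 M = {f. f \<in> borel_measurable M \<and> integrable M (\<lambda>x. (cmod (f x))\<^sup>2)}"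

definition L2_norm :: "'a measure \<Rightarrow> ('a \<Rightarrow> complex) \<Rightarrow> real" where
  "L2_norm M f = sqrt (LINT x|M. (cmod (f x))\<^sup>2)"

text \<open>For an operator \<open>A\<close> with domain \<open>D\<close>, the point \<open>z\<close> is in the resolvent set if
  \<open>A - z\<close> is a bijection from \<open>D\<close> onto \<open>L\<^sup>2(M)\<close> (modulo null sets) with bounded inverse.\<close>

definition resolvent_set ::
  "'a measure \<Rightarrow> ('a \<Rightarrow> complex) set \<Rightarrow> (('a \<Rightarrow> complex) \<Rightarrow> 'a \<Rightarrow> complex) \<Rightarrow> complex set" where
  "resolvent_set M D A = {z. \<exists>C. \<forall>f\<in>L2 M. \<exists>u\<in>D.
      (AE x in M. A u x - z * u x = f x) \<and>
      L2_norm M u \<le> C * L2_norm M f \<and>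
      (\<forall>w\<in>D. (AE x in M. A w x - z * w x = f x) \<longrightarrow> (AE x in M. w x = u x))}"

definition spectrum ::
  "'a measure \<Rightarrow> ('a \<Rightarrow> complex) set \<Rightarrow> (('a \<Rightarrow> complex) \<Rightarrow> 'a \<Rightarrow> complex) \<Rightarrow> complex set" where
  "spectrum M D A = - resolvent_set M D A"

text \<open>Intended for selfadjoint operators, whose spectrum is real. Since \<^term>\<open>Least\<close> is
  unspecified when there is no least element, using this value requires the minimum to exist.\<close>

definition min_spec ::
  "'a measure \<Rightarrow> ('a \<Rightarrow> complex) set \<Rightarrow> (('a \<Rightarrow> complex) \<Rightarrow> 'a \<Rightarrow> complex) \<Rightarrow> real" where
  "min_spec M D A = (LEAST r::real. complex_of_real r \<in> spectrum M D A)"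

section \<open>Sobolev spaces\<close>

definition weak_partial ::
  "'n \<Rightarrow> (real^'n \<Rightarrow> complex) \<Rightarrow> (real^'n \<Rightarrow> complex) \<Rightarrow> bool" where
  "weak_partial i u g \<longleftrightarrow> (\<forall>\<phi>. test_function \<phi> \<longrightarrow>
     (LINT x|lborel. u x * frechet_derivative \<phi> (at x) (axis i 1)) =
     - (LINT x|lborel. g x * \<phi> x))"

definition H1 :: "(real^'n \<Rightarrow> complex) set" where
  "H1 = {u \<in> L2 lborel. \<forall>i. \<exists>g\<in>L2 lborel. weak_partial i u g}"

definition H2 :: "(real^'n \<Rightarrow> complex) set" where
  "H2 = {u \<in> L2 lborel. \<forall>i. \<exists>g\<in>H1. weak_partial i u g}"

text \<open>Weak derivatives are unique almost everywhere, so the choice of representative below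
  is immaterial.\<close>

definition weak_D :: "'n \<Rightarrow> (real^'n \<Rightarrow> complex) \<Rightarrow> real^'n \<Rightarrow> complex" where
  "weak_D i u = (SOME g. g \<in> L2 lborel \<and> weak_partial i u g)"

definition laplacian :: "(real^'n \<Rightarrow> complex) \<Rightarrow> real^'n \<Rightarrow> complex" where
  "laplacian u x = (\<Sum>i\<in>UNIV. weak_D i (weak_D i u) x)"

section \<open>The discrete and the continuous operator\<close>

definition P_d ::
  "(real^'n \<Rightarrow> real) \<Rightarrow> real \<Rightarrow> (int^'n \<Rightarrow> complex) \<Rightarrow> int^'n \<Rightarrow> complex" where
  "P_d V h v \<gamma> = (\<Sum>j\<in>UNIV. 2 * v \<gamma> - v (\<gamma> + axis j 1) - v (\<gamma> - axis j 1))
     + complex_of_real (V (h *\<^sub>R lattice_vec \<gamma>)) * v \<gamma>"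

definition P_c ::
  "(real^'n \<Rightarrow> real) \<Rightarrow> real \<Rightarrow> (real^'n \<Rightarrow> complex) \<Rightarrow> real^'n \<Rightarrow> complex" where
  "P_c V h u x = - laplacian u x + complex_of_real (V (h *\<^sub>R x)) * u x"

text \<open>The space \<open>\<ell>\<^sup>2(\<int>\<^sup>n)\<close> is \<open>L\<^sup>2\<close> of the counting measure.\<close>

definition min_spec_d :: "(real^'n \<Rightarrow> real) \<Rightarrow> real \<Rightarrow> real" where
  "min_spec_d V h = min_spec (count_space UNIV) (L2 (count_space UNIV)) (P_d V h)"

definition min_spec_c :: "(real^'n \<Rightarrow> real) \<Rightarrow> real \<Rightarrow> real" where
  "min_spec_c V h = min_spec lborel H2 (P_c V h)"

end

theory Submission
  imports Defs
begin

text \<open>The bottom of each spectrum is the best constant in the corresponding form inequality, over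
  finitely supported \<open>v\<close> respectively compactly supported \<open>C\<^sup>2\<close> functions \<open>u\<close>. For the continuous
  operator this needs that \<open>-\<Delta> + \<mu>\<close> maps \<open>H\<^sup>2\<close> onto \<open>L\<^sup>2\<close>; the complement of the range vanishes by the
  maximum principle applied to mollifications.

  After subtracting \<open>min V\<close>, let \<open>a\<close> and \<open>b\<close> be the continuous and the discrete bottom, and let
  \<open>\<beta>\<close> be the tensor product cubic B-spline. Sampling \<open>u\<close> on the lattice shifted by \<open>s\<close> and averaging
  over \<open>s\<close> with weight \<open>\<beta>(s)\<close> gives \<open>b \<le> (1 + C h) a + C h\<^sup>3\<close>; interpolating \<open>v\<close> by
  \<open>\<Sum>v(\<gamma>) \<beta>(x - \<gamma>)\<close> gives the converse estimate \<open>a - C h\<^sup>3 \<le> (1 + C h + C a) b\<close>. In both cases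
  the first order Taylor term of \<open>V\<close> cancels by symmetry, and the second order term is integrated
  (summed) by parts and absorbed using \<open>|\<nabla>V|\<^sup>2 \<le> C V\<close>. Since the domain hypothesis makes \<open>V\<close>
  nonconstant, \<open>a \<ge> c h\<^sup>2\<close>, so the \<open>h\<^sup>3\<close> errors are relative errors of order \<open>h\<close>; a rescaled bump at
  a minimum of \<open>V\<close> shows \<open>a \<le> C h\<close>.\<close>

section \<open>\<open>L\<^sup>2\<close> as a real Hilbert space of functions\<close>

text \<open>What counts is the relative error: when the minimum of \<open>V\<close> is 0, both
  spectral bottoms tend to 0, and the continuous one is only known to be at least of order h^2.
  Hence errors of order h^2 times the norm must not remain, and the kinetic energies must be
  compared with constant exactly 1. This selects the kernel. It has to be a partition of unity, to
  preserve norms under averaging; its lattice second moments have to be a constant multiple of the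
  identity, so that the quadratic Taylor term is a multiple of the Laplacian of \<open>V\<close> at
  every point; it has to be C^2, so that combinations of translates are admissible trial functions;
  and its derivative has to be a difference, at integer distance, of a kernel of mass one, so that
  differences of coefficients become derivatives without loss. The cubic B-spline does all this. The
  price is that spline functions are local averages of their coefficients and lose norm. The loss is
  at most a multiple of the discrete kinetic energy, and multiplied by \<open>a\<close> it produces
  the term \<open>C a\<close> of the converse estimate; the upper bound on \<open>a\<close> makes
  that term harmless.\<close>

definition L2_inner :: "'a measure \<Rightarrow> ('a \<Rightarrow> complex) \<Rightarrow> ('a \<Rightarrow> complex) \<Rightarrow> real" where
  "L2_inner M f g = (LINT x|M. f x \<bullet> g x)"

text \<open>Common source of the Cauchy-Schwarz inequality in L2, of its version for a degenerate
  nonnegative form, of the orthogonality of a minimiser and of the gradient bound for a nonnegative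
  function. The case \<open>c = 0\<close> is separate because there the vertex
  \<open>- b / c\<close> does not exist.\<close>

lemma discriminant_le:
  fixes a b c :: real
  assumes "\<And>t. 0 \<le> a + 2 * t * b + t\<^sup>2 * c" and "0 \<le> a" and "0 \<le> c"
  shows "b\<^sup>2 \<le> a * c"
proof (cases "c = 0")
  case True
  have "b = 0"
  proof (rule ccontr)
    assume "b \<noteq> 0"
    then have "a + 2 * (- (a + 1) / (2 * b)) * b = -1" by (simp add: field_simps)
    with assms(1)[of "- (a + 1) / (2 * b)"] True show False by simp
  qed
  with True show ?thesis by simp
next
  case False
  with assms have c: "c > 0" by simp
  have "a + 2 * (- b / c) * b + (- b / c)\<^sup>2 * c = a - b\<^sup>2 / c"
    using c by (simp add: field_simps power2_eq_square)
  with assms(1)[of "- b / c"] have "b\<^sup>2 / c \<le> a" by simp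
  with c show ?thesis by (simp add: field_simps)
qed

section \<open>Square-integrable functions, their real inner product and norm\<close>

lemma L2_measurable [measurable_dest]: "f \<in> L2 M \<Longrightarrow> f \<in> borel_measurable M"
  by (simp add: L2_def)

lemma L2_integrable: "f \<in> L2 M \<Longrightarrow> integrable M (\<lambda>x. (cmod (f x))\<^sup>2)"
  by (simp add: L2_def)

lemma norm_mult_le_squares: "a * b \<le> a\<^sup>2 + b\<^sup>2" for a b :: real
  using sum_squares_bound[of a b] zero_le_power2[of a] zero_le_power2[of b] by linarith

lemma norm_add_square_le:
  fixes a b :: "'a::real_normed_vector"
  shows "(norm (a + b))\<^sup>2 \<le> 2 * (norm a)\<^sup>2 + 2 * (norm b)\<^sup>2"
proof -
  have "(norm (a + b))\<^sup>2 \<le> (norm a + norm b)\<^sup>2"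
    by (intro power_mono norm_triangle_ineq) simp
  also have "\<dots> \<le> 2 * (norm a)\<^sup>2 + 2 * (norm b)\<^sup>2"
    using sum_squares_bound[of "norm a" "norm b"] by (simp add: power2_sum)
  finally show ?thesis .
qed

lemma L2_lin:
  assumes f: "f \<in> L2 M" and g: "g \<in> L2 M"
  shows "(\<lambda>x. f x + t *\<^sub>R g x) \<in> L2 M"
proof -
  have [measurable]: "f \<in> borel_measurable M" "g \<in> borel_measurable M" using f g by (simp_all add: L2_def)
  have "integrable M (\<lambda>x. (cmod (f x + t *\<^sub>R g x))\<^sup>2)"
  proof (rule Bochner_Integration.integrable_bound)
    show "integrable M (\<lambda>x. 2 * (cmod (f x))\<^sup>2 + 2 * t\<^sup>2 * (cmod (g x))\<^sup>2)"
      using f g by (intro Bochner_Integration.integrable_add integrable_mult_right) (simp_all add: L2_def)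
    show "AE x in M. norm ((cmod (f x + t *\<^sub>R g x))\<^sup>2) \<le> norm (2 * (cmod (f x))\<^sup>2 + 2 * t\<^sup>2 * (cmod (g x))\<^sup>2)"
      using norm_add_square_le[of "f _" "t *\<^sub>R g _"] by (auto simp: power_mult_distrib mult.assoc intro!: AE_I2)
  qed simp
  then show ?thesis by (simp add: L2_def)
qed

lemma L2_add: "f \<in> L2 M \<Longrightarrow> g \<in> L2 M \<Longrightarrow> (\<lambda>x. f x + g x) \<in> L2 M"
  using L2_lin[of f M g 1] by simp

lemma L2_diff: "f \<in> L2 M \<Longrightarrow> g \<in> L2 M \<Longrightarrow> (\<lambda>x. f x - g x) \<in> L2 M"
  using L2_lin[of f M g "-1"] by simp

lemma L2_zero: "(\<lambda>x. 0) \<in> L2 M"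
  by (simp add: L2_def)

lemma L2_scaleR: "g \<in> L2 M \<Longrightarrow> (\<lambda>x. t *\<^sub>R g x) \<in> L2 M"
  using L2_lin[OF L2_zero, of g M t] by simp

lemma L2_sum: "(\<And>i. i \<in> I \<Longrightarrow> f i \<in> L2 M) \<Longrightarrow> (\<lambda>x. \<Sum>i\<in>I. f i x) \<in> L2 M"
  by (induction I rule: infinite_finite_induct) (auto simp: L2_zero intro: L2_add)

lemma L2_bounded_mult:
  assumes f: "f \<in> L2 M" and a: "a \<in> borel_measurable M" "\<And>x. cmod (a x) \<le> B"
  shows "(\<lambda>x. a x * f x) \<in> L2 M"
proof -
  note [measurable] = a(1) L2_measurable[OF f]
  have "integrable M (\<lambda>x. (cmod (a x * f x))\<^sup>2)"
  proof (rule Bochner_Integration.integrable_bound)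
    show "integrable M (\<lambda>x. B\<^sup>2 * (cmod (f x))\<^sup>2)" using f by (auto simp: L2_def)
    show "AE x in M. norm ((cmod (a x * f x))\<^sup>2) \<le> norm (B\<^sup>2 * (cmod (f x))\<^sup>2)"
      using a(2) by (auto simp: norm_mult power_mult_distrib intro!: AE_I2 mult_right_mono power_mono)
  qed simp
  then show ?thesis by (simp add: L2_def)
qed

lemma L2_integrable_mult:
  assumes f: "f \<in> L2 M" and g: "g \<in> L2 M"
  shows "integrable M (\<lambda>x. f x * g x)"
proof -
  note [measurable] = L2_measurable[OF f] L2_measurable[OF g]
  show ?thesis
  proof (rule Bochner_Integration.integrable_bound)
    show "integrable M (\<lambda>x. (cmod (f x))\<^sup>2 + (cmod (g x))\<^sup>2)" using f g by (simp add: L2_def)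
    show "AE x in M. norm (f x * g x) \<le> norm ((cmod (f x))\<^sup>2 + (cmod (g x))\<^sup>2)"
      using norm_mult_le_squares by (auto simp: norm_mult intro!: AE_I2)
  qed simp
qed

text \<open>The inner product on complex numbers is the real one, so \<open>L2_inner\<close> is the
  real part of the usual Hermitian product. Quadratic forms of symmetric operators are real, and
  complex linearity is recovered by testing with multiples by the imaginary unit.\<close>

lemma inner_complex_eq_Re: "x \<bullet> y = Re (x * cnj y)" for x y :: complex
  by (simp add: inner_complex_def)

lemma L2_cnj:
  assumes "f \<in> L2 M"
  shows "(\<lambda>x. cnj (f x)) \<in> L2 M"
  using assms measurable_compose[OF L2_measurable[OF assms]
      borel_measurable_continuous_onI[OF continuous_on_cnj[OF continuous_on_id]]]
  by (simp add: L2_def)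

lemma L2_integrable_inner:
  assumes "f \<in> L2 M" "g \<in> L2 M"
  shows "integrable M (\<lambda>x. f x \<bullet> g x)"
  using L2_integrable_mult[OF assms(1) L2_cnj[OF assms(2)]] unfolding inner_complex_eq_Re
  by (rule integrable_Re)

lemma L2_inner_commute: "L2_inner M f g = L2_inner M g f"
  by (simp add: L2_inner_def inner_commute)

lemma L2_inner_lin_left:
  assumes "f \<in> L2 M" "g \<in> L2 M" "k \<in> L2 M"
  shows "L2_inner M (\<lambda>x. f x + t *\<^sub>R g x) k = L2_inner M f k + t * L2_inner M g k"
  unfolding L2_inner_def using L2_integrable_inner[OF assms(1,3)] L2_integrable_inner[OF assms(2,3)]
  by (simp add: inner_add_left)

lemma L2_inner_lin_right:
  assumes "f \<in> L2 M" "g \<in> L2 M" "k \<in> L2 M"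
  shows "L2_inner M k (\<lambda>x. f x + t *\<^sub>R g x) = L2_inner M k f + t * L2_inner M k g"
  using L2_inner_lin_left[OF assms] by (simp add: L2_inner_commute)

lemma L2_inner_add_left:
  "f \<in> L2 M \<Longrightarrow> g \<in> L2 M \<Longrightarrow> k \<in> L2 M \<Longrightarrow> L2_inner M (\<lambda>x. f x + g x) k = L2_inner M f k + L2_inner M g k"
  using L2_inner_lin_left[of f M g k 1] by simp

lemma L2_inner_diff_left:
  "f \<in> L2 M \<Longrightarrow> g \<in> L2 M \<Longrightarrow> k \<in> L2 M \<Longrightarrow> L2_inner M (\<lambda>x. f x - g x) k = L2_inner M f k - L2_inner M g k"
  using L2_inner_lin_left[of f M g k "-1"] by simp

lemma L2_inner_diff_right:
  "f \<in> L2 M \<Longrightarrow> g \<in> L2 M \<Longrightarrow> k \<in> L2 M \<Longrightarrow> L2_inner M k (\<lambda>x. f x - g x) = L2_inner M k f - L2_inner M k g"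
  using L2_inner_lin_right[of f M g k "-1"] by simp

lemma L2_inner_scaleR_left: "L2_inner M (\<lambda>x. t *\<^sub>R f x) k = t * L2_inner M f k"
  by (simp add: L2_inner_def)

lemma L2_inner_scaleR_right: "L2_inner M k (\<lambda>x. t *\<^sub>R f x) = t * L2_inner M k f"
  by (simp add: L2_inner_def)

lemma L2_inner_sum_left:
  "(\<And>i. i \<in> I \<Longrightarrow> f i \<in> L2 M) \<Longrightarrow> k \<in> L2 M \<Longrightarrow> L2_inner M (\<lambda>x. \<Sum>i\<in>I. f i x) k = (\<Sum>i\<in>I. L2_inner M (f i) k)"
  unfolding L2_inner_def inner_sum_left by (intro Bochner_Integration.integral_sum L2_integrable_inner)

lemma L2_inner_cong_AE:
  assumes "AE x in M. f x = f' x" "AE x in M. g x = g' x"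
    and "f \<in> L2 M" "g \<in> L2 M" "f' \<in> L2 M" "g' \<in> L2 M"
  shows "L2_inner M f g = L2_inner M f' g'"
  unfolding L2_inner_def
proof (rule integral_cong_AE)
  show "AE x in M. f x \<bullet> g x = f' x \<bullet> g' x" using assms(1,2) by eventually_elim simp
qed (use assms in \<open>auto simp: L2_def\<close>)

lemma L2_inner_ge_0: "0 \<le> L2_inner M f f"
  by (simp add: L2_inner_def)

lemma L2_norm_ge_0 [simp]: "0 \<le> L2_norm M f"
  by (simp add: L2_norm_def)

lemma L2_norm_square: "(L2_norm M f)\<^sup>2 = L2_inner M f f"
  by (simp add: L2_norm_def L2_inner_def power2_norm_eq_inner)

lemma L2_norm_cong_AE:
  assumes "AE x in M. f x = g x" "f \<in> L2 M" "g \<in> L2 M"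
  shows "L2_norm M f = L2_norm M g"
  unfolding L2_norm_def
  by (rule arg_cong[where f = sqrt], rule integral_cong_AE) (use assms in \<open>auto simp: L2_def\<close>)

lemma L2_norm_minus: "L2_norm M (\<lambda>x. f x - g x) = L2_norm M (\<lambda>x. g x - f x)"
  by (simp add: L2_norm_def norm_minus_commute)

lemma L2_norm_scaleR: "L2_norm M (\<lambda>x. t *\<^sub>R f x) = \<bar>t\<bar> * L2_norm M f"
  by (simp add: L2_norm_def power_mult_distrib real_sqrt_mult)

lemma L2_inner_expand:
  assumes "f \<in> L2 M" "g \<in> L2 M"
  shows "L2_inner M (\<lambda>x. f x + t *\<^sub>R g x) (\<lambda>x. f x + t *\<^sub>R g x)
    = L2_inner M f f + 2 * t * L2_inner M f g + t\<^sup>2 * L2_inner M g g"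
  using assms
  by (simp add: L2_inner_lin_left L2_inner_lin_right L2_lin L2_inner_commute[of M g f] power2_eq_square algebra_simps)

lemma L2_Cauchy_Schwarz:
  assumes f: "f \<in> L2 M" and g: "g \<in> L2 M"
  shows "\<bar>L2_inner M f g\<bar> \<le> L2_norm M f * L2_norm M g"
proof -
  have "(L2_inner M f g)\<^sup>2 \<le> L2_inner M f f * L2_inner M g g"
  proof (rule discriminant_le)
    show "0 \<le> L2_inner M f f + 2 * t * L2_inner M f g + t\<^sup>2 * L2_inner M g g" for t
      unfolding L2_inner_expand[OF f g, symmetric] by (rule L2_inner_ge_0)
  qed (rule L2_inner_ge_0)+
  then have "(L2_inner M f g)\<^sup>2 \<le> (L2_norm M f * L2_norm M g)\<^sup>2"
    by (simp add: power_mult_distrib L2_norm_square)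
  then show ?thesis
    using power2_le_iff_abs_le[of "L2_norm M f * L2_norm M g"] by simp
qed

lemma L2_norm_triangle:
  assumes f: "f \<in> L2 M" and g: "g \<in> L2 M"
  shows "L2_norm M (\<lambda>x. f x + g x) \<le> L2_norm M f + L2_norm M g"
proof (rule power2_le_imp_le)
  have "(L2_norm M (\<lambda>x. f x + g x))\<^sup>2 = L2_inner M f f + 2 * L2_inner M f g + L2_inner M g g"
    using L2_inner_expand[OF f g, of 1] by (simp add: L2_norm_square)
  also have "\<dots> \<le> (L2_norm M f + L2_norm M g)\<^sup>2"
    using L2_Cauchy_Schwarz[OF f g] by (simp add: power2_sum L2_norm_square[symmetric])
  finally show "(L2_norm M (\<lambda>x. f x + g x))\<^sup>2 \<le> (L2_norm M f + L2_norm M g)\<^sup>2" .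
qed simp

lemma L2_norm_triangle_diff:
  assumes "f \<in> L2 M" "g \<in> L2 M" "k \<in> L2 M"
  shows "L2_norm M (\<lambda>x. f x - k x) \<le> L2_norm M (\<lambda>x. f x - g x) + L2_norm M (\<lambda>x. g x - k x)"
  using L2_norm_triangle[OF L2_diff[OF assms(1,2)] L2_diff[OF assms(2,3)]] by simp

lemma L2_norm_eq_0:
  assumes "f \<in> L2 M" "L2_norm M f = 0"
  shows "AE x in M. f x = 0"
proof -
  have "AE x in M. (cmod (f x))\<^sup>2 = 0"
    using assms integral_nonneg_eq_0_iff_AE[of M "\<lambda>x. (cmod (f x))\<^sup>2"] by (simp add: L2_def L2_norm_def)
  then show ?thesis by simp
qed

lemma L2_norm_nn_integral:
  assumes "f \<in> L2 M"
  shows "(\<integral>\<^sup>+ x. ennreal ((cmod (f x))\<^sup>2) \<partial>M) = ennreal ((L2_norm M f)\<^sup>2)"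
  using nn_integral_eq_integral[OF L2_integrable[OF assms]] by (simp add: L2_norm_def)

section \<open>Completeness, contractions and density in L2\<close>

lemma L2_inner_tendsto:
  assumes f: "\<And>n. f n \<in> L2 M" "f' \<in> L2 M" and g: "\<And>n. g n \<in> L2 M" "g' \<in> L2 M"
    and "(\<lambda>n. L2_norm M (\<lambda>x. f n x - f' x)) \<longlonglongrightarrow> 0" and "(\<lambda>n. L2_norm M (\<lambda>x. g n x - g' x)) \<longlonglongrightarrow> 0"
  shows "(\<lambda>n. L2_inner M (f n) (g n)) \<longlonglongrightarrow> L2_inner M f' g'"
proof -
  let ?F = "\<lambda>n. L2_norm M (\<lambda>x. f n x - f' x)" and ?G = "\<lambda>n. L2_norm M (\<lambda>x. g n x - g' x)"
  have "norm (L2_inner M (f n) (g n) - L2_inner M f' g') \<le> ?F n * ?G n + ?F n * L2_norm M g' + L2_norm M f' * ?G n" for n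
  proof -
    have "L2_inner M (f n) (g n) - L2_inner M f' g' =
      L2_inner M (\<lambda>x. f n x - f' x) (\<lambda>x. g n x - g' x) + L2_inner M (\<lambda>x. f n x - f' x) g' + L2_inner M f' (\<lambda>x. g n x - g' x)"
      unfolding L2_inner_diff_left[OF f(1)[of n] f(2) g(2)] L2_inner_diff_right[OF g(1)[of n] g(2) f(2)]
        L2_inner_diff_left[OF f(1)[of n] f(2) L2_diff[OF g(1)[of n] g(2)]] L2_inner_diff_right[OF g(1)[of n] g(2) f(1)[of n]]
      by linarith
    then show ?thesis
      using L2_Cauchy_Schwarz[OF L2_diff[OF f(1)[of n] f(2)] L2_diff[OF g(1)[of n] g(2)]]
        L2_Cauchy_Schwarz[OF L2_diff[OF f(1)[of n] f(2)] g(2)]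
        L2_Cauchy_Schwarz[OF f(2) L2_diff[OF g(1)[of n] g(2)]] by simp
  qed
  moreover from assms(5,6) have "(\<lambda>n. ?F n * ?G n + ?F n * L2_norm M g' + L2_norm M f' * ?G n) \<longlonglongrightarrow> 0"
    by (auto intro!: tendsto_eq_intros)
  ultimately have "(\<lambda>n. L2_inner M (f n) (g n) - L2_inner M f' g') \<longlonglongrightarrow> 0"
    by (rule Lim_null_comparison[OF always_eventually[OF allI]])
  then show ?thesis by (rule LIM_zero_cancel)
qed

text \<open>Riesz-Fischer: a subsequence with geometrically small increments converges almost
  everywhere, and Fatou's lemma turns the pointwise limit into a limit in norm for the whole
  sequence.\<close>

lemma L2_complete:
  assumes f: "\<And>n. f n \<in> L2 M"
    and Cauchy: "\<And>e. e > 0 \<Longrightarrow> \<exists>N. \<forall>m\<ge>N. \<forall>n\<ge>N. L2_norm M (\<lambda>x. f m x - f n x) < e"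
  shows "\<exists>g\<in>L2 M. (\<lambda>n. L2_norm M (\<lambda>x. f n x - g x)) \<longlonglongrightarrow> 0"
proof -
  note [measurable] = L2_measurable[OF f]
  have "\<exists>N. \<forall>k. \<forall>m\<ge>N k. \<forall>n\<ge>N k. L2_norm M (\<lambda>x. f m x - f n x) < (1/2)^k"
    using Cauchy by (intro choice) simp
  then obtain N where N: "\<And>k m n. m \<ge> N k \<Longrightarrow> n \<ge> N k \<Longrightarrow> L2_norm M (\<lambda>x. f m x - f n x) < (1/2)^k" by blast
  \<comment> \<open>Partial sums of \<open>N\<close> make \<open>r\<close> monotone and large enough
    for every earlier accuracy, so that \<open>r k \<ge> N i\<close> for all
    \<open>i \<le> k\<close>.\<close>
  define r where "r k = (\<Sum>i\<le>k. N i)" for k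
  have rN: "r k \<ge> N k" "r (Suc k) \<ge> N k" "r k \<ge> N i" if "i \<le> k" for k i
    using that by (auto simp: r_def intro: member_le_sum trans_le_add1)
  define d where "d k x = f (r (Suc k)) x - f (r k) x" for k x
  have d: "d k \<in> L2 M" for k unfolding d_def by (intro L2_diff f)
  have d': "L2_norm M (d k) < (1/2)^k" for k
    unfolding d_def using rN[of k k] by (intro N) auto
  \<comment> \<open>The weight \<open>(3/2)^k\<close> leaves the squares summable, since
    \<open>3/2 * 1/4 = 3/8 < 1\<close>, and still controls the increments themselves: completing the
    square gives \<open>2 * cmod (d k x) \<le> w k x + (2/3)^k\<close>. This works for measures of
    infinite total mass, where L2 does not embed into L1.\<close>
  define w where "w k x = (cmod (d k x))\<^sup>2 * (3/2)^k" for k x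
  have wm[measurable]: "w k \<in> borel_measurable M" for k unfolding w_def d_def by measurable
  have "(\<integral>\<^sup>+ x. (\<Sum>k. ennreal (w k x)) \<partial>M) = (\<Sum>k. \<integral>\<^sup>+ x. ennreal (w k x) \<partial>M)"
    by (intro nn_integral_suminf) measurable
  also have "\<dots> \<le> (\<Sum>k. ennreal ((3/8)^k))"
  proof (rule suminf_le)
    fix k
    have "(\<integral>\<^sup>+ x. ennreal (w k x) \<partial>M) = ennreal ((3/2)^k) * (\<integral>\<^sup>+ x. ennreal ((cmod (d k x))\<^sup>2) \<partial>M)"
      unfolding w_def by (subst nn_integral_cmult[symmetric])
        (use L2_measurable[OF d] in \<open>auto intro!: nn_integral_cong simp: ennreal_mult'[symmetric] mult.commute\<close>)
    also have "\<dots> = ennreal ((3/2)^k * (L2_norm M (d k))\<^sup>2)"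
      by (simp add: L2_norm_nn_integral[OF d] ennreal_mult')
    also have "\<dots> \<le> ennreal ((3/2)^k * ((1/2)^k)\<^sup>2)"
      using d'[of k] by (intro ennreal_leI mult_left_mono power_mono) auto
    also have "((3/2)^k * ((1/2)^k)\<^sup>2 :: real) = (3/8)^k"
      by (simp add: power2_eq_square flip: power_mult_distrib)
    finally show "(\<integral>\<^sup>+ x. ennreal (w k x) \<partial>M) \<le> ennreal ((3/8)^k)" .
  qed auto
  also have "\<dots> = ennreal (\<Sum>k. (3/8)^k)"
    by (intro suminf_ennreal2) (auto intro!: summable_geometric)
  also have "\<dots> < \<infinity>" by simp
  finally have "(\<integral>\<^sup>+ x. (\<Sum>k. ennreal (w k x)) \<partial>M) \<noteq> \<infinity>" by simp
  then have "AE x in M. (\<Sum>k. ennreal (w k x)) \<noteq> \<infinity>"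
    by (intro nn_integral_noteq_infinite) auto
  then have conv: "AE x in M. convergent (\<lambda>k. f (r k) x)"
  proof eventually_elim
    case (elim x)
    have sw: "summable (\<lambda>k. w k x)"
      by (rule summable_suminf_not_top) (use elim in \<open>auto simp: w_def\<close>)
    have sg: "summable (\<lambda>k. (2/3::real)^k)" by (intro summable_geometric) simp
    have "cmod (d k x) \<le> w k x + (2/3)^k" for k
    proof -
      have p: "(2/3::real)^k * (3/2)^k = 1" by (simp flip: power_mult_distrib)
      have "2 * cmod (d k x) \<le> (cmod (d k x))\<^sup>2 * (3/2)^k + (2/3)^k"
      proof -
        have "0 \<le> (3/2)^k * (cmod (d k x) - (2/3)^k)\<^sup>2" by simp
        also have "\<dots> = (cmod (d k x))\<^sup>2 * (3/2)^k - 2 * cmod (d k x) * ((2/3::real)^k * (3/2)^k) + ((2/3::real)^k * (3/2)^k) * (2/3)^k"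
          by (simp add: power2_eq_square algebra_simps)
        finally show ?thesis unfolding p by simp
      qed
      then show ?thesis unfolding w_def using norm_ge_zero[of "d k x"] by linarith
    qed
    then have "summable (\<lambda>k. d k x)"
      by (intro summable_comparison_test[OF _ summable_add[OF sw sg]]) auto
    then have "convergent (\<lambda>n. \<Sum>k<n. d k x)" by (simp add: summable_iff_convergent)
    moreover have "(\<Sum>k<n. d k x) = f (r n) x - f (r 0) x" for n
      unfolding d_def by (rule sum_lessThan_telescope)
    ultimately have "convergent (\<lambda>n. f (r n) x - f (r 0) x)" by simp
    then have "convergent (\<lambda>n. (f (r n) x - f (r 0) x) + f (r 0) x)"
      by (intro convergent_add convergent_const)
    then show ?case by simp
  qed
  \<comment> \<open>Where the subsequence diverges \<open>lim\<close> has some unspecified value;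
    this is a null set, and \<open>g\<close> is measurable in any case.\<close>
  define g where "g x = lim (\<lambda>k. f (r k) x)" for x
  have gm[measurable]: "g \<in> borel_measurable M" unfolding g_def by measurable
  have lim: "AE x in M. (\<lambda>k. f (r k) x) \<longlonglongrightarrow> g x"
    using conv by eventually_elim (simp add: g_def convergent_LIMSEQ_iff)
  \<comment> \<open>Fatou along the subsequence: for \<open>j \<ge> k\<close> the index
    \<open>r j\<close> is beyond \<open>N k\<close>, so \<open>f (r j)\<close> is within
    \<open>(1/2)^k\<close> of \<open>f n\<close>.\<close>
  have bound: "(\<integral>\<^sup>+ x. ennreal ((cmod (f n x - g x))\<^sup>2) \<partial>M) \<le> ennreal (((1/2)^k)\<^sup>2)" if n: "n \<ge> N k" for n k
  proof -
    have "(\<integral>\<^sup>+ x. ennreal ((cmod (f n x - g x))\<^sup>2) \<partial>M) = (\<integral>\<^sup>+ x. liminf (\<lambda>j. ennreal ((cmod (f n x - f (r j) x))\<^sup>2)) \<partial>M)"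
    proof (rule nn_integral_cong_AE, use lim in eventually_elim)
      case (elim x)
      then have "(\<lambda>j. ennreal ((cmod (f n x - f (r j) x))\<^sup>2)) \<longlonglongrightarrow> ennreal ((cmod (f n x - g x))\<^sup>2)"
        by (intro tendsto_intros)
      from lim_imp_Liminf[OF sequentially_bot this] show ?case by simp
    qed
    also have "\<dots> \<le> liminf (\<lambda>j. \<integral>\<^sup>+ x. ennreal ((cmod (f n x - f (r j) x))\<^sup>2) \<partial>M)"
      by (intro nn_integral_liminf) measurable
    also have "\<dots> \<le> liminf (\<lambda>j::nat. ennreal (((1/2)^k)\<^sup>2))"
    proof (rule Liminf_mono, rule eventually_sequentiallyI[of k])
      fix j assume j: "k \<le> j"
      have "(\<integral>\<^sup>+ x. ennreal ((cmod (f n x - f (r j) x))\<^sup>2) \<partial>M) = ennreal ((L2_norm M (\<lambda>x. f n x - f (r j) x))\<^sup>2)"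
        by (intro L2_norm_nn_integral L2_diff f)
      also have "\<dots> \<le> ennreal (((1/2)^k)\<^sup>2)"
        using N[of k n "r j"] n rN(3)[OF j] by (intro ennreal_leI power_mono) auto
      finally show "(\<integral>\<^sup>+ x. ennreal ((cmod (f n x - f (r j) x))\<^sup>2) \<partial>M) \<le> ennreal (((1/2)^k)\<^sup>2)" .
    qed
    also have "\<dots> = ennreal (((1/2)^k)\<^sup>2)" by (simp add: Liminf_const)
    finally show ?thesis .
  qed
  have fg: "(\<lambda>x. f n x - g x) \<in> L2 M" if "n \<ge> N k" for n k
    unfolding L2_def using bound[OF that]
    by (auto simp: integrable_iff_bounded intro: le_less_trans)
  have g: "g \<in> L2 M" using L2_diff[OF f[of "N 0"] fg[OF order_refl, of 0]] by simp
  have small: "L2_norm M (\<lambda>x. f n x - g x) \<le> (1/2)^k" if "n \<ge> N k" for n k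
  proof (rule power2_le_imp_le)
    have "ennreal ((L2_norm M (\<lambda>x. f n x - g x))\<^sup>2) \<le> ennreal (((1/2)^k)\<^sup>2)"
      using bound[OF that] L2_norm_nn_integral[OF L2_diff[OF f[of n] g]] by simp
    then show "(L2_norm M (\<lambda>x. f n x - g x))\<^sup>2 \<le> ((1/2)^k)\<^sup>2"
      by (subst (asm) ennreal_le_iff) auto
  qed simp
  have "(\<lambda>n. L2_norm M (\<lambda>x. f n x - g x)) \<longlonglongrightarrow> 0"
  proof (rule LIMSEQ_I)
    fix e :: real assume "e > 0"
    then obtain k where "(1/2)^k < e" using real_arch_pow_inv[of e "1/2"] by auto
    then have "norm (L2_norm M (\<lambda>x. f n x - g x) - 0) < e" if "n \<ge> N k" for n
      using small[OF that] by simp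
    then show "\<exists>n0. \<forall>n\<ge>n0. norm (L2_norm M (\<lambda>x. f n x - g x) - 0) < e" by blast
  qed
  with g show ?thesis by blast
qed

lemma L2_convergent_Cauchy:
  assumes f: "\<And>n. f n \<in> L2 M" "g \<in> L2 M" and "(\<lambda>n. L2_norm M (\<lambda>x. f n x - g x)) \<longlonglongrightarrow> 0" and "e > 0"
  shows "\<exists>N. \<forall>m\<ge>N. \<forall>n\<ge>N. L2_norm M (\<lambda>x. f m x - f n x) < e"
proof -
  obtain N where N: "\<And>n. n \<ge> N \<Longrightarrow> L2_norm M (\<lambda>x. f n x - g x) < e / 2"
    using LIMSEQ_D[OF assms(3), of "e/2"] \<open>e > 0\<close> by auto
  have "L2_norm M (\<lambda>x. f m x - f n x) < e" if "m \<ge> N" "n \<ge> N" for m n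
    using L2_norm_triangle_diff[OF f(1)[of m] f(2) f(1)[of n]] N[OF that(1)] N[OF that(2)]
      L2_norm_minus[of M g "f n"] by simp
  then show ?thesis by blast
qed

text \<open>Banach's fixed point theorem, started at 0. Equality holds only almost everywhere
  because the iteration takes place on functions and not on classes; the contraction bound also
  shows that \<open>T\<close> respects almost everywhere equality.\<close>

lemma L2_contraction:
  assumes T: "\<And>u. u \<in> L2 M \<Longrightarrow> T u \<in> L2 M"
    and q: "0 \<le> q" "q < 1"
    and contr: "\<And>u w. u \<in> L2 M \<Longrightarrow> w \<in> L2 M \<Longrightarrow>
      L2_norm M (\<lambda>x. T u x - T w x) \<le> q * L2_norm M (\<lambda>x. u x - w x)"
  shows "\<exists>u\<in>L2 M. AE x in M. T u x = u x"
proof -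
  define f where "f n = (T ^^ n) (\<lambda>x. 0)" for n
  have f: "f n \<in> L2 M" for n by (induction n) (auto simp: f_def L2_zero T)
  have fS: "f (Suc n) = T (f n)" for n by (simp add: f_def)
  define K where "K = L2_norm M (\<lambda>x. f 1 x - f 0 x)"
  have step: "L2_norm M (\<lambda>x. f (Suc n) x - f n x) \<le> q^n * K" for n
  proof (induction n)
    case (Suc n)
    have "L2_norm M (\<lambda>x. f (Suc (Suc n)) x - f (Suc n) x) \<le> q * L2_norm M (\<lambda>x. f (Suc n) x - f n x)"
      using contr[OF f[of "Suc n"] f[of n]] by (simp add: fS)
    also have "\<dots> \<le> q * (q^n * K)" by (intro mult_left_mono Suc q)
    finally show ?case by simp
  qed (simp add: K_def)
  have K0: "K \<ge> 0" by (simp add: K_def)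
  \<comment> \<open>The factor \<open>1 - q^p\<close> is the exact geometric partial sum; without it
    the induction on \<open>p\<close> would not close.\<close>
  have tail: "L2_norm M (\<lambda>x. f (n + p) x - f n x) \<le> q^n * K / (1 - q) * (1 - q^p)" for n p
  proof (induction p)
    case 0 then show ?case by (simp add: L2_norm_def)
  next
    case (Suc p)
    have "L2_norm M (\<lambda>x. f (n + Suc p) x - f n x) \<le> L2_norm M (\<lambda>x. f (Suc (n + p)) x - f (n + p) x) + L2_norm M (\<lambda>x. f (n + p) x - f n x)"
      using L2_norm_triangle_diff[OF f[of "Suc (n + p)"] f[of "n + p"] f[of n]] by simp
    also have "\<dots> \<le> q^(n + p) * K + q^n * K / (1 - q) * (1 - q^p)"
      by (intro add_mono step Suc)
    also have "\<dots> = q^n * K / (1 - q) * (1 - q^Suc p)"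
      using q by (simp add: power_add field_simps)
    finally show ?case .
  qed
  have tail': "L2_norm M (\<lambda>x. f m x - f n x) \<le> q^n * K / (1 - q)" if "m \<ge> n" for m n
  proof -
    have "L2_norm M (\<lambda>x. f m x - f n x) \<le> q^n * K / (1 - q) * (1 - q^(m - n))" using tail[of n "m - n"] that by simp
    also have "\<dots> \<le> q^n * K / (1 - q) * 1"
      using q K0 by (intro mult_left_mono) auto
    finally show ?thesis by simp
  qed
  have lim: "(\<lambda>n. q^n * K / (1 - q)) \<longlonglongrightarrow> 0"
    using q by (auto intro!: tendsto_eq_intros LIMSEQ_realpow_zero)
  have "\<exists>N. \<forall>m\<ge>N. \<forall>n\<ge>N. L2_norm M (\<lambda>x. f m x - f n x) < e" if "e > 0" for e
  proof -
    obtain N where N: "\<And>n. n \<ge> N \<Longrightarrow> q^n * K / (1 - q) < e"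
      using order_tendstoD(2)[OF lim \<open>e > 0\<close>] by (auto simp: eventually_sequentially)
    have "L2_norm M (\<lambda>x. f m x - f n x) < e" if "m \<ge> N" "n \<ge> N" for m n
    proof (cases "n \<le> m")
      case True then show ?thesis using tail'[of n m] N[OF that(2)] by linarith
    next
      case False then show ?thesis using tail'[of m n] N[OF that(1)] L2_norm_minus[of M "f m" "f n"] by linarith
    qed
    then show ?thesis by blast
  qed
  then obtain u where u: "u \<in> L2 M" "(\<lambda>n. L2_norm M (\<lambda>x. f n x - u x)) \<longlonglongrightarrow> 0"
    using L2_complete[of f M] f by blast
  have "L2_norm M (\<lambda>x. T u x - u x) \<le> q * L2_norm M (\<lambda>x. f n x - u x) + L2_norm M (\<lambda>x. f (Suc n) x - u x)" for n
    using L2_norm_triangle_diff[OF T[OF u(1)] f[of "Suc n"] u(1)] contr[OF u(1) f[of n]] L2_norm_minus[of M u "f n"]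
    by (simp add: fS)
  moreover have "(\<lambda>n. q * L2_norm M (\<lambda>x. f n x - u x) + L2_norm M (\<lambda>x. f (Suc n) x - u x)) \<longlonglongrightarrow> q * 0 + 0"
    by (intro tendsto_intros u(2) LIMSEQ_Suc[OF u(2)])
  ultimately have "L2_norm M (\<lambda>x. T u x - u x) \<le> 0"
    by (intro LIMSEQ_le_const[of _ "0"]) auto
  then have "L2_norm M (\<lambda>x. T u x - u x) = 0" by (simp add: antisym)
  from L2_norm_eq_0[OF L2_diff[OF T[OF u(1)] u(1)] this] u(1) show ?thesis by auto
qed

text \<open>Orthogonal projection onto the closure of \<open>S\<close>. A minimising sequence in
  \<open>S\<close> is Cauchy by the parallelogram law, the difference of \<open>f\<close> and its
  limit is orthogonal to \<open>S\<close>, and by \<open>triv\<close> it vanishes, so the minimising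
  sequence itself approaches \<open>f\<close>.\<close>

lemma L2_dense_if_orthogonal_trivial:
  assumes S: "S \<subseteq> L2 M" "S \<noteq> {}" and lin: "\<And>s s' t. s \<in> S \<Longrightarrow> s' \<in> S \<Longrightarrow> (\<lambda>x. s x + t *\<^sub>R s' x) \<in> S"
    and triv: "\<And>g. g \<in> L2 M \<Longrightarrow> (\<And>s. s \<in> S \<Longrightarrow> L2_inner M g s = 0) \<Longrightarrow> AE x in M. g x = 0"
    and f: "f \<in> L2 M" and "e > 0"
  shows "\<exists>s\<in>S. L2_norm M (\<lambda>x. f x - s x) < e"
proof -
  let ?d2 = "\<lambda>s. L2_inner M (\<lambda>x. f x - s x) (\<lambda>x. f x - s x)"
  define d where "d = Inf (?d2 ` S)"
  have bdd: "bdd_below (?d2 ` S)" by (rule bdd_belowI[of _ 0]) (auto simp: L2_inner_ge_0)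
  have dle: "d \<le> ?d2 s" if "s \<in> S" for s unfolding d_def using that bdd by (intro cInf_lower) auto
  have "\<exists>s\<in>S. ?d2 s < d + 1 / real (Suc n)" for n
    using cInf_lessD[of "?d2 ` S" "d + 1 / real (Suc n)"] S by (force simp: d_def)
  then obtain s where s: "\<And>n. s n \<in> S" "\<And>n. ?d2 (s n) < d + 1 / real (Suc n)" by metis
  have sL: "s n \<in> L2 M" for n using S s by auto
  \<comment> \<open>Parallelogram law: the midpoint of \<open>s m\<close> and \<open>s n\<close>
    lies in \<open>S\<close>, hence has squared distance at least \<open>d\<close> from
    \<open>f\<close>.\<close>
  have para: "L2_inner M (\<lambda>x. s m x - s n x) (\<lambda>x. s m x - s n x) \<le> 2 * (1 / real (Suc m)) + 2 * (1 / real (Suc n))" for m n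
  proof -
    let ?a = "\<lambda>x. f x - s m x" and ?b = "\<lambda>x. f x - s n x"
    have ab: "?a \<in> L2 M" "?b \<in> L2 M" using f sL by (auto intro: L2_diff)
    have mid: "(\<lambda>x. s m x + (1/2) *\<^sub>R (s n x + (-1) *\<^sub>R s m x)) \<in> S"
      by (intro lin s)
    have half: "(\<lambda>x. f x - (s m x + (1/2) *\<^sub>R (s n x + (-1) *\<^sub>R s m x))) = (\<lambda>x. (1/2) *\<^sub>R (?a x + 1 *\<^sub>R ?b x))"
      by (rule ext) (simp add: complex_eq_iff algebra_simps)
    have "d \<le> 1/4 * L2_inner M (\<lambda>x. ?a x + 1 *\<^sub>R ?b x) (\<lambda>x. ?a x + 1 *\<^sub>R ?b x)"
      using dle[OF mid] unfolding half L2_inner_scaleR_left L2_inner_scaleR_right by simp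
    moreover have "(\<lambda>x. s m x - s n x) = (\<lambda>x. ?b x + (-1) *\<^sub>R ?a x)" by auto
    ultimately show ?thesis
      using L2_inner_expand[OF ab, of 1] L2_inner_expand[OF ab(2,1), of "-1"] s(2)[of m] s(2)[of n] L2_inner_commute[of M ?a ?b]
      by simp
  qed
  have "\<exists>N. \<forall>m\<ge>N. \<forall>n\<ge>N. L2_norm M (\<lambda>x. s m x - s n x) < e'" if e: "e' > 0" for e'
  proof -
    obtain N where N: "1 / real (Suc N) < e'\<^sup>2 / 4"
      using nat_approx_posE[of "e'\<^sup>2 / 4"] e by (metis zero_less_divide_iff zero_less_numeral zero_less_power)
    have "L2_norm M (\<lambda>x. s m x - s n x) < e'" if "m \<ge> N" "n \<ge> N" for m n
    proof (rule power2_less_imp_less)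
      have "1 / real (Suc m) \<le> 1 / real (Suc N)" "1 / real (Suc n) \<le> 1 / real (Suc N)" using that by (auto simp: frac_le)
      then show "(L2_norm M (\<lambda>x. s m x - s n x))\<^sup>2 < e'\<^sup>2"
        using para[of m n] N by (simp add: L2_norm_square)
    qed (use e in simp)
    then show ?thesis by blast
  qed
  then obtain p where p: "p \<in> L2 M" "(\<lambda>n. L2_norm M (\<lambda>x. s n x - p x)) \<longlonglongrightarrow> 0"
    using L2_complete[of s M] sL by blast
  define g where "g x = f x - p x" for x
  have g: "g \<in> L2 M" unfolding g_def by (intro L2_diff f p)
  have "L2_inner M g s' = 0" if s': "s' \<in> S" for s'
  proof -
    have s'L: "s' \<in> L2 M" using s' S by auto
    have conv: "(\<lambda>n. L2_norm M (\<lambda>x. (f x - s n x) - g x)) \<longlonglongrightarrow> 0"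
      using p(2) unfolding g_def by (simp add: L2_norm_minus[of M p] L2_norm_def norm_minus_commute)
    have fs: "(\<lambda>x. f x - s n x) \<in> L2 M" for n by (intro L2_diff f sL)
    have gg: "(\<lambda>n. ?d2 (s n)) \<longlonglongrightarrow> L2_inner M g g"
      by (rule L2_inner_tendsto[OF fs g fs g conv conv])
    have gs: "(\<lambda>n. L2_inner M (\<lambda>x. f x - s n x) s') \<longlonglongrightarrow> L2_inner M g s'"
      by (rule L2_inner_tendsto[OF fs g s'L s'L conv]) (simp add: L2_norm_def)
    have ggd: "L2_inner M g g \<le> d"
    proof -
      have "(\<lambda>n. d + 1 / real (Suc n)) \<longlonglongrightarrow> d + 0"
        by (intro tendsto_intros LIMSEQ_Suc lim_1_over_n)
      then show ?thesis
        using LIMSEQ_le[OF gg, of "\<lambda>n. d + 1 / real (Suc n)" "d + 0"] less_imp_le[OF s(2)] by auto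
    qed
    \<comment> \<open>Perturbing the minimising sequence by multiples of \<open>s'\<close> cannot
      bring the squared distance below \<open>d\<close>. In the limit the constant coefficient is 0,
      so the discriminant forces the linear coefficient to vanish.\<close>
    have "0 \<le> 0 + 2 * t * L2_inner M g s' + t\<^sup>2 * L2_inner M s' s'" for t
    proof -
      have "d \<le> ?d2 (s n) + 2 * t * L2_inner M (\<lambda>x. f x - s n x) s' + t\<^sup>2 * L2_inner M s' s'" for n
        using dle[OF lin[OF s(1)[of n] s', of "-t"]] L2_inner_expand[OF fs[of n] s'L, of t]
        by (simp add: algebra_simps)
      moreover have "(\<lambda>n. ?d2 (s n) + 2 * t * L2_inner M (\<lambda>x. f x - s n x) s' + t\<^sup>2 * L2_inner M s' s')
        \<longlonglongrightarrow> L2_inner M g g + 2 * t * L2_inner M g s' + t\<^sup>2 * L2_inner M s' s'"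
        by (intro tendsto_intros gg gs)
      ultimately have "d \<le> L2_inner M g g + 2 * t * L2_inner M g s' + t\<^sup>2 * L2_inner M s' s'"
        by (intro LIMSEQ_le_const) auto
      with ggd show ?thesis by simp
    qed
    from discriminant_le[OF this] show ?thesis by (simp add: L2_inner_ge_0)
  qed
  then have g0: "AE x in M. g x = 0" by (intro triv g)
  have "L2_norm M (\<lambda>x. f x - s n x) = L2_norm M (\<lambda>x. s n x - p x)" for n
    using L2_norm_cong_AE[where M = M and f = "\<lambda>x. f x - s n x" and g = "\<lambda>x. p x - s n x"] g0 f p sL L2_norm_minus[of M p "s n"]
    by (auto simp: g_def L2_diff)
  then have "\<exists>n. L2_norm M (\<lambda>x. f x - s n x) < e"
    using LIMSEQ_D[OF p(2) \<open>e > 0\<close>] by auto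
  with s show ?thesis by blast
qed

section \<open>The bottom of the spectrum of a semibounded symmetric operator\<close>

text \<open>A symmetric operator whose form has the sharp lower bound \<open>E\<close>. Solvability
  at all real points far to the left stands in for selfadjointness: it is what puts the points below
  \<open>E\<close> into the resolvent set. Linearity of \<open>A\<close> is only almost everywhere,
  because the weak Laplacian picks representatives. The real structure suffices because only real
  spectral points are compared.\<close>

locale semibounded_operator =
  fixes M :: "'a measure" and D :: "('a \<Rightarrow> complex) set" and A :: "('a \<Rightarrow> complex) \<Rightarrow> 'a \<Rightarrow> complex" and E :: real
  assumes D_L2: "u \<in> D \<Longrightarrow> u \<in> L2 M"
    and A_L2: "u \<in> D \<Longrightarrow> A u \<in> L2 M"
    and D_lin: "u \<in> D \<Longrightarrow> w \<in> D \<Longrightarrow> (\<lambda>x. u x + t *\<^sub>R w x) \<in> D"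
    and A_lin: "u \<in> D \<Longrightarrow> w \<in> D \<Longrightarrow> AE x in M. A (\<lambda>x. u x + t *\<^sub>R w x) x = A u x + t *\<^sub>R A w x"
    and symmetric: "u \<in> D \<Longrightarrow> w \<in> D \<Longrightarrow> L2_inner M (A u) w = L2_inner M u (A w)"
    and form_ge: "u \<in> D \<Longrightarrow> E * L2_inner M u u \<le> L2_inner M (A u) u"
    and form_sharp: "(\<And>u. u \<in> D \<Longrightarrow> c * L2_inner M u u \<le> L2_inner M (A u) u) \<Longrightarrow> c \<le> E"
    and surj_far: "\<exists>R. \<forall>r<R. \<forall>f\<in>L2 M. \<exists>u\<in>D. AE x in M. A u x - r *\<^sub>R u x = f x"
begin

lemma norm_bound:
  assumes u: "u \<in> D" and f: "f \<in> L2 M" "AE x in M. A u x - r *\<^sub>R u x = f x" and r: "r < E"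
  shows "(E - r) * L2_norm M u \<le> L2_norm M f"
proof -
  have "L2_inner M f u = L2_inner M (\<lambda>x. A u x + (-r) *\<^sub>R u x) u"
    by (intro L2_inner_cong_AE L2_lin A_L2 D_L2 u f) (use f(2) in auto)
  also have "\<dots> = L2_inner M (A u) u + (-r) * L2_inner M u u"
    using u by (intro L2_inner_lin_left A_L2 D_L2)
  finally have "(E - r) * (L2_norm M u)\<^sup>2 \<le> L2_norm M f * L2_norm M u"
    using form_ge[OF u] L2_Cauchy_Schwarz[OF f(1) D_L2[OF u]] by (simp add: L2_norm_square algebra_simps)
  then show ?thesis
    by (cases "L2_norm M u = 0") (auto simp: power2_eq_square less_le)
qed

lemma AE_lin_solve:
  assumes u: "u \<in> D" "AE x in M. A u x - r *\<^sub>R u x = f x"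
    and w: "w \<in> D" "AE x in M. A w x - r *\<^sub>R w x = g x"
  shows "AE x in M. A (\<lambda>x. u x + t *\<^sub>R w x) x - r *\<^sub>R (u x + t *\<^sub>R w x) = f x + t *\<^sub>R g x"
  using A_lin[OF u(1) w(1), of t] u(2) w(2)
proof eventually_elim
  case (elim x)
  have "A u x = f x + r *\<^sub>R u x" "A w x = g x + r *\<^sub>R w x" using elim(2,3) by (auto simp: algebra_simps)
  with elim(1) show ?case by (simp add: algebra_simps)
qed

text \<open>Write \<open>A - r\<close> as \<open>(A - r0) - (r - r0)\<close> with \<open>r0\<close>
  far to the left. The inverse of \<open>A - r0\<close> has norm at most
  \<open>1 / (E - r0)\<close>, so the fixed point equation has contraction factor
  \<open>q = (r - r0) / (E - r0) < 1\<close>, and a single step reaches every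
  \<open>r < E\<close>.\<close>

lemma surj:
  assumes r: "r < E" and f: "f \<in> L2 M"
  shows "\<exists>u\<in>D. AE x in M. A u x - r *\<^sub>R u x = f x"
proof -
  obtain R where R: "\<And>r f. r < R \<Longrightarrow> f \<in> L2 M \<Longrightarrow> \<exists>u\<in>D. AE x in M. A u x - r *\<^sub>R u x = f x"
    using surj_far by blast
  obtain r0 where r0: "r0 < R" "r0 < r" using lt_ex[of "min R r"] by auto
  define S where "S g = (SOME u. u \<in> D \<and> (AE x in M. A u x - r0 *\<^sub>R u x = g x))" for g
  have S: "S g \<in> D" "AE x in M. A (S g) x - r0 *\<^sub>R S g x = g x" if "g \<in> L2 M" for g
  proof -
    have "\<exists>u. u \<in> D \<and> (AE x in M. A u x - r0 *\<^sub>R u x = g x)" using R[OF r0(1) that] by blast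
    from someI_ex[OF this] show "S g \<in> D" "AE x in M. A (S g) x - r0 *\<^sub>R S g x = g x" by (auto simp: S_def)
  qed
  define q where "q = (r - r0) / (E - r0)"
  have Er0: "E - r0 > 0" using r r0 by simp
  have rhs: "(\<lambda>x. f x + (r - r0) *\<^sub>R u x) \<in> L2 M" if "u \<in> L2 M" for u using f that by (rule L2_lin)
  let ?T = "\<lambda>u. S (\<lambda>x. f x + (r - r0) *\<^sub>R u x)"
  have "\<exists>u\<in>L2 M. AE x in M. ?T u x = u x"
  proof (rule L2_contraction)
    show "?T u \<in> L2 M" if "u \<in> L2 M" for u using D_L2[OF S(1)[OF rhs[OF that]]] .
    show "0 \<le> q" "q < 1" using r r0 by (auto simp: q_def field_simps)
    fix u w assume uw: "u \<in> L2 M" "w \<in> L2 M"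
    have "AE x in M. A (\<lambda>x. ?T u x + (-1) *\<^sub>R ?T w x) x - r0 *\<^sub>R (?T u x + (-1) *\<^sub>R ?T w x)
      = (f x + (r - r0) *\<^sub>R u x) + (-1) *\<^sub>R (f x + (r - r0) *\<^sub>R w x)"
      by (rule AE_lin_solve; intro S rhs uw)
    then have "AE x in M. A (\<lambda>x. ?T u x + (-1) *\<^sub>R ?T w x) x - r0 *\<^sub>R (?T u x + (-1) *\<^sub>R ?T w x)
      = (r - r0) *\<^sub>R (u x - w x)" by eventually_elim (simp add: algebra_simps)
    from norm_bound[OF D_lin[OF S(1)[OF rhs[OF uw(1)]] S(1)[OF rhs[OF uw(2)]]] _ this]
    have "(E - r0) * L2_norm M (\<lambda>x. ?T u x - ?T w x) \<le> L2_norm M (\<lambda>x. (r - r0) *\<^sub>R (u x - w x))"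
      using r r0 uw by (simp add: L2_scaleR L2_diff)
    then show "L2_norm M (\<lambda>x. ?T u x - ?T w x) \<le> q * L2_norm M (\<lambda>x. u x - w x)"
      using Er0 r0 unfolding L2_norm_scaleR q_def by (simp add: field_simps)
  qed
  then obtain u where u: "u \<in> L2 M" "AE x in M. ?T u x = u x" by blast
  have "AE x in M. A (?T u) x - r *\<^sub>R ?T u x = f x"
    using S(2)[OF rhs[OF u(1)]] u(2) by eventually_elim (simp add: algebra_simps)
  with S(1)[OF rhs[OF u(1)]] show ?thesis by blast
qed

lemma below_in_resolvent_set:
  assumes r: "r < E"
  shows "complex_of_real r \<in> resolvent_set M D A"
proof -
  have "\<exists>u\<in>D. (AE x in M. A u x - complex_of_real r * u x = f x) \<and>
      L2_norm M u \<le> (1 / (E - r)) * L2_norm M f \<and>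
      (\<forall>w\<in>D. (AE x in M. A w x - complex_of_real r * w x = f x) \<longrightarrow> (AE x in M. w x = u x))"
    if f: "f \<in> L2 M" for f
  proof -
    from surj[OF r f] obtain u where u: "u \<in> D" "AE x in M. A u x - r *\<^sub>R u x = f x" by blast
    have "AE x in M. w x = u x" if w: "w \<in> D" "AE x in M. A w x - r *\<^sub>R w x = f x" for w
    proof -
      have "AE x in M. A (\<lambda>x. w x + (-1) *\<^sub>R u x) x - r *\<^sub>R (w x + (-1) *\<^sub>R u x) = 0"
        using AE_lin_solve[OF w u, of "-1"] by simp
      from norm_bound[OF D_lin[OF w(1) u(1)] L2_zero this r]
      have "(E - r) * L2_norm M (\<lambda>x. w x - u x) \<le> 0" by (simp add: L2_norm_def)
      then have "L2_norm M (\<lambda>x. w x - u x) = 0"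
        using r L2_norm_ge_0[of M "\<lambda>x. w x - u x"] by (simp add: mult_le_0_iff)
      from L2_norm_eq_0[OF _ this] show ?thesis using w u by (simp add: L2_diff D_L2)
    qed
    moreover have "L2_norm M u \<le> (1 / (E - r)) * L2_norm M f"
      using norm_bound[OF u(1) f u(2) r] r by (simp add: field_simps)
    ultimately show ?thesis using u unfolding scaleR_conv_of_real[symmetric] by blast
  qed
  then show ?thesis unfolding resolvent_set_def by blast
qed

text \<open>If \<open>E\<close> were in the resolvent set with bound \<open>C\<close>, solve
  \<open>(A - E) w = u\<close>. Cauchy-Schwarz for the nonnegative form \<open>a\<close> of
  \<open>A - E\<close> bounds the square of \<open>a w u\<close> by \<open>a w w * a u u\<close>;
  here \<open>a w u\<close> is the squared norm of \<open>u\<close>, and \<open>a w w\<close> is at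
  most \<open>C'\<close> times it. Hence the form bound improves to \<open>E + 1 / C'\<close>,
  against sharpness.\<close>

lemma bottom_in_spectrum: "complex_of_real E \<in> spectrum M D A"
proof (rule ccontr)
  assume "complex_of_real E \<notin> spectrum M D A"
  then obtain C where C: "\<And>f. f \<in> L2 M \<Longrightarrow> \<exists>w\<in>D. (AE x in M. A w x - E *\<^sub>R w x = f x) \<and> L2_norm M w \<le> C * L2_norm M f"
    unfolding spectrum_def resolvent_set_def scaleR_conv_of_real by auto blast
  \<comment> \<open>The bound \<open>C\<close> from the definition of the resolvent set need not be
    positive.\<close>
  define C' where "C' = max C 1"
  have C'0: "C' > 0" by (simp add: C'_def)
  have key: "(E + 1 / C') * L2_inner M u u \<le> L2_inner M (A u) u" if u: "u \<in> D" for u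
  proof -
    note uL = D_L2[OF u]
    obtain w where w: "w \<in> D" "AE x in M. A w x - E *\<^sub>R w x = u x" "L2_norm M w \<le> C * L2_norm M u"
      using C[OF uL] by blast
    define a where "a v z = L2_inner M (A v) z - E * L2_inner M v z" for v z
    have aw: "a w z = L2_inner M u z" if z: "z \<in> D" for z
    proof -
      have "L2_inner M u z = L2_inner M (\<lambda>x. A w x + (-E) *\<^sub>R w x) z"
        by (intro L2_inner_cong_AE L2_lin A_L2 D_L2 u w z) (use w(2) in auto)
      also have "\<dots> = L2_inner M (A w) z + (-E) * L2_inner M w z"
        using w z by (intro L2_inner_lin_left A_L2 D_L2)
      finally show ?thesis by (simp add: a_def)
    qed
    have a_ge: "0 \<le> a v v" if "v \<in> D" for v using form_ge[OF that] by (simp add: a_def)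
    have "(a w u)\<^sup>2 \<le> a w w * a u u"
    proof (rule discriminant_le)
      fix t :: real
      let ?v = "\<lambda>x. w x + t *\<^sub>R u x"
      note L = D_L2[OF w(1)] uL A_L2[OF w(1)] A_L2[OF u]
      have "L2_inner M (A ?v) ?v = L2_inner M (\<lambda>x. A w x + t *\<^sub>R A u x) ?v"
        using A_lin[OF w(1) u, of t] L D_lin[OF w(1) u, of t] by (intro L2_inner_cong_AE) (auto intro: L2_lin A_L2)
      also have "\<dots> = L2_inner M (A w) w + 2 * t * L2_inner M (A w) u + t\<^sup>2 * L2_inner M (A u) u"
        using L trans[OF symmetric[OF u w(1)] L2_inner_commute]
        by (simp add: L2_inner_lin_left L2_inner_lin_right L2_lin power2_eq_square algebra_simps)
      finally have "a ?v ?v = a w w + 2 * t * a w u + t\<^sup>2 * a u u"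
        using L2_inner_expand[OF L(1,2), of t] by (simp add: a_def algebra_simps)
      with a_ge[OF D_lin[OF w(1) u, of t]] show "0 \<le> a w w + 2 * t * a w u + t\<^sup>2 * a u u" by simp
    qed (use a_ge u w in auto)
    moreover have "a w w \<le> C' * L2_inner M u u"
    proof -
      have "a w w \<le> L2_norm M u * L2_norm M w" using aw[OF w(1)] L2_Cauchy_Schwarz[OF uL D_L2[OF w(1)]] by simp
      also have "\<dots> \<le> L2_norm M u * (C * L2_norm M u)" using w(3) by (intro mult_left_mono) auto
      also have "\<dots> = C * L2_inner M u u" by (simp add: L2_norm_square[symmetric] power2_eq_square)
      also have "\<dots> \<le> C' * L2_inner M u u" by (intro mult_right_mono L2_inner_ge_0) (simp add: C'_def)
      finally show ?thesis .
    qed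
    ultimately have "(L2_inner M u u)\<^sup>2 \<le> C' * L2_inner M u u * a u u"
      using aw[OF u] a_ge[OF u] mult_right_mono[of "a w w" "C' * L2_inner M u u" "a u u"] by simp
    then have "L2_inner M u u \<le> C' * a u u"
      using L2_inner_ge_0[of M u] a_ge[OF u] C'0 by (cases "L2_inner M u u = 0") (auto simp: power2_eq_square less_le)
    then show ?thesis using C'0 by (simp add: a_def field_simps)
  qed
  from form_sharp[OF this] C'0 show False by simp
qed

theorem min_spec_eq: "min_spec M D A = E"
  unfolding min_spec_def
proof (rule Least_equality)
  show "complex_of_real E \<in> spectrum M D A" by (rule bottom_in_spectrum)
  show "E \<le> y" if "complex_of_real y \<in> spectrum M D A" for y
    using that below_in_resolvent_set[of y] by (force simp: spectrum_def)
qed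

end

section \<open>Calculus of \<open>C\<^sup>k\<close> functions\<close>

text \<open>The expression inside \<open>C_k\<close>, named so that iterated partial derivatives can
  be written as functions.\<close>

definition pd :: "'n \<Rightarrow> (real^'n \<Rightarrow> 'b::real_normed_vector) \<Rightarrow> real^'n \<Rightarrow> 'b" where
  "pd i f x = frechet_derivative f (at x) (axis i 1)"

lemma C_k_Suc: "C_k (Suc k) f \<longleftrightarrow> (\<forall>x. f differentiable (at x)) \<and> (\<forall>i. C_k k (pd i f))"
  by (simp add: pd_def[abs_def])

declare C_k.simps(2) [simp del]

lemma pd_eqI: "(f has_derivative f') (at x) \<Longrightarrow> pd i f x = f' (axis i 1)"
  using frechet_derivative_at[of f f' x] by (simp add: pd_def)

lemma C_k_Suc_has_derivative: "C_k (Suc k) f \<Longrightarrow> (f has_derivative frechet_derivative f (at x)) (at x)"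
  by (simp add: C_k_Suc frechet_derivative_works)

lemma C_k_pd: "C_k (Suc k) f \<Longrightarrow> C_k k (pd i f)"
  by (simp add: C_k_Suc)

lemma C_k_SucI:
  assumes "\<And>x. (f has_derivative f' x) (at x)" and "\<And>i. C_k k (\<lambda>x. f' x (axis i 1))"
  shows "C_k (Suc k) f"
proof -
  have "pd i f = (\<lambda>x. f' x (axis i 1))" for i using pd_eqI[OF assms(1)] by blast
  with assms show ?thesis by (auto simp: C_k_Suc differentiable_def)
qed

lemma C_k_continuous: "C_k k f \<Longrightarrow> continuous_on UNIV f"
  by (cases k) (auto simp: C_k_Suc intro!: differentiable_imp_continuous_on differentiable_at_imp_differentiable_on)

lemma C_k_SucD: "C_k (Suc k) f \<Longrightarrow> C_k k f"
  by (induction k arbitrary: f) (auto simp: C_k_Suc intro!: differentiable_imp_continuous_on differentiable_at_imp_differentiable_on)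

lemma C_k_mono: "C_k k f \<Longrightarrow> j \<le> k \<Longrightarrow> C_k j f"
  by (induction k) (auto simp: le_Suc_eq dest: C_k_SucD)

lemma C_k_const: "C_k k (\<lambda>x. c)"
proof (induction k arbitrary: c)
  case (Suc k)
  show ?case by (rule C_k_SucI[of _ "\<lambda>x h. 0"]) (auto simp: Suc)
qed simp

lemma C_k_bounded_linear:
  assumes "bounded_linear L"
  shows "C_k k f \<Longrightarrow> C_k k (\<lambda>x. L (f x))"
proof (induction k arbitrary: f)
  case 0
  then show ?case using bounded_linear.continuous_on[OF assms] by simp
next
  case (Suc k)
  have "((\<lambda>x. L (f x)) has_derivative (\<lambda>h. L (frechet_derivative f (at x) h))) (at x)" for x
    by (rule bounded_linear.has_derivative[OF assms C_k_Suc_has_derivative[OF Suc.prems]])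
  then show ?case
    by (rule C_k_SucI) (use Suc.IH[OF C_k_pd[OF Suc.prems]] in \<open>simp add: pd_def[abs_def]\<close>)
qed

lemma pd_bounded_linear:
  assumes "bounded_linear L" "C_k (Suc 0) f"
  shows "pd i (\<lambda>x. L (f x)) x = L (pd i f x)"
  using pd_eqI[OF bounded_linear.has_derivative[OF assms(1) C_k_Suc_has_derivative[OF assms(2)]]]
  by (simp add: pd_def)

lemma C_k_add: "C_k k f \<Longrightarrow> C_k k g \<Longrightarrow> C_k k (\<lambda>x. f x + g x)"
proof (induction k arbitrary: f g)
  case 0 then show ?case by (auto intro: continuous_intros)
next
  case (Suc k)
  have "((\<lambda>x. f x + g x) has_derivative (\<lambda>h. frechet_derivative f (at x) h + frechet_derivative g (at x) h)) (at x)" for x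
    by (intro has_derivative_add C_k_Suc_has_derivative[OF Suc.prems(1)] C_k_Suc_has_derivative[OF Suc.prems(2)])
  then show ?case
    by (rule C_k_SucI) (use Suc.IH[OF C_k_pd[OF Suc.prems(1)] C_k_pd[OF Suc.prems(2)]] in \<open>simp add: pd_def[abs_def]\<close>)
qed

lemma pd_add: "C_k (Suc 0) f \<Longrightarrow> C_k (Suc 0) g \<Longrightarrow> pd i (\<lambda>x. f x + g x) x = pd i f x + pd i g x"
  using pd_eqI[OF has_derivative_add[OF C_k_Suc_has_derivative C_k_Suc_has_derivative]] by (fastforce simp: pd_def)

lemma C_k_bilinear:
  assumes B: "bounded_bilinear B"
  shows "C_k k f \<Longrightarrow> C_k k g \<Longrightarrow> C_k k (\<lambda>x. B (f x) (g x))"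
proof (induction k arbitrary: f g)
  case 0 then show ?case using bounded_bilinear.continuous_on[OF B] by auto
next
  case (Suc k)
  have "((\<lambda>x. B (f x) (g x)) has_derivative
      (\<lambda>h. B (f x) (frechet_derivative g (at x) h) + B (frechet_derivative f (at x) h) (g x))) (at x)" for x
    by (intro bounded_bilinear.FDERIV[OF B] C_k_Suc_has_derivative[OF Suc.prems(1)] C_k_Suc_has_derivative[OF Suc.prems(2)])
  then show ?case
  proof (rule C_k_SucI)
    show "C_k k (\<lambda>x. B (f x) (frechet_derivative g (at x) (axis i 1)) + B (frechet_derivative f (at x) (axis i 1)) (g x))" for i
      using Suc.IH[OF C_k_SucD[OF Suc.prems(1)] C_k_pd[OF Suc.prems(2), of i]]
        Suc.IH[OF C_k_pd[OF Suc.prems(1), of i] C_k_SucD[OF Suc.prems(2)]]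
      by (intro C_k_add) (simp_all add: pd_def[abs_def])
  qed
qed

lemma pd_bilinear:
  assumes "bounded_bilinear B" "C_k (Suc 0) f" "C_k (Suc 0) g"
  shows "pd i (\<lambda>x. B (f x) (g x)) x = B (f x) (pd i g x) + B (pd i f x) (g x)"
  using pd_eqI[OF bounded_bilinear.FDERIV[OF assms(1) C_k_Suc_has_derivative[OF assms(2)] C_k_Suc_has_derivative[OF assms(3)]]]
  by (simp add: pd_def)

lemmas C_k_mult = C_k_bilinear[OF bounded_bilinear_mult]
lemmas C_k_scaleR = C_k_bounded_linear[OF bounded_linear_scaleR_right]
lemmas C_k_of_real = C_k_bounded_linear[OF bounded_linear_of_real]
lemmas C_k_cnj = C_k_bounded_linear[OF bounded_linear_cnj]
lemmas pd_mult = pd_bilinear[OF bounded_bilinear_mult]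
lemmas pd_scaleR = pd_bounded_linear[OF bounded_linear_scaleR_right]
lemmas pd_of_real = pd_bounded_linear[OF bounded_linear_of_real]
lemmas pd_cnj = pd_bounded_linear[OF bounded_linear_cnj]

lemma C_k_lin: "C_k k f \<Longrightarrow> C_k k g \<Longrightarrow> C_k k (\<lambda>x. f x + t *\<^sub>R g x)"
  by (intro C_k_add C_k_scaleR)

lemma C_k_diff: "C_k k f \<Longrightarrow> C_k k g \<Longrightarrow> C_k k (\<lambda>x. f x - g x)"
  using C_k_lin[of k f g "-1"] by simp

lemma pd_lin: "C_k (Suc 0) f \<Longrightarrow> C_k (Suc 0) g \<Longrightarrow> pd i (\<lambda>x. f x + t *\<^sub>R g x) x = pd i f x + t *\<^sub>R pd i g x"
  by (subst pd_add) (auto intro: C_k_scaleR simp: pd_scaleR)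

lemma C_k_sum: "(\<And>j. j \<in> J \<Longrightarrow> C_k k (f j)) \<Longrightarrow> C_k k (\<lambda>x. \<Sum>j\<in>J. f j x)"
  by (induction J rule: infinite_finite_induct) (auto intro: C_k_const C_k_add)

lemma pd_zero: "pd i (\<lambda>x. c) x = 0"
  using pd_eqI[OF has_derivative_const] by blast

lemma pd_sum: "(\<And>j. j \<in> J \<Longrightarrow> C_k (Suc 0) (f j)) \<Longrightarrow> pd i (\<lambda>x. \<Sum>j\<in>J. f j x) x = (\<Sum>j\<in>J. pd i (f j) x)"
  by (induction J rule: infinite_finite_induct) (auto simp: pd_zero pd_add C_k_sum)

lemma C_k_prod:
  fixes f :: "'j \<Rightarrow> real^'n \<Rightarrow> 'b::real_normed_field"
  shows "(\<And>j. j \<in> J \<Longrightarrow> C_k k (f j)) \<Longrightarrow> C_k k (\<lambda>x. \<Prod>j\<in>J. f j x)"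
  by (induction J rule: infinite_finite_induct) (auto intro: C_k_const C_k_mult)

lemma has_derivative_coord:
  assumes "(g has_real_derivative g') (at (x $ i))"
  shows "((\<lambda>x. g (x $ i)) has_derivative (\<lambda>h. g' * h $ i)) (at x)"
  using has_derivative_compose[OF bounded_linear.has_derivative[OF bounded_linear_vec_nth has_derivative_ident], of g "(*) g'" x]
    assms unfolding has_field_derivative_def by simp

lemma pd_coord:
  assumes "(g has_real_derivative g') (at (x $ i))"
  shows "pd j (\<lambda>x. g (x $ i)) x = (if j = i then g' else 0)"
  using pd_eqI[OF has_derivative_coord[OF assms], of j] by (auto simp: axis_def)

lemma C_k_affine: "C_k k f \<Longrightarrow> C_k k (\<lambda>x. f (a + c *\<^sub>R x))"
proof (induction k arbitrary: f)
  case 0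
  then show ?case by (auto intro!: continuous_on_compose2[of UNIV f] continuous_intros)
next
  case (Suc k)
  have "((\<lambda>x. f (a + c *\<^sub>R x)) has_derivative (\<lambda>h. frechet_derivative f (at (a + c *\<^sub>R x)) (c *\<^sub>R h))) (at x)" for x
    by (rule has_derivative_compose[OF _ C_k_Suc_has_derivative[OF Suc.prems]]) (auto intro!: derivative_eq_intros)
  then show ?case
  proof (rule C_k_SucI)
    have "linear (frechet_derivative f (at y))" for y
      using C_k_Suc_has_derivative[OF Suc.prems] by (rule has_derivative_linear)
    then show "C_k k (\<lambda>x. frechet_derivative f (at (a + c *\<^sub>R x)) (c *\<^sub>R axis i 1))" for i
      using C_k_scaleR[OF Suc.IH[OF C_k_pd[OF Suc.prems, of i]], of c] by (simp add: linear_scale pd_def)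
  qed
qed

lemma pd_affine:
  assumes "C_k (Suc 0) f"
  shows "pd i (\<lambda>x. f (a + c *\<^sub>R x)) x = c *\<^sub>R pd i f (a + c *\<^sub>R x)"
proof -
  have "((\<lambda>x. f (a + c *\<^sub>R x)) has_derivative (\<lambda>h. frechet_derivative f (at (a + c *\<^sub>R x)) (c *\<^sub>R h))) (at x)"
    by (rule has_derivative_compose[OF _ C_k_Suc_has_derivative[OF assms]]) (auto intro!: derivative_eq_intros)
  moreover have "linear (frechet_derivative f (at y))" for y
    using C_k_Suc_has_derivative[OF assms] by (rule has_derivative_linear)
  ultimately show ?thesis using pd_eqI by (simp add: linear_scale pd_def)
qed

lemma smooth_C_k: "smooth f \<Longrightarrow> C_k k f"
  by (simp add: smooth_def)

lemma smooth_pd: "smooth f \<Longrightarrow> smooth (pd i f)"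
  unfolding smooth_def using C_k_pd by blast

section \<open>Directional derivatives and Taylor estimates\<close>

lemma pd_sum_axis:
  fixes z :: "real^'n"
  assumes "C_k (Suc 0) f"
  shows "frechet_derivative f (at x) z = (\<Sum>i\<in>UNIV. z $ i *\<^sub>R pd i f x)"
proof -
  have lin: "linear (frechet_derivative f (at x))"
    using C_k_Suc_has_derivative[OF assms] by (rule has_derivative_linear)
  have "z = (\<Sum>i\<in>UNIV. z $ i *\<^sub>R axis i 1)"
    using basis_expansion[of z] by (simp add: scalar_mult_eq_scaleR)
  then have "frechet_derivative f (at x) z = frechet_derivative f (at x) (\<Sum>i\<in>UNIV. z $ i *\<^sub>R axis i 1)" by simp
  also have "\<dots> = (\<Sum>i\<in>UNIV. z $ i *\<^sub>R pd i f x)"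
    by (simp add: linear_sum[OF lin] linear_scale[OF lin] pd_def)
  finally show ?thesis .
qed

text \<open>Defined through \<open>pd\<close> and not through the Frechet derivative, so that
  \<open>dird z\<close> visibly maps \<open>C_k (Suc k)\<close> functions to \<open>C_k k\<close>
  functions and can be iterated in Taylor's formula.\<close>

definition dird :: "real^'n \<Rightarrow> (real^'n \<Rightarrow> 'b::real_normed_vector) \<Rightarrow> real^'n \<Rightarrow> 'b" where
  "dird z f x = (\<Sum>i\<in>UNIV. z $ i *\<^sub>R pd i f x)"

lemma dird_axis: "dird (axis i t) f = (\<lambda>x. t *\<^sub>R pd i f x)"
proof
  fix x
  have "dird (axis i t) f x = (\<Sum>j\<in>UNIV. if j = i then t *\<^sub>R pd j f x else 0)"
    unfolding dird_def by (intro sum.cong) (auto simp: axis_def)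
  then show "dird (axis i t) f x = t *\<^sub>R pd i f x" by simp
qed

lemma C_k_dird: "C_k (Suc k) f \<Longrightarrow> C_k k (dird z f)"
  unfolding dird_def[abs_def] by (intro C_k_sum C_k_scaleR C_k_pd)

lemma dird_along_line:
  assumes "C_k (Suc k) f"
  shows "((\<lambda>t. f (x + t *\<^sub>R z)) has_vector_derivative dird z f (x + t *\<^sub>R z)) (at t)"
proof -
  have "((\<lambda>t. f (x + t *\<^sub>R z)) has_derivative (\<lambda>s. frechet_derivative f (at (x + t *\<^sub>R z)) (s *\<^sub>R z))) (at t)"
    by (rule has_derivative_compose[OF _ C_k_Suc_has_derivative[OF assms]]) (auto intro!: derivative_eq_intros)
  moreover have "linear (frechet_derivative f (at y))" for y
    using C_k_Suc_has_derivative[OF assms] by (rule has_derivative_linear)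
  moreover have "C_k (Suc 0) f" using assms by (rule C_k_mono) simp
  ultimately show ?thesis
    unfolding has_vector_derivative_def dird_def pd_sum_axis[symmetric, OF \<open>C_k (Suc 0) f\<close>] by (simp add: linear_scale)
qed

lemma pd_along_line:
  assumes "C_k (Suc k) f"
  shows "((\<lambda>t. f (x + t *\<^sub>R axis i 1)) has_vector_derivative pd i f (x + t *\<^sub>R axis i 1)) (at t)"
  using dird_along_line[OF assms, of x "axis i 1" t] by (simp add: dird_axis)

lemma pd_line_bound:
  assumes f: "C_k (Suc 0) f" and B: "\<And>x. norm (pd i f x) \<le> B"
  shows "norm (f (x + t *\<^sub>R axis i 1) - f x) \<le> B * \<bar>t\<bar>"
proof -
  have "norm (f (x + t *\<^sub>R axis i 1) - f (x + 0 *\<^sub>R axis i 1)) \<le> B * norm (t - 0)"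
  proof (rule differentiable_bound[of UNIV "\<lambda>t. f (x + t *\<^sub>R axis i 1)" "\<lambda>t s. s *\<^sub>R pd i f (x + t *\<^sub>R axis i 1)"])
    show "((\<lambda>t. f (x + t *\<^sub>R axis i 1)) has_derivative (\<lambda>s. s *\<^sub>R pd i f (x + t *\<^sub>R axis i 1))) (at t)" for t
      using pd_along_line[OF f, of x i t] by (simp add: has_vector_derivative_def)
    show "onorm (\<lambda>s. s *\<^sub>R pd i f (x + t *\<^sub>R axis i 1)) \<le> B" for t
      by (rule onorm_le) (simp add: mult.commute[of B] mult_left_mono B)
  qed auto
  then show ?thesis by simp
qed

text \<open>Maclaurin's formula on the segment: the \<open>m\<close>-th derivative of
  \<open>f (x + t *\<^sub>R z)\<close> in \<open>t\<close> is the \<open>m\<close>-fold iterate of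
  \<open>dird z\<close>.\<close>

lemma Taylor_dird:
  fixes f :: "real^'n \<Rightarrow> real"
  assumes "C_k n f" "n > 0"
  shows "\<exists>t. 0 < t \<and> t < 1 \<and>
    f (x + z) = (\<Sum>m<n. (dird z ^^ m) f x / fact m) + (dird z ^^ n) f (x + t *\<^sub>R z) / fact n"
proof -
  have Ck: "C_k (n - m) ((dird z ^^ m) f)" if "m \<le> n" for m
    using that
  proof (induction m)
    case (Suc m)
    then have "C_k (Suc (n - Suc m)) ((dird z ^^ m) f)" by (simp add: Suc_diff_Suc)
    from C_k_dird[OF this] show ?case by simp
  qed (simp add: assms)
  have "DERIV (\<lambda>t. (dird z ^^ m) f (x + t *\<^sub>R z)) t :> (dird z ^^ Suc m) f (x + t *\<^sub>R z)" if "m < n" for m t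
  proof -
    have "C_k (Suc (n - Suc m)) ((dird z ^^ m) f)" using Ck[of m] that by (simp add: Suc_diff_Suc)
    from dird_along_line[OF this] show ?thesis by (simp add: has_real_derivative_iff_has_vector_derivative)
  qed
  then show ?thesis
    using Maclaurin[of 1 n "\<lambda>m t. (dird z ^^ m) f (x + t *\<^sub>R z)" "\<lambda>t. f (x + t *\<^sub>R z)"] assms(2) by auto
qed

lemma pd_dird:
  assumes "C_k (Suc (Suc 0)) f"
  shows "pd i (dird z f) x = (\<Sum>j\<in>UNIV. z $ j *\<^sub>R pd i (pd j f) x)"
proof -
  have "pd i (dird z f) x = (\<Sum>j\<in>UNIV. pd i (\<lambda>x. z $ j *\<^sub>R pd j f x) x)"
    unfolding dird_def[abs_def] by (intro pd_sum C_k_scaleR C_k_pd assms)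
  also have "\<dots> = (\<Sum>j\<in>UNIV. z $ j *\<^sub>R pd i (pd j f) x)"
    by (intro sum.cong refl pd_scaleR C_k_pd assms)
  finally show ?thesis .
qed

lemma dird_twice:
  fixes f :: "real^'n \<Rightarrow> real"
  assumes "C_k (Suc (Suc 0)) f"
  shows "dird z (dird z f) x = (\<Sum>i\<in>UNIV. \<Sum>j\<in>UNIV. z $ i * z $ j * pd i (pd j f) x)"
proof -
  show ?thesis
    by (simp add: dird_def[of z "dird z f"] pd_dird[OF assms] sum_distrib_left mult.assoc)
qed

text \<open>The l1 norm of \<open>z\<close> appears because each entry of the Hessian is bounded
  separately. The factor 1/2 of the remainder is given away.\<close>

lemma Taylor2_bound:
  fixes f :: "real^'n \<Rightarrow> real"
  assumes f: "C_k 2 f" and B: "\<And>i j x. \<bar>pd i (pd j f) x\<bar> \<le> B"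
  shows "\<bar>f (x + z) - f x - dird z f x\<bar> \<le> (\<Sum>i\<in>UNIV. \<bar>z $ i\<bar>)\<^sup>2 * B"
proof -
  let ?s = "\<Sum>i\<in>UNIV. \<bar>z $ i\<bar>"
  have f2: "C_k (Suc (Suc 0)) f" using f by (simp add: numeral_2_eq_2)
  obtain t where "f (x + z) = (\<Sum>m<2. (dird z ^^ m) f x / fact m) + (dird z ^^ 2) f (x + t *\<^sub>R z) / fact 2"
    using Taylor_dird[OF f, of x z] by auto
  then have eq: "f (x + z) - f x - dird z f x = dird z (dird z f) (x + t *\<^sub>R z) / 2"
    by (simp add: numeral_2_eq_2)
  have "\<bar>dird z (dird z f) y\<bar> \<le> ?s * (?s * B)" for y
    unfolding dird_twice[OF f2]
  proof -
    have "\<bar>\<Sum>i\<in>UNIV. \<Sum>j\<in>UNIV. z $ i * z $ j * pd i (pd j f) y\<bar> \<le> (\<Sum>i\<in>UNIV. \<Sum>j\<in>UNIV. \<bar>z $ i\<bar> * (\<bar>z $ j\<bar> * B))"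
      by (intro order_trans[OF sum_abs] sum_mono) (auto simp: abs_mult mult.assoc intro!: mult_left_mono B)
    also have "\<dots> = ?s * (?s * B)" by (simp only: flip: sum_distrib_left sum_distrib_right)
    finally show "\<bar>\<Sum>i\<in>UNIV. \<Sum>j\<in>UNIV. z $ i * z $ j * pd i (pd j f) y\<bar> \<le> ?s * (?s * B)" .
  qed
  then have "\<bar>dird z (dird z f) (x + t *\<^sub>R z)\<bar> \<le> ?s\<^sup>2 * B" by (simp add: power2_eq_square mult.assoc)
  then show ?thesis unfolding eq by simp
qed

text \<open>The factor 1/6 of the cubic remainder is given away; the quadratic part is kept as an
  explicit double sum because it is later evaluated against second moments.\<close>

lemma Taylor3_bound:
  fixes f :: "real^'n \<Rightarrow> real"
  assumes f: "C_k 3 f" and B: "\<And>i j k x. \<bar>pd i (pd j (pd k f)) x\<bar> \<le> B"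
  shows "\<bar>f (x + z) - f x - dird z f x - (\<Sum>i\<in>UNIV. \<Sum>j\<in>UNIV. z $ i * z $ j * pd i (pd j f) x) / 2\<bar>
    \<le> (\<Sum>i\<in>UNIV. \<bar>z $ i\<bar>)^3 * B"
proof -
  let ?s = "\<Sum>i\<in>UNIV. \<bar>z $ i\<bar>"
  have f3: "C_k (Suc (Suc (Suc 0))) f" using f by (simp add: numeral_3_eq_3)
  have f2: "C_k (Suc (Suc 0)) f" using C_k_SucD[OF f3] .
  obtain t where "f (x + z) = (\<Sum>m<3. (dird z ^^ m) f x / fact m) + (dird z ^^ 3) f (x + t *\<^sub>R z) / fact 3"
    using Taylor_dird[OF f, of x z] by auto
  then have eq: "f (x + z) - f x - dird z f x - dird z (dird z f) x / 2 = dird z (dird z (dird z f)) (x + t *\<^sub>R z) / 6"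
    by (simp add: numeral_3_eq_3)
  \<comment> \<open>The inner direction is expanded by linearity, the two outer ones by
    \<open>dird_twice\<close> applied to \<open>dird z f\<close>.\<close>
  have p1: "pd k (dird z f) = (\<lambda>y. \<Sum>i\<in>UNIV. z $ i *\<^sub>R pd k (pd i f) y)" for k
    by (intro ext pd_dird[OF f2])
  have p2: "pd j (pd k (dird z f)) y = (\<Sum>i\<in>UNIV. z $ i * pd j (pd k (pd i f)) y)" for j k y
  proof -
    have "pd j (pd k (dird z f)) y = (\<Sum>i\<in>UNIV. pd j (\<lambda>y. z $ i *\<^sub>R pd k (pd i f) y) y)"
      unfolding p1 by (intro pd_sum C_k_scaleR C_k_pd f3)
    also have "\<dots> = (\<Sum>i\<in>UNIV. z $ i *\<^sub>R pd j (pd k (pd i f)) y)"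
      by (intro sum.cong refl pd_scaleR C_k_pd f3)
    finally show ?thesis by simp
  qed
  have "\<bar>pd j (pd k (dird z f)) y\<bar> \<le> ?s * B" for j k y
    unfolding p2 sum_distrib_right
    by (intro order_trans[OF sum_abs] sum_mono) (auto simp: abs_mult intro!: mult_left_mono B)
  moreover have "dird z (dird z (dird z f)) y = (\<Sum>i\<in>UNIV. \<Sum>j\<in>UNIV. z $ i * z $ j * pd i (pd j (dird z f)) y)" for y
    by (rule dird_twice[OF C_k_dird[OF f3]])
  moreover have "\<bar>\<Sum>i\<in>UNIV. \<Sum>j\<in>UNIV. z $ i * z $ j * pd i (pd j (dird z f)) y\<bar> \<le> (\<Sum>i\<in>UNIV. \<Sum>j\<in>UNIV. \<bar>z $ i\<bar> * (\<bar>z $ j\<bar> * (?s * B)))" for y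
    by (intro order_trans[OF sum_abs] sum_mono) (auto simp: abs_mult mult.assoc intro!: mult_left_mono calculation(1))
  moreover have "(\<Sum>i\<in>UNIV. \<Sum>j\<in>UNIV. \<bar>z $ i\<bar> * (\<bar>z $ j\<bar> * (?s * B))) = ?s^3 * B"
    by (simp only: flip: sum_distrib_left sum_distrib_right) (simp add: power3_eq_cube mult.assoc)
  ultimately have "\<bar>dird z (dird z (dird z f)) (x + t *\<^sub>R z)\<bar> \<le> ?s^3 * B" by simp
  then show ?thesis using eq unfolding dird_twice[OF f2] by simp
qed

section \<open>Compactly supported functions\<close>

text \<open>In finite dimension boundedness of the nonzero set is equivalent to compactness of the
  support, and it can be transferred through the operations below without taking closures.\<close>

lemma bounded_support_iff:
  fixes f :: "real^'n \<Rightarrow> 'b::real_normed_vector"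
  shows "bounded {x. f x \<noteq> 0} \<longleftrightarrow> (\<exists>R>0. \<forall>x. R \<le> norm x \<longrightarrow> f x = 0)"
proof
  assume "bounded {x. f x \<noteq> 0}"
  then obtain R where "R > 0" "\<And>x. f x \<noteq> 0 \<Longrightarrow> norm x < R" by (auto simp: bounded_pos_less)
  then show "\<exists>R>0. \<forall>x. R \<le> norm x \<longrightarrow> f x = 0" by (metis not_le)
next
  assume "\<exists>R>0. \<forall>x. R \<le> norm x \<longrightarrow> f x = 0"
  then show "bounded {x. f x \<noteq> 0}" unfolding bounded_pos_less by (metis (mono_tags, lifting) mem_Collect_eq not_le)
qed

lemma bounded_support_pd:
  assumes "bounded {x. f x \<noteq> 0}"
  shows "bounded {x. pd i f x \<noteq> 0}"
proof -
  obtain R where R: "R > 0" "\<And>x. R \<le> norm x \<Longrightarrow> f x = 0" using assms by (auto simp: bounded_support_iff)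
  have "pd i f x = 0" if "R + 1 \<le> norm x" for x
  proof -
    have "(f has_derivative (\<lambda>h. 0)) (at x)"
    proof (rule has_derivative_transform_within_open[where f = "\<lambda>x. 0" and s = "- cball 0 R"])
      show "0 = f y" if "y \<in> - cball 0 R" for y using that R(2)[of y] by simp
    qed (use that in auto)
    then show ?thesis by (simp add: pd_eqI)
  qed
  then show ?thesis unfolding bounded_support_iff using R(1) by (intro exI[of _ "R + 1"]) auto
qed

lemma bounded_support_bound:
  fixes f :: "real^'n \<Rightarrow> 'b::real_normed_vector"
  assumes "continuous_on UNIV f" "bounded {x. f x \<noteq> 0}"
  shows "\<exists>B\<ge>0. \<forall>x. norm (f x) \<le> B"
proof -
  obtain R where R: "R > 0" "\<And>x. R \<le> norm x \<Longrightarrow> f x = 0" using assms by (auto simp: bounded_support_iff)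
  have "compact (f ` cball 0 R)"
    by (intro compact_continuous_image continuous_on_subset[OF assms(1)]) auto
  then obtain B where B: "\<And>x. x \<in> cball 0 R \<Longrightarrow> norm (f x) \<le> B"
    using compact_imp_bounded by (fastforce simp: bounded_iff)
  have "norm (f x) \<le> max B 0" for x
    using B[of x] R(2)[of x] by (cases "norm x \<le> R") auto
  then show ?thesis by (intro exI[of _ "max B 0"]) auto
qed

lemma integrable_bounded_support:
  fixes f :: "real^'n \<Rightarrow> 'b::{banach, second_countable_topology}"
  assumes "continuous_on UNIV f" "bounded {x. f x \<noteq> 0}"
  shows "integrable lborel f"
proof -
  obtain R where R: "R > 0" "\<And>x. R \<le> norm x \<Longrightarrow> f x = 0" using assms by (auto simp: bounded_support_iff)
  have "integrable lborel (\<lambda>x. indicator (cball 0 R) x *\<^sub>R f x)"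
    by (intro borel_integrable_compact continuous_on_subset[OF assms(1)]) auto
  moreover have "(\<lambda>x. indicator (cball 0 R) x *\<^sub>R f x) = f"
    using R(2) by (auto simp: indicator_def fun_eq_iff)
  ultimately show ?thesis by simp
qed

lemma bounded_support_affine:
  assumes "bounded {x. f x \<noteq> 0}" "c \<noteq> 0"
  shows "bounded {x::real^'n. f (a + c *\<^sub>R x) \<noteq> 0}"
proof -
  have "{x. f (a + c *\<^sub>R x) \<noteq> 0} \<subseteq> (\<lambda>y. (1/c) *\<^sub>R (y - a)) ` {x. f x \<noteq> 0}"
  proof
    fix x assume "x \<in> {x. f (a + c *\<^sub>R x) \<noteq> 0}"
    then show "x \<in> (\<lambda>y. (1/c) *\<^sub>R (y - a)) ` {x. f x \<noteq> 0}"
      using assms(2) by (intro image_eqI[of _ _ "a + c *\<^sub>R x"]) auto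
  qed
  moreover have "bounded ((\<lambda>y. (1/c) *\<^sub>R (y - a)) ` {x. f x \<noteq> 0})"
    using bounded_scaling[OF bounded_translation_minus[OF assms(1), of a], of "1/c"] by (simp add: image_image)
  ultimately show ?thesis by (rule bounded_subset[rotated])
qed

section \<open>Affine changes of variables and integration by parts\<close>

lemma
  fixes f :: "real^'n \<Rightarrow> 'b::{banach, second_countable_topology}"
  assumes [measurable]: "f \<in> borel_measurable borel" and c: "c \<noteq> 0"
  shows lborel_integral_affine: "(LINT x|lborel. f x) = \<bar>c\<bar>^CARD('n) *\<^sub>R (LINT x|lborel. f (a + c *\<^sub>R x))"
    and lborel_integrable_affine: "integrable lborel f \<Longrightarrow> integrable lborel (\<lambda>x. f (a + c *\<^sub>R x))"
proof -
  note eq = lborel_affine[OF c, of a, unfolded DIM_cart DIM_real mult_1_right]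
  show "(LINT x|lborel. f x) = \<bar>c\<bar>^CARD('n) *\<^sub>R (LINT x|lborel. f (a + c *\<^sub>R x))"
    by (subst eq) (simp add: integral_density integral_distr)
  show "integrable lborel (\<lambda>x. f (a + c *\<^sub>R x))" if "integrable lborel f"
  proof -
    have "integrable (density (distr lborel borel (\<lambda>x. a + c *\<^sub>R x)) (\<lambda>_. ennreal (\<bar>c\<bar>^CARD('n)))) f"
      using that by (subst (asm) eq)
    then have "integrable lborel (\<lambda>x. \<bar>c\<bar>^CARD('n) *\<^sub>R f (a + c *\<^sub>R x))"
      by (simp add: integrable_density integrable_distr_eq)
    from integrable_scaleR_right[OF this, of "1 / \<bar>c\<bar>^CARD('n)"] show ?thesis using c by simp
  qed
qed

lemma lborel_integral_translate:
  fixes f :: "real^'n \<Rightarrow> 'b::{banach, second_countable_topology}"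
  assumes "f \<in> borel_measurable borel"
  shows "(LINT x|lborel. f (a + x)) = (LINT x|lborel. f x)"
  using lborel_integral_affine[OF assms, of 1 a] by simp

lemma C_k_measurable: "C_k k f \<Longrightarrow> f \<in> borel_measurable borel"
  using C_k_continuous borel_measurable_continuous_onI by blast

text \<open>Both facts together feed dominated convergence for difference quotients: pointwise
  convergence, and a bound by a constant on a fixed ball. The radius exceeds that of the support by
  one because the steps have length at most 1.\<close>

lemma
  fixes f :: "real^'n \<Rightarrow> 'b::real_normed_vector" and i :: 'n
  defines "s \<equiv> \<lambda>n x. real (Suc n) *\<^sub>R (f (x + (1 / real (Suc n)) *\<^sub>R axis i 1) - f x)"
  assumes f: "C_k (Suc 0) f"
  shows difference_quotient_tendsto: "(\<lambda>n. s n x) \<longlonglongrightarrow> pd i f x"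
    and difference_quotient_bound: "bounded {x. f x \<noteq> 0} \<Longrightarrow> \<exists>B\<ge>0. \<exists>R. \<forall>n x. norm (s n x) \<le> B * indicator (cball 0 R) x"
proof -
  let ?e = "axis i 1 :: real^'n"
  show "(\<lambda>n. s n x) \<longlonglongrightarrow> pd i f x"
  proof -
      have "((\<lambda>t. f (x + t *\<^sub>R ?e)) has_vector_derivative pd i f (x + 0 *\<^sub>R ?e)) (at 0)"
        by (rule pd_along_line[OF f])
      then have "((\<lambda>t. norm (f (x + t *\<^sub>R ?e) - f x - t *\<^sub>R pd i f x) / norm t) \<longlongrightarrow> 0) (at 0)"
        by (simp add: has_vector_derivative_def has_derivative_at)
      moreover have "filterlim (\<lambda>n. 1 / real (Suc n)) (at 0) sequentially"
      proof -
        have "(\<lambda>n. 1 / real (Suc n)) \<longlonglongrightarrow> 0" by (rule LIMSEQ_Suc[OF lim_1_over_n])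
        then show ?thesis by (simp add: filterlim_at)
      qed
      ultimately have "(\<lambda>n. norm (f (x + (1 / real (Suc n)) *\<^sub>R ?e) - f x - (1 / real (Suc n)) *\<^sub>R pd i f x) / norm (1 / real (Suc n))) \<longlonglongrightarrow> 0"
        by (rule filterlim_compose)
      moreover have "norm (f (x + (1 / real (Suc n)) *\<^sub>R ?e) - f x - (1 / real (Suc n)) *\<^sub>R pd i f x) / norm (1 / real (Suc n)) = norm (s n x - pd i f x)" for n
      proof -
        have "s n x - pd i f x = real (Suc n) *\<^sub>R (f (x + (1 / real (Suc n)) *\<^sub>R ?e) - f x - (1 / real (Suc n)) *\<^sub>R pd i f x)"
          by (simp add: s_def scaleR_diff_right del: of_nat_Suc)
        then have "norm (s n x - pd i f x) = real (Suc n) * norm (f (x + (1 / real (Suc n)) *\<^sub>R ?e) - f x - (1 / real (Suc n)) *\<^sub>R pd i f x)"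
          by (simp del: of_nat_Suc)
        then show ?thesis by (simp add: field_simps del: of_nat_Suc)
      qed
      ultimately have "(\<lambda>n. norm (s n x - pd i f x)) \<longlonglongrightarrow> 0" by simp
      then show "(\<lambda>n. s n x) \<longlonglongrightarrow> pd i f x" by (rule LIM_zero_cancel[OF tendsto_norm_zero_cancel])
  qed
  show "\<exists>B\<ge>0. \<exists>R. \<forall>n x. norm (s n x) \<le> B * indicator (cball 0 R) x" if supp: "bounded {x. f x \<noteq> 0}"
  proof -
    have pdc: "continuous_on UNIV (pd i f)" using C_k_pd[OF f, of i] by simp
    obtain B where B: "B \<ge> 0" "\<And>x. norm (pd i f x) \<le> B"
      using bounded_support_bound[OF pdc bounded_support_pd[OF supp]] by blast
    obtain R where R: "R > 0" "\<And>x. R \<le> norm x \<Longrightarrow> f x = 0" using supp by (auto simp: bounded_support_iff)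
    have "norm (s n x) \<le> B * indicator (cball 0 (R + 1)) x" for n x
    proof -
      let ?t = "1 / real (Suc n)"
      have t: "0 < ?t" "?t \<le> 1" by auto
      show "norm (s n x) \<le> B * indicator (cball 0 (R + 1)) x"
      proof (cases "x \<in> cball 0 (R + 1)")
        case True
        have "norm (f (x + ?t *\<^sub>R ?e) - f x) \<le> B * \<bar>?t\<bar>"
          by (rule pd_line_bound[OF f B(2)])
        moreover have "norm (s n x) = real (Suc n) * norm (f (x + ?t *\<^sub>R ?e) - f x)"
          by (simp add: s_def del: of_nat_Suc)
        ultimately show ?thesis using True by (simp add: field_simps del: of_nat_Suc)
      next
        case False
        then have "norm x > R + 1" by simp
        moreover have "norm x \<le> norm (x + ?t *\<^sub>R ?e) + norm (?t *\<^sub>R ?e)" using norm_triangle_ineq4[of "x + ?t *\<^sub>R ?e" "?t *\<^sub>R ?e"] by simp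
        moreover have "norm (?t *\<^sub>R ?e) \<le> 1" using t by simp
        ultimately have "R \<le> norm x" "R \<le> norm (x + ?t *\<^sub>R ?e)" by linarith+
        then have "f x = 0" "f (x + ?t *\<^sub>R ?e) = 0" using R(2) by blast+
        then show ?thesis using False by (simp add: s_def)
      qed
    qed
    with B(1) show ?thesis by blast
  qed
qed

text \<open>Translation invariance makes the integral of every difference quotient 0, and dominated
  convergence passes this to the derivative. This takes the place of Fubini and the fundamental
  theorem in one variable.\<close>

lemma integral_pd_eq_0:
  fixes f :: "real^'n \<Rightarrow> 'b::{banach, second_countable_topology}"
  assumes f: "C_k (Suc 0) f" and supp: "bounded {x. f x \<noteq> 0}"
  shows "(LINT x|lborel. pd i f x) = 0"
proof -
  let ?e = "axis i 1 :: real^'n"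
  note [measurable] = C_k_measurable[OF f] C_k_measurable[OF C_k_pd[OF f, of i]]
  define s where "s n x = real (Suc n) *\<^sub>R (f (x + (1 / real (Suc n)) *\<^sub>R ?e) - f x)" for n x
  obtain B R where B: "B \<ge> 0" "\<And>n x. norm (s n x) \<le> B * indicator (cball 0 R) x"
    using difference_quotient_bound[OF f supp, of i] unfolding s_def by blast
  have "(\<lambda>n. LINT x|lborel. s n x) \<longlonglongrightarrow> (LINT x|lborel. pd i f x)"
  proof (rule integral_dominated_convergence[where w = "\<lambda>x. B * indicator (cball 0 R) x"])
    show "AE x in lborel. (\<lambda>n. s n x) \<longlonglongrightarrow> pd i f x"
      unfolding s_def by (intro AE_I2 difference_quotient_tendsto f)
    show "AE x in lborel. norm (s n x) \<le> B * indicator (cball 0 R) x" for n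
      using B(2) by (intro AE_I2)
    show "integrable lborel (\<lambda>x. B * indicator (cball 0 R) (x :: real^'n) :: real)"
      by (intro integrable_mult_right integrable_real_indicator emeasure_lborel_cball_finite) auto
  qed (auto simp: s_def)
  moreover have "(LINT x|lborel. s n x) = 0" for n
  proof -
    have fi: "integrable lborel f" using integrable_bounded_support[OF C_k_continuous[OF f] supp] .
    have "integrable lborel (\<lambda>x. f (x + (1 / real (Suc n)) *\<^sub>R ?e))"
      using lborel_integrable_affine[OF _ _ fi, of 1 "(1 / real (Suc n)) *\<^sub>R ?e"] by (simp add: add.commute)
    then show ?thesis
      unfolding s_def using fi lborel_integral_translate[of f "(1 / real (Suc n)) *\<^sub>R ?e"] by (simp add: add.commute)
  qed
  ultimately show ?thesis using LIMSEQ_unique[of "\<lambda>n. 0::'b"] by auto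
qed

text \<open>A general bilinear \<open>B\<close> covers both uses: multiplication of real functions
  and the inner product of complex ones.\<close>

lemma integral_by_parts:
  fixes f :: "real^'n \<Rightarrow> 'a::real_normed_vector" and g :: "real^'n \<Rightarrow> 'b::real_normed_vector"
    and B :: "'a \<Rightarrow> 'b \<Rightarrow> 'c::{banach, second_countable_topology}"
  assumes B: "bounded_bilinear B" and f: "C_k (Suc 0) f" and g: "C_k (Suc 0) g"
    and supp: "bounded {x. f x \<noteq> 0} \<or> bounded {x. g x \<noteq> 0}"
  shows "(LINT x|lborel. B (f x) (pd i g x)) = - (LINT x|lborel. B (pd i f x) (g x))"
proof -
  interpret bounded_bilinear B by (rule B)
  have *: "bounded {x. B (u x) (v x) \<noteq> 0}" if "bounded {x. u x \<noteq> 0} \<or> bounded {x. v x \<noteq> 0}" for u v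
    using that by (auto elim!: bounded_subset simp: zero_left zero_right)
  have supp': "bounded {x. B (f x) (g x) \<noteq> 0}" "bounded {x. B (pd i f x) (g x) \<noteq> 0}" "bounded {x. B (f x) (pd i g x) \<noteq> 0}"
    using supp bounded_support_pd[of f i] bounded_support_pd[of g i] by (blast intro: *)+
  have Ck: "C_k 0 (\<lambda>x. B (pd i f x) (g x))" "C_k 0 (\<lambda>x. B (f x) (pd i g x))"
    by (intro C_k_bilinear[OF B] C_k_pd f g C_k_mono[OF f] C_k_mono[OF g]; simp)+
  have "0 = (LINT x|lborel. pd i (\<lambda>x. B (f x) (g x)) x)"
    using integral_pd_eq_0[OF C_k_bilinear[OF B f g] supp'(1)] by simp
  also have "\<dots> = (LINT x|lborel. B (f x) (pd i g x) + B (pd i f x) (g x))"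
    by (simp add: pd_bilinear[OF B f g])
  also have "\<dots> = (LINT x|lborel. B (f x) (pd i g x)) + (LINT x|lborel. B (pd i f x) (g x))"
    using Ck supp' by (intro Bochner_Integration.integral_add integrable_bounded_support) auto
  finally show ?thesis by (simp add: eq_neg_iff_add_eq_0)
qed

section \<open>Smooth cut-offs and the fundamental lemma\<close>

text \<open>The functions \<open>exp (- 1 / t) / t^m\<close>, extended by 0. The powers make the
  family closed under differentiation up to linear combinations, so that smoothness follows by one
  induction over all \<open>m\<close>.\<close>

definition flat :: "nat \<Rightarrow> real \<Rightarrow> real" where
  "flat m t = (if t > 0 then exp (- inverse t) * inverse t ^ m else 0)"

lemma flat_tendsto_0: "((flat m) \<longlongrightarrow> 0) (at 0)"
proof -
  have "((flat m) \<longlongrightarrow> 0) (at_left 0)"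
    by (rule tendsto_eventually) (auto simp: flat_def eventually_at_filter)
  moreover have "((flat m) \<longlongrightarrow> 0) (at_right 0)"
    unfolding filterlim_at_right_to_top
  proof (rule Lim_transform_eventually[OF tendsto_power_div_exp_0[of m]])
    show "\<forall>\<^sub>F x in at_top. x ^ m / exp x = flat m (inverse x)"
      using eventually_gt_at_top[of 0] by eventually_elim (simp add: flat_def exp_minus field_simps)
  qed
  ultimately show ?thesis by (simp add: filterlim_split_at)
qed

lemma flat_has_derivative:
  "(flat m has_real_derivative flat (Suc (Suc m)) t - real m * flat (Suc m) t) (at t)"
proof -
  consider "t > 0" | "t < 0" | "t = 0" by linarith
  then show ?thesis
  proof cases
    case 1
    have "((\<lambda>t. exp (- inverse t) * inverse t ^ m) has_real_derivative flat (Suc (Suc m)) t - real m * flat (Suc m) t) (at t)"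
    proof (cases m)
      case 0
      then show ?thesis using 1 by (auto intro!: derivative_eq_intros simp: flat_def power2_eq_square field_simps)
    next
      case (Suc k)
      show ?thesis unfolding Suc
        by (rule derivative_eq_intros refl | use 1 in \<open>simp add: flat_def field_simps\<close>)+
    qed
    then show ?thesis
      by (rule has_field_derivative_transform_within_open[where S = "{0<..}"]) (use 1 in \<open>auto simp: flat_def\<close>)
  next
    case 2
    have "((\<lambda>t. 0) has_real_derivative 0) (at t)" by simp
    then have "(flat m has_real_derivative 0) (at t)"
      by (rule has_field_derivative_transform_within_open[where S = "{..<0}"]) (use 2 in \<open>auto simp: flat_def\<close>)
    then show ?thesis using 2 by (simp add: flat_def)
  next
    case 3
    have "((\<lambda>h. (flat m h - flat m 0) / h) \<longlongrightarrow> 0) (at 0)"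
    proof (rule Lim_transform_eventually[OF flat_tendsto_0[of "Suc m"]])
      show "\<forall>\<^sub>F x in at 0. flat (Suc m) x = (flat m x - flat m 0) / x"
        by (rule always_eventually) (auto simp: flat_def field_simps)
    qed
    then show ?thesis using 3 by (simp add: has_field_derivative_iff flat_def)
  qed
qed

lemma C_k_flat: "C_k k (\<lambda>x::real^'n. flat m (x $ i))"
proof (induction k arbitrary: m)
  case 0
  have "continuous_on UNIV (flat m)"
    using flat_has_derivative DERIV_isCont by (blast intro: continuous_at_imp_continuous_on)
  then show ?case by (auto intro!: continuous_on_compose2[of UNIV "flat m"] continuous_intros)
next
  case (Suc k)
  show ?case
  proof (rule C_k_SucI[OF has_derivative_coord[OF flat_has_derivative]])
    show "C_k k (\<lambda>x::real^'n. (flat (Suc (Suc m)) (x $ i) - real m * flat (Suc m) (x $ i)) * axis j 1 $ i)" for j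
      by (intro C_k_mult C_k_diff C_k_const Suc)
  qed
qed

lemma flat_0_bounds: "0 \<le> flat 0 t" "flat 0 t \<le> 1"
  by (auto simp: flat_def)

text \<open>Supported in the box for every \<open>n\<close>. Since
  \<open>exp (- 1 / (n * c))\<close> tends to 1 for \<open>c > 0\<close>, these functions converge
  pointwise to the indicator of the open box while staying between 0 and 1.\<close>

definition box_approx :: "nat \<Rightarrow> real^'n \<Rightarrow> real^'n \<Rightarrow> real^'n \<Rightarrow> real" where
  "box_approx n a b x = (\<Prod>i\<in>UNIV. flat 0 (real n * (x $ i - a $ i)) * flat 0 (real n * (b $ i - x $ i)))"

lemma smooth_box_approx: "smooth (box_approx n a b)"
  unfolding smooth_def
proof
  fix k
  have "C_k k (\<lambda>x. flat 0 ((- (real n *\<^sub>R a) + real n *\<^sub>R x) $ i))" for i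
    by (rule C_k_affine[OF C_k_flat])
  moreover have "C_k k (\<lambda>x. flat 0 (((real n *\<^sub>R b) + (- real n) *\<^sub>R x) $ i))" for i
    by (rule C_k_affine[OF C_k_flat])
  ultimately show "C_k k (box_approx n a b)"
    unfolding box_approx_def[abs_def] by (intro C_k_prod C_k_mult) (simp_all add: right_diff_distrib)
qed

lemma box_approx_bounds: "0 \<le> box_approx n a b x" "box_approx n a b x \<le> 1"
  unfolding box_approx_def using flat_0_bounds by (auto intro!: prod_nonneg prod_le_1 mult_le_one)

lemma box_approx_outside:
  assumes "x \<notin> box a b"
  shows "box_approx n a b x = 0"
proof -
  obtain i where "\<not> (a $ i < x $ i \<and> x $ i < b $ i)" using assms by (auto simp: mem_box_cart)
  then have "flat 0 (real n * (x $ i - a $ i)) * flat 0 (real n * (b $ i - x $ i)) = 0"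
    by (auto simp: flat_def zero_less_mult_iff)
  then show ?thesis unfolding box_approx_def by (meson UNIV_I finite prod_zero)
qed

lemma flat_scaled_tendsto:
  assumes "c > 0"
  shows "(\<lambda>n. flat 0 (real n * c)) \<longlonglongrightarrow> 1"
proof (rule Lim_transform_eventually)
  have "(\<lambda>n. inverse (real n)) \<longlonglongrightarrow> 0" by (rule lim_inverse_n)
  then have "(\<lambda>n. exp (- (inverse (real n) * inverse c))) \<longlonglongrightarrow> exp (- (0 * inverse c))"
    by (intro tendsto_intros)
  then show "(\<lambda>n. exp (- (inverse (real n) * inverse c))) \<longlonglongrightarrow> 1" by simp
  show "\<forall>\<^sub>F n in sequentially. exp (- (inverse (real n) * inverse c)) = flat 0 (real n * c)"
    using eventually_gt_at_top[of 0] by eventually_elim (use assms in \<open>simp add: flat_def\<close>)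
qed

lemma box_approx_tendsto: "(\<lambda>n. box_approx n a b x) \<longlonglongrightarrow> indicator (box a b) x"
proof (cases "x \<in> box a b")
  case True
  then have "(\<lambda>n. box_approx n a b x) \<longlonglongrightarrow> (\<Prod>i\<in>(UNIV::'a set). 1 * 1)"
    unfolding box_approx_def by (intro tendsto_prod tendsto_mult flat_scaled_tendsto) (auto simp: mem_box_cart)
  with True show ?thesis by simp
next
  case False
  then show ?thesis by (simp add: box_approx_outside)
qed

lemma bounded_support_box_approx: "bounded {x. box_approx n a b x \<noteq> 0}"
  by (rule bounded_subset[OF bounded_box[of a b]]) (use box_approx_outside in blast)

text \<open>Testing with the cut-offs shows that \<open>g\<close> has integral 0 over every box. So
  the measures whose densities are the positive and the negative part of \<open>g\<close> agree on
  boxes, an intersection-stable generator of the Borel sets; hence they are equal, and so are their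
  densities almost everywhere.\<close>

lemma fundamental_lemma:
  fixes g :: "real^'n \<Rightarrow> real"
  assumes [measurable]: "g \<in> borel_measurable borel"
    and gi: "\<And>a b. integrable lborel (\<lambda>x. g x * indicator (box a b) x)"
    and g0: "\<And>\<eta>. smooth \<eta> \<Longrightarrow> bounded {x. \<eta> x \<noteq> 0} \<Longrightarrow> (LINT x|lborel. g x * \<eta> x) = 0"
  shows "AE x in lborel. g x = 0"
proof -
  have box0: "(LINT x|lborel. g x * indicator (box a b) x) = 0" for a b
  proof -
    have m: "box_approx n a b \<in> borel_measurable borel" for n
      using smooth_C_k[OF smooth_box_approx, of 0] by (rule C_k_measurable)
    have "(\<lambda>n. LINT x|lborel. g x * box_approx n a b x) \<longlonglongrightarrow> (LINT x|lborel. g x * indicator (box a b) x)"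
    proof (rule integral_dominated_convergence[where w = "\<lambda>x. norm (g x * indicator (box a b) x)"])
      show "AE x in lborel. norm (g x * box_approx n a b x) \<le> norm (g x * indicator (box a b) x)" for n
      proof (rule AE_I2)
        fix x show "norm (g x * box_approx n a b x) \<le> norm (g x * indicator (box a b) x)"
          using box_approx_bounds[of n a b x] by (cases "x \<in> box a b") (auto simp: abs_mult mult_left_le box_approx_outside)
      qed
      show "AE x in lborel. (\<lambda>n. g x * box_approx n a b x) \<longlonglongrightarrow> g x * indicator (box a b) x"
        by (intro AE_I2 tendsto_mult tendsto_const box_approx_tendsto)
    qed (use gi m in auto)
    moreover have "(LINT x|lborel. g x * box_approx n a b x) = 0" for n
      by (intro g0 smooth_box_approx bounded_support_box_approx)
    ultimately show ?thesis by (simp add: LIMSEQ_const_iff)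
  qed
  let ?p = "\<lambda>x. ennreal (max 0 (g x))" and ?m = "\<lambda>x. ennreal (max 0 (- g x))"
  have ip: "integrable lborel (\<lambda>x. max 0 (g x) * indicator (box a b) x)"
    and im: "integrable lborel (\<lambda>x. max 0 (- g x) * indicator (box a b) x)" for a b
    by (rule Bochner_Integration.integrable_bound[OF gi[of a b]]; auto simp: indicator_def)+
  have ep: "emeasure (density lborel ?p) (box a b) = ennreal (LINT x|lborel. max 0 (g x) * indicator (box a b) x)" for a b
  proof -
    have "emeasure (density lborel ?p) (box a b) = (\<integral>\<^sup>+x. ennreal (max 0 (g x) * indicator (box a b) x) \<partial>lborel)"
      by (subst emeasure_density) (auto intro!: nn_integral_cong simp: indicator_def)
    then show ?thesis by (simp add: nn_integral_eq_integral[OF ip])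
  qed
  have em: "emeasure (density lborel ?m) (box a b) = ennreal (LINT x|lborel. max 0 (- g x) * indicator (box a b) x)" for a b
  proof -
    have "emeasure (density lborel ?m) (box a b) = (\<integral>\<^sup>+x. ennreal (max 0 (- g x) * indicator (box a b) x) \<partial>lborel)"
      by (subst emeasure_density) (auto intro!: nn_integral_cong simp: indicator_def)
    then show ?thesis by (simp add: nn_integral_eq_integral[OF im])
  qed
  have eq: "emeasure (density lborel ?p) (box a b) = emeasure (density lborel ?m) (box a b)" for a b
  proof -
    have "(LINT x|lborel. max 0 (g x) * indicator (box a b) x) - (LINT x|lborel. max 0 (- g x) * indicator (box a b) x)
      = (LINT x|lborel. g x * indicator (box a b) x)"
      by (subst Bochner_Integration.integral_diff[OF ip im, symmetric])
        (auto intro!: Bochner_Integration.integral_cong simp: max_def indicator_def)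
    then show ?thesis using box0[of a b] by (simp add: ep em)
  qed
  have "density lborel ?p = density lborel ?m"
  proof (rule measure_eqI_generator_eq)
    let ?E = "range (\<lambda>(a, b). box a b::(real^'n) set)"
    show "Int_stable ?E" by (auto simp: Int_stable_def box_Int_box)
    show "?E \<subseteq> Pow UNIV" "sets (density lborel ?p) = sigma_sets UNIV ?E" "sets (density lborel ?m) = sigma_sets UNIV ?E"
      by (simp_all add: borel_eq_box)
    let ?A = "\<lambda>n::nat. box (- (real n *\<^sub>R One)) (real n *\<^sub>R One) :: (real^'n) set"
    show "range ?A \<subseteq> ?E" "(\<Union>i. ?A i) = UNIV" unfolding UN_box_eq_UNIV by auto
    show "emeasure (density lborel ?p) (?A i) \<noteq> \<infinity>" for i by (simp add: ep)
    show "emeasure (density lborel ?p) X = emeasure (density lborel ?m) X" if "X \<in> ?E" for X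
      using that eq by auto
  qed
  then have "AE x in lborel. ?p x = ?m x"
    by (intro sigma_finite_measure.density_unique[OF sigma_finite_lborel]) auto
  then show ?thesis
  proof eventually_elim
    case (elim x)
    then have "max 0 (g x) = max 0 (- g x)" by (subst (asm) ennreal_inj) auto
    then show ?case by (auto simp: max_def split: if_splits)
  qed
qed

section \<open>Square-integrable solutions of \<open>\<mu>g = \<Delta>g\<close> vanish\<close>

lemma uniform_bound:
  fixes F :: "'i::finite \<Rightarrow> 'x \<Rightarrow> 'b::real_normed_vector"
  assumes "\<And>i. \<exists>B\<ge>0. \<forall>x. norm (F i x) \<le> B"
  shows "\<exists>B\<ge>0. \<forall>i x. norm (F i x) \<le> B"
proof -
  obtain B where B: "\<And>i. B i \<ge> (0::real)" "\<And>i x. norm (F i x) \<le> B i" using assms by metis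
  have "B i \<le> (\<Sum>j\<in>UNIV. B j)" for i using B by (intro member_le_sum) auto
  then have "norm (F i x) \<le> (\<Sum>j\<in>UNIV. B j)" for i x using B(2)[of i x] order_trans by blast
  moreover have "(\<Sum>j\<in>UNIV. B j) \<ge> 0" using B by (intro sum_nonneg) auto
  ultimately show ?thesis by blast
qed

lemma integrable_square_mult:
  fixes g \<theta> :: "real^'n \<Rightarrow> real"
  assumes [measurable]: "g \<in> borel_measurable borel" and g2: "integrable lborel (\<lambda>x. (g x)\<^sup>2)"
    and \<theta>: "continuous_on UNIV \<theta>" "bounded {x. \<theta> x \<noteq> 0}"
  shows "integrable lborel (\<lambda>x. g x * \<theta> x)" "\<bar>LINT x|lborel. g x * \<theta> x\<bar> \<le> (LINT x|lborel. (g x)\<^sup>2) + (LINT x|lborel. (\<theta> x)\<^sup>2)"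
proof -
  have [measurable]: "\<theta> \<in> borel_measurable borel" using \<theta>(1) by (rule borel_measurable_continuous_onI)
  have \<theta>2: "integrable lborel (\<lambda>x. (\<theta> x)\<^sup>2)"
    by (rule integrable_bounded_support) (use \<theta> in \<open>auto intro!: continuous_intros\<close>)
  have le: "\<bar>g x * \<theta> x\<bar> \<le> (g x)\<^sup>2 + (\<theta> x)\<^sup>2" for x
    using norm_mult_le_squares[of "\<bar>g x\<bar>" "\<bar>\<theta> x\<bar>"] by (simp add: abs_mult)
  show i: "integrable lborel (\<lambda>x. g x * \<theta> x)"
    by (rule Bochner_Integration.integrable_bound[OF Bochner_Integration.integrable_add[OF g2 \<theta>2]]) (use le in \<open>auto intro!: AE_I2\<close>)
  have "\<bar>LINT x|lborel. g x * \<theta> x\<bar> \<le> (LINT x|lborel. \<bar>g x * \<theta> x\<bar>)" by (rule integral_abs_bound)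
  also have "\<dots> \<le> (LINT x|lborel. (g x)\<^sup>2 + (\<theta> x)\<^sup>2)"
    by (intro integral_mono integrable_abs i Bochner_Integration.integrable_add g2 \<theta>2 le)
  also have "\<dots> = (LINT x|lborel. (g x)\<^sup>2) + (LINT x|lborel. (\<theta> x)\<^sup>2)" using g2 \<theta>2 by simp
  finally show "\<bar>LINT x|lborel. g x * \<theta> x\<bar> \<le> (LINT x|lborel. (g x)\<^sup>2) + (LINT x|lborel. (\<theta> x)\<^sup>2)" .
qed

lemma integrable_square_indicator:
  fixes g :: "real^'n \<Rightarrow> real"
  assumes [measurable]: "g \<in> borel_measurable borel" and g2: "integrable lborel (\<lambda>x. (g x)\<^sup>2)"
    and S: "bounded S" "S \<in> sets borel"
  shows "integrable lborel (\<lambda>x. g x * indicator S x)"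
proof -
  obtain R where R: "S \<subseteq> cball 0 R" using S(1) by (auto simp: bounded_iff subset_eq)
  have [measurable]: "S \<in> sets borel" by fact
  have "integrable lborel (\<lambda>x. (g x)\<^sup>2 + indicator (cball 0 R) x)"
    by (intro Bochner_Integration.integrable_add g2 integrable_real_indicator emeasure_lborel_cball_finite) auto
  then show ?thesis
  proof (rule Bochner_Integration.integrable_bound)
    show "AE x in lborel. norm (g x * indicator S x) \<le> norm ((g x)\<^sup>2 + indicator (cball 0 R) x)"
    proof (rule AE_I2)
      fix x
      show "norm (g x * indicator S x) \<le> norm ((g x)\<^sup>2 + indicator (cball 0 R) x)"
        using R norm_mult_le_squares[of "\<bar>g x\<bar>" 1] by (auto simp: indicator_def)
    qed
  qed simp
qed

text \<open>\<open>G \<eta>\<close> is a mollification of \<open>g\<close>, bounded, with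
  \<open>\<mu> * G \<eta> = \<Delta> (G \<eta>)\<close>. If it were positive at 0, then
  \<open>H\<close>, which is \<open>G \<eta>\<close> minus \<open>d\<close> times the squared norm,
  would have a global maximum \<open>p\<close>, where each second derivative of
  \<open>G \<eta>\<close> is at most \<open>2 * d\<close>. Summing over the coordinates,
  \<open>\<mu> * G \<eta> p\<close> is at most half of \<open>\<mu> * G \<eta> 0\<close>, although
  \<open>G \<eta> p \<ge> G \<eta> 0\<close>.\<close>

lemma weak_Laplace_eigen_nonpos:
  fixes g :: "real^'n \<Rightarrow> real"
  assumes gm[measurable]: "g \<in> borel_measurable borel" and g2: "integrable lborel (\<lambda>x. (g x)\<^sup>2)"
    and \<mu>: "\<mu> > 0"
    and eq: "\<And>\<phi>. smooth \<phi> \<Longrightarrow> bounded {x. \<phi> x \<noteq> 0} \<Longrightarrow>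
      (LINT x|lborel. g x * (\<mu> * \<phi> x - (\<Sum>i\<in>UNIV. pd i (pd i \<phi>) x))) = 0"
    and \<eta>: "smooth \<eta>" "bounded {x. \<eta> x \<noteq> 0}"
  shows "(LINT x|lborel. g x * \<eta> x) \<le> 0"
proof (rule ccontr)
  assume pos: "\<not> (LINT x|lborel. g x * \<eta> x) \<le> 0"
  have Ck: "C_k k (\<lambda>y. \<theta> (x + y))" and bs: "bounded {y. \<theta> (x + y) \<noteq> 0}"
    if "smooth \<theta>" "bounded {x. \<theta> x \<noteq> 0}" for k x and \<theta> :: "real^'n \<Rightarrow> real"
    using C_k_affine[OF smooth_C_k[OF that(1)], of k x 1] bounded_support_affine[OF that(2), of 1 x] by simp_all
  \<comment> \<open>With \<open>x + y\<close> instead of \<open>x - y\<close> the test functions are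
    translates of \<open>\<theta>\<close>, without a reflection. \<open>G \<eta>\<close> is never
    differentiated: \<open>G\<close> applied to a second derivative of \<open>\<eta>\<close> plays
    the role of its second derivative.\<close>
  define G where "G \<theta> x = (LINT y|lborel. g y * \<theta> (x + y))" for \<theta> x
  have sm2: "smooth (pd i (pd i \<eta>))" "bounded {x. pd i (pd i \<eta>) x \<noteq> 0}" for i
    by (intro smooth_pd bounded_support_pd \<eta>)+
  have Gi: "integrable lborel (\<lambda>y. g y * \<theta> (x + y))" if "smooth \<theta>" "bounded {x. \<theta> x \<noteq> 0}" for \<theta> x
    using Ck[OF that, of 0] by (intro integrable_square_mult gm g2 bs[OF that]) simp
  define M where "M = (LINT x|lborel. (g x)\<^sup>2) + (LINT x|lborel. (\<eta> x)\<^sup>2)"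
  have M: "\<bar>G \<eta> x\<bar> \<le> M" for x
  proof -
    have "\<bar>G \<eta> x\<bar> \<le> (LINT x|lborel. (g x)\<^sup>2) + (LINT y|lborel. (\<eta> (x + y))\<^sup>2)"
      unfolding G_def using Ck[OF \<eta>, of 0] by (intro integrable_square_mult gm g2 bs[OF \<eta>]) simp
    also have "(LINT y|lborel. (\<eta> (x + y))\<^sup>2) = (LINT y|lborel. (\<eta> y)\<^sup>2)"
      using C_k_measurable[OF smooth_C_k[OF \<eta>(1), of 0]] by (intro lborel_integral_translate) simp
    finally show ?thesis by (simp add: M_def)
  qed
  have Geq: "\<mu> * G \<eta> x = (\<Sum>i\<in>UNIV. G (pd i (pd i \<eta>)) x)" for x
  proof -
    let ?\<phi> = "\<lambda>y. \<eta> (x + y)"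
    have "pd i ?\<phi> = (\<lambda>y. pd i \<eta> (x + y))" for i
      using pd_affine[OF smooth_C_k[OF \<eta>(1)], of i x 1] by auto
    moreover have "pd i (\<lambda>y. pd i \<eta> (x + y)) = (\<lambda>y. pd i (pd i \<eta>) (x + y))" for i
      using pd_affine[OF smooth_C_k[OF smooth_pd[OF \<eta>(1)]], of i i x 1] by auto
    ultimately have "0 = (LINT y|lborel. g y * (\<mu> * \<eta> (x + y) - (\<Sum>i\<in>UNIV. pd i (pd i \<eta>) (x + y))))"
      using eq[of ?\<phi>] Ck[OF \<eta>] bs[OF \<eta>] by (simp add: smooth_def)
    also have "\<dots> = (LINT y|lborel. \<mu> * (g y * \<eta> (x + y)) - (\<Sum>i\<in>UNIV. g y * pd i (pd i \<eta>) (x + y)))"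
      by (simp add: right_diff_distrib sum_distrib_left mult.left_commute)
    also have "\<dots> = \<mu> * G \<eta> x - (\<Sum>i\<in>UNIV. G (pd i (pd i \<eta>)) x)"
      using Gi[OF \<eta>] Gi[OF sm2] unfolding G_def by (subst Bochner_Integration.integral_diff) (auto intro!: Bochner_Integration.integrable_sum)
    finally show ?thesis by simp
  qed
  have third: "\<exists>B\<ge>0. \<forall>i j k x. \<bar>pd i (pd j (pd k \<eta>)) x\<bar> \<le> B"
  proof -
    have b1: "\<exists>B\<ge>0. \<forall>x. norm (pd i (pd j (pd k \<eta>)) x) \<le> B" for i j k
      by (intro bounded_support_bound bounded_support_pd \<eta> C_k_continuous[OF smooth_C_k[of _ 0]] smooth_pd)
    have b2: "\<exists>B\<ge>0. \<forall>i x. norm (pd i (pd j (pd k \<eta>)) x) \<le> B" for j k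
      by (rule uniform_bound[OF b1])
    have b3: "\<exists>B\<ge>0. \<forall>j y. norm (pd (fst y) (pd j (pd k \<eta>)) (snd y)) \<le> B" for k
      by (rule uniform_bound) (use b2 in fastforce)
    have "\<exists>B\<ge>0. \<forall>k y. norm (pd (fst y) (pd (fst (snd y)) (pd k \<eta>)) (snd (snd y))) \<le> B"
      by (rule uniform_bound) (use b3 in fastforce)
    then obtain B where "B \<ge> 0"
      "\<And>k y. norm (pd (fst y) (pd (fst (snd y)) (pd k \<eta>)) (snd (snd y))) \<le> B" by blast
    from this(1) this(2)[of "(_, _, _)"] show ?thesis by auto
  qed
  then obtain B where B: "B \<ge> 0" "\<And>i j k x. \<bar>pd i (pd j (pd k \<eta>)) x\<bar> \<le> B" by blast
  \<comment> \<open>In the symmetric second difference the odd Taylor terms of \<open>\<eta>\<close>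
    cancel, leaving a cubic error that is uniform in \<open>z\<close>.\<close>
  have second_diff: "\<bar>\<eta> (z + t *\<^sub>R axis i 1) + \<eta> (z - t *\<^sub>R axis i 1) - 2 * \<eta> z - t\<^sup>2 * pd i (pd i \<eta>) z\<bar> \<le> 2 * B * \<bar>t\<bar>^3" for z t i
  proof -
    have T: "\<bar>\<eta> (z + axis i s) - \<eta> z - s * pd i \<eta> z - s\<^sup>2 * pd i (pd i \<eta>) z / 2\<bar> \<le> \<bar>s\<bar>^3 * B" for s
    proof -
      have C2: "C_k (Suc (Suc 0)) \<eta>" using \<eta>(1) by (rule smooth_C_k)
      have "(\<Sum>k\<in>UNIV. \<Sum>j\<in>UNIV. axis i s $ k * axis i s $ j * pd k (pd j \<eta>) z) = dird (axis i s) (dird (axis i s) \<eta>) z"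
        by (rule dird_twice[OF C2, symmetric])
      also have "\<dots> = s\<^sup>2 * pd i (pd i \<eta>) z"
        using pd_scaleR[OF C_k_pd[OF C2], of i s i z] by (simp add: dird_axis power2_eq_square mult.assoc)
      finally show ?thesis
        using Taylor3_bound[OF smooth_C_k[OF \<eta>(1)] B(2), of z "axis i s"]
        by (simp add: dird_axis) (simp add: axis_def if_distrib[of abs] cong: if_cong)
    qed
    have shift: "z + t *\<^sub>R axis i 1 = z + axis i t" "z - t *\<^sub>R axis i 1 = z + axis i (- t)"
      by (auto simp: vec_eq_iff axis_def)
    show ?thesis unfolding shift using T[of t] T[of "- t"] by (simp add: abs_le_iff mult.assoc mult.commute[of B])
  qed
  \<comment> \<open>Chosen so that the sum of \<open>2 * d\<close> over the coordinates is half of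
    \<open>\<mu> * G \<eta> 0\<close>.\<close>
  define d where "d = G \<eta> 0 * \<mu> / (4 * real CARD('n))"
  have G0: "G \<eta> 0 > 0" using pos by (simp add: G_def)
  have d0: "d > 0" using G0 \<mu> by (simp add: d_def)
  define H where "H x = G \<eta> x - d * (norm x)\<^sup>2" for x
  have Gcont: "continuous_on UNIV (G \<eta>)"
  proof (rule continuous_at_imp_continuous_on, safe)
    fix x
    obtain R where R: "R > 0" "\<And>y. R \<le> norm y \<Longrightarrow> \<eta> y = 0" using \<eta>(2) by (auto simp: bounded_support_iff)
    obtain K where K: "K \<ge> 0" "\<And>y. norm (\<eta> y) \<le> K"
      using bounded_support_bound[OF C_k_continuous[OF smooth_C_k[OF \<eta>(1), of 0]] \<eta>(2)] by blast
    note \<eta>m[measurable] = C_k_measurable[OF smooth_C_k[OF \<eta>(1), of 0]]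
    show "isCont (G \<eta>) x"
      unfolding continuous_at_sequentially comp_def
    proof (intro allI impI)
      fix u assume u: "u \<longlonglongrightarrow> x"
      obtain L where L: "\<And>n. norm (u n) \<le> L" using convergent_imp_Bseq[of u] u by (auto simp: convergent_def Bseq_def)
      show "(\<lambda>n. G \<eta> (u n)) \<longlonglongrightarrow> G \<eta> x"
        unfolding G_def
      proof (rule integral_dominated_convergence[where w = "\<lambda>y. K * norm (g y * indicator (cball 0 (R + L)) y)"])
        show "integrable lborel (\<lambda>y. K * norm (g y * indicator (cball 0 (R + L)) y))"
          by (intro integrable_mult_right integrable_norm integrable_square_indicator gm g2) auto
        show "AE y in lborel. (\<lambda>n. g y * \<eta> (u n + y)) \<longlonglongrightarrow> g y * \<eta> (x + y)"
          using C_k_continuous[OF smooth_C_k[OF \<eta>(1), of 0]] u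
          by (auto intro!: AE_I2 tendsto_intros isCont_tendsto_compose[of _ \<eta>] simp: continuous_on_eq_continuous_at)
        show "AE y in lborel. norm (g y * \<eta> (u n + y)) \<le> K * norm (g y * indicator (cball 0 (R + L)) y)" for n
        proof (rule AE_I2)
          fix y
          show "norm (g y * \<eta> (u n + y)) \<le> K * norm (g y * indicator (cball 0 (R + L)) y)"
          proof (cases "y \<in> cball 0 (R + L)")
            case True
            then show ?thesis using mult_left_mono[OF K(2)[of "u n + y"], of "\<bar>g y\<bar>"] by (simp add: abs_mult mult.commute)
          next
            case False
            have "norm y \<le> norm (u n + y) + norm (u n)" using norm_triangle_ineq4[of "u n + y" "u n"] by simp
            then have "\<eta> (u n + y) = 0" using False L[of n] by (intro R(2)) auto
            then show ?thesis using K by simp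
          qed
        qed
      qed simp_all
    qed
  qed
  \<comment> \<open>Outside this ball \<open>d * (norm x)\<^sup>2 > 2 * M\<close>, so
    \<open>H < - M\<close>, while \<open>H 0 = G \<eta> 0 > 0\<close>; the maximum over the ball is
    therefore global.\<close>
  define \<rho> where "\<rho> = sqrt (2 * M / d) + 1"
  have "continuous_on (cball 0 \<rho>) H"
    unfolding H_def by (intro continuous_intros continuous_on_subset[OF Gcont]) auto
  moreover have M0: "M \<ge> 0" using M[of 0] by simp
  then have \<rho>0: "\<rho> \<ge> 1" using d0 by (simp add: \<rho>_def)
  ultimately obtain p where p: "p \<in> cball 0 \<rho>" "\<And>x. x \<in> cball 0 \<rho> \<Longrightarrow> H x \<le> H p"
    using continuous_attains_sup[of "cball 0 \<rho>" H] by auto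
  have H0: "H p \<ge> G \<eta> 0" using p(2)[of 0] \<rho>0 by (simp add: H_def)
  have pmax: "H x \<le> H p" for x
  proof (cases "x \<in> cball 0 \<rho>")
    case False
    then have "norm x > \<rho>" by simp
    then have "(norm x)\<^sup>2 > (sqrt (2 * M / d))\<^sup>2"
      using M0 d0 by (intro power_strict_mono) (auto simp: \<rho>_def)
    then have "d * (norm x)\<^sup>2 > 2 * M" using M0 d0 by (simp add: field_simps)
    then have "H x < - M" using M[of x] by (simp add: H_def)
    with H0 G0 M0 show ?thesis by linarith
  qed (use p in auto)
  have "0 \<le> d * (norm p)\<^sup>2" using d0 by simp
  then have Gp: "G \<eta> p \<ge> G \<eta> 0" using H0 unfolding H_def by linarith
  obtain R where R: "R > 0" "\<And>y. R \<le> norm y \<Longrightarrow> \<eta> y = 0" using \<eta>(2) by (auto simp: bounded_support_iff)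
  obtain R' where R': "R' > 0" "\<And>i y. R' \<le> norm y \<Longrightarrow> pd i (pd i \<eta>) y = 0"
  proof -
    have "\<forall>i. \<exists>r>0. \<forall>y. r \<le> norm y \<longrightarrow> pd i (pd i \<eta>) y = 0" using sm2(2) by (auto simp: bounded_support_iff)
    then obtain r where r: "\<And>i. r i > 0" "\<And>i y. r i \<le> norm y \<Longrightarrow> pd i (pd i \<eta>) y = 0" by metis
    have "r i \<le> (\<Sum>j\<in>UNIV. r j)" for i using r(1) by (intro member_le_sum) (auto intro: less_imp_le)
    then have "pd i (pd i \<eta>) y = 0" if "(\<Sum>j\<in>UNIV. r j) \<le> norm y" for i y
      using r(2)[of i y] that order_trans by blast
    moreover have "(\<Sum>j\<in>UNIV. r j) > 0" using r(1) by (intro sum_pos) auto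
    ultimately show ?thesis using that by blast
  qed
  \<comment> \<open>A ball containing the supports, as functions of \<open>y\<close>, of all shifted
    copies of \<open>\<eta>\<close> and of its pure second derivatives that occur for step lengths
    \<open>t \<le> 1\<close>.\<close>
  define Q where "Q = cball (0::real^'n) (norm p + R + R' + 1)"
  define K where "K = (LINT y|lborel. \<bar>g y * indicator Q y\<bar>) * 2 * B"
  have gQ: "integrable lborel (\<lambda>y. \<bar>g y * indicator Q y\<bar>)"
    unfolding Q_def by (intro integrable_abs integrable_square_indicator gm g2) auto
  have Gii: "G (pd i (pd i \<eta>)) p \<le> 2 * d" for i
  proof -
    let ?e = "axis i 1 :: real^'n"
    \<comment> \<open>Maximality of \<open>H\<close> at \<open>p\<close> bounds the second
      difference of \<open>G \<eta>\<close> by \<open>2 * d * t\<^sup>2\<close>; the Taylor error,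
      integrated against \<open>g\<close> over \<open>Q\<close>, costs
      \<open>K * t^3\<close>.\<close>
    have step: "G (pd i (pd i \<eta>)) p \<le> 2 * d + K * t" if t: "0 < t" "t \<le> 1" for t
    proof -
      define w where "w y = g y * (\<eta> (p + t *\<^sub>R ?e + y) + \<eta> (p - t *\<^sub>R ?e + y) - 2 * \<eta> (p + y) - t\<^sup>2 * pd i (pd i \<eta>) (p + y))" for y
      have w': "w y = g y * \<eta> (p + t *\<^sub>R ?e + y) + g y * \<eta> (p - t *\<^sub>R ?e + y) - 2 * (g y * \<eta> (p + y)) - t\<^sup>2 * (g y * pd i (pd i \<eta>) (p + y))" for y
        by (simp add: w_def algebra_simps)
      have wi: "integrable lborel w" unfolding w'[abs_def] using Gi[OF \<eta>] Gi[OF sm2] by auto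
      have wI: "(LINT y|lborel. w y) = G \<eta> (p + t *\<^sub>R ?e) + G \<eta> (p - t *\<^sub>R ?e) - 2 * G \<eta> p - t\<^sup>2 * G (pd i (pd i \<eta>)) p"
        unfolding w' G_def using Gi[OF \<eta>] Gi[OF sm2] by simp
      have wb: "\<bar>w y\<bar> \<le> \<bar>g y * indicator Q y\<bar> * (2 * B * t^3)" for y
      proof (cases "y \<in> Q")
        case True
        have "\<bar>\<eta> (p + y + t *\<^sub>R ?e) + \<eta> (p + y - t *\<^sub>R ?e) - 2 * \<eta> (p + y) - t\<^sup>2 * pd i (pd i \<eta>) (p + y)\<bar> \<le> 2 * B * t^3"
          using second_diff[of "p + y" t i] t by simp
        then have "\<bar>g y\<bar> * \<bar>\<eta> (p + y + t *\<^sub>R ?e) + \<eta> (p + y - t *\<^sub>R ?e) - 2 * \<eta> (p + y) - t\<^sup>2 * pd i (pd i \<eta>) (p + y)\<bar> \<le> \<bar>g y\<bar> * (2 * B * t^3)"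
          by (rule mult_left_mono) simp
        moreover have e: "p + t *\<^sub>R ?e + y = p + y + t *\<^sub>R ?e" "p - t *\<^sub>R ?e + y = p + y - t *\<^sub>R ?e"
          by (simp_all add: algebra_simps)
        ultimately show ?thesis using True unfolding w_def abs_mult e by simp
      next
        case False
        then have far: "norm y > norm p + R + R' + 1" by (simp add: Q_def)
        have n1: "norm (p + t *\<^sub>R ?e) \<le> norm p + 1" "norm (p - t *\<^sub>R ?e) \<le> norm p + 1"
          using norm_triangle_ineq[of p "t *\<^sub>R ?e"] norm_triangle_ineq4[of p "t *\<^sub>R ?e"] t by (simp_all)
        have n2: "norm y \<le> norm (q + y) + norm q" for q using norm_triangle_ineq4[of "q + y" q] by simp
        have "\<eta> (p + t *\<^sub>R ?e + y) = 0" "\<eta> (p - t *\<^sub>R ?e + y) = 0" "\<eta> (p + y) = 0" "pd i (pd i \<eta>) (p + y) = 0"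
          using far n1 n2[of "p + t *\<^sub>R ?e"] n2[of "p - t *\<^sub>R ?e"] n2[of p] R(1) R'(1)
          by (auto intro!: R(2) R'(2))
        then show ?thesis using False by (simp add: w_def)
      qed
      have "\<bar>LINT y|lborel. w y\<bar> \<le> (LINT y|lborel. \<bar>w y\<bar>)" by (rule integral_abs_bound)
      also have "\<dots> \<le> (LINT y|lborel. \<bar>g y * indicator Q y\<bar> * (2 * B * t^3))"
        by (intro integral_mono integrable_abs wi integrable_mult_left gQ wb)
      also have "\<dots> = K * t^3" by (simp add: K_def)
      finally have "t\<^sup>2 * G (pd i (pd i \<eta>)) p \<le> G \<eta> (p + t *\<^sub>R ?e) + G \<eta> (p - t *\<^sub>R ?e) - 2 * G \<eta> p + K * t^3"
        unfolding wI by linarith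
      also have "G \<eta> (p + t *\<^sub>R ?e) + G \<eta> (p - t *\<^sub>R ?e) - 2 * G \<eta> p \<le> 2 * d * t\<^sup>2"
      proof -
        have "(norm (p + t *\<^sub>R ?e))\<^sup>2 + (norm (p - t *\<^sub>R ?e))\<^sup>2 = 2 * (norm p)\<^sup>2 + 2 * t\<^sup>2"
          unfolding power2_norm_eq_inner inner_add_left inner_add_right inner_diff_left inner_diff_right
            inner_scaleR_left inner_scaleR_right inner_axis_axis by (simp add: power2_eq_square algebra_simps)
        then have "d * (norm (p + t *\<^sub>R ?e))\<^sup>2 + d * (norm (p - t *\<^sub>R ?e))\<^sup>2 = d * (2 * (norm p)\<^sup>2 + 2 * t\<^sup>2)"
          unfolding distrib_left[symmetric] by (rule arg_cong)
        moreover have "d * (2 * (norm p)\<^sup>2 + 2 * t\<^sup>2) = 2 * (d * (norm p)\<^sup>2) + 2 * d * t\<^sup>2"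
          by (simp add: algebra_simps)
        ultimately show ?thesis
          using pmax[of "p + t *\<^sub>R ?e"] pmax[of "p - t *\<^sub>R ?e"] unfolding H_def by linarith
      qed
      finally have "t\<^sup>2 * G (pd i (pd i \<eta>)) p \<le> t\<^sup>2 * (2 * d + K * t)"
        by (simp add: algebra_simps power2_eq_square power3_eq_cube)
      then show ?thesis using t by simp
    qed
    have "(\<lambda>n. 2 * d + K * (1 / real (Suc n))) \<longlonglongrightarrow> 2 * d + K * 0"
      by (intro tendsto_intros LIMSEQ_Suc[OF lim_1_over_n])
    from LIMSEQ_le_const[OF this, of "G (pd i (pd i \<eta>)) p"] show ?thesis
      using step[of "1 / real (Suc _)"] by simp
  qed
  have "\<mu> * G \<eta> p \<le> (\<Sum>i\<in>(UNIV::'n set). 2 * d)" unfolding Geq by (intro sum_mono Gii)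
  also have "\<dots> = \<mu> * G \<eta> 0 / 2" by (simp add: d_def field_simps)
  finally have "G \<eta> p \<le> G \<eta> 0 / 2" using \<mu> by simp
  with Gp G0 show False by linarith
qed

lemma weak_Laplace_eigen_zero:
  fixes g :: "real^'n \<Rightarrow> real"
  assumes gm: "g \<in> borel_measurable borel" and g2: "integrable lborel (\<lambda>x. (g x)\<^sup>2)"
    and \<mu>: "\<mu> > 0"
    and eq: "\<And>\<phi>. smooth \<phi> \<Longrightarrow> bounded {x. \<phi> x \<noteq> 0} \<Longrightarrow>
      (LINT x|lborel. g x * (\<mu> * \<phi> x - (\<Sum>i\<in>UNIV. pd i (pd i \<phi>) x))) = 0"
  shows "AE x in lborel. g x = 0"
proof (rule fundamental_lemma[OF gm])
  show "integrable lborel (\<lambda>x. g x * indicator (box a b) x)" for a b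
    by (intro integrable_square_indicator gm g2) auto
  fix \<eta> :: "real^'n \<Rightarrow> real" assume \<eta>: "smooth \<eta>" "bounded {x. \<eta> x \<noteq> 0}"
  have "smooth (\<lambda>x. - \<eta> x)" using \<eta>(1) C_k_scaleR[of _ \<eta> "-1"] by (simp add: smooth_def)
  from weak_Laplace_eigen_nonpos[OF gm g2 \<mu> eq this] weak_Laplace_eigen_nonpos[OF gm g2 \<mu> eq \<eta>] \<eta>(2)
  show "(LINT x|lborel. g x * \<eta> x) = 0" by simp
qed

section \<open>Symmetry of second derivatives\<close>

text \<open>The mixed second difference does not depend on the order of \<open>i\<close> and
  \<open>j\<close>, and two applications of the mean value theorem express it by either mixed
  derivative at a nearby point. Schwarz's theorem follows in the limit.\<close>

lemma second_difference_mvt: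
  fixes f :: "real^'n \<Rightarrow> real"
  assumes f: "C_k (Suc (Suc 0)) f" and t: "t > 0"
  shows "\<exists>s s'. 0 < s \<and> s < t \<and> 0 < s' \<and> s' < t \<and>
    f (x + t *\<^sub>R axis i 1 + t *\<^sub>R axis j 1) - f (x + t *\<^sub>R axis i 1) - f (x + t *\<^sub>R axis j 1) + f x
      = t\<^sup>2 * pd j (pd i f) (x + s *\<^sub>R axis i 1 + s' *\<^sub>R axis j 1)"
proof -
  let ?i = "axis i 1 :: real^'n" and ?j = "axis j 1 :: real^'n"
  define g where "g s = f (x + t *\<^sub>R ?j + s *\<^sub>R ?i) - f (x + s *\<^sub>R ?i)" for s
  have "DERIV g s :> pd i f (x + t *\<^sub>R ?j + s *\<^sub>R ?i) - pd i f (x + s *\<^sub>R ?i)" for s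
    unfolding g_def has_real_derivative_iff_has_vector_derivative
    by (intro has_vector_derivative_diff pd_along_line[OF f])
  from MVT2[OF t this] obtain s where s: "0 < s" "s < t"
    "g t - g 0 = t * (pd i f (x + t *\<^sub>R ?j + s *\<^sub>R ?i) - pd i f (x + s *\<^sub>R ?i))" by auto
  have "DERIV (\<lambda>r. pd i f (x + s *\<^sub>R ?i + r *\<^sub>R ?j)) r :> pd j (pd i f) (x + s *\<^sub>R ?i + r *\<^sub>R ?j)" for r
    unfolding has_real_derivative_iff_has_vector_derivative by (rule pd_along_line[OF C_k_pd[OF f]])
  from MVT2[OF t this] obtain s' where s': "0 < s'" "s' < t"
    "pd i f (x + s *\<^sub>R ?i + t *\<^sub>R ?j) - pd i f (x + s *\<^sub>R ?i) = t * pd j (pd i f) (x + s *\<^sub>R ?i + s' *\<^sub>R ?j)" by auto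
  show ?thesis
    using s s' by (intro exI[of _ s] exI[of _ s']) (simp add: g_def algebra_simps power2_eq_square)
qed

lemma pd_commute_real:
  fixes f :: "real^'n \<Rightarrow> real"
  assumes f: "C_k (Suc (Suc 0)) f"
  shows "pd i (pd j f) x = pd j (pd i f) x"
proof -
  have *: "\<exists>u. u \<longlonglongrightarrow> x \<and> (\<forall>n. f (x + (1 / real (Suc n)) *\<^sub>R axis i 1 + (1 / real (Suc n)) *\<^sub>R axis j 1)
      - f (x + (1 / real (Suc n)) *\<^sub>R axis i 1) - f (x + (1 / real (Suc n)) *\<^sub>R axis j 1) + f x
      = (1 / real (Suc n))\<^sup>2 * pd j (pd i f) (u n))" for i j
  proof -
    have "\<exists>s s'. 0 < s \<and> s < 1 / real (Suc n) \<and> 0 < s' \<and> s' < 1 / real (Suc n) \<and>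
      f (x + (1 / real (Suc n)) *\<^sub>R axis i 1 + (1 / real (Suc n)) *\<^sub>R axis j 1)
      - f (x + (1 / real (Suc n)) *\<^sub>R axis i 1) - f (x + (1 / real (Suc n)) *\<^sub>R axis j 1) + f x
      = (1 / real (Suc n))\<^sup>2 * pd j (pd i f) (x + s *\<^sub>R axis i 1 + s' *\<^sub>R axis j 1)" for n
      by (rule second_difference_mvt[OF f]) simp
    then obtain s s' where s: "\<And>n. 0 < s n" "\<And>n. s n < 1 / real (Suc n)" "\<And>n. 0 < s' n" "\<And>n. s' n < 1 / real (Suc n)"
      "\<And>n. f (x + (1 / real (Suc n)) *\<^sub>R axis i 1 + (1 / real (Suc n)) *\<^sub>R axis j 1)
      - f (x + (1 / real (Suc n)) *\<^sub>R axis i 1) - f (x + (1 / real (Suc n)) *\<^sub>R axis j 1) + f x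
      = (1 / real (Suc n))\<^sup>2 * pd j (pd i f) (x + s n *\<^sub>R axis i 1 + s' n *\<^sub>R axis j 1)" by metis
    have lim: "(\<lambda>n. 1 / real (Suc n)) \<longlonglongrightarrow> 0" by (rule LIMSEQ_Suc[OF lim_1_over_n])
    have "s \<longlonglongrightarrow> 0" "s' \<longlonglongrightarrow> 0"
      using s by (auto intro!: tendsto_sandwich[OF _ _ tendsto_const lim] always_eventually less_imp_le)
    then have "(\<lambda>n. x + s n *\<^sub>R axis i 1 + s' n *\<^sub>R axis j 1) \<longlonglongrightarrow> x + 0 *\<^sub>R axis i 1 + 0 *\<^sub>R axis j 1"
      by (intro tendsto_intros)
    then show ?thesis using s(5) by (intro exI[of _ "\<lambda>n. x + s n *\<^sub>R axis i 1 + s' n *\<^sub>R axis j 1"]) simp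
  qed
  obtain u where u: "u \<longlonglongrightarrow> x" "\<And>n. f (x + (1 / real (Suc n)) *\<^sub>R axis i 1 + (1 / real (Suc n)) *\<^sub>R axis j 1)
      - f (x + (1 / real (Suc n)) *\<^sub>R axis i 1) - f (x + (1 / real (Suc n)) *\<^sub>R axis j 1) + f x
      = (1 / real (Suc n))\<^sup>2 * pd j (pd i f) (u n)" using *[of i j] by blast
  obtain v where v: "v \<longlonglongrightarrow> x" "\<And>n. f (x + (1 / real (Suc n)) *\<^sub>R axis j 1 + (1 / real (Suc n)) *\<^sub>R axis i 1)
      - f (x + (1 / real (Suc n)) *\<^sub>R axis j 1) - f (x + (1 / real (Suc n)) *\<^sub>R axis i 1) + f x
      = (1 / real (Suc n))\<^sup>2 * pd i (pd j f) (v n)" using *[of j i] by blast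
  have "(1 / real (Suc n))\<^sup>2 * pd j (pd i f) (u n) = (1 / real (Suc n))\<^sup>2 * pd i (pd j f) (v n)" for n
    unfolding u(2)[symmetric] v(2)[symmetric] by (simp add: add.assoc add.commute[of "_ *\<^sub>R axis i 1"])
  then have eq: "pd j (pd i f) (u n) = pd i (pd j f) (v n)" for n
    by (metis mult_cancel_left of_nat_neq_0 divide_eq_0_iff zero_neq_one power_not_zero)
  have c: "isCont (pd i (pd j f)) x" for i j
    using C_k_continuous[OF C_k_pd[OF C_k_pd[OF f]], of i j] by (simp add: continuous_on_eq_continuous_at)
  show ?thesis
    using LIMSEQ_unique[OF isCont_tendsto_compose[OF c u(1), of j i] isCont_tendsto_compose[OF c v(1), of i j, folded eq]]
    by simp
qed

lemma pd_commute:
  fixes f :: "real^'n \<Rightarrow> complex"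
  assumes f: "C_k (Suc (Suc 0)) f"
  shows "pd i (pd j f) x = pd j (pd i f) x"
proof (rule complex_eqI)
  have *: "L (pd i (pd j f) x) = pd i (pd j (\<lambda>y. L (f y))) x" if L: "bounded_linear L" for L :: "complex \<Rightarrow> real" and i j
  proof -
    have "pd j (\<lambda>y. L (f y)) = (\<lambda>y. L (pd j f y))" using pd_bounded_linear[OF L C_k_SucD[OF f]] by blast
    then show ?thesis using pd_bounded_linear[OF L C_k_pd[OF f]] by simp
  qed
  show "Re (pd i (pd j f) x) = Re (pd j (pd i f) x)" "Im (pd i (pd j f) x) = Im (pd j (pd i f) x)"
    using f by (simp_all add: * bounded_linear_Re bounded_linear_Im pd_commute_real C_k_bounded_linear)
qed

section \<open>Weak derivatives\<close>

lemma test_function_iff: "test_function \<phi> \<longleftrightarrow> smooth \<phi> \<and> bounded {x. \<phi> x \<noteq> 0}"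
  by (simp add: test_function_def compact_closure)

lemma test_function_pd: "test_function \<phi> \<Longrightarrow> test_function (pd i \<phi>)"
  by (simp add: test_function_iff smooth_pd bounded_support_pd)

lemma test_function_C_k: "test_function \<phi> \<Longrightarrow> C_k k \<phi>"
  by (simp add: test_function_iff smooth_def)

lemma bounded_support_lin:
  fixes f g :: "'a::metric_space \<Rightarrow> 'b::real_vector"
  assumes "bounded {x. f x \<noteq> 0}" "bounded {x. g x \<noteq> 0}"
  shows "bounded {x. f x + t *\<^sub>R g x \<noteq> 0}"
  by (rule bounded_subset[of "{x. f x \<noteq> 0} \<union> {x. g x \<noteq> 0}"]) (use assms in auto)

lemma test_function_lin: "test_function f \<Longrightarrow> test_function g \<Longrightarrow> test_function (\<lambda>x. f x + t *\<^sub>R g x)"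
  unfolding test_function_iff smooth_def by (auto intro: C_k_lin bounded_support_lin)

lemma test_function_cmult: "test_function \<phi> \<Longrightarrow> test_function (\<lambda>x. c * \<phi> x)"
  unfolding test_function_iff smooth_def by (auto intro: C_k_mult C_k_const elim!: bounded_subset)

lemma test_function_cnj: "test_function \<phi> \<Longrightarrow> test_function (\<lambda>x. cnj (\<phi> x))"
  unfolding test_function_iff smooth_def by (auto intro: C_k_cnj)

lemma test_function_of_real:
  "smooth \<eta> \<Longrightarrow> bounded {x. \<eta> x \<noteq> 0} \<Longrightarrow> test_function (\<lambda>x. complex_of_real (\<eta> x))"
  unfolding test_function_iff smooth_def by (auto intro: C_k_of_real)

lemma C_k_L2: "C_k k f \<Longrightarrow> bounded {x. f x \<noteq> 0} \<Longrightarrow> f \<in> L2 lborel"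
  unfolding L2_def using C_k_measurable[of k f] C_k_continuous[of k f]
  by (auto intro!: integrable_bounded_support continuous_intros)

lemma test_function_L2: "test_function \<phi> \<Longrightarrow> \<phi> \<in> L2 lborel"
  using C_k_L2[of 0] test_function_C_k test_function_iff by blast

text \<open>\<open>weak_partial\<close> uses the complex bilinear pairing, \<open>L2_inner\<close>
  the real part of the Hermitian one. Conjugating the test function translates one into the other,
  and multiplying it by the imaginary unit recovers the imaginary part.\<close>

lemma weak_partial_iff_inner:
  fixes u g :: "real^'n \<Rightarrow> complex"
  assumes u: "u \<in> L2 lborel" and g: "g \<in> L2 lborel"
  shows "weak_partial i u g \<longleftrightarrow>
    (\<forall>\<phi>. test_function \<phi> \<longrightarrow> L2_inner lborel u (pd i \<phi>) = - L2_inner lborel g \<phi>)"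
proof -
  have Re: "L2_inner lborel f (\<lambda>x. cnj (\<phi> x)) = Re (LINT x|lborel. f x * \<phi> x)" if "f \<in> L2 lborel" "test_function \<phi>" for f \<phi> :: "real^'n \<Rightarrow> complex"
    unfolding L2_inner_def inner_complex_eq_Re complex_cnj_cnj
    by (rule integral_Re[OF L2_integrable_mult[OF that(1) test_function_L2[OF that(2)]]])
  have pdc: "pd i (\<lambda>x. cnj (\<phi> x)) = (\<lambda>x. cnj (pd i \<phi> x))" if "test_function \<phi>" for \<phi> :: "real^'n \<Rightarrow> complex"
    using pd_cnj[OF test_function_C_k[OF that]] by blast
  have pdi: "pd i (\<lambda>x. \<i> * \<phi> x) = (\<lambda>x. \<i> * pd i \<phi> x)" if "test_function \<phi>" for \<phi> :: "real^'n \<Rightarrow> complex"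
    using pd_bounded_linear[OF bounded_linear_mult_right test_function_C_k[OF that]] by blast
  show ?thesis
  proof
    assume w: "weak_partial i u g"
    show "\<forall>\<phi>. test_function \<phi> \<longrightarrow> L2_inner lborel u (pd i \<phi>) = - L2_inner lborel g \<phi>"
    proof (intro allI impI)
      fix \<phi> :: "real^'n \<Rightarrow> complex" assume t: "test_function \<phi>"
      let ?\<psi> = "\<lambda>x. cnj (\<phi> x)"
      have t': "test_function ?\<psi>" using t by (rule test_function_cnj)
      have "(LINT x|lborel. u x * pd i ?\<psi> x) = - (LINT x|lborel. g x * ?\<psi> x)"
        using w t' unfolding weak_partial_def pd_def by blast
      then show "L2_inner lborel u (pd i \<phi>) = - L2_inner lborel g \<phi>"
        using Re[OF u test_function_pd[OF t'], of i] Re[OF g t'] by (simp add: pdc[OF t])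
    qed
  next
    assume *: "\<forall>\<phi>. test_function \<phi> \<longrightarrow> L2_inner lborel u (pd i \<phi>) = - L2_inner lborel g \<phi>"
    have re: "Re (LINT x|lborel. u x * pd i \<phi> x) = - Re (LINT x|lborel. g x * \<phi> x)" if t: "test_function \<phi>" for \<phi>
    proof -
      have "L2_inner lborel u (pd i (\<lambda>x. cnj (\<phi> x))) = - L2_inner lborel g (\<lambda>x. cnj (\<phi> x))"
        using * test_function_cnj[OF t] by blast
      then show ?thesis using Re[OF u test_function_pd[OF t]] Re[OF g t] by (simp add: pdc[OF t])
    qed
    show "weak_partial i u g"
      unfolding weak_partial_def
    proof (intro allI impI)
      fix \<phi> :: "real^'n \<Rightarrow> complex" assume t: "test_function \<phi>"
      have "Re (\<i> * (LINT x|lborel. u x * pd i \<phi> x)) = - Re (\<i> * (LINT x|lborel. g x * \<phi> x))"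
        using re[OF test_function_cmult[OF t, of \<i>]]
        by (simp add: pdi[OF t] mult.left_commute[of _ \<i>] del: complex_i_mult_minus)
      then show "(LINT x|lborel. u x * frechet_derivative \<phi> (at x) (axis i 1)) = - (LINT x|lborel. g x * \<phi> x)"
        using re[OF t] unfolding pd_def by (simp add: complex_eq_iff)
    qed
  qed
qed

lemma L2_Re_Im:
  assumes "f \<in> L2 lborel"
  shows "(\<lambda>x. Re (f x)) \<in> borel_measurable borel" "(\<lambda>x. Im (f x)) \<in> borel_measurable borel"
    "integrable lborel (\<lambda>x. (Re (f x))\<^sup>2)" "integrable lborel (\<lambda>x. (Im (f x))\<^sup>2)"
proof -
  have [measurable]: "f \<in> borel_measurable borel" using assms by (simp add: L2_def)
  show "(\<lambda>x. Re (f x)) \<in> borel_measurable borel" "(\<lambda>x. Im (f x)) \<in> borel_measurable borel" by measurable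
  show "integrable lborel (\<lambda>x. (Re (f x))\<^sup>2)" "integrable lborel (\<lambda>x. (Im (f x))\<^sup>2)"
    by (rule Bochner_Integration.integrable_bound[OF L2_integrable[OF assms]]; auto simp: cmod_power2)+
qed

lemma L2_inner_of_real: "L2_inner M f (\<lambda>x. complex_of_real (r x)) = (LINT x|M. Re (f x) * r x)"
  by (simp add: L2_inner_def inner_complex_def)

lemma L2_inner_i_of_real: "L2_inner M f (\<lambda>x. \<i> * complex_of_real (r x)) = (LINT x|M. Im (f x) * r x)"
  by (simp add: L2_inner_def inner_complex_def)

lemma L2_fundamental_lemma:
  assumes f: "f \<in> L2 lborel" and 0: "\<And>\<phi>. test_function \<phi> \<Longrightarrow> L2_inner lborel f \<phi> = 0"
  shows "AE x in lborel. f x = (0::complex)"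
proof -
  note Lf = L2_Re_Im[OF f]
  have "AE x in lborel. Re (f x) = 0"
  proof (rule fundamental_lemma)
    show "(LINT x|lborel. Re (f x) * \<eta> x) = 0" if "smooth \<eta>" "bounded {x. \<eta> x \<noteq> 0}" for \<eta>
      using 0[OF test_function_of_real[OF that]] by (simp add: L2_inner_of_real)
  qed (use Lf in \<open>auto intro!: integrable_square_indicator\<close>)
  moreover have "AE x in lborel. Im (f x) = 0"
  proof (rule fundamental_lemma)
    show "(LINT x|lborel. Im (f x) * \<eta> x) = 0" if "smooth \<eta>" "bounded {x. \<eta> x \<noteq> 0}" for \<eta>
      using 0[OF test_function_cmult[OF test_function_of_real[OF that], of \<i>]] by (simp add: L2_inner_i_of_real)
  qed (use Lf in \<open>auto intro!: integrable_square_indicator\<close>)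
  ultimately show ?thesis by eventually_elim (simp add: complex_eq_iff)
qed

lemma weak_partial_unique:
  fixes u g :: "real^'n \<Rightarrow> complex"
  assumes u: "u \<in> L2 lborel" "u' \<in> L2 lborel" "AE x in lborel. u x = u' x"
    and g: "g \<in> L2 lborel" "weak_partial i u g" and g': "g' \<in> L2 lborel" "weak_partial i u' g'"
  shows "AE x in lborel. g x = g' x"
proof -
  have "AE x in lborel. g x - g' x = 0"
  proof (rule L2_fundamental_lemma[OF L2_diff[OF g(1) g'(1)]])
    fix \<phi> :: "real^'n \<Rightarrow> complex" assume t: "test_function \<phi>"
    note tL = test_function_L2[OF t] test_function_L2[OF test_function_pd[OF t]]
    have "L2_inner lborel u (pd i \<phi>) = L2_inner lborel u' (pd i \<phi>)"
      using u tL by (intro L2_inner_cong_AE) auto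
    then show "L2_inner lborel (\<lambda>x. g x - g' x) \<phi> = 0"
      using g(2) g'(2) t tL weak_partial_iff_inner[OF u(1) g(1)] weak_partial_iff_inner[OF u(2) g'(1)]
      by (simp add: L2_inner_diff_left g(1) g'(1))
  qed
  then show ?thesis by simp
qed

lemma weak_partial_cong_AE:
  fixes u g :: "real^'n \<Rightarrow> complex"
  assumes u: "u \<in> L2 lborel" "u' \<in> L2 lborel" "AE x in lborel. u x = u' x"
    and g: "g \<in> L2 lborel" "weak_partial i u g"
  shows "weak_partial i u' g"
  unfolding weak_partial_iff_inner[OF u(2) g(1)]
proof (intro allI impI)
  fix \<phi> :: "real^'n \<Rightarrow> complex" assume t: "test_function \<phi>"
  have "L2_inner lborel u (pd i \<phi>) = L2_inner lborel u' (pd i \<phi>)"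
    using u test_function_L2[OF test_function_pd[OF t]] by (intro L2_inner_cong_AE) auto
  then show "L2_inner lborel u' (pd i \<phi>) = - L2_inner lborel g \<phi>"
    using g(2) t weak_partial_iff_inner[OF u(1) g(1)] by simp
qed

lemma weak_partial_lin:
  assumes u: "u \<in> L2 lborel" "g \<in> L2 lborel" "weak_partial i u g"
    and v: "v \<in> L2 lborel" "k \<in> L2 lborel" "weak_partial i v k"
  shows "weak_partial i (\<lambda>x. u x + t *\<^sub>R v x) (\<lambda>x. g x + t *\<^sub>R k x)"
  using u v weak_partial_iff_inner[OF L2_lin[OF u(1) v(1)] L2_lin[OF u(2) v(2)]]
    weak_partial_iff_inner[OF u(1,2)] weak_partial_iff_inner[OF v(1,2)]
  by (simp add: L2_inner_lin_left test_function_L2 test_function_pd)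

lemma weak_partial_limit:
  fixes u' g' :: "real^'n \<Rightarrow> complex"
  assumes u: "\<And>n. u n \<in> L2 lborel" "u' \<in> L2 lborel" "(\<lambda>n. L2_norm lborel (\<lambda>x. u n x - u' x)) \<longlonglongrightarrow> 0"
    and g: "\<And>n. g n \<in> L2 lborel" "g' \<in> L2 lborel" "(\<lambda>n. L2_norm lborel (\<lambda>x. g n x - g' x)) \<longlonglongrightarrow> 0"
    and w: "\<And>n. weak_partial i (u n) (g n)"
  shows "weak_partial i u' g'"
  unfolding weak_partial_iff_inner[OF u(2) g(2)]
proof (intro allI impI)
  fix \<phi> :: "real^'n \<Rightarrow> complex" assume t: "test_function \<phi>"
  note tL = test_function_L2[OF t] test_function_L2[OF test_function_pd[OF t]]
  have "(\<lambda>n. L2_inner lborel (u n) (pd i \<phi>)) \<longlonglongrightarrow> L2_inner lborel u' (pd i \<phi>)"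
    by (rule L2_inner_tendsto[OF u(1,2) tL(2) tL(2) u(3)]) (simp add: L2_norm_def)
  moreover have "(\<lambda>n. - L2_inner lborel (g n) \<phi>) \<longlonglongrightarrow> - L2_inner lborel g' \<phi>"
    by (intro tendsto_minus L2_inner_tendsto[OF g(1,2) tL(1) tL(1) g(3)]) (simp add: L2_norm_def)
  moreover have "L2_inner lborel (u n) (pd i \<phi>) = - L2_inner lborel (g n) \<phi>" for n
    using w t weak_partial_iff_inner[OF u(1) g(1)] by blast
  ultimately show "L2_inner lborel u' (pd i \<phi>) = - L2_inner lborel g' \<phi>"
    using LIMSEQ_unique by simp
qed

lemma L2_inner_pd:
  assumes "C_k (Suc 0) f" "C_k (Suc 0) g" "bounded {x. f x \<noteq> 0} \<or> bounded {x. g x \<noteq> 0}"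
  shows "L2_inner lborel f (pd i g) = - L2_inner lborel (pd i f) g"
  using integral_by_parts[OF bounded_bilinear_inner assms] by (simp add: L2_inner_def)

lemma weak_partial_classical:
  assumes "C_k (Suc 0) f" "bounded {x. f x \<noteq> 0}"
  shows "weak_partial i f (pd i f)"
  using assms weak_partial_iff_inner[OF C_k_L2[OF assms] C_k_L2[OF C_k_pd[OF assms(1)] bounded_support_pd[OF assms(2)]]]
  by (simp add: L2_inner_pd test_function_C_k)

section \<open>The space H2 and its weak Laplacian\<close>

lemma weak_D_AE:
  assumes "u \<in> L2 lborel" "g \<in> L2 lborel" "weak_partial i u g"
  shows "weak_D i u \<in> L2 lborel" "weak_partial i u (weak_D i u)" "AE x in lborel. weak_D i u x = g x"
proof -
  have "weak_D i u \<in> L2 lborel \<and> weak_partial i u (weak_D i u)"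
    unfolding weak_D_def by (rule someI[of _ g]) (use assms in simp)
  then show 1: "weak_D i u \<in> L2 lborel" "weak_partial i u (weak_D i u)" by auto
  show "AE x in lborel. weak_D i u x = g x"
    by (rule weak_partial_unique[OF assms(1,1) _ 1 assms(2,3)]) simp
qed

text \<open>\<open>laplacian\<close> applies the choice in \<open>weak_D\<close> twice. By
  uniqueness of weak derivatives any first derivatives \<open>g\<close> and second derivatives
  \<open>k\<close> compute it almost everywhere, so concrete candidates can replace the chosen ones.
  Mixed derivatives are included because \<open>H2\<close> asks the first derivatives to lie in
  \<open>H1\<close>.\<close>

lemma H2_I:
  assumes u: "u \<in> L2 lborel"
    and g: "\<And>i. g i \<in> L2 lborel" "\<And>i. weak_partial i u (g i)"
    and k: "\<And>i j. k i j \<in> L2 lborel" "\<And>i j. weak_partial j (g i) (k i j)"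
  shows "u \<in> H2" "AE x in lborel. laplacian u x = (\<Sum>i\<in>UNIV. k i i x)" "laplacian u \<in> L2 lborel"
proof -
  show "u \<in> H2" unfolding H2_def H1_def using assms by blast
  have *: "weak_D i (weak_D i u) \<in> L2 lborel \<and> (AE x in lborel. weak_D i (weak_D i u) x = k i i x)" for i
  proof -
    note d = weak_D_AE[OF u g(1) g(2), of i]
    have "weak_partial i (weak_D i u) (k i i)"
      by (rule weak_partial_cong_AE[OF g(1)[of i] d(1) _ k(1) k(2)]) (use d(3) in auto)
    from weak_D_AE[OF d(1) k(1) this] show ?thesis by blast
  qed
  have "AE x in lborel. \<forall>i\<in>UNIV. weak_D i (weak_D i u) x = k i i x"
    using * by (intro AE_finite_allI) auto
  then show "AE x in lborel. laplacian u x = (\<Sum>i\<in>UNIV. k i i x)"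
    by eventually_elim (simp add: laplacian_def)
  show "laplacian u \<in> L2 lborel" unfolding laplacian_def[abs_def] using * by (intro L2_sum) auto
qed

lemma H2_E:
  assumes "u \<in> H2"
  obtains g k where "u \<in> L2 lborel" "\<And>i. g i \<in> L2 lborel" "\<And>i. weak_partial i u (g i)"
    "\<And>i j. k i j \<in> L2 lborel" "\<And>i j. weak_partial j (g i) (k i j)"
proof -
  have "\<forall>i. \<exists>g. g \<in> L2 lborel \<and> weak_partial i u g \<and> (\<forall>j. \<exists>k\<in>L2 lborel. weak_partial j g k)"
    using assms unfolding H2_def H1_def by blast
  then obtain g where g: "\<And>i. g i \<in> L2 lborel" "\<And>i. weak_partial i u (g i)"
    "\<And>i j. \<exists>k\<in>L2 lborel. weak_partial j (g i) k" by metis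
  from g(3) have "\<forall>i j. \<exists>k. k \<in> L2 lborel \<and> weak_partial j (g i) k" by blast
  then obtain k where "\<And>i j. k i j \<in> L2 lborel" "\<And>i j. weak_partial j (g i) (k i j)"
    unfolding choice_iff by blast
  with g assms show ?thesis by (intro that[of g k]) (auto simp: H2_def)
qed

lemma H2_L2: "u \<in> H2 \<Longrightarrow> u \<in> L2 lborel"
  by (simp add: H2_def)

lemma laplacian_L2: "u \<in> H2 \<Longrightarrow> laplacian u \<in> L2 lborel"
  using H2_I(3) H2_E by metis

lemma H2_lin:
  assumes u: "u \<in> H2" and v: "v \<in> H2"
  shows "(\<lambda>x. u x + t *\<^sub>R v x) \<in> H2"
    and "AE x in lborel. laplacian (\<lambda>x. u x + t *\<^sub>R v x) x = laplacian u x + t *\<^sub>R laplacian v x"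
proof -
  obtain g k where g: "u \<in> L2 lborel" "\<And>i. g i \<in> L2 lborel" "\<And>i. weak_partial i u (g i)"
    "\<And>i j. k i j \<in> L2 lborel" "\<And>i j. weak_partial j (g i) (k i j)" by (rule H2_E[OF u], rule that; assumption)
  obtain g' k' where g': "v \<in> L2 lborel" "\<And>i. g' i \<in> L2 lborel" "\<And>i. weak_partial i v (g' i)"
    "\<And>i j. k' i j \<in> L2 lborel" "\<And>i j. weak_partial j (g' i) (k' i j)" by (rule H2_E[OF v], rule that; assumption)
  note I = H2_I[where u = "\<lambda>x. u x + t *\<^sub>R v x" and g = "\<lambda>i x. g i x + t *\<^sub>R g' i x" and k = "\<lambda>i j x. k i j x + t *\<^sub>R k' i j x",
      OF L2_lin[OF g(1) g'(1)] L2_lin[OF g(2) g'(2)] weak_partial_lin[OF g(1,2,3) g'(1,2,3)]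
        L2_lin[OF g(4) g'(4)] weak_partial_lin[OF g(2,4,5) g'(2,4,5)]]
  show "(\<lambda>x. u x + t *\<^sub>R v x) \<in> H2" by (rule I(1))
  from I(2) H2_I(2)[OF g] H2_I(2)[OF g']
  show "AE x in lborel. laplacian (\<lambda>x. u x + t *\<^sub>R v x) x = laplacian u x + t *\<^sub>R laplacian v x"
    by eventually_elim (simp add: sum.distrib scaleR_sum_right)
qed

text \<open>The pointwise classical Laplacian, as opposed to the weak one, \<open>laplacian\<close>,
  which is determined only almost everywhere.\<close>

definition lap :: "(real^'n \<Rightarrow> complex) \<Rightarrow> real^'n \<Rightarrow> complex" where
  "lap f x = (\<Sum>i\<in>UNIV. pd i (pd i f) x)"

lemma classical_H2:
  assumes f: "C_k (Suc (Suc 0)) f" "bounded {x. f x \<noteq> 0}"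
  shows "f \<in> H2" "AE x in lborel. laplacian f x = lap f x"
proof -
  note c = C_k_SucD[OF f(1)] f(2)
  note c1 = C_k_pd[OF f(1)] bounded_support_pd[OF f(2)]
  note c2 = C_k_pd[OF c1(1)] bounded_support_pd[OF c1(2)]
  note I = H2_I[OF C_k_L2[OF c] C_k_L2[OF c1] weak_partial_classical[OF c] C_k_L2[OF c2] weak_partial_classical[OF c1]]
  show "f \<in> H2" by (rule I(1))
  show "AE x in lborel. laplacian f x = lap f x" using I(2) by (simp add: lap_def)
qed

lemma lap_test_function: "test_function \<phi> \<Longrightarrow> test_function (lap \<phi>)"
proof -
  assume t: "test_function \<phi>"
  have "test_function (\<lambda>x. \<Sum>i\<in>I. pd i (pd i \<phi>) x)" for I
  proof (induction I rule: infinite_finite_induct)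
    case (insert i I)
    then show ?case
      using test_function_lin[OF test_function_pd[OF test_function_pd[OF t]] insert.IH, of i i 1] by simp
  qed (auto simp: test_function_iff smooth_def C_k_const)
  then show "test_function (lap \<phi>)" by (simp add: lap_def[abs_def])
qed

lemma laplacian_weak:
  assumes u: "u \<in> H2" and t: "test_function \<phi>"
  shows "L2_inner lborel (laplacian u) \<phi> = L2_inner lborel u (lap \<phi>)"
proof -
  obtain g k where g: "u \<in> L2 lborel" "\<And>i. g i \<in> L2 lborel" "\<And>i. weak_partial i u (g i)"
    "\<And>i j. k i j \<in> L2 lborel" "\<And>i j. weak_partial j (g i) (k i j)" by (rule H2_E[OF u], rule that; assumption)
  note tp = test_function_pd[OF t]
  have "L2_inner lborel (laplacian u) \<phi> = L2_inner lborel (\<lambda>x. \<Sum>i\<in>UNIV. k i i x) \<phi>"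
    using H2_I[OF g] test_function_L2[OF t] g(4) by (intro L2_inner_cong_AE) (auto intro: L2_sum)
  also have "\<dots> = (\<Sum>i\<in>UNIV. L2_inner lborel (k i i) \<phi>)"
    using g(4) test_function_L2[OF t] by (intro L2_inner_sum_left) auto
  also have "\<dots> = (\<Sum>i\<in>UNIV. L2_inner lborel u (pd i (pd i \<phi>)))"
  proof (intro sum.cong refl)
    fix i
    have "L2_inner lborel (g i) (pd i \<phi>) = - L2_inner lborel (k i i) \<phi>"
      using g(5) t weak_partial_iff_inner[OF g(2,4)] by blast
    moreover have "L2_inner lborel u (pd i (pd i \<phi>)) = - L2_inner lborel (g i) (pd i \<phi>)"
      using g(3) tp weak_partial_iff_inner[OF g(1,2)] by blast
    ultimately show "L2_inner lborel (k i i) \<phi> = L2_inner lborel u (pd i (pd i \<phi>))" by simp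
  qed
  also have "\<dots> = L2_inner lborel (lap \<phi>) u"
    unfolding lap_def[abs_def] using tp g(1)
    by (subst L2_inner_sum_left) (auto intro: test_function_L2 test_function_pd simp: L2_inner_commute)
  finally show ?thesis by (simp add: L2_inner_commute)
qed

text \<open>Uniqueness applied to the real and the imaginary part, with test functions
  \<open>\<eta>\<close> and \<open>\<i> * \<eta>\<close>. It says that the range of
  \<open>\<mu> - \<Delta>\<close> on test functions has trivial orthogonal complement.\<close>

lemma L2_ortho_resolvent_range:
  fixes w :: "real^'n \<Rightarrow> complex"
  assumes w: "w \<in> L2 lborel" and \<mu>: "\<mu> > 0"
    and 0: "\<And>\<phi>. test_function \<phi> \<Longrightarrow> L2_inner lborel w (\<lambda>x. \<mu> *\<^sub>R \<phi> x - lap \<phi> x) = 0"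
  shows "AE x in lborel. w x = 0"
proof -
  note Lw = L2_Re_Im[OF w]
  have pdr: "pd i (\<lambda>x. complex_of_real (\<eta> x)) = (\<lambda>x. complex_of_real (pd i \<eta> x))" if "smooth \<eta>" for \<eta> :: "real^'n \<Rightarrow> real" and i
    using pd_of_real[OF smooth_C_k[OF that]] by blast
  have lapr: "\<mu> *\<^sub>R complex_of_real (\<eta> x) - lap (\<lambda>x. complex_of_real (\<eta> x)) x = complex_of_real (\<mu> * \<eta> x - (\<Sum>i\<in>UNIV. pd i (pd i \<eta>) x))" if "smooth \<eta>" for \<eta> :: "real^'n \<Rightarrow> real" and x
    by (simp add: lap_def pdr that smooth_pd scaleR_conv_of_real)
  have pdi: "pd i (\<lambda>x. \<i> * \<phi> x) = (\<lambda>x. \<i> * pd i \<phi> x)" if "test_function \<phi>" for \<phi> :: "real^'n \<Rightarrow> complex" and i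
    using pd_bounded_linear[OF bounded_linear_mult_right test_function_C_k[OF that]] by blast
  have lapi: "\<mu> *\<^sub>R (\<i> * \<phi> x) - lap (\<lambda>x. \<i> * \<phi> x) x = \<i> * (\<mu> *\<^sub>R \<phi> x - lap \<phi> x)" if "test_function \<phi>" for \<phi> :: "real^'n \<Rightarrow> complex" and x
    by (simp add: lap_def pdi that test_function_pd sum_distrib_left right_diff_distrib)
  have "AE x in lborel. Re (w x) = 0"
  proof (rule weak_Laplace_eigen_zero[OF Lw(1,3) \<mu>])
    show "(LINT x|lborel. Re (w x) * (\<mu> * \<eta> x - (\<Sum>i\<in>UNIV. pd i (pd i \<eta>) x))) = 0" if "smooth \<eta>" "bounded {x. \<eta> x \<noteq> 0}" for \<eta>
      using 0[OF test_function_of_real[OF that]] by (simp only: lapr[OF that(1)] L2_inner_of_real)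
  qed
  moreover have "AE x in lborel. Im (w x) = 0"
  proof (rule weak_Laplace_eigen_zero[OF Lw(2,4) \<mu>])
    show "(LINT x|lborel. Im (w x) * (\<mu> * \<eta> x - (\<Sum>i\<in>UNIV. pd i (pd i \<eta>) x))) = 0" if "smooth \<eta>" "bounded {x. \<eta> x \<noteq> 0}" for \<eta>
      using 0[OF test_function_cmult[OF test_function_of_real[OF that], of \<i>]]
      by (simp only: lapi[OF test_function_of_real[OF that]] lapr[OF that(1)] L2_inner_i_of_real)
  qed
  ultimately show ?thesis by eventually_elim (simp add: complex_eq_iff)
qed

section \<open>Solvability of \<open>\<mu>u - \<Delta>u = f\<close> in \<open>H\<^sup>2\<close>\<close>

abbreviation L2_lim :: "(nat \<Rightarrow> real^'n \<Rightarrow> complex) \<Rightarrow> (real^'n \<Rightarrow> complex) \<Rightarrow> bool" where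
  "L2_lim f g \<equiv> (\<lambda>n. L2_norm lborel (\<lambda>x. f n x - g x)) \<longlonglongrightarrow> 0"

lemma L2_lim_lin:
  assumes f: "\<And>n. f n \<in> L2 lborel" "f' \<in> L2 lborel" "L2_lim f f'"
    and g: "\<And>n. g n \<in> L2 lborel" "g' \<in> L2 lborel" "L2_lim g g'"
  shows "L2_lim (\<lambda>n x. f n x + t *\<^sub>R g n x) (\<lambda>x. f' x + t *\<^sub>R g' x)"
proof (rule Lim_null_comparison[OF always_eventually])
  show "\<forall>n. norm (L2_norm lborel (\<lambda>x. (f n x + t *\<^sub>R g n x) - (f' x + t *\<^sub>R g' x)))
      \<le> L2_norm lborel (\<lambda>x. f n x - f' x) + \<bar>t\<bar> * L2_norm lborel (\<lambda>x. g n x - g' x)"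
  proof
    fix n
    have "(\<lambda>x. (f n x + t *\<^sub>R g n x) - (f' x + t *\<^sub>R g' x)) = (\<lambda>x. (f n x - f' x) + t *\<^sub>R (g n x - g' x))"
      by (simp add: fun_eq_iff algebra_simps)
    then show "norm (L2_norm lborel (\<lambda>x. (f n x + t *\<^sub>R g n x) - (f' x + t *\<^sub>R g' x)))
      \<le> L2_norm lborel (\<lambda>x. f n x - f' x) + \<bar>t\<bar> * L2_norm lborel (\<lambda>x. g n x - g' x)"
      using L2_norm_triangle[OF L2_diff[OF f(1)[of n] f(2)] L2_scaleR[OF L2_diff[OF g(1)[of n] g(2)], of t]]
      by (simp add: L2_norm_scaleR)
  qed
  show "(\<lambda>n. L2_norm lborel (\<lambda>x. f n x - f' x) + \<bar>t\<bar> * L2_norm lborel (\<lambda>x. g n x - g' x)) \<longlonglongrightarrow> 0"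
    using f(3) g(3) by (auto intro!: tendsto_eq_intros)
qed

lemma L2_lim_sum:
  assumes "\<And>i n. i \<in> I \<Longrightarrow> f i n \<in> L2 lborel" "\<And>i. i \<in> I \<Longrightarrow> f' i \<in> L2 lborel" "\<And>i. i \<in> I \<Longrightarrow> L2_lim (f i) (f' i)"
  shows "L2_lim (\<lambda>n x. \<Sum>i\<in>I. f i n x) (\<lambda>x. \<Sum>i\<in>I. f' i x)"
  using assms
proof (induction I rule: infinite_finite_induct)
  case (insert i I)
  then show ?case
    using L2_lim_lin[of "f i" "f' i" "\<lambda>n x. \<Sum>i\<in>I. f i n x" "\<lambda>x. \<Sum>i\<in>I. f' i x" 1] by (simp add: L2_sum)
qed (simp_all add: L2_norm_def)

lemma L2_lim_unique:
  assumes f: "\<And>n. f n \<in> L2 lborel" and g: "g \<in> L2 lborel" "L2_lim f g" and k: "k \<in> L2 lborel" "L2_lim f k"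
  shows "AE x in lborel. g x = k x"
proof -
  have "L2_norm lborel (\<lambda>x. g x - k x) \<le> L2_norm lborel (\<lambda>x. f n x - g x) + L2_norm lborel (\<lambda>x. f n x - k x)" for n
    using L2_norm_triangle_diff[OF g(1) f[of n] k(1)] L2_norm_minus[of lborel g "f n"] by simp
  moreover have "(\<lambda>n. L2_norm lborel (\<lambda>x. f n x - g x) + L2_norm lborel (\<lambda>x. f n x - k x)) \<longlonglongrightarrow> 0"
    using tendsto_add[OF g(2) k(2)] by simp
  ultimately have "L2_norm lborel (\<lambda>x. g x - k x) \<le> 0"
    by (intro LIMSEQ_le_const) auto
  then have "L2_norm lborel (\<lambda>x. g x - k x) = 0" by (simp add: antisym)
  from L2_norm_eq_0[OF L2_diff[OF g(1) k(1)] this] show ?thesis by simp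
qed

lemma L2_lim_cong_AE:
  assumes f: "\<And>n. f n \<in> L2 lborel" and g: "g \<in> L2 lborel" "L2_lim f g" and k: "k \<in> L2 lborel" "AE x in lborel. g x = k x"
  shows "L2_lim f k"
proof -
  have "L2_norm lborel (\<lambda>x. f n x - g x) = L2_norm lborel (\<lambda>x. f n x - k x)" for n
    by (rule L2_norm_cong_AE) (use assms in \<open>auto intro: L2_diff\<close>)
  with g(2) show ?thesis by simp
qed

section \<open>A priori estimates, solvability and graph density of test functions\<close>

lemma inner_lap_self:
  assumes f: "C_k (Suc (Suc 0)) f" "bounded {x. f x \<noteq> 0}"
  shows "L2_inner lborel (lap f) f = - (\<Sum>i\<in>UNIV. L2_inner lborel (pd i f) (pd i f))"
proof -
  have L: "pd i (pd i f) \<in> L2 lborel" for i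
    using C_k_pd[OF C_k_pd[OF f(1)]] bounded_support_pd[OF bounded_support_pd[OF f(2)]] by (rule C_k_L2)
  have "L2_inner lborel (lap f) f = (\<Sum>i\<in>UNIV. L2_inner lborel (pd i (pd i f)) f)"
    unfolding lap_def[abs_def] using L C_k_L2[OF f] by (rule L2_inner_sum_left)
  also have "\<dots> = (\<Sum>i\<in>UNIV. - L2_inner lborel (pd i f) (pd i f))"
    using L2_inner_pd[OF C_k_pd[OF f(1)] C_k_SucD[OF f(1)] disjI2[OF f(2)]] by (intro sum.cong) auto
  finally show ?thesis by (simp add: sum_negf)
qed

text \<open>Two integrations by parts and exchanges of derivatives turn the pairing of two pure
  second derivatives into the square of a mixed one. The Laplacian thus controls all second
  derivatives, as membership in \<open>H2\<close> requires.\<close>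

lemma inner_lap_lap:
  assumes t: "test_function \<phi>"
  shows "L2_inner lborel (lap \<phi>) (lap \<phi>) = (\<Sum>i\<in>UNIV. \<Sum>j\<in>UNIV. L2_inner lborel (pd j (pd i \<phi>)) (pd j (pd i \<phi>)))"
proof -
  note tp = test_function_pd[OF t]
  note tpp = test_function_pd[OF tp]
  have swap: "L2_inner lborel (pd i (pd i \<phi>)) (pd j (pd j \<phi>)) = L2_inner lborel (pd j (pd i \<phi>)) (pd j (pd i \<phi>))" for i j
  proof -
    have ibp: "L2_inner lborel f (pd i g) = - L2_inner lborel (pd i f) g" if "test_function f" "test_function g" for f g i
      using that by (intro L2_inner_pd test_function_C_k) (auto simp: test_function_iff)
    have "L2_inner lborel (pd i (pd i \<phi>)) (pd j (pd j \<phi>)) = - L2_inner lborel (pd j (pd i (pd i \<phi>))) (pd j \<phi>)"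
      by (rule ibp[OF tpp tp])
    also have "pd j (pd i (pd i \<phi>)) = pd i (pd j (pd i \<phi>))"
      by (intro ext pd_commute test_function_C_k tp)
    also have "- L2_inner lborel (pd i (pd j (pd i \<phi>))) (pd j \<phi>) = L2_inner lborel (pd j (pd i \<phi>)) (pd i (pd j \<phi>))"
      using ibp[OF tpp tp] by simp
    also have "pd i (pd j \<phi>) = pd j (pd i \<phi>)"
      by (intro ext pd_commute test_function_C_k t)
    finally show ?thesis .
  qed
  have "L2_inner lborel (lap \<phi>) (lap \<phi>) = (\<Sum>i\<in>UNIV. \<Sum>j\<in>UNIV. L2_inner lborel (pd i (pd i \<phi>)) (pd j (pd j \<phi>)))"
  proof -
    have "L2_inner lborel (lap \<phi>) (lap \<phi>) = (\<Sum>i\<in>UNIV. L2_inner lborel (pd i (pd i \<phi>)) (lap \<phi>))"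
      using tpp test_function_L2[OF lap_test_function[OF t]]
      by (subst (1) lap_def[abs_def], intro L2_inner_sum_left) (auto intro: test_function_L2)
    also have "\<dots> = (\<Sum>i\<in>UNIV. \<Sum>j\<in>UNIV. L2_inner lborel (pd j (pd j \<phi>)) (pd i (pd i \<phi>)))"
      using tpp by (subst L2_inner_commute, subst lap_def[abs_def], subst L2_inner_sum_left) (auto intro: test_function_L2)
    finally show ?thesis by (subst (asm) L2_inner_commute[of _ "pd _ (pd _ \<phi>)" "pd _ (pd _ \<phi>)"])
  qed
  also have "\<dots> = (\<Sum>i\<in>UNIV. \<Sum>j\<in>UNIV. L2_inner lborel (pd j (pd i \<phi>)) (pd j (pd i \<phi>)))"
    by (intro sum.cong refl swap)
  finally show ?thesis .
qed

text \<open>Pairing \<open>\<mu> \<phi> - \<Delta> \<phi>\<close> with \<open>\<phi>\<close> bounds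
  the function by \<open>F / \<mu>\<close> and each first derivative by
  \<open>F / sqrt \<mu>\<close>; the triangle inequality then bounds the Laplacian by
  \<open>2 * F\<close>, and with it all second derivatives.\<close>

lemma resolvent_estimates:
  assumes \<mu>: "\<mu> > 0"
  shows "\<exists>C. \<forall>\<phi> :: real^'n \<Rightarrow> complex. test_function \<phi> \<longrightarrow> (let F = L2_norm lborel (\<lambda>x. \<mu> *\<^sub>R \<phi> x - lap \<phi> x) in
    L2_norm lborel \<phi> \<le> C * F \<and> (\<forall>i. L2_norm lborel (pd i \<phi>) \<le> C * F) \<and> (\<forall>i j. L2_norm lborel (pd j (pd i \<phi>)) \<le> C * F))"
proof -
  define C where "C = 2 + 1 / \<mu> + 1 / sqrt \<mu>"
  have C: "1 / \<mu> \<le> C" "1 / sqrt \<mu> \<le> C" "2 \<le> C" using \<mu> by (auto simp: C_def)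
  have "L2_norm lborel \<phi> \<le> C * F \<and> (\<forall>i. L2_norm lborel (pd i \<phi>) \<le> C * F) \<and> (\<forall>i j. L2_norm lborel (pd j (pd i \<phi>)) \<le> C * F)"
    if t: "test_function \<phi>" and F: "F = L2_norm lborel (\<lambda>x. \<mu> *\<^sub>R \<phi> x - lap \<phi> x)" for \<phi> :: "real^'n \<Rightarrow> complex" and F
  proof -
    have L: "\<phi> \<in> L2 lborel" "lap \<phi> \<in> L2 lborel"
      using t lap_test_function by (auto intro: test_function_L2)
    have Lf: "(\<lambda>x. \<mu> *\<^sub>R \<phi> x - lap \<phi> x) \<in> L2 lborel" using L by (intro L2_diff L2_scaleR)
    have F0: "F \<ge> 0" unfolding F by simp
    have sup: "C_k (Suc (Suc 0)) \<phi>" "bounded {x. \<phi> x \<noteq> 0}" using t by (auto simp: test_function_iff smooth_def)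
    have "L2_inner lborel (\<lambda>x. \<mu> *\<^sub>R \<phi> x - lap \<phi> x) \<phi> = \<mu> * (L2_norm lborel \<phi>)\<^sup>2 + (\<Sum>i\<in>UNIV. (L2_norm lborel (pd i \<phi>))\<^sup>2)"
      using L by (simp add: L2_inner_diff_left L2_scaleR L2_inner_scaleR_left inner_lap_self[OF sup] L2_norm_square)
    then have e: "\<mu> * (L2_norm lborel \<phi>)\<^sup>2 + (\<Sum>i\<in>UNIV. (L2_norm lborel (pd i \<phi>))\<^sup>2) \<le> F * L2_norm lborel \<phi>"
      using L2_Cauchy_Schwarz[OF Lf L(1)] by (simp add: F)
    moreover have s0: "(\<Sum>i\<in>UNIV. (L2_norm lborel (pd i \<phi>))\<^sup>2) \<ge> 0" by (intro sum_nonneg) auto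
    ultimately have "\<mu> * (L2_norm lborel \<phi>)\<^sup>2 \<le> F * L2_norm lborel \<phi>" by linarith
    then have n0: "\<mu> * L2_norm lborel \<phi> \<le> F"
      using F0 by (cases "L2_norm lborel \<phi> = 0") (auto simp: power2_eq_square less_le)
    then have n0': "L2_norm lborel \<phi> \<le> 1 / \<mu> * F" using \<mu> by (simp add: field_simps)
    have n1: "L2_norm lborel (pd i \<phi>) \<le> 1 / sqrt \<mu> * F" for i
    proof (rule power2_le_imp_le)
      have "(L2_norm lborel (pd i \<phi>))\<^sup>2 \<le> (\<Sum>i\<in>UNIV. (L2_norm lborel (pd i \<phi>))\<^sup>2)"
        by (rule member_le_sum) auto
      also have "\<dots> \<le> F * L2_norm lborel \<phi>"
      proof -
        have "0 \<le> \<mu> * (L2_norm lborel \<phi>)\<^sup>2" using \<mu> by simp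
        with e show ?thesis by linarith
      qed
      also have "\<dots> \<le> F * (1 / \<mu> * F)" using n0' F0 by (intro mult_left_mono)
      also have "\<dots> = (1 / sqrt \<mu> * F)\<^sup>2" using \<mu> by (simp add: power_mult_distrib power_divide power2_eq_square)
      finally show "(L2_norm lborel (pd i \<phi>))\<^sup>2 \<le> (1 / sqrt \<mu> * F)\<^sup>2" .
    qed (use F0 \<mu> in auto)
    have nl: "L2_norm lborel (lap \<phi>) \<le> 2 * F"
    proof -
      have "L2_norm lborel (\<lambda>x. lap \<phi> x - 0) \<le> L2_norm lborel (\<lambda>x. lap \<phi> x - \<mu> *\<^sub>R \<phi> x) + L2_norm lborel (\<lambda>x. \<mu> *\<^sub>R \<phi> x - 0)"
        using L by (intro L2_norm_triangle_diff L2_scaleR L2_zero)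
      then show ?thesis using n0 \<mu> by (simp add: F L2_norm_minus[of _ "lap \<phi>"] L2_norm_scaleR)
    qed
    have n2: "L2_norm lborel (pd j (pd i \<phi>)) \<le> 2 * F" for i j
    proof (rule order_trans[OF power2_le_imp_le nl])
      have "(L2_norm lborel (pd j (pd i \<phi>)))\<^sup>2 \<le> (\<Sum>j\<in>UNIV. (L2_norm lborel (pd j (pd i \<phi>)))\<^sup>2)"
        by (rule member_le_sum) auto
      also have "\<dots> \<le> (\<Sum>i\<in>UNIV. \<Sum>j\<in>UNIV. (L2_norm lborel (pd j (pd i \<phi>)))\<^sup>2)"
        by (rule member_le_sum[of i UNIV "\<lambda>i. \<Sum>j\<in>UNIV. (L2_norm lborel (pd j (pd i \<phi>)))\<^sup>2"]) (auto intro: sum_nonneg)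
      also have "\<dots> = (L2_norm lborel (lap \<phi>))\<^sup>2" by (simp add: L2_norm_square inner_lap_lap[OF t])
      finally show "(L2_norm lborel (pd j (pd i \<phi>)))\<^sup>2 \<le> (L2_norm lborel (lap \<phi>))\<^sup>2" .
    qed simp
    show ?thesis
      using n0' n1 n2 mult_right_mono[OF C(1) F0] mult_right_mono[OF C(2) F0] mult_right_mono[OF C(3) F0]
      by (meson order_trans)
  qed
  then show ?thesis by (intro exI[of _ C]) (simp add: Let_def)
qed

lemma lap_diff:
  assumes "test_function \<phi>" "test_function \<psi>"
  shows "lap (\<lambda>x. \<phi> x - \<psi> x) x = lap \<phi> x - lap \<psi> x"
proof -
  have 1: "pd i (\<lambda>x. f x - g x) = (\<lambda>x. pd i f x - pd i g x)" if "test_function f" "test_function g" for f g :: "real^'n \<Rightarrow> complex" and i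
    using pd_lin[OF test_function_C_k[OF that(1)] test_function_C_k[OF that(2)], of i "-1"] by auto
  show ?thesis using assms by (simp add: lap_def 1 test_function_pd sum_subtractf)
qed

lemma pd_diff_test:
  assumes "test_function \<phi>" "test_function \<psi>"
  shows "pd i (\<lambda>x. \<phi> x - \<psi> x) = (\<lambda>x. pd i \<phi> x - pd i \<psi> x)"
  using pd_lin[OF test_function_C_k[OF assms(1)] test_function_C_k[OF assms(2)], of i "-1"] by auto

lemma test_function_diff: "test_function f \<Longrightarrow> test_function g \<Longrightarrow> test_function (\<lambda>x. f x - g x)"
  using test_function_lin[of f g "-1"] by simp

text \<open>The estimates make the functions and their derivatives up to order two Cauchy along with
  the right hand sides; weak derivatives are closed under L2 limits, so the limit lies in
  \<open>H2\<close>.\<close>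

lemma resolvent_limit:
  fixes \<phi> :: "nat \<Rightarrow> real^'n \<Rightarrow> complex"
  assumes \<mu>: "\<mu> > 0" and t: "\<And>n. test_function (\<phi> n)" and f: "f \<in> L2 lborel"
    and lim: "L2_lim (\<lambda>n x. \<mu> *\<^sub>R \<phi> n x - lap (\<phi> n) x) f"
  shows "\<exists>u\<in>H2. L2_lim \<phi> u \<and> L2_lim (\<lambda>n. lap (\<phi> n)) (laplacian u) \<and> (AE x in lborel. \<mu> *\<^sub>R u x - laplacian u x = f x)"
proof -
  let ?f = "\<lambda>n x. \<mu> *\<^sub>R \<phi> n x - lap (\<phi> n) x"
  obtain C where "\<forall>\<phi> :: real^'n \<Rightarrow> complex. test_function \<phi> \<longrightarrow> (let F = L2_norm lborel (\<lambda>x. \<mu> *\<^sub>R \<phi> x - lap \<phi> x) in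
    L2_norm lborel \<phi> \<le> C * F \<and> (\<forall>i. L2_norm lborel (pd i \<phi>) \<le> C * F) \<and> (\<forall>i j. L2_norm lborel (pd j (pd i \<phi>)) \<le> C * F))"
    using resolvent_estimates[OF \<mu>] by blast
  then have est: "L2_norm lborel \<psi> \<le> C * L2_norm lborel (\<lambda>x. \<mu> *\<^sub>R \<psi> x - lap \<psi> x)"
    "L2_norm lborel (pd i \<psi>) \<le> C * L2_norm lborel (\<lambda>x. \<mu> *\<^sub>R \<psi> x - lap \<psi> x)"
    "L2_norm lborel (pd j (pd i \<psi>)) \<le> C * L2_norm lborel (\<lambda>x. \<mu> *\<^sub>R \<psi> x - lap \<psi> x)" if "test_function \<psi>" for \<psi> :: "real^'n \<Rightarrow> complex" and i j
    using that by (auto simp: Let_def)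
  have tL: "\<phi> n \<in> L2 lborel" "pd i (\<phi> n) \<in> L2 lborel" "pd j (pd i (\<phi> n)) \<in> L2 lborel" "lap (\<phi> n) \<in> L2 lborel" for n i j
    by (intro test_function_L2 test_function_pd lap_test_function t)+
  have fL: "?f n \<in> L2 lborel" for n using tL by (intro L2_diff L2_scaleR)
  \<comment> \<open>One argument, used with the identity and with all first and second partial
    derivatives as \<open>T\<close>.\<close>
  have ex: "\<exists>g\<in>L2 lborel. L2_lim (\<lambda>n. T (\<phi> n)) g"
    if T: "\<And>\<psi>. test_function \<psi> \<Longrightarrow> T \<psi> \<in> L2 lborel"
      "\<And>\<psi> \<zeta>. test_function \<psi> \<Longrightarrow> test_function \<zeta> \<Longrightarrow> T (\<lambda>x. \<psi> x - \<zeta> x) = (\<lambda>x. T \<psi> x - T \<zeta> x)"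
      "\<And>\<psi>. test_function \<psi> \<Longrightarrow> L2_norm lborel (T \<psi>) \<le> C * L2_norm lborel (\<lambda>x. \<mu> *\<^sub>R \<psi> x - lap \<psi> x)"
    for T :: "(real^'n \<Rightarrow> complex) \<Rightarrow> real^'n \<Rightarrow> complex"
  proof (rule L2_complete)
    show "T (\<phi> n) \<in> L2 lborel" for n using T(1) t by blast
    fix e :: real assume e: "e > 0"
    define e' where "e' = e / (\<bar>C\<bar> + 1)"
    have "e' > 0" using e by (simp add: e'_def add_pos_nonneg)
    from L2_convergent_Cauchy[OF fL f lim this] obtain N where N: "\<And>m n. m \<ge> N \<Longrightarrow> n \<ge> N \<Longrightarrow> L2_norm lborel (\<lambda>x. ?f m x - ?f n x) < e'" by blast
    have "L2_norm lborel (\<lambda>x. T (\<phi> m) x - T (\<phi> n) x) < e" if "m \<ge> N" "n \<ge> N" for m n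
    proof -
      have eq: "(\<lambda>x. \<mu> *\<^sub>R (\<phi> m x - \<phi> n x) - lap (\<lambda>x. \<phi> m x - \<phi> n x) x) = (\<lambda>x. ?f m x - ?f n x)"
        using lap_diff[OF t[of m] t[of n]] by (auto simp: algebra_simps)
      have "L2_norm lborel (\<lambda>x. T (\<phi> m) x - T (\<phi> n) x) \<le> C * L2_norm lborel (\<lambda>x. ?f m x - ?f n x)"
        using T(3)[OF test_function_diff[OF t[of m] t[of n]]] unfolding T(2)[OF t t] eq .
      also have "\<dots> \<le> (\<bar>C\<bar> + 1) * L2_norm lborel (\<lambda>x. ?f m x - ?f n x)" by (intro mult_right_mono) auto
      also have "\<dots> < (\<bar>C\<bar> + 1) * e'" using N[OF that] by (intro mult_strict_left_mono) auto
      also have "\<dots> = e" by (simp add: e'_def add_pos_nonneg less_imp_neq[symmetric])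
      finally show ?thesis .
    qed
    then show "\<exists>N. \<forall>m\<ge>N. \<forall>n\<ge>N. L2_norm lborel (\<lambda>x. T (\<phi> m) x - T (\<phi> n) x) < e" by blast
  qed
  obtain u where u: "u \<in> L2 lborel" "L2_lim \<phi> u"
    using ex[of "\<lambda>\<psi>. \<psi>"] est(1) test_function_L2 by auto
  have "\<exists>g\<in>L2 lborel. L2_lim (\<lambda>n. pd i (\<phi> n)) g" for i
    by (rule ex) (auto intro: est(2) test_function_L2 test_function_pd simp: pd_diff_test)
  then have "\<forall>i. \<exists>g. g \<in> L2 lborel \<and> L2_lim (\<lambda>n. pd i (\<phi> n)) g" by blast
  then obtain g where g: "\<And>i. g i \<in> L2 lborel" "\<And>i. L2_lim (\<lambda>n. pd i (\<phi> n)) (g i)"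
    unfolding choice_iff by blast
  have "\<exists>k\<in>L2 lborel. L2_lim (\<lambda>n. pd j (pd i (\<phi> n))) k" for i j
    by (rule ex) (auto intro: est(3) test_function_L2 test_function_pd simp: pd_diff_test test_function_pd)
  then have "\<forall>i j. \<exists>k. k \<in> L2 lborel \<and> L2_lim (\<lambda>n. pd j (pd i (\<phi> n))) k" by blast
  then obtain k where k: "\<And>i j. k i j \<in> L2 lborel" "\<And>i j. L2_lim (\<lambda>n. pd j (pd i (\<phi> n))) (k i j)"
    unfolding choice_iff by blast
  have wc: "weak_partial i \<psi> (pd i \<psi>)" if "test_function \<psi>" for i and \<psi> :: "real^'n \<Rightarrow> complex"
    using that by (intro weak_partial_classical test_function_C_k) (auto simp: test_function_iff)
  have wu: "weak_partial i u (g i)" for i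
    by (rule weak_partial_limit[OF tL(1) u tL(2) g wc[OF t]])
  have wg: "weak_partial j (g i) (k i j)" for i j
    by (rule weak_partial_limit[OF tL(2) g tL(3) k wc[OF test_function_pd[OF t]]])
  note H = H2_I[OF u(1) g(1) wu k(1) wg]
  have sumL: "(\<lambda>x. \<Sum>i\<in>UNIV. k i i x) \<in> L2 lborel" by (intro L2_sum k(1))
  have liml0: "L2_lim (\<lambda>n. lap (\<phi> n)) (\<lambda>x. \<Sum>i\<in>UNIV. k i i x)"
    unfolding lap_def by (rule L2_lim_sum[OF tL(3) k])
  have "AE x in lborel. (\<Sum>i\<in>UNIV. k i i x) = laplacian u x" using H(2) by eventually_elim simp
  note liml = L2_lim_cong_AE[OF tL(4) sumL liml0 H(3) this]
  have "L2_lim (\<lambda>n x. (0 + \<mu> *\<^sub>R \<phi> n x) + (-1) *\<^sub>R lap (\<phi> n) x) (\<lambda>x. (0 + \<mu> *\<^sub>R u x) + (-1) *\<^sub>R laplacian u x)"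
    using tL u liml H(3) by (intro L2_lim_lin L2_lin L2_zero) (simp_all add: L2_norm_def)
  then have "L2_lim ?f (\<lambda>x. \<mu> *\<^sub>R u x - laplacian u x)" by simp
  moreover have "(\<lambda>x. \<mu> *\<^sub>R u x - laplacian u x) \<in> L2 lborel" by (intro L2_diff L2_scaleR u(1) H(3))
  ultimately have "AE x in lborel. \<mu> *\<^sub>R u x - laplacian u x = f x" using L2_lim_unique[OF fL _ _ f lim] by blast
  with H(1) u(2) liml show ?thesis by blast
qed

text \<open>The range on test functions is dense, and \<open>resolvent_limit\<close> attains its
  limits. The approximating sequence is kept in the statement because \<open>H2_approx\<close>
  extracts it.\<close>

lemma resolvent_solve:
  fixes f :: "real^'n \<Rightarrow> complex"
  assumes \<mu>: "\<mu> > 0" and f: "f \<in> L2 lborel"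
  shows "\<exists>u\<in>H2. (AE x in lborel. \<mu> *\<^sub>R u x - laplacian u x = f x) \<and>
    (\<exists>\<phi>. (\<forall>n. test_function (\<phi> n)) \<and> L2_lim \<phi> u \<and> L2_lim (\<lambda>n. lap (\<phi> n)) (laplacian u))"
proof -
  define R where "R \<phi> = (\<lambda>x. \<mu> *\<^sub>R \<phi> x - lap \<phi> x)" for \<phi> :: "real^'n \<Rightarrow> complex"
  have "\<exists>s\<in>R ` Collect test_function. L2_norm lborel (\<lambda>x. f x - s x) < 1 / real (Suc n)" for n
  proof (rule L2_dense_if_orthogonal_trivial[OF _ _ _ _ f])
    show "R ` Collect test_function \<subseteq> L2 lborel"
    proof -
      have "R \<phi> \<in> L2 lborel" if "test_function \<phi>" for \<phi>
        unfolding R_def by (intro L2_diff L2_scaleR test_function_L2 lap_test_function that)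
      then show ?thesis by blast
    qed
    have "test_function (\<lambda>x::real^'n. 0)" by (simp add: test_function_iff smooth_def C_k_const)
    then show "R ` Collect test_function \<noteq> {}" by blast
    show "(\<lambda>x. s x + t *\<^sub>R s' x) \<in> R ` Collect test_function"
      if s: "s \<in> R ` Collect test_function" "s' \<in> R ` Collect test_function" for s s' t
    proof -
      obtain \<phi> \<psi> where *: "test_function \<phi>" "s = R \<phi>" "test_function \<psi>" "s' = R \<psi>" using s by blast
      have 1: "pd i (\<lambda>x. f x + t *\<^sub>R g x) = (\<lambda>x. pd i f x + t *\<^sub>R pd i g x)" if "test_function f" "test_function g" for f g :: "real^'n \<Rightarrow> complex" and i
        using pd_lin[OF test_function_C_k[OF that(1)] test_function_C_k[OF that(2)]] by blast
      have "lap (\<lambda>x. \<phi> x + t *\<^sub>R \<psi> x) x = lap \<phi> x + t *\<^sub>R lap \<psi> x" for x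
        using * by (simp add: lap_def 1 test_function_pd sum.distrib scaleR_sum_right)
      then have "(\<lambda>x. s x + t *\<^sub>R s' x) = R (\<lambda>x. \<phi> x + t *\<^sub>R \<psi> x)" unfolding * R_def by (simp add: algebra_simps)
      with * show ?thesis using test_function_lin by blast
    qed
    show "AE x in lborel. g x = 0" if "g \<in> L2 lborel" "\<And>s. s \<in> R ` Collect test_function \<Longrightarrow> L2_inner lborel g s = 0" for g
      using that by (intro L2_ortho_resolvent_range[OF _ \<mu>]) (auto simp: R_def)
  qed simp
  then have "\<forall>n. \<exists>\<phi>. test_function \<phi> \<and> L2_norm lborel (\<lambda>x. f x - R \<phi> x) < 1 / real (Suc n)" by blast
  then obtain \<phi> where \<phi>: "\<And>n. test_function (\<phi> n)" "\<And>n. L2_norm lborel (\<lambda>x. f x - R (\<phi> n) x) < 1 / real (Suc n)"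
    unfolding choice_iff by blast
  have lim: "L2_lim (\<lambda>n. R (\<phi> n)) f"
  proof (rule Lim_null_comparison[OF always_eventually])
    show "\<forall>n. norm (L2_norm lborel (\<lambda>x. R (\<phi> n) x - f x)) \<le> 1 / real (Suc n)"
      using \<phi>(2) L2_norm_minus[of lborel f] by (simp add: less_imp_le)
    show "(\<lambda>n. 1 / real (Suc n)) \<longlonglongrightarrow> 0" by (rule LIMSEQ_Suc[OF lim_1_over_n])
  qed
  from resolvent_limit[OF \<mu> \<phi>(1) f lim[unfolded R_def]] \<phi>(1) show ?thesis by blast
qed

text \<open>Density of test functions in the graph norm. The solution \<open>v\<close> of
  \<open>v - \<Delta> v = u - \<Delta> u\<close> constructed above is a limit of test functions, and
  \<open>u - v\<close> is orthogonal to the range of \<open>1 - \<Delta>\<close> on test functions,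
  so \<open>u = v\<close>. Solvability thus takes the place of cut-off and mollification.\<close>

lemma H2_approx:
  fixes u :: "real^'n \<Rightarrow> complex"
  assumes u: "u \<in> H2"
  shows "\<exists>\<phi>. (\<forall>n. test_function (\<phi> n)) \<and> L2_lim \<phi> u \<and> L2_lim (\<lambda>n. lap (\<phi> n)) (laplacian u)"
proof -
  note uL = H2_L2[OF u] laplacian_L2[OF u]
  have f: "(\<lambda>x. 1 *\<^sub>R u x - laplacian u x) \<in> L2 lborel" by (intro L2_diff L2_scaleR uL)
  obtain v \<phi> where v: "v \<in> H2" "AE x in lborel. 1 *\<^sub>R v x - laplacian v x = 1 *\<^sub>R u x - laplacian u x"
    "\<And>n. test_function (\<phi> n)" "L2_lim \<phi> v" "L2_lim (\<lambda>n. lap (\<phi> n)) (laplacian v)"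
    using resolvent_solve[OF _ f, of 1] by auto
  note vL = H2_L2[OF v(1)] laplacian_L2[OF v(1)]
  define w where "w x = u x + (-1) *\<^sub>R v x" for x
  have w: "w \<in> H2" "AE x in lborel. laplacian w x = laplacian u x + (-1) *\<^sub>R laplacian v x"
    unfolding w_def[abs_def] by (rule H2_lin[OF u v(1)])+
  have w0: "AE x in lborel. w x = 0"
  proof (rule L2_ortho_resolvent_range[OF H2_L2[OF w(1)], of 1])
    fix \<psi> :: "real^'n \<Rightarrow> complex" assume t: "test_function \<psi>"
    note tL = test_function_L2[OF t] test_function_L2[OF lap_test_function[OF t]]
    have "L2_inner lborel w (\<lambda>x. 1 *\<^sub>R \<psi> x - lap \<psi> x) = L2_inner lborel (\<lambda>x. w x - laplacian w x) \<psi>"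
      using tL H2_L2[OF w(1)] laplacian_L2[OF w(1)] laplacian_weak[OF w(1) t]
      by (simp add: L2_inner_diff_left L2_inner_diff_right)
    also have "\<dots> = L2_inner lborel (\<lambda>x. 0) \<psi>"
    proof (intro L2_inner_cong_AE)
      show "AE x in lborel. w x - laplacian w x = 0"
        using w(2) v(2)
      proof eventually_elim
        case (elim x)
        have "w x - laplacian w x = (1 *\<^sub>R u x - laplacian u x) - (1 *\<^sub>R v x - laplacian v x)"
          unfolding elim(1) by (simp add: w_def)
        with elim(2) show ?case by simp
      qed
    qed (use tL H2_L2[OF w(1)] laplacian_L2[OF w(1)] in \<open>auto intro: L2_diff L2_zero\<close>)
    finally show "L2_inner lborel w (\<lambda>x. 1 *\<^sub>R \<psi> x - lap \<psi> x) = 0" by (simp add: L2_inner_def)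
  qed simp
  have "AE x in lborel. v x = u x" using w0 by eventually_elim (simp add: w_def)
  then have 1: "L2_lim \<phi> u" by (intro L2_lim_cong_AE[OF test_function_L2[OF v(3)] vL(1) v(4) uL(1)])
  have "AE x in lborel. laplacian v x = laplacian u x"
    using w0 v(2) by eventually_elim (simp add: w_def algebra_simps)
  then have "L2_lim (\<lambda>n. lap (\<phi> n)) (laplacian u)"
    by (intro L2_lim_cong_AE[OF test_function_L2[OF lap_test_function[OF v(3)]] vL(2) v(5) uL(2)])
  with 1 v(3) show ?thesis by blast
qed

lemma laplacian_symmetric:
  fixes u w :: "real^'n \<Rightarrow> complex"
  assumes u: "u \<in> H2" and w: "w \<in> H2"
  shows "L2_inner lborel (laplacian u) w = L2_inner lborel u (laplacian w)"
proof -
  obtain \<phi> where \<phi>: "\<And>n. test_function (\<phi> n)" "L2_lim \<phi> u" "L2_lim (\<lambda>n. lap (\<phi> n)) (laplacian u)"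
    using H2_approx[OF u] by blast
  note L = H2_L2[OF u] laplacian_L2[OF u] H2_L2[OF w] laplacian_L2[OF w]
  have z: "(\<lambda>n. L2_norm lborel (\<lambda>x. g x - g x)) \<longlonglongrightarrow> 0" for g :: "real^'n \<Rightarrow> complex" by (simp add: L2_norm_def)
  have "(\<lambda>n. L2_inner lborel (lap (\<phi> n)) w) \<longlonglongrightarrow> L2_inner lborel (laplacian u) w"
    by (rule L2_inner_tendsto[OF test_function_L2[OF lap_test_function[OF \<phi>(1)]] L(2) L(3) L(3) \<phi>(3) z])
  moreover have "(\<lambda>n. L2_inner lborel (\<phi> n) (laplacian w)) \<longlonglongrightarrow> L2_inner lborel u (laplacian w)"
    by (rule L2_inner_tendsto[OF test_function_L2[OF \<phi>(1)] L(1) L(4) L(4) \<phi>(2) z])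
  moreover have "L2_inner lborel (lap (\<phi> n)) w = L2_inner lborel (\<phi> n) (laplacian w)" for n
    using laplacian_weak[OF w \<phi>(1)] by (simp add: L2_inner_commute)
  ultimately show ?thesis using LIMSEQ_unique by simp
qed

lemma laplacian_nonpos:
  fixes u :: "real^'n \<Rightarrow> complex"
  assumes u: "u \<in> H2"
  shows "L2_inner lborel (laplacian u) u \<le> 0"
proof -
  obtain \<phi> where \<phi>: "\<And>n. test_function (\<phi> n)" "L2_lim \<phi> u" "L2_lim (\<lambda>n. lap (\<phi> n)) (laplacian u)"
    using H2_approx[OF u] by blast
  have "(\<lambda>n. L2_inner lborel (lap (\<phi> n)) (\<phi> n)) \<longlonglongrightarrow> L2_inner lborel (laplacian u) u"
    by (rule L2_inner_tendsto[OF test_function_L2[OF lap_test_function[OF \<phi>(1)]] laplacian_L2[OF u]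
        test_function_L2[OF \<phi>(1)] H2_L2[OF u] \<phi>(3) \<phi>(2)])
  moreover have "L2_inner lborel (lap (\<phi> n)) (\<phi> n) \<le> 0" for n
  proof -
    have "C_k (Suc (Suc 0)) (\<phi> n)" "bounded {x. \<phi> n x \<noteq> 0}" using \<phi>(1) by (auto simp: test_function_iff smooth_def)
    from inner_lap_self[OF this] show ?thesis by (simp add: sum_nonneg L2_inner_ge_0)
  qed
  ultimately show ?thesis by (intro LIMSEQ_le_const2) auto
qed

section \<open>The variational principle for the continuous operator\<close>

text \<open>Real functions suffice, since the forms split into real and imaginary parts. Only two
  derivatives are asked for, so that spline functions are admissible while all members still lie in
  \<open>H2\<close>.\<close>

definition C2c :: "(real^'n \<Rightarrow> real) set" where
  "C2c = {u. C_k (Suc (Suc 0)) u \<and> bounded {x. u x \<noteq> 0}}"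

definition energy :: "(real^'n \<Rightarrow> real) \<Rightarrow> (real^'n \<Rightarrow> real) \<Rightarrow> real" where
  "energy W u = (\<Sum>i\<in>UNIV. LINT x|lborel. (pd i u x)\<^sup>2) + (LINT x|lborel. W x * (u x)\<^sup>2)"

lemma C2c_integrable:
  assumes u: "u \<in> C2c" and g: "continuous_on UNIV g"
  shows "integrable lborel (\<lambda>x. (pd i u x)\<^sup>2)" "integrable lborel (\<lambda>x. g x * (u x)\<^sup>2)"
proof -
  have "C_k (Suc 0) (pd i u)" "C_k (Suc (Suc 0)) u" using u by (auto simp: C2c_def intro: C_k_pd)
  then have c: "continuous_on UNIV (pd i u)" "continuous_on UNIV u" by (auto intro: C_k_continuous)
  have b: "bounded {x. pd i u x \<noteq> 0}" "bounded {x. u x \<noteq> 0}" using u by (auto simp: C2c_def intro: bounded_support_pd)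
  show "integrable lborel (\<lambda>x. (pd i u x)\<^sup>2)" "integrable lborel (\<lambda>x. g x * (u x)\<^sup>2)"
    using c b g by (auto intro!: integrable_bounded_support continuous_intros elim: bounded_subset)
qed

text \<open>Real and imaginary parts decouple because \<open>W\<close> is real and partial
  derivatives commute with \<open>Re\<close> and \<open>Im\<close>.\<close>

lemma energy_complex:
  fixes \<phi> :: "real^'n \<Rightarrow> complex"
  assumes \<phi>: "C_k (Suc (Suc 0)) \<phi>" "bounded {x. \<phi> x \<noteq> 0}"
    and W: "continuous_on UNIV W" "\<And>x. \<bar>W x\<bar> \<le> B"
  shows "(\<lambda>x. Re (\<phi> x)) \<in> C2c" "(\<lambda>x. Im (\<phi> x)) \<in> C2c"
    and "L2_inner lborel (\<lambda>x. - lap \<phi> x + complex_of_real (W x) * \<phi> x) \<phi>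
      = energy W (\<lambda>x. Re (\<phi> x)) + energy W (\<lambda>x. Im (\<phi> x))"
    and "L2_inner lborel \<phi> \<phi> = (LINT x|lborel. (Re (\<phi> x))\<^sup>2) + (LINT x|lborel. (Im (\<phi> x))\<^sup>2)"
proof -
  let ?r = "\<lambda>x. Re (\<phi> x)" and ?s = "\<lambda>x. Im (\<phi> x)"
  show r: "?r \<in> C2c" and s: "?s \<in> C2c"
    using \<phi> by (auto simp: C2c_def intro!: C_k_bounded_linear[OF bounded_linear_Re] C_k_bounded_linear[OF bounded_linear_Im] elim!: bounded_subset)
  have sq: "z \<bullet> z = (Re z)\<^sup>2 + (Im z)\<^sup>2" for z :: complex by (simp add: inner_complex_def power2_eq_square)
  have one: "continuous_on UNIV (\<lambda>x::real^'n. 1::real)" by simp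
  show "L2_inner lborel \<phi> \<phi> = (LINT x|lborel. (?r x)\<^sup>2) + (LINT x|lborel. (?s x)\<^sup>2)"
    using C2c_integrable(2)[OF r one] C2c_integrable(2)[OF s one] by (simp add: L2_inner_def sq)
  have p: "L2_inner lborel (pd i \<phi>) (pd i \<phi>) = (LINT x|lborel. (pd i ?r x)\<^sup>2) + (LINT x|lborel. (pd i ?s x)\<^sup>2)" for i
  proof -
    have "Re (pd i \<phi> x) = pd i ?r x" "Im (pd i \<phi> x) = pd i ?s x" for x
      using pd_bounded_linear[OF bounded_linear_Re C_k_SucD[OF \<phi>(1)]] pd_bounded_linear[OF bounded_linear_Im C_k_SucD[OF \<phi>(1)]] by simp_all
    then show ?thesis
      using C2c_integrable(1)[OF r one] C2c_integrable(1)[OF s one] by (simp add: L2_inner_def sq)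
  qed
  have L: "\<phi> \<in> L2 lborel" using \<phi> by (rule C_k_L2)
  have Wm: "(\<lambda>x. complex_of_real (W x)) \<in> borel_measurable lborel"
    using borel_measurable_continuous_onI[OF W(1)] by simp
  have LW: "(\<lambda>x. complex_of_real (W x) * \<phi> x) \<in> L2 lborel"
    by (rule L2_bounded_mult[OF L Wm, of B]) (use W in simp)
  have Ll: "lap \<phi> \<in> L2 lborel"
    unfolding lap_def[abs_def] using C_k_pd[OF C_k_pd[OF \<phi>(1)]] bounded_support_pd[OF bounded_support_pd[OF \<phi>(2)]]
    by (intro L2_sum C_k_L2[of 0]) auto
  have "L2_inner lborel (\<lambda>x. complex_of_real (W x) * \<phi> x) \<phi> = (LINT x|lborel. W x * (?r x)\<^sup>2 + W x * (?s x)\<^sup>2)"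
    unfolding L2_inner_def by (rule arg_cong[where f = "integral\<^sup>L lborel"])
      (auto simp: inner_complex_def power2_eq_square algebra_simps)
  also have "\<dots> = (LINT x|lborel. W x * (?r x)\<^sup>2) + (LINT x|lborel. W x * (?s x)\<^sup>2)"
    using C2c_integrable(2)[OF r W(1)] C2c_integrable(2)[OF s W(1)] by simp
  finally have "L2_inner lborel (\<lambda>x. complex_of_real (W x) * \<phi> x - lap \<phi> x) \<phi> = energy W ?r + energy W ?s"
    using L2_inner_diff_left[OF LW Ll L] by (simp add: inner_lap_self[OF \<phi>] p energy_def sum.distrib)
  then show "L2_inner lborel (\<lambda>x. - lap \<phi> x + complex_of_real (W x) * \<phi> x) \<phi> = energy W ?r + energy W ?s"
    by (simp add: add.commute)
qed

text \<open>Instance of the abstract result. The lower bound passes from test functions to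
  \<open>H2\<close> by graph density, and sharpness holds because \<open>C2c\<close> embeds into
  \<open>H2\<close>. For \<open>r < - B\<close> the equation is solved by iterating the resolvent of
  the Laplacian, with \<open>W\<close> as a bounded perturbation and contraction factor
  \<open>B / \<mu> < 1\<close>, where \<open>\<mu> = - r\<close>.\<close>

theorem min_spec_Schroedinger:
  fixes W :: "real^'n \<Rightarrow> real"
  assumes W: "continuous_on UNIV W" "\<And>x. \<bar>W x\<bar> \<le> B"
    and ge: "\<And>u. u \<in> C2c \<Longrightarrow> E * (LINT x|lborel. (u x)\<^sup>2) \<le> energy W u"
    and sharp: "\<And>c. (\<And>u. u \<in> C2c \<Longrightarrow> c * (LINT x|lborel. (u x)\<^sup>2) \<le> energy W u) \<Longrightarrow> c \<le> E"
  shows "min_spec lborel H2 (\<lambda>u x. - laplacian u x + complex_of_real (W x) * u x) = E"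
proof -
  let ?A = "\<lambda>u x. - laplacian u x + complex_of_real (W x) * u x"
  have B0: "B \<ge> 0" using W(2)[of 0] by linarith
  have Wm: "(\<lambda>x. complex_of_real (W x)) \<in> borel_measurable lborel"
    using borel_measurable_continuous_onI[OF W(1)] by simp
  have LW: "(\<lambda>x. complex_of_real (W x) * f x) \<in> L2 lborel" if "f \<in> L2 lborel" for f
    by (rule L2_bounded_mult[OF that Wm, of B]) (use W in simp)
  have Wsym: "L2_inner lborel (\<lambda>x. complex_of_real (W x) * f x) g = L2_inner lborel f (\<lambda>x. complex_of_real (W x) * g x)" for f g
    by (simp add: L2_inner_def inner_complex_def algebra_simps)
  have Aeq: "?A u = (\<lambda>x. complex_of_real (W x) * u x - laplacian u x)" for u by auto
  have NW: "L2_norm lborel (\<lambda>x. complex_of_real (W x) * f x) \<le> B * L2_norm lborel f" if f: "f \<in> L2 lborel" for f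
  proof (rule power2_le_imp_le)
    have "(LINT x|lborel. (cmod (complex_of_real (W x) * f x))\<^sup>2) \<le> (LINT x|lborel. B\<^sup>2 * (cmod (f x))\<^sup>2)"
      using L2_integrable[OF LW[OF f]] L2_integrable[OF f] W(2) B0
      by (intro integral_mono) (auto simp: norm_mult power_mult_distrib intro!: mult_right_mono abs_le_square_iff[THEN iffD1])
    then show "(L2_norm lborel (\<lambda>x. complex_of_real (W x) * f x))\<^sup>2 \<le> (B * L2_norm lborel f)\<^sup>2"
      by (simp add: L2_norm_def power_mult_distrib)
  qed (use B0 in auto)
  interpret semibounded_operator lborel H2 ?A E
  proof
    show "u \<in> L2 lborel" if "u \<in> H2" for u :: "real^'n \<Rightarrow> complex" using that by (rule H2_L2)
    show AL: "?A u \<in> L2 lborel" if "u \<in> H2" for u :: "real^'n \<Rightarrow> complex"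
      unfolding Aeq by (intro L2_diff LW H2_L2 laplacian_L2 that)
    show "(\<lambda>x. u x + t *\<^sub>R w x) \<in> H2" if "u \<in> H2" "w \<in> H2" for u w :: "real^'n \<Rightarrow> complex" and t
      using that by (rule H2_lin)
    show "AE x in lborel. ?A (\<lambda>x. u x + t *\<^sub>R w x) x = ?A u x + t *\<^sub>R ?A w x" if "u \<in> H2" "w \<in> H2" for u w :: "real^'n \<Rightarrow> complex" and t
      using H2_lin(2)[OF that, of t] by eventually_elim (simp add: algebra_simps)
    show "L2_inner lborel (?A u) w = L2_inner lborel u (?A w)" if "u \<in> H2" "w \<in> H2" for u w :: "real^'n \<Rightarrow> complex"
      unfolding Aeq using that
      by (simp add: L2_inner_diff_left L2_inner_diff_right LW H2_L2 laplacian_L2 Wsym laplacian_symmetric)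
    show "E * L2_inner lborel u u \<le> L2_inner lborel (?A u) u" if u: "u \<in> H2" for u :: "real^'n \<Rightarrow> complex"
    proof -
      obtain \<phi> where \<phi>: "\<And>n. test_function (\<phi> n)" "L2_lim \<phi> u" "L2_lim (\<lambda>n. lap (\<phi> n)) (laplacian u)"
        using H2_approx[OF u] by blast
      note uL = H2_L2[OF u] laplacian_L2[OF u]
      note tL = test_function_L2[OF \<phi>(1)] test_function_L2[OF lap_test_function[OF \<phi>(1)]]
      have "L2_lim (\<lambda>n x. complex_of_real (W x) * \<phi> n x) (\<lambda>x. complex_of_real (W x) * u x)"
      proof (rule Lim_null_comparison[OF always_eventually])
        show "\<forall>n. norm (L2_norm lborel (\<lambda>x. complex_of_real (W x) * \<phi> n x - complex_of_real (W x) * u x)) \<le> B * L2_norm lborel (\<lambda>x. \<phi> n x - u x)"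
          using NW[OF L2_diff[OF tL(1) uL(1)]] by (simp add: right_diff_distrib)
        show "(\<lambda>n. B * L2_norm lborel (\<lambda>x. \<phi> n x - u x)) \<longlonglongrightarrow> 0" using tendsto_mult_right_zero[OF \<phi>(2)] by simp
      qed
      from L2_lim_lin[OF LW[OF tL(1)] LW[OF uL(1)] this tL(2) uL(2) \<phi>(3), of "-1"]
      have "L2_lim (\<lambda>n x. - lap (\<phi> n) x + complex_of_real (W x) * \<phi> n x) (?A u)" by (simp add: Aeq)
      then have "(\<lambda>n. L2_inner lborel (\<lambda>x. - lap (\<phi> n) x + complex_of_real (W x) * \<phi> n x) (\<phi> n)) \<longlonglongrightarrow> L2_inner lborel (?A u) u"
        using L2_diff[OF LW[OF tL(1)] tL(2)] AL[OF u] by (intro L2_inner_tendsto tL(1) uL(1) \<phi>(2)) simp_all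
      moreover have "(\<lambda>n. E * L2_inner lborel (\<phi> n) (\<phi> n)) \<longlonglongrightarrow> E * L2_inner lborel u u"
        by (intro tendsto_mult tendsto_const L2_inner_tendsto tL(1) uL(1) \<phi>(2))
      moreover have "E * L2_inner lborel (\<phi> n) (\<phi> n) \<le> L2_inner lborel (\<lambda>x. - lap (\<phi> n) x + complex_of_real (W x) * \<phi> n x) (\<phi> n)" for n
      proof -
        have "C_k (Suc (Suc 0)) (\<phi> n)" "bounded {x. \<phi> n x \<noteq> 0}" using \<phi>(1) by (auto simp: test_function_iff smooth_def)
        note e = energy_complex[OF this W]
        show ?thesis unfolding e(3) e(4) distrib_left by (intro add_mono ge e(1,2))
      qed
      ultimately show ?thesis by (intro LIMSEQ_le) auto
    qed
    show "c \<le> E" if c: "\<And>u::real^'n \<Rightarrow> complex. u \<in> H2 \<Longrightarrow> c * L2_inner lborel u u \<le> L2_inner lborel (?A u) u" for c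
    proof (rule sharp)
      fix u :: "real^'n \<Rightarrow> real" assume u: "u \<in> C2c"
      let ?u = "\<lambda>x. complex_of_real (u x)"
      have cu: "C_k (Suc (Suc 0)) ?u" "bounded {x. ?u x \<noteq> 0}" using u by (auto simp: C2c_def intro: C_k_of_real)
      note e = energy_complex[OF cu W] and H = classical_H2[OF cu]
      have "energy W (\<lambda>x. 0) = 0" by (simp add: energy_def pd_zero)
      then have "L2_inner lborel (\<lambda>x. - lap ?u x + complex_of_real (W x) * ?u x) ?u = energy W u" using e(3) by simp
      moreover have "L2_inner lborel (?A ?u) ?u = L2_inner lborel (\<lambda>x. - lap ?u x + complex_of_real (W x) * ?u x) ?u"
      proof (rule L2_inner_cong_AE)
        show "AE x in lborel. ?A ?u x = - lap ?u x + complex_of_real (W x) * ?u x" using H(2) by eventually_elim simp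
        have "lap ?u \<in> L2 lborel"
          unfolding lap_def[abs_def] using C_k_pd[OF C_k_pd[OF cu(1)]] bounded_support_pd[OF bounded_support_pd[OF cu(2)]]
          by (intro L2_sum C_k_L2[of 0]) auto
        from L2_diff[OF LW[OF C_k_L2[OF cu]] this]
        show "(\<lambda>x. - lap ?u x + complex_of_real (W x) * ?u x) \<in> L2 lborel" by simp
      qed (use AL[OF H(1)] C_k_L2[OF cu] in auto)
      ultimately show "c * (LINT x|lborel. (u x)\<^sup>2) \<le> energy W u" using c[OF H(1)] e(4) by simp
    qed
    show "\<exists>R. \<forall>r<R. \<forall>f\<in>L2 lborel. \<exists>u\<in>H2. AE x in lborel. ?A u x - r *\<^sub>R u x = f x"
    proof (intro exI[of _ "- B"] allI impI ballI)
      fix r :: real and f :: "real^'n \<Rightarrow> complex" assume r: "r < - B" and f: "f \<in> L2 lborel"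
      define \<mu> where "\<mu> = - r"
      have \<mu>: "\<mu> > 0" "\<mu> > B" using r B0 by (auto simp: \<mu>_def)
      define S where "S g = (SOME u. u \<in> H2 \<and> (AE x in lborel. \<mu> *\<^sub>R u x - laplacian u x = g x))" for g :: "real^'n \<Rightarrow> complex"
      have S: "S g \<in> H2" "AE x in lborel. \<mu> *\<^sub>R S g x - laplacian (S g) x = g x" if "g \<in> L2 lborel" for g
      proof -
        have "\<exists>u. u \<in> H2 \<and> (AE x in lborel. \<mu> *\<^sub>R u x - laplacian u x = g x)" using resolvent_solve[OF \<mu>(1) that] by blast
        from someI_ex[OF this] show "S g \<in> H2" "AE x in lborel. \<mu> *\<^sub>R S g x - laplacian (S g) x = g x" by (auto simp: S_def)
      qed
      \<comment> \<open>\<open>- \<Delta>\<close> is nonnegative, so its resolvent at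
        \<open>- \<mu>\<close> has norm at most \<open>1 / \<mu>\<close>.\<close>
      have bound: "\<mu> * L2_norm lborel u \<le> L2_norm lborel g"
        if u: "u \<in> H2" and g: "g \<in> L2 lborel" "AE x in lborel. \<mu> *\<^sub>R u x - laplacian u x = g x" for u g :: "real^'n \<Rightarrow> complex"
      proof -
        note uL = H2_L2[OF u] laplacian_L2[OF u]
        have "L2_inner lborel g u = L2_inner lborel (\<lambda>x. \<mu> *\<^sub>R u x - laplacian u x) u"
          using g uL by (intro L2_inner_cong_AE) (auto intro: L2_diff L2_scaleR)
        also have "\<dots> = \<mu> * (L2_norm lborel u)\<^sup>2 - L2_inner lborel (laplacian u) u"
          using uL by (simp add: L2_inner_diff_left L2_scaleR L2_inner_scaleR_left L2_norm_square)
        finally have "\<mu> * (L2_norm lborel u)\<^sup>2 \<le> L2_norm lborel g * L2_norm lborel u"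
          using laplacian_nonpos[OF u] L2_Cauchy_Schwarz[OF g(1) uL(1)] by linarith
        then show ?thesis by (cases "L2_norm lborel u = 0") (auto simp: power2_eq_square less_le)
      qed
      let ?g = "\<lambda>u x. f x - complex_of_real (W x) * u x"
      have gL: "?g u \<in> L2 lborel" if "u \<in> L2 lborel" for u using f LW[OF that] by (rule L2_diff)
      have "\<exists>u\<in>L2 lborel. AE x in lborel. S (?g u) x = u x"
      proof (rule L2_contraction)
        show "S (?g u) \<in> L2 lborel" if "u \<in> L2 lborel" for u using H2_L2[OF S(1)[OF gL[OF that]]] .
        show "0 \<le> B / \<mu>" "B / \<mu> < 1" using \<mu> B0 by auto
        fix u w :: "real^'n \<Rightarrow> complex" assume uw: "u \<in> L2 lborel" "w \<in> L2 lborel"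
        let ?v = "\<lambda>x. S (?g u) x + (-1) *\<^sub>R S (?g w) x"
        have "AE x in lborel. \<mu> *\<^sub>R ?v x - laplacian ?v x = complex_of_real (W x) * (w x - u x)"
          using H2_lin(2)[OF S(1)[OF gL[OF uw(1)]] S(1)[OF gL[OF uw(2)]], of "-1"] S(2)[OF gL[OF uw(1)]] S(2)[OF gL[OF uw(2)]]
        proof eventually_elim
          case (elim x)
          have "\<mu> *\<^sub>R ?v x - laplacian ?v x = (\<mu> *\<^sub>R S (?g u) x - laplacian (S (?g u)) x) - (\<mu> *\<^sub>R S (?g w) x - laplacian (S (?g w)) x)"
            unfolding elim(1) by (simp add: algebra_simps)
          then show ?case unfolding elim(2,3) by (simp add: algebra_simps)
        qed
        from bound[OF H2_lin(1)[OF S(1)[OF gL[OF uw(1)]] S(1)[OF gL[OF uw(2)]]] LW[OF L2_diff[OF uw(2,1)]] this]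
        have "\<mu> * L2_norm lborel (\<lambda>x. S (?g u) x - S (?g w) x) \<le> B * L2_norm lborel (\<lambda>x. w x - u x)"
          using NW[OF L2_diff[OF uw(2,1)]] by simp
        then show "L2_norm lborel (\<lambda>x. S (?g u) x - S (?g w) x) \<le> B / \<mu> * L2_norm lborel (\<lambda>x. u x - w x)"
          using \<mu> by (simp add: L2_norm_minus[of _ w] field_simps)
      qed
      then obtain u where u: "u \<in> L2 lborel" "AE x in lborel. S (?g u) x = u x" by blast
      have "AE x in lborel. ?A (S (?g u)) x - r *\<^sub>R S (?g u) x = f x"
        using S(2)[OF gL[OF u(1)]] u(2) by eventually_elim (simp add: \<mu>_def algebra_simps)
      with S(1)[OF gL[OF u(1)]] show "\<exists>u\<in>H2. AE x in lborel. ?A u x - r *\<^sub>R u x = f x" by blast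
    qed
  qed
  show ?thesis by (rule min_spec_eq)
qed

section \<open>The variational principle for the discrete operator\<close>

abbreviation count :: "(int^'n) measure" where "count \<equiv> count_space UNIV"

definition discrete_energy :: "(int^'n \<Rightarrow> real) \<Rightarrow> (int^'n \<Rightarrow> real) \<Rightarrow> real" where
  "discrete_energy U v = (\<Sum>j\<in>UNIV. LINT \<gamma>|count. (v (\<gamma> + axis j 1) - v \<gamma>)\<^sup>2) + (LINT \<gamma>|count. U \<gamma> * (v \<gamma>)\<^sup>2)"

lemma integral_count_shift:
  fixes f :: "int^'n \<Rightarrow> 'b::{banach, second_countable_topology}"
  shows "(LINT \<gamma>|count. f (\<gamma> + a)) = (LINT \<gamma>|count. f \<gamma>)"
    and "integrable count (\<lambda>\<gamma>. f (\<gamma> + a)) \<longleftrightarrow> integrable count f"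
proof -
  have "bij_betw (\<lambda>\<gamma>::int^'n. \<gamma> + a) UNIV UNIV"
    by (rule bij_betw_byWitness[where f' = "\<lambda>\<gamma>. \<gamma> - a"]) auto
  from integral_bij_count_space[OF this, of f] integrable_bij_count_space[OF this, of f]
  show "(LINT \<gamma>|count. f (\<gamma> + a)) = (LINT \<gamma>|count. f \<gamma>)"
    "integrable count (\<lambda>\<gamma>. f (\<gamma> + a)) \<longleftrightarrow> integrable count f" by simp_all
qed

lemma integrable_finite_support:
  fixes f :: "'a \<Rightarrow> 'b::{banach, second_countable_topology}"
  assumes "finite {x. f x \<noteq> 0}"
  shows "integrable (count_space UNIV) f"
proof -
  have "integrable (count_space UNIV) (\<lambda>x. indicator {x. f x \<noteq> 0} x *\<^sub>R f x)"
    using integrable_count_space[OF assms, of f]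
      integrable_restrict_space[of "{x. f x \<noteq> 0}" "count_space UNIV" f] by (simp add: restrict_count_space)
  moreover have "(\<lambda>x. indicator {x. f x \<noteq> 0} x *\<^sub>R f x) = f" by (auto simp: indicator_def fun_eq_iff)
  ultimately show ?thesis by simp
qed

lemma finite_vec_range:
  assumes "finite S"
  shows "finite {\<gamma>::'a^'n. \<forall>i. \<gamma> $ i \<in> S}"
proof -
  have "finite (PiE (UNIV::'n set) (\<lambda>_. S))" using assms by (intro finite_PiE) auto
  then have "finite (vec_lambda ` PiE (UNIV::'n set) (\<lambda>_. S) :: ('a^'n) set)" by simp
  moreover have "{\<gamma>::'a^'n. \<forall>i. \<gamma> $ i \<in> S} \<subseteq> vec_lambda ` PiE (UNIV::'n set) (\<lambda>_. S)"
  proof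
    fix \<gamma> :: "'a^'n" assume "\<gamma> \<in> {\<gamma>. \<forall>i. \<gamma> $ i \<in> S}"
    then show "\<gamma> \<in> vec_lambda ` PiE (UNIV::'n set) (\<lambda>_. S)"
      by (intro image_eqI[of _ _ "vec_nth \<gamma>"]) auto
  qed
  ultimately show ?thesis by (rule finite_subset[rotated])
qed

text \<open>Serves as an exhaustion of the lattice by finite sets and, being a product set, as an
  index set over which sums of coordinatewise products factorise.\<close>

definition int_box :: "nat \<Rightarrow> (int^'n) set" where
  "int_box N = {\<gamma>. \<forall>i. \<gamma> $ i \<in> {- int N..int N}}"

lemma finite_int_box: "finite (int_box N)"
  unfolding int_box_def by (rule finite_vec_range) simp

lemma eventually_in_int_box: "\<forall>\<^sub>F N in sequentially. \<gamma> \<in> int_box N"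
proof (rule eventually_sequentiallyI)
  fix N assume N: "(\<Sum>i\<in>UNIV. nat \<bar>\<gamma> $ i\<bar>) \<le> N"
  have "nat \<bar>\<gamma> $ i\<bar> \<le> (\<Sum>i\<in>UNIV. nat \<bar>\<gamma> $ i\<bar>)" for i by (rule member_le_sum) auto
  then have "nat \<bar>\<gamma> $ i\<bar> \<le> N" for i using N le_trans by blast
  then have "\<bar>\<gamma> $ i\<bar> \<le> int N" for i by (metis nat_le_iff)
  then show "\<gamma> \<in> int_box N" by (simp add: int_box_def abs_le_iff minus_le_iff)
qed

lemma discrete_energy_integrable:
  fixes U v :: "int^'n \<Rightarrow> real"
  assumes v: "integrable count (\<lambda>\<gamma>. (v \<gamma>)\<^sup>2)" and U: "\<And>\<gamma>. \<bar>U \<gamma>\<bar> \<le> B"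
  shows "integrable count (\<lambda>\<gamma>. (v (\<gamma> + a) - v \<gamma>)\<^sup>2)" "integrable count (\<lambda>\<gamma>. U \<gamma> * (v \<gamma>)\<^sup>2)"
proof -
  have B: "B \<ge> 0" using U[of undefined] by linarith
  have "integrable count (\<lambda>\<gamma>. B * (v \<gamma>)\<^sup>2)" using v by simp
  then show "integrable count (\<lambda>\<gamma>. U \<gamma> * (v \<gamma>)\<^sup>2)"
    by (rule Bochner_Integration.integrable_bound) (use U B in \<open>auto simp: abs_mult intro!: mult_right_mono\<close>)
  have "integrable count (\<lambda>\<gamma>. 2 * (v (\<gamma> + a))\<^sup>2 + 2 * (v \<gamma>)\<^sup>2)"
    using v integral_count_shift(2)[of "\<lambda>\<gamma>. (v \<gamma>)\<^sup>2"] by auto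
  then show "integrable count (\<lambda>\<gamma>. (v (\<gamma> + a) - v \<gamma>)\<^sup>2)"
    by (rule Bochner_Integration.integrable_bound) (use norm_add_square_le[of "v _" "- v _"] in auto)
qed

text \<open>Truncation to boxes and dominated convergence, applied separately to the norm, the
  potential term and each kinetic term.\<close>

lemma discrete_form_ge_extends:
  fixes U v :: "int^'n \<Rightarrow> real"
  assumes U: "\<And>\<gamma>. \<bar>U \<gamma>\<bar> \<le> B"
    and ge: "\<And>v. finite {\<gamma>. v \<gamma> \<noteq> 0} \<Longrightarrow> E * (LINT \<gamma>|count. (v \<gamma>)\<^sup>2) \<le> discrete_energy U v"
    and v: "integrable count (\<lambda>\<gamma>. (v \<gamma>)\<^sup>2)"
  shows "E * (LINT \<gamma>|count. (v \<gamma>)\<^sup>2) \<le> discrete_energy U v"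
proof -
  define w where "w N \<gamma> = v \<gamma> * indicator (int_box N) \<gamma>" for N \<gamma>
  have ev: "\<forall>\<^sub>F N in sequentially. w N \<gamma> = v \<gamma>" for \<gamma>
    using eventually_in_int_box[of \<gamma>] by eventually_elim (simp add: w_def)
  have ev2: "\<forall>\<^sub>F N in sequentially. (w N \<gamma>)\<^sup>2 = (v \<gamma>)\<^sup>2" "\<forall>\<^sub>F N in sequentially. U \<gamma> * (w N \<gamma>)\<^sup>2 = U \<gamma> * (v \<gamma>)\<^sup>2" for \<gamma>
    using ev[of \<gamma>] by (eventually_elim, simp)+
  have wv: "(w N \<gamma>)\<^sup>2 \<le> (v \<gamma>)\<^sup>2" for N \<gamma> by (simp add: w_def indicator_def)
  note U0 = discrete_energy_integrable[OF v U]
  have "(\<lambda>N. LINT \<gamma>|count. (w N \<gamma>)\<^sup>2) \<longlonglongrightarrow> (LINT \<gamma>|count. (v \<gamma>)\<^sup>2)"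
  proof (rule integral_dominated_convergence[OF _ _ v])
    show "AE \<gamma> in count. (\<lambda>N. (w N \<gamma>)\<^sup>2) \<longlonglongrightarrow> (v \<gamma>)\<^sup>2"
      by (intro AE_I2 tendsto_eventually ev2)
  qed (use wv in auto)
  moreover have "(\<lambda>N. LINT \<gamma>|count. U \<gamma> * (w N \<gamma>)\<^sup>2) \<longlonglongrightarrow> (LINT \<gamma>|count. U \<gamma> * (v \<gamma>)\<^sup>2)"
  proof (rule integral_dominated_convergence[OF _ _ integrable_norm[OF U0(2)]])
    show "AE \<gamma> in count. (\<lambda>N. U \<gamma> * (w N \<gamma>)\<^sup>2) \<longlonglongrightarrow> U \<gamma> * (v \<gamma>)\<^sup>2"
      by (intro AE_I2 tendsto_eventually ev2)
    show "AE \<gamma> in count. norm (U \<gamma> * (w N \<gamma>)\<^sup>2) \<le> norm (U \<gamma> * (v \<gamma>)\<^sup>2)" for N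
      using wv by (auto simp: abs_mult intro!: mult_left_mono)
  qed simp_all
  moreover have "(\<lambda>N. LINT \<gamma>|count. (w N (\<gamma> + a) - w N \<gamma>)\<^sup>2) \<longlonglongrightarrow> (LINT \<gamma>|count. (v (\<gamma> + a) - v \<gamma>)\<^sup>2)" for a
  proof (rule integral_dominated_convergence[where w = "\<lambda>\<gamma>. 2 * (v (\<gamma> + a))\<^sup>2 + 2 * (v \<gamma>)\<^sup>2"])
    show "AE \<gamma> in count. (\<lambda>N. (w N (\<gamma> + a) - w N \<gamma>)\<^sup>2) \<longlonglongrightarrow> (v (\<gamma> + a) - v \<gamma>)\<^sup>2"
    proof (intro AE_I2 tendsto_eventually)
      show "\<forall>\<^sub>F N in sequentially. (w N (\<gamma> + a) - w N \<gamma>)\<^sup>2 = (v (\<gamma> + a) - v \<gamma>)\<^sup>2" for \<gamma>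
        using ev[of "\<gamma> + a"] ev[of \<gamma>] by eventually_elim simp
    qed
    show "integrable count (\<lambda>\<gamma>. 2 * (v (\<gamma> + a))\<^sup>2 + 2 * (v \<gamma>)\<^sup>2)"
      using v integral_count_shift(2)[of "\<lambda>\<gamma>. (v \<gamma>)\<^sup>2"] by auto
    show "AE \<gamma> in count. norm ((w N (\<gamma> + a) - w N \<gamma>)\<^sup>2) \<le> 2 * (v (\<gamma> + a))\<^sup>2 + 2 * (v \<gamma>)\<^sup>2" for N
    proof (rule AE_I2)
      fix \<gamma> show "norm ((w N (\<gamma> + a) - w N \<gamma>)\<^sup>2) \<le> 2 * (v (\<gamma> + a))\<^sup>2 + 2 * (v \<gamma>)\<^sup>2"
        using norm_add_square_le[of "w N (\<gamma> + a)" "- w N \<gamma>"] wv[of N "\<gamma> + a"] wv[of N \<gamma>] by simp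
    qed
  qed simp_all
  ultimately have "(\<lambda>N. discrete_energy U (w N)) \<longlonglongrightarrow> discrete_energy U v"
    "(\<lambda>N. E * (LINT \<gamma>|count. (w N \<gamma>)\<^sup>2)) \<longlonglongrightarrow> E * (LINT \<gamma>|count. (v \<gamma>)\<^sup>2)"
    unfolding discrete_energy_def by (auto intro!: tendsto_intros)
  moreover have "E * (LINT \<gamma>|count. (w N \<gamma>)\<^sup>2) \<le> discrete_energy U (w N)" for N
    by (rule ge, rule finite_subset[OF _ finite_int_box[of N]]) (auto simp: w_def indicator_def)
  ultimately show ?thesis by (intro LIMSEQ_le) auto
qed

lemma L2_shift: "(\<lambda>\<gamma>. v (\<gamma> + a)) \<in> L2 count \<longleftrightarrow> v \<in> L2 count"
  using integral_count_shift(2)[of "\<lambda>\<gamma>. (cmod (v \<gamma>))\<^sup>2" a] by (simp add: L2_def)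

text \<open>The discrete operator is bounded, so its domain is all of \<open>L2 count\<close>, and
  for \<open>r\<close> below \<open>- C\<close> the equation \<open>A u - r u = f\<close> is solved
  by iterating \<open>u = (A u - f) / r\<close>.\<close>

theorem min_spec_discrete:
  fixes U :: "int^'n \<Rightarrow> real"
  assumes U: "\<And>\<gamma>. \<bar>U \<gamma>\<bar> \<le> B"
    and ge: "\<And>v. finite {\<gamma>. v \<gamma> \<noteq> 0} \<Longrightarrow> E * (LINT \<gamma>|count. (v \<gamma>)\<^sup>2) \<le> discrete_energy U v"
    and sharp: "\<And>c. (\<And>v. finite {\<gamma>. v \<gamma> \<noteq> 0} \<Longrightarrow> c * (LINT \<gamma>|count. (v \<gamma>)\<^sup>2) \<le> discrete_energy U v) \<Longrightarrow> c \<le> E"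
  shows "min_spec count (L2 count) (\<lambda>v \<gamma>. (\<Sum>j\<in>UNIV. 2 * v \<gamma> - v (\<gamma> + axis j 1) - v (\<gamma> - axis j 1))
     + complex_of_real (U \<gamma>) * v \<gamma>) = E"
proof -
  let ?A = "\<lambda>v \<gamma>. (\<Sum>j\<in>UNIV. 2 * v \<gamma> - v (\<gamma> + axis j 1) - v (\<gamma> - axis j 1)) + complex_of_real (U \<gamma>) * v \<gamma>"
  let ?K = "\<lambda>j v \<gamma>. 2 * v \<gamma> - v (\<gamma> + axis j 1) - v (\<gamma> - axis j (1::int))"
  have B0: "B \<ge> 0" using U[of 0] by linarith
  have sh: "(\<lambda>\<gamma>. v (\<gamma> + a)) \<in> L2 count" "(\<lambda>\<gamma>. v (\<gamma> - a)) \<in> L2 count" if "v \<in> L2 count" for v :: "int^'n \<Rightarrow> complex" and a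
    using that L2_shift[of v a] L2_shift[of v "- a"] by simp_all
  have K2: "(\<lambda>\<gamma>. 2 * v \<gamma>) \<in> L2 count" if "v \<in> L2 count" for v :: "int^'n \<Rightarrow> complex"
    using L2_scaleR[OF that, of 2] by (simp add: scaleR_conv_of_real)
  have KL: "?K j v \<in> L2 count" if "v \<in> L2 count" for j and v :: "int^'n \<Rightarrow> complex"
    using that by (intro L2_diff K2 sh)
  have KsL: "(\<lambda>\<gamma>. \<Sum>j\<in>J. ?K j v \<gamma>) \<in> L2 count" if "v \<in> L2 count" for J and v :: "int^'n \<Rightarrow> complex"
    by (intro L2_sum KL that)
  have UL: "(\<lambda>\<gamma>. complex_of_real (U \<gamma>) * v \<gamma>) \<in> L2 count" if "v \<in> L2 count" for v :: "int^'n \<Rightarrow> complex"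
    by (rule L2_bounded_mult[OF that, of _ B]) (use U in auto)
  have AL: "?A v \<in> L2 count" if "v \<in> L2 count" for v :: "int^'n \<Rightarrow> complex"
    using that by (intro L2_add L2_sum KL UL)
  have NU: "L2_norm count (\<lambda>\<gamma>. complex_of_real (U \<gamma>) * v \<gamma>) \<le> B * L2_norm count v" if v: "v \<in> L2 count" for v :: "int^'n \<Rightarrow> complex"
  proof (rule power2_le_imp_le)
    have "(LINT \<gamma>|count. (cmod (complex_of_real (U \<gamma>) * v \<gamma>))\<^sup>2) \<le> (LINT \<gamma>|count. B\<^sup>2 * (cmod (v \<gamma>))\<^sup>2)"
      using L2_integrable[OF UL[OF v]] L2_integrable[OF v] U B0
      by (intro integral_mono) (auto simp: norm_mult power_mult_distrib intro!: mult_right_mono abs_le_square_iff[THEN iffD1])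
    then show "(L2_norm count (\<lambda>\<gamma>. complex_of_real (U \<gamma>) * v \<gamma>))\<^sup>2 \<le> (B * L2_norm count v)\<^sup>2"
      by (simp add: L2_norm_def power_mult_distrib)
  qed (use B0 in auto)
  have inner_shift: "L2_inner count (\<lambda>\<gamma>. f (\<gamma> + a)) g = L2_inner count f (\<lambda>\<gamma>. g (\<gamma> - a))" for f g :: "int^'n \<Rightarrow> complex" and a
    using integral_count_shift(1)[of "\<lambda>\<gamma>. f \<gamma> \<bullet> g (\<gamma> - a)" a] by (simp add: L2_inner_def)
  have inner_shift': "L2_inner count (\<lambda>\<gamma>. f (\<gamma> - a)) g = L2_inner count f (\<lambda>\<gamma>. g (\<gamma> + a))" for f g :: "int^'n \<Rightarrow> complex" and a
    using inner_shift[of g a f] by (simp add: L2_inner_commute)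
  have norm_shift: "L2_norm count (\<lambda>\<gamma>. v (\<gamma> + a)) = L2_norm count v" "L2_norm count (\<lambda>\<gamma>. v (\<gamma> - a)) = L2_norm count v" for v :: "int^'n \<Rightarrow> complex" and a
    using integral_count_shift(1)[of "\<lambda>\<gamma>. (cmod (v \<gamma>))\<^sup>2" a] integral_count_shift(1)[of "\<lambda>\<gamma>. (cmod (v \<gamma>))\<^sup>2" "- a"]
    by (simp_all add: L2_norm_def)
  have scal2: "L2_inner count (\<lambda>\<gamma>. 2 * f \<gamma>) g = 2 * L2_inner count f g" for f g :: "int^'n \<Rightarrow> complex"
    using L2_inner_scaleR_left[of count 2 f g] by (simp add: scaleR_conv_of_real)
  have K_inner: "L2_inner count (?K j u) w = 2 * L2_inner count u w - L2_inner count (\<lambda>\<gamma>. u (\<gamma> + axis j 1)) w - L2_inner count (\<lambda>\<gamma>. u (\<gamma> - axis j 1)) w"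
    if "u \<in> L2 count" "w \<in> L2 count" for j and u w :: "int^'n \<Rightarrow> complex"
    using that by (simp add: L2_inner_diff_left L2_diff K2 sh scal2)
  have A_inner: "L2_inner count (?A u) w = (\<Sum>j\<in>UNIV. L2_inner count (?K j u) w) + L2_inner count (\<lambda>\<gamma>. complex_of_real (U \<gamma>) * u \<gamma>) w"
    if "u \<in> L2 count" "w \<in> L2 count" for u w :: "int^'n \<Rightarrow> complex"
  proof -
    have "L2_inner count (\<lambda>\<gamma>. \<Sum>j\<in>UNIV. ?K j u \<gamma>) w = (\<Sum>j\<in>UNIV. L2_inner count (?K j u) w)"
      by (rule L2_inner_sum_left) (use that in \<open>auto intro: KL\<close>)
    then show ?thesis using L2_inner_add_left[OF KsL[OF that(1)] UL[OF that(1)] that(2)] by simp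
  qed
  have form: "L2_inner count (?A u) u = discrete_energy U (\<lambda>\<gamma>. Re (u \<gamma>)) + discrete_energy U (\<lambda>\<gamma>. Im (u \<gamma>))"
    and self: "L2_inner count u u = (LINT \<gamma>|count. (Re (u \<gamma>))\<^sup>2) + (LINT \<gamma>|count. (Im (u \<gamma>))\<^sup>2)"
    and sq: "integrable count (\<lambda>\<gamma>. (Re (u \<gamma>))\<^sup>2)" "integrable count (\<lambda>\<gamma>. (Im (u \<gamma>))\<^sup>2)"
    if u: "u \<in> L2 count" for u :: "int^'n \<Rightarrow> complex"
  proof -
    show r: "integrable count (\<lambda>\<gamma>. (Re (u \<gamma>))\<^sup>2)" and s: "integrable count (\<lambda>\<gamma>. (Im (u \<gamma>))\<^sup>2)"
      by (rule Bochner_Integration.integrable_bound[OF L2_integrable[OF u]]; auto simp: cmod_power2)+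
    note rI = discrete_energy_integrable[OF r U] and sI = discrete_energy_integrable[OF s U]
    have sqc: "z \<bullet> z = (Re z)\<^sup>2 + (Im z)\<^sup>2" for z :: complex by (simp add: inner_complex_def power2_eq_square)
    show "L2_inner count u u = (LINT \<gamma>|count. (Re (u \<gamma>))\<^sup>2) + (LINT \<gamma>|count. (Im (u \<gamma>))\<^sup>2)"
      using r s by (simp add: L2_inner_def sqc)
    have "L2_inner count (?K j u) u = (LINT \<gamma>|count. (Re (u (\<gamma> + axis j 1)) - Re (u \<gamma>))\<^sup>2) + (LINT \<gamma>|count. (Im (u (\<gamma> + axis j 1)) - Im (u \<gamma>))\<^sup>2)" for j
    proof -
      \<comment> \<open>Summation by parts: shift invariance of the counting measure turns the
        squared norm of the first difference into the second difference tested with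
        \<open>u\<close>.\<close>
      let ?d = "\<lambda>\<gamma>. u (\<gamma> + axis j 1) + (-1) *\<^sub>R u \<gamma>"
      have "L2_inner count ?d ?d = L2_inner count (\<lambda>\<gamma>. u (\<gamma> + axis j 1)) (\<lambda>\<gamma>. u (\<gamma> + axis j 1)) - 2 * L2_inner count (\<lambda>\<gamma>. u (\<gamma> + axis j 1)) u + L2_inner count u u"
        using L2_inner_expand[OF sh(1)[OF u] u, of "axis j 1" "-1"] by simp
      also have "\<dots> = L2_inner count (?K j u) u"
        using inner_shift[of u "axis j 1" u] inner_shift[of u "axis j 1" "\<lambda>\<gamma>. u (\<gamma> + axis j 1)"]
        by (simp add: K_inner[OF u u] L2_inner_commute[of _ u "\<lambda>\<gamma>. u (\<gamma> - axis j 1)"])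
      finally show ?thesis using rI(1) sI(1) by (simp add: L2_inner_def sqc)
    qed
    moreover have "L2_inner count (\<lambda>\<gamma>. complex_of_real (U \<gamma>) * u \<gamma>) u = (LINT \<gamma>|count. U \<gamma> * (Re (u \<gamma>))\<^sup>2 + U \<gamma> * (Im (u \<gamma>))\<^sup>2)"
      unfolding L2_inner_def by (rule arg_cong[where f = "integral\<^sup>L count"])
        (auto simp: inner_complex_def power2_eq_square algebra_simps)
    ultimately show "L2_inner count (?A u) u = discrete_energy U (\<lambda>\<gamma>. Re (u \<gamma>)) + discrete_energy U (\<lambda>\<gamma>. Im (u \<gamma>))"
      using rI(2) sI(2) by (simp add: A_inner[OF u u] discrete_energy_def sum.distrib)
  qed
  have A_diff: "?A (\<lambda>x. u x + t *\<^sub>R w x) = (\<lambda>x. ?A u x + t *\<^sub>R ?A w x)" for u w :: "int^'n \<Rightarrow> complex" and t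
  proof
    fix \<gamma>
    have "(\<Sum>j\<in>UNIV. ?K j (\<lambda>x. u x + t *\<^sub>R w x) \<gamma>) = (\<Sum>j\<in>UNIV. ?K j u \<gamma> + t *\<^sub>R ?K j w \<gamma>)"
      by (intro sum.cong refl) (simp add: scaleR_conv_of_real algebra_simps)
    then show "?A (\<lambda>x. u x + t *\<^sub>R w x) \<gamma> = ?A u \<gamma> + t *\<^sub>R ?A w \<gamma>"
      by (simp add: sum.distrib flip: scaleR_sum_right) (simp add: scaleR_conv_of_real algebra_simps)
  qed
  interpret semibounded_operator count "L2 count" ?A E
  proof
    show "u \<in> L2 count" if "u \<in> L2 count" for u :: "int^'n \<Rightarrow> complex" using that .
    show "?A u \<in> L2 count" if "u \<in> L2 count" for u :: "int^'n \<Rightarrow> complex" using that by (rule AL)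
    show "(\<lambda>x. u x + t *\<^sub>R w x) \<in> L2 count" if "u \<in> L2 count" "w \<in> L2 count" for u w :: "int^'n \<Rightarrow> complex" and t
      using that by (rule L2_lin)
    show "AE x in count. ?A (\<lambda>x. u x + t *\<^sub>R w x) x = ?A u x + t *\<^sub>R ?A w x" for u w :: "int^'n \<Rightarrow> complex" and t
      using fun_cong[OF A_diff] by (intro AE_I2)
    show "L2_inner count (?A u) w = L2_inner count u (?A w)" if u: "u \<in> L2 count" and w: "w \<in> L2 count" for u w :: "int^'n \<Rightarrow> complex"
    proof -
      have "L2_inner count (?K j u) w = L2_inner count (?K j w) u" for j
        using inner_shift[of u "axis j 1" w] inner_shift'[of u "axis j 1" w]
        by (simp add: K_inner[OF u w] K_inner[OF w u] L2_inner_commute[of _ u])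
      moreover have "L2_inner count (\<lambda>\<gamma>. complex_of_real (U \<gamma>) * u \<gamma>) w = L2_inner count (\<lambda>\<gamma>. complex_of_real (U \<gamma>) * w \<gamma>) u"
        unfolding L2_inner_def by (rule arg_cong[where f = "integral\<^sup>L count"]) (auto simp: inner_complex_def algebra_simps)
      ultimately have "L2_inner count (?A u) w = L2_inner count (?A w) u"
        by (simp add: A_inner[OF u w] A_inner[OF w u])
      then show ?thesis by (subst L2_inner_commute)
    qed
    show "E * L2_inner count u u \<le> L2_inner count (?A u) u" if u: "u \<in> L2 count" for u :: "int^'n \<Rightarrow> complex"
      unfolding form[OF u] self[OF u] distrib_left
      by (intro add_mono discrete_form_ge_extends[OF U ge] sq[OF u])
    show "c \<le> E" if c: "\<And>u::int^'n \<Rightarrow> complex. u \<in> L2 count \<Longrightarrow> c * L2_inner count u u \<le> L2_inner count (?A u) u" for c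
    proof (rule sharp)
      fix v :: "int^'n \<Rightarrow> real" assume fin: "finite {\<gamma>. v \<gamma> \<noteq> 0}"
      have "integrable count (\<lambda>\<gamma>. (v \<gamma>)\<^sup>2)" by (rule integrable_finite_support) (use fin in simp)
      then have L: "(\<lambda>\<gamma>. complex_of_real (v \<gamma>)) \<in> L2 count" by (simp add: L2_def)
      have "discrete_energy U (\<lambda>\<gamma>. 0) = 0" by (simp add: discrete_energy_def)
      then show "c * (LINT \<gamma>|count. (v \<gamma>)\<^sup>2) \<le> discrete_energy U v"
        using c[OF L] form[OF L] self[OF L] by simp
    qed
    \<comment> \<open>Each coordinate contributes \<open>2 + 1 + 1\<close> to the operator norm, the
      potential at most \<open>B\<close>.\<close>
    define C where "C = 4 * real CARD('n) + B"
    have C0: "C \<ge> 0" using B0 by (simp add: C_def)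
    have NA: "L2_norm count (?A v) \<le> C * L2_norm count v" if v: "v \<in> L2 count" for v :: "int^'n \<Rightarrow> complex"
    proof -
      have NK: "L2_norm count (?K j v) \<le> 4 * L2_norm count v" for j
      proof -
        have "L2_norm count (?K j v) \<le> L2_norm count (\<lambda>\<gamma>. 2 *\<^sub>R v \<gamma> + (-1) *\<^sub>R v (\<gamma> + axis j 1)) + L2_norm count (\<lambda>\<gamma>. (-1) *\<^sub>R v (\<gamma> - axis j 1))"
          using L2_norm_triangle[OF L2_lin[OF L2_scaleR[OF v, of 2] sh(1)[OF v], of "-1" "axis j 1"] L2_scaleR[OF sh(2)[OF v], of "-1" "axis j 1"]]
          by (simp add: scaleR_conv_of_real)
        also have "L2_norm count (\<lambda>\<gamma>. 2 *\<^sub>R v \<gamma> + (-1) *\<^sub>R v (\<gamma> + axis j 1)) \<le> L2_norm count (\<lambda>\<gamma>. 2 *\<^sub>R v \<gamma>) + L2_norm count (\<lambda>\<gamma>. (-1) *\<^sub>R v (\<gamma> + axis j 1))"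
          by (intro L2_norm_triangle L2_scaleR v sh)
        finally show ?thesis unfolding L2_norm_scaleR norm_shift by simp
      qed
      have "L2_norm count (\<lambda>\<gamma>. \<Sum>j\<in>J. ?K j v \<gamma>) \<le> real (card J) * (4 * L2_norm count v)" for J
      proof (induction J rule: infinite_finite_induct)
        case (insert j J)
        have "L2_norm count (\<lambda>\<gamma>. \<Sum>j\<in>insert j J. ?K j v \<gamma>) \<le> L2_norm count (?K j v) + L2_norm count (\<lambda>\<gamma>. \<Sum>j\<in>J. ?K j v \<gamma>)"
          using insert L2_norm_triangle[OF KL[OF v] KsL[OF v], of j J] by simp
        then show ?case using insert NK[of j] by (simp add: algebra_simps)
      qed (simp_all add: L2_norm_def)
      from this[of UNIV] NU[OF v] L2_norm_triangle[OF KsL[OF v] UL[OF v], of UNIV]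
      show ?thesis by (simp add: C_def algebra_simps)
    qed
    show "\<exists>R. \<forall>r<R. \<forall>f\<in>L2 count. \<exists>u\<in>L2 count. AE x in count. ?A u x - r *\<^sub>R u x = f x"
    proof (intro exI[of _ "- C"] allI impI ballI)
      fix r and f :: "int^'n \<Rightarrow> complex" assume r: "r < - C" and f: "f \<in> L2 count"
      let ?T = "\<lambda>u x. (1 / r) *\<^sub>R (?A u x - f x)"
      have "\<exists>u\<in>L2 count. AE x in count. ?T u x = u x"
      proof (rule L2_contraction)
        show "?T u \<in> L2 count" if "u \<in> L2 count" for u by (intro L2_scaleR L2_diff AL that f)
        show "0 \<le> C / (- r)" "C / (- r) < 1" using r C0 by (auto simp: field_simps)
        fix u w :: "int^'n \<Rightarrow> complex" assume uw: "u \<in> L2 count" "w \<in> L2 count"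
        have "(\<lambda>x. ?T u x - ?T w x) = (\<lambda>x. (1 / r) *\<^sub>R ?A (\<lambda>x. u x + (-1) *\<^sub>R w x) x)"
        proof
          fix x
          have "(1 / r) *\<^sub>R (a - f x) - (1 / r) *\<^sub>R (b - f x) = (1 / r) *\<^sub>R (a + (-1) *\<^sub>R b)" for a b
            by (simp add: algebra_simps)
          then show "?T u x - ?T w x = (1 / r) *\<^sub>R ?A (\<lambda>x. u x + (-1) *\<^sub>R w x) x"
            unfolding fun_cong[OF A_diff[of u "-1" w]] .
        qed
        then have "L2_norm count (\<lambda>x. ?T u x - ?T w x) = \<bar>1 / r\<bar> * L2_norm count (?A (\<lambda>x. u x + (-1) *\<^sub>R w x))"
          by (simp only: L2_norm_scaleR)
        also have "\<dots> \<le> \<bar>1 / r\<bar> * (C * L2_norm count (\<lambda>x. u x + (-1) *\<^sub>R w x))"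
          by (intro mult_left_mono NA L2_lin uw) simp
        also have "\<dots> = C / (- r) * L2_norm count (\<lambda>x. u x - w x)" using r C0 by simp
        finally show "L2_norm count (\<lambda>x. ?T u x - ?T w x) \<le> C / (- r) * L2_norm count (\<lambda>x. u x - w x)" .
      qed
      then obtain u where u: "u \<in> L2 count" "AE x in count. ?T u x = u x" by blast
      have "AE x in count. ?A u x - r *\<^sub>R u x = f x"
        using u(2)
      proof eventually_elim
        case (elim x)
        have "r *\<^sub>R ((1 / r) *\<^sub>R (?A u x - f x)) = r *\<^sub>R u x" using elim by (rule arg_cong)
        moreover have "r * (1 / r) = 1" using r C0 by simp
        ultimately have "?A u x - f x = r *\<^sub>R u x" by (simp only: scaleR_scaleR scaleR_one)
        then show ?case by (simp only: diff_eq_eq) (simp only: add.commute)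
      qed
      with u(1) show "\<exists>u\<in>L2 count. AE x in count. ?A u x - r *\<^sub>R u x = f x" by blast
    qed
  qed
  show ?thesis by (rule min_spec_eq)
qed

section \<open>B-splines\<close>

text \<open>Truncated powers. The derivative rule below starts at exponent 2 because
  \<open>tp 1\<close> has a kink at 0.\<close>

definition tp :: "nat \<Rightarrow> real \<Rightarrow> real" where
  "tp k t = (max 0 t) ^ k"

lemma tp_deriv: "(tp (Suc (Suc k)) has_real_derivative real (Suc (Suc k)) * tp (Suc k) t) (at t)"
proof -
  consider "t > 0" | "t < 0" | "t = 0" by linarith
  then show ?thesis
  proof cases
    case 1
    have "((\<lambda>t. t ^ Suc (Suc k)) has_real_derivative real (Suc (Suc k)) * tp (Suc k) t) (at t)"
      using 1 DERIV_pow[of "Suc (Suc k)" t UNIV] by (simp add: tp_def)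
    then show ?thesis
      by (rule has_field_derivative_transform_within_open[where S = "{0<..}"]) (use 1 in \<open>auto simp: tp_def\<close>)
  next
    case 2
    have "((\<lambda>t. 0) has_real_derivative 0) (at t)" by simp
    then have "(tp (Suc (Suc k)) has_real_derivative 0) (at t)"
      by (rule has_field_derivative_transform_within_open[where S = "{..<0}"]) (use 2 in \<open>auto simp: tp_def\<close>)
    then show ?thesis using 2 by (simp add: tp_def)
  next
    case 3
    have "isCont (\<lambda>h. (max 0 h) ^ Suc k) (0::real)" by (intro continuous_intros)
    then have "((\<lambda>h. tp (Suc k) h) \<longlongrightarrow> 0) (at 0)" by (simp add: isCont_def tp_def)
    then have "((\<lambda>h. (tp (Suc (Suc k)) h - tp (Suc (Suc k)) 0) / h) \<longlongrightarrow> 0) (at 0)"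
      by (rule Lim_transform_eventually) (auto simp: tp_def max_def eventually_at_filter)
    then show ?thesis using 3 by (simp add: has_field_derivative_iff tp_def)
  qed
qed

lemma tp_deriv_shift [derivative_intros]:
  "((\<lambda>t. tp 2 (t + a)) has_real_derivative 2 * tp 1 (t + a)) (at t)"
  "((\<lambda>t. tp 3 (t + a)) has_real_derivative 3 * tp 2 (t + a)) (at t)"
  "((\<lambda>t. tp 4 (t + a)) has_real_derivative 4 * tp 3 (t + a)) (at t)"
proof -
  have *: "((\<lambda>t. tp (Suc (Suc k)) (t + a)) has_real_derivative real (Suc (Suc k)) * tp (Suc k) (t + a)) (at t)" for k
    using tp_deriv[of k "t + a"] unfolding DERIV_shift .
  show "((\<lambda>t. tp 2 (t + a)) has_real_derivative 2 * tp 1 (t + a)) (at t)"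
    "((\<lambda>t. tp 3 (t + a)) has_real_derivative 3 * tp 2 (t + a)) (at t)"
    "((\<lambda>t. tp 4 (t + a)) has_real_derivative 4 * tp 3 (t + a)) (at t)"
    using *[of 0] *[of 1] *[of 2] by (simp_all add: eval_nat_numeral)
qed

lemma tp_continuous [continuous_intros]: "continuous_on S f \<Longrightarrow> continuous_on S (\<lambda>t. tp k (f t))"
  unfolding tp_def by (intro continuous_intros)

text \<open>The centred cubic B-spline: one sixth of the fourth central difference of the truncated
  cube, supported in \<open>{-2..2}\<close>. The terms \<open>t + 0\<close> and
  \<open>t + - 1\<close> are written so as to match \<open>tp_deriv_shift\<close>.\<close>

definition Bs :: "real \<Rightarrow> real" where
  "Bs t = (tp 3 (t + 2) - 4 * tp 3 (t + 1) + 6 * tp 3 (t + 0) - 4 * tp 3 (t + - 1) + tp 3 (t + - 2)) / 6"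

text \<open>The quadratic B-spline, shifted so that the derivative of the cubic one is a difference of its
  values at integer distance.\<close>

definition bq :: "real \<Rightarrow> real" where
  "bq t = (tp 2 (t + 2) - 3 * tp 2 (t + 1) + 3 * tp 2 (t + 0) - tp 2 (t + - 1)) / 2"

text \<open>The derivative of \<open>bq\<close>. It is continuous and piecewise linear, which gives
  \<open>Bs\<close> its continuous second derivative.\<close>

definition bl :: "real \<Rightarrow> real" where
  "bl t = tp 1 (t + 2) - 3 * tp 1 (t + 1) + 3 * tp 1 (t + 0) - tp 1 (t + - 1)"

lemma Bs_deriv: "(Bs has_real_derivative bq t - bq (t - 1)) (at t)"
proof -
  have e: "t - 1 + 2 = t + 1" "t - 1 + 1 = t + 0" "t - 1 + 0 = t + - 1" "t - 1 + - 1 = t + - 2" by simp_all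
  show ?thesis
    unfolding Bs_def[abs_def] bq_def e
    by (rule derivative_eq_intros refl)+ (simp_all add: field_simps)
qed

lemma bq_deriv: "(bq has_real_derivative bl t) (at t)"
  unfolding bq_def[abs_def] bl_def
  by (rule derivative_eq_intros refl)+ (simp_all add: field_simps)

lemma C2_Bs: "C_k (Suc (Suc 0)) (\<lambda>x::real^'n. Bs (x $ i))"
proof (rule C_k_SucI[OF has_derivative_coord[OF Bs_deriv]])
  fix j
  have "((\<lambda>t. bq t - bq (t - 1)) has_real_derivative bl t - bl (t - 1)) (at t)" for t
  proof -
    have "((\<lambda>t. bq (t + - 1)) has_real_derivative bl (t + - 1)) (at t)"
      using bq_deriv[of "t + - 1"] unfolding DERIV_shift .
    from DERIV_diff[OF bq_deriv this] show ?thesis by simp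
  qed
  from has_derivative_coord[OF this]
  have "C_k (Suc 0) (\<lambda>x::real^'n. bq (x $ i) - bq (x $ i - 1))"
    by (rule C_k_SucI) (auto simp: bl_def intro!: continuous_intros)
  then show "C_k (Suc 0) (\<lambda>x::real^'n. (bq (x $ i) - bq (x $ i - 1)) * axis j 1 $ i)"
    by (intro C_k_mult C_k_const)
qed

text \<open>All four cubic pieces are transported to one parameter \<open>s\<close>, so that the
  values at points differing by integers can be added as polynomials.\<close>

lemma Bs_pieces:
  assumes "0 \<le> s" "s \<le> 1"
  shows "Bs (s + 1) = (1 - s)^3 / 6" "Bs s = (4 - 6 * s\<^sup>2 + 3 * s^3) / 6"
    "Bs (s - 1) = (1 + 3 * s + 3 * s\<^sup>2 - 3 * s^3) / 6" "Bs (s - 2) = s^3 / 6"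
  using assms
  by (simp_all add: Bs_def tp_def max_absorb1 max_absorb2) (simp_all add: power2_eq_square power3_eq_cube algebra_simps)

lemma bq_pieces:
  assumes "0 \<le> s" "s \<le> 1"
  shows "bq (s + 1) = 0" "bq s = (1 - s)\<^sup>2 / 2" "bq (s - 1) = (1 + 2 * s - 2 * s\<^sup>2) / 2" "bq (s - 2) = s\<^sup>2 / 2"
  using assms
  by (simp_all add: bq_def tp_def max_absorb1 max_absorb2) (simp_all add: power2_eq_square algebra_simps)

lemma Bs_outside: "2 \<le> \<bar>t\<bar> \<Longrightarrow> Bs t = 0"
  by (cases "t \<ge> 0"; simp add: Bs_def tp_def max_absorb1 max_absorb2) (simp add: power3_eq_cube algebra_simps)

lemma bq_outside: "2 \<le> \<bar>t\<bar> \<Longrightarrow> bq t = 0"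
  by (cases "t \<ge> 0"; simp add: bq_def tp_def max_absorb1 max_absorb2) (simp add: power2_eq_square algebra_simps)

lemma unit_interval_cases:
  fixes t :: real
  assumes "\<bar>t\<bar> < 2"
  obtains s where "0 \<le> s" "s \<le> 1" "t = s + 1 \<or> t = s \<or> t = s - 1 \<or> t = s - 2"
proof -
  consider "t \<ge> 1" | "0 \<le> t" "t \<le> 1" | "-1 \<le> t" "t \<le> 0" | "t \<le> -1" by linarith
  then show ?thesis
    using assms that[of "t - 1"] that[of t] that[of "t + 1"] that[of "t + 2"] by cases auto
qed

lemma cube_le_square: "0 \<le> s \<Longrightarrow> s \<le> 1 \<Longrightarrow> s^3 \<le> s\<^sup>2" for s :: real
  by (rule power_decreasing) auto

lemma Bs_nonneg: "0 \<le> Bs t"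
proof (cases "\<bar>t\<bar> < 2")
  case True
  then obtain s where s: "0 \<le> s" "s \<le> 1" "t = s + 1 \<or> t = s \<or> t = s - 1 \<or> t = s - 2" by (rule unit_interval_cases)
  \<comment> \<open>By evenness this piece is the next one with \<open>1 - s\<close> in place of
    \<open>s\<close>, so the same comparison of cube and square settles both.\<close>
  have "4 - 6 * s\<^sup>2 + 3 * s^3 = 1 + 3 * (1 - s) + 3 * (1 - s)\<^sup>2 - 3 * (1 - s)^3"
    by (simp add: power2_eq_square power3_eq_cube algebra_simps)
  moreover have "(1 - s)^3 \<le> (1 - s)\<^sup>2" using s by (intro cube_le_square) auto
  ultimately have "0 \<le> 4 - 6 * s\<^sup>2 + 3 * s^3" using s by simp
  then show ?thesis
    using s(3) cube_le_square[OF s(1,2)] s(1,2) by (elim disjE) (simp_all add: Bs_pieces[OF s(1,2)])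
qed (use Bs_outside in auto)

lemma bq_nonneg: "0 \<le> bq t"
proof (cases "\<bar>t\<bar> < 2")
  case True
  then obtain s where s: "0 \<le> s" "s \<le> 1" "t = s + 1 \<or> t = s \<or> t = s - 1 \<or> t = s - 2" by (rule unit_interval_cases)
  have "s\<^sup>2 \<le> s" using s by (simp add: power2_eq_square mult_left_le)
  then show ?thesis
    using s(3) s(1,2) by (elim disjE) (simp_all add: bq_pieces[OF s(1,2)])
qed (use bq_outside in auto)

lemma Bs_even: "Bs (- t) = Bs t"
proof -
  have *: "tp 3 (- s) = tp 3 s - s^3" for s by (auto simp: tp_def max_def)
  have "tp 3 (- t + c) = tp 3 (t + - c) - (t - c)^3" for c using *[of "t - c"] by simp
  then show ?thesis unfolding Bs_def by (simp only:) (simp add: power3_eq_cube algebra_simps)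
qed

lemma integral_of_antiderivative:
  fixes F f :: "real \<Rightarrow> real"
  assumes F: "\<And>t. (F has_real_derivative f t) (at t)" and f: "continuous_on UNIV f"
    and out: "\<And>t. 2 \<le> \<bar>t\<bar> \<Longrightarrow> f t = 0"
  shows "(LINT t|lborel. f t) = F 2 - F (- 2)"
proof -
  have "(LINT t|lborel. indicator {-2..2} t *\<^sub>R f t) = F 2 - F (- 2)"
    using F f by (intro integral_FTC_atLeastAtMost)
      (auto simp: has_real_derivative_iff_has_vector_derivative intro: has_vector_derivative_at_within continuous_on_subset)
  moreover have "(\<lambda>t. indicator {-2..2} t *\<^sub>R f t) = f"
  proof
    fix t show "indicator {-2..2} t *\<^sub>R f t = f t" using out[of t] by (cases "2 \<le> \<bar>t\<bar>") (auto simp: indicator_def)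
  qed
  ultimately show ?thesis by simp
qed

text \<open>What the cubic and the quadratic spline share, so that tensor products mixing both can
  be treated at once. With support in \<open>{-2..2}\<close> only four integer translates matter at
  a given point, hence the four-term form of the partition of unity.\<close>

definition unit_kernel :: "(real \<Rightarrow> real) \<Rightarrow> bool" where
  "unit_kernel f \<longleftrightarrow> continuous_on UNIV f \<and> (\<forall>t. 0 \<le> f t) \<and> (\<forall>t. 2 \<le> \<bar>t\<bar> \<longrightarrow> f t = 0) \<and>
    (\<forall>s. 0 \<le> s \<and> s \<le> 1 \<longrightarrow> f (s + 1) + f s + f (s - 1) + f (s - 2) = 1) \<and> (LINT t|lborel. f t) = 1"

lemma unit_kernel_Bs: "unit_kernel Bs"
  unfolding unit_kernel_def
proof (intro conjI allI impI)
  show c: "continuous_on UNIV Bs" unfolding Bs_def[abs_def] by (intro continuous_intros) auto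
  show "Bs (s + 1) + Bs s + Bs (s - 1) + Bs (s - 2) = 1" if "0 \<le> s \<and> s \<le> 1" for s
    unfolding Bs_pieces[OF conjunct1[OF that] conjunct2[OF that]]
    by (simp add: power2_eq_square power3_eq_cube field_simps)
  let ?F = "\<lambda>t. (tp 4 (t + 2) - 4 * tp 4 (t + 1) + 6 * tp 4 (t + 0) - 4 * tp 4 (t + - 1) + tp 4 (t + - 2)) / 24"
  have "(?F has_real_derivative Bs t) (at t)" for t
    unfolding Bs_def by (rule derivative_eq_intros refl)+ (simp_all add: field_simps)
  from integral_of_antiderivative[OF this c Bs_outside] show "(LINT t|lborel. Bs t) = 1" by (simp add: tp_def)
qed (auto simp: Bs_nonneg Bs_outside)

lemma unit_kernel_bq: "unit_kernel bq"
  unfolding unit_kernel_def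
proof (intro conjI allI impI)
  show c: "continuous_on UNIV bq" unfolding bq_def[abs_def] by (intro continuous_intros) auto
  show "bq (s + 1) + bq s + bq (s - 1) + bq (s - 2) = 1" if "0 \<le> s \<and> s \<le> 1" for s
    unfolding bq_pieces[OF conjunct1[OF that] conjunct2[OF that]] by (simp add: power2_eq_square field_simps)
  let ?F = "\<lambda>t. (tp 3 (t + 2) - 3 * tp 3 (t + 1) + 3 * tp 3 (t + 0) - tp 3 (t + - 1)) / 6"
  have "(?F has_real_derivative bq t) (at t)" for t
    unfolding bq_def by (rule derivative_eq_intros refl)+ (simp_all add: field_simps)
  from integral_of_antiderivative[OF this c bq_outside] show "(LINT t|lborel. bq t) = 1" by (simp add: tp_def)
qed (auto simp: bq_nonneg bq_outside)

text \<open>Only the integers from \<open>\<lfloor>t\<rfloor> - 1\<close> to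
  \<open>\<lfloor>t\<rfloor> + 2\<close> can lie closer than 2 to \<open>t\<close>; the margin 3
  keeps them in the summation range. The weight \<open>g\<close> is there for the moments.\<close>

lemma lattice_sum_1d:
  assumes out: "\<And>t. 2 \<le> \<bar>t\<bar> \<Longrightarrow> f t = 0" and N: "\<bar>t\<bar> + 3 \<le> real N"
  shows "(\<Sum>k\<in>{- int N..int N}. f (t - of_int k) * g k) =
    f (frac t + 1) * g (\<lfloor>t\<rfloor> - 1) + f (frac t) * g \<lfloor>t\<rfloor> + f (frac t - 1) * g (\<lfloor>t\<rfloor> + 1) + f (frac t - 2) * (g (\<lfloor>t\<rfloor> + 2) :: real)"
proof -
  let ?m = "\<lfloor>t\<rfloor>"
  have m: "of_int ?m \<le> t" "t < of_int ?m + 1" by linarith+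
  have "(\<Sum>k\<in>{- int N..int N}. f (t - of_int k) * g k) = (\<Sum>k\<in>{?m - 1, ?m, ?m + 1, ?m + 2}. f (t - of_int k) * g k)"
  proof (rule sum.mono_neutral_right)
    show "{?m - 1, ?m, ?m + 1, ?m + 2} \<subseteq> {- int N..int N}" using m N by auto linarith+
    show "\<forall>k\<in>{- int N..int N} - {?m - 1, ?m, ?m + 1, ?m + 2}. f (t - of_int k) * g k = 0"
    proof
      fix k assume "k \<in> {- int N..int N} - {?m - 1, ?m, ?m + 1, ?m + 2}"
      then have "k \<le> ?m - 2 \<or> k \<ge> ?m + 3" by auto
      then have "2 \<le> \<bar>t - of_int k\<bar>" using m by (auto simp: abs_if) linarith+
      then show "f (t - of_int k) * g k = 0" using out by simp
    qed
  qed simp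
  then show ?thesis by (simp add: frac_def algebra_simps)
qed

lemma unit_kernel_sum:
  assumes "unit_kernel f" "\<bar>t\<bar> + 3 \<le> real N"
  shows "(\<Sum>k\<in>{- int N..int N}. f (t - of_int k)) = 1"
  using lattice_sum_1d[of f t N "\<lambda>_. 1"] assms frac_lt_1[of t] by (simp add: unit_kernel_def)

text \<open>\<open>Bs\<close> is the density of a sum of four independent variables, uniform on the
  unit interval centred at 0; the variance is \<open>4 / 12 = 1 / 3\<close>. The lattice sums of the
  cubic spline reproduce these moments exactly at every \<open>t\<close>, so the second order Taylor
  term carries no position-dependent factor.\<close>

lemma Bs_moments:
  assumes "\<bar>t\<bar> + 3 \<le> real N"
  shows "(\<Sum>k\<in>{- int N..int N}. Bs (t - of_int k) * (of_int k - t)) = 0"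
    and "(\<Sum>k\<in>{- int N..int N}. Bs (t - of_int k) * (of_int k - t)\<^sup>2) = 1 / 3"
proof -
  define s where "s = frac t"
  have s: "0 \<le> s" "s \<le> 1" using frac_lt_1[of t] by (auto simp: s_def)
  have k: "of_int (\<lfloor>t\<rfloor> - 1) - t = - s - 1" "of_int \<lfloor>t\<rfloor> - t = - s" "of_int (\<lfloor>t\<rfloor> + 1) - t = 1 - s" "of_int (\<lfloor>t\<rfloor> + 2) - t = 2 - s"
    by (auto simp: s_def frac_def)
  \<comment> \<open>Pulls out the denominator common to all pieces, leaving the two integer
    polynomial identities that follow.\<close>
  have six: "a / 6 * a' + b / 6 * b' + c / 6 * c' + d / 6 * d' = (a * a' + b * b' + c * c' + d * d') / 6" for a b c d a' b' c' d' :: real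
    by (simp add: add_divide_distrib)
  have 1: "(1 - s)^3 * (- s - 1) + (4 - 6 * s\<^sup>2 + 3 * s^3) * - s + (1 + 3 * s + 3 * s\<^sup>2 - 3 * s^3) * (1 - s) + s^3 * (2 - s) = 0"
    by (simp add: power2_eq_square power3_eq_cube algebra_simps)
  have 2: "(1 - s)^3 * (- s - 1)\<^sup>2 + (4 - 6 * s\<^sup>2 + 3 * s^3) * (- s)\<^sup>2 + (1 + 3 * s + 3 * s\<^sup>2 - 3 * s^3) * (1 - s)\<^sup>2 + s^3 * (2 - s)\<^sup>2 = 2"
    by (simp add: power2_eq_square power3_eq_cube algebra_simps)
  show "(\<Sum>k\<in>{- int N..int N}. Bs (t - of_int k) * (of_int k - t)) = 0"
    by (rule trans[OF lattice_sum_1d[where f = Bs and g = "\<lambda>k. of_int k - t", OF Bs_outside assms]])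
      (unfold k s_def[symmetric] Bs_pieces[OF s] six 1, simp_all)
  show "(\<Sum>k\<in>{- int N..int N}. Bs (t - of_int k) * (of_int k - t)\<^sup>2) = 1 / 3"
    by (rule trans[OF lattice_sum_1d[where f = Bs and g = "\<lambda>k. (of_int k - t)\<^sup>2", OF Bs_outside assms]])
      (unfold k s_def[symmetric] Bs_pieces[OF s] six 2, simp_all)
qed

section \<open>Tensor product kernels\<close>

lemma sum_int_box_prod:
  fixes F :: "'n::finite \<Rightarrow> int \<Rightarrow> real"
  shows "(\<Sum>\<gamma>\<in>int_box N. \<Prod>i\<in>UNIV. F i (\<gamma> $ i)) = (\<Prod>i\<in>UNIV. \<Sum>k\<in>{- int N..int N}. F i k)"
proof -
  have "(\<Prod>i\<in>UNIV. \<Sum>k\<in>{- int N..int N}. F i k) = (\<Sum>g\<in>PiE UNIV (\<lambda>_. {- int N..int N}). \<Prod>i\<in>UNIV. F i (g i))"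
    by (rule prod_sum_PiE) auto
  also have "\<dots> = (\<Sum>\<gamma>\<in>int_box N. \<Prod>i\<in>UNIV. F i (\<gamma> $ i))"
    by (rule sum.reindex_bij_witness[of _ vec_nth vec_lambda]) (auto simp: int_box_def PiE_def Pi_def extensional_def)
  finally show ?thesis ..
qed

lemma lattice_vec_nth [simp]: "lattice_vec \<gamma> $ i = of_int (\<gamma> $ i)"
  by (simp add: lattice_vec_def)

lemma lattice_vec_add: "lattice_vec (\<gamma> + \<delta>) = lattice_vec \<gamma> + lattice_vec \<delta>"
  by (simp add: vec_eq_iff)

lemma lattice_vec_axis: "lattice_vec (axis j k) = axis j (of_int k)"
  by (simp add: vec_eq_iff axis_def)

text \<open>Factors may differ between coordinates because a partial derivative replaces the factor
  in its direction only.\<close>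

definition tensor :: "('n::finite \<Rightarrow> real \<Rightarrow> real) \<Rightarrow> real^'n \<Rightarrow> real" where
  "tensor f x = (\<Prod>i\<in>UNIV. f i (x $ i))"

lemma tensor_sum_eq_1:
  assumes f: "\<And>i. unit_kernel (f i)" and N: "\<And>i. \<bar>x $ i\<bar> + 3 \<le> real N"
  shows "(\<Sum>\<gamma>\<in>int_box N. tensor f (x - lattice_vec \<gamma>)) = 1"
proof -
  have "(\<Sum>\<gamma>\<in>int_box N. tensor f (x - lattice_vec \<gamma>)) = (\<Prod>i\<in>UNIV. \<Sum>k\<in>{- int N..int N}. f i (x $ i - of_int k))"
    unfolding tensor_def by (subst sum_int_box_prod[symmetric]) simp
  then show ?thesis by (simp add: unit_kernel_sum[OF f N])
qed

lemma tensor_nonneg: "(\<And>i. unit_kernel (f i)) \<Longrightarrow> 0 \<le> tensor f x"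
  unfolding tensor_def unit_kernel_def by (intro prod_nonneg) auto

lemma tensor_outside:
  assumes "\<And>i. unit_kernel (f i)" "2 \<le> \<bar>x $ i\<bar>"
  shows "tensor f x = 0"
  unfolding tensor_def by (rule prod_zero) (use assms in \<open>auto simp: unit_kernel_def\<close>)

lemma ex_real_nat_bound: "\<exists>N0. \<forall>N\<ge>N0. \<forall>i. \<bar>(x::real^'n) $ i\<bar> + c \<le> real N"
proof -
  obtain N0 where N0: "norm x + c \<le> real N0" using real_arch_simple by blast
  have "\<bar>x $ i\<bar> + c \<le> real N" if "N0 \<le> N" for N i
    using component_le_norm_cart[of x i] N0 that by linarith
  then show ?thesis by blast
qed

lemma int_box_mono:
  assumes "M \<le> N"
  shows "int_box M \<subseteq> int_box N"
proof
  fix \<gamma> assume "\<gamma> \<in> int_box M"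
  then have "- int M \<le> \<gamma> $ i \<and> \<gamma> $ i \<le> int M" for i by (simp add: int_box_def)
  then have "- int N \<le> \<gamma> $ i \<and> \<gamma> $ i \<le> int N" for i using assms by (meson dual_order.trans of_nat_mono neg_le_iff_le)
  then show "\<gamma> \<in> int_box N" by (simp add: int_box_def)
qed

lemma finite_subset_int_box:
  assumes "finite (S :: (int^'n) set)"
  shows "\<exists>N0. \<forall>N\<ge>N0. S \<subseteq> int_box N"
  using assms
proof (induction S rule: finite_induct)
  case (insert \<gamma> S)
  then obtain N0 where N0: "\<And>N. N \<ge> N0 \<Longrightarrow> S \<subseteq> int_box N" by blast
  obtain N1 where "\<And>N. N \<ge> N1 \<Longrightarrow> \<gamma> \<in> int_box N"
    using eventually_in_int_box[of \<gamma>] by (auto simp: eventually_sequentially)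
  with N0 have "insert \<gamma> S \<subseteq> int_box N" if "N \<ge> max N0 N1" for N using that by auto
  then show ?case by blast
qed auto

lemma tensor_sum_le_1:
  fixes x :: "real^'n"
  assumes f: "\<And>i. unit_kernel (f i)" and S: "finite S"
  shows "(\<Sum>\<gamma>\<in>S. tensor f (x - lattice_vec \<gamma>)) \<le> 1"
proof -
  obtain N0 where N0: "\<And>N. N \<ge> N0 \<Longrightarrow> S \<subseteq> int_box N" using finite_subset_int_box[OF S] by blast
  obtain N1 where N1: "\<And>N i. N \<ge> N1 \<Longrightarrow> \<bar>x $ i\<bar> + 3 \<le> real N" using ex_real_nat_bound[of x 3] by blast
  let ?N = "max N0 N1"
  have "(\<Sum>\<gamma>\<in>S. tensor f (x - lattice_vec \<gamma>)) \<le> (\<Sum>\<gamma>\<in>int_box ?N. tensor f (x - lattice_vec \<gamma>))"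
    using N0[of ?N] finite_int_box tensor_nonneg[of f, OF f] by (intro sum_mono2) auto
  also have "\<dots> = 1" using N1[of ?N] by (intro tensor_sum_eq_1 f) auto
  finally show ?thesis .
qed

lemma tensor_continuous:
  fixes f :: "'n::finite \<Rightarrow> real \<Rightarrow> real"
  assumes "\<And>i. unit_kernel (f i)"
  shows "continuous_on UNIV (tensor f)"
proof -
  have "continuous_on UNIV (\<lambda>x::real^'n. f i (x $ i))" for i
    by (rule continuous_on_compose2[of UNIV "f i"])
      (use assms[of i] in \<open>auto simp: unit_kernel_def intro: continuous_on_component continuous_on_id\<close>)
  then show ?thesis unfolding tensor_def[abs_def] by (intro continuous_on_prod) auto
qed

lemma tensor_bounded_support:
  fixes f :: "'n::finite \<Rightarrow> real \<Rightarrow> real"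
  assumes "\<And>i. unit_kernel (f i)"
  shows "bounded {x. tensor f x \<noteq> 0}"
proof (rule boundedI)
  fix x assume "x \<in> {x. tensor f x \<noteq> 0}"
  then have "\<bar>x $ i\<bar> \<le> 2" for i using tensor_outside[of f x i, OF assms] by force
  then have "(\<Sum>i\<in>UNIV. \<bar>x $ i\<bar>) \<le> (\<Sum>i\<in>(UNIV::'n set). 2)" by (intro sum_mono) auto
  then show "norm x \<le> real CARD('n) * 2" using norm_le_l1_cart[of x] by simp
qed

lemma tensor_integral:
  fixes f :: "'n::finite \<Rightarrow> real \<Rightarrow> real"
  assumes f: "\<And>i. unit_kernel (f i)"
  shows "(LINT x|lborel. tensor f x) = 1"
proof -
  have fm[measurable]: "f i \<in> borel_measurable borel" for i
    using f[of i] borel_measurable_continuous_onI by (auto simp: unit_kernel_def)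
  have one: "(\<integral>\<^sup>+t. ennreal (f i t) \<partial>lborel) = 1" for i
  proof -
    have "integrable lborel (f i)"
      using f[of i] not_integrable_integral_eq[of lborel "f i"] by (auto simp: unit_kernel_def)
    then show ?thesis using f[of i] by (subst nn_integral_eq_integral) (auto simp: unit_kernel_def)
  qed
  \<comment> \<open>Inverse of \<open>axis _ 1\<close>: the product formula for
    \<open>lborel\<close> is indexed by basis vectors, \<open>tensor\<close> by coordinates.\<close>
  define ix where "ix b = (SOME i. b = axis i (1::real))" for b :: "real^'n"
  have ix: "ix (axis i 1) = i" for i
  proof -
    have "axis i (1::real) = axis (ix (axis i 1)) 1" unfolding ix_def by (rule someI[of _ i]) simp
    then show ?thesis by (simp add: axis_eq_axis)
  qed
  have B: "(Basis :: (real^'n) set) = range (\<lambda>i. axis i 1)" by (auto simp: Basis_vec_def)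
  have inj: "inj (\<lambda>i::'n. axis i (1::real))" by (auto simp: inj_def axis_eq_axis)
  have "(\<integral>\<^sup>+x. ennreal (tensor f x) \<partial>lborel) = (\<integral>\<^sup>+x. (\<Prod>b\<in>Basis. ennreal (f (ix b) (x \<bullet> b))) \<partial>lborel)"
  proof (rule nn_integral_cong)
    fix x :: "real^'n"
    have "(\<Prod>b\<in>Basis. ennreal (f (ix b) (x \<bullet> b))) = (\<Prod>i\<in>UNIV. ennreal (f i (x $ i)))"
      unfolding B by (subst prod.reindex[OF inj]) (simp add: ix inner_axis)
    also have "\<dots> = ennreal (tensor f x)"
      unfolding tensor_def using f by (intro prod_ennreal) (auto simp: unit_kernel_def)
    finally show "ennreal (tensor f x) = (\<Prod>b\<in>Basis. ennreal (f (ix b) (x \<bullet> b)))" ..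
  qed
  also have "\<dots> = (\<Prod>b\<in>(Basis::(real^'n) set). \<integral>\<^sup>+t. ennreal (f (ix b) t) \<partial>lborel)"
    by (rule nn_integral_lborel_prod) auto
  also have "\<dots> = 1" by (simp add: one)
  finally have "(\<integral>\<^sup>+x. ennreal (tensor f x) \<partial>lborel) = 1" .
  then show ?thesis
    using tensor_nonneg[of f, OF f] borel_measurable_continuous_onI[OF tensor_continuous[of f, OF f]]
    by (subst integral_eq_nn_integral) auto
qed

lemma tensor_translate:
  fixes f :: "'n::finite \<Rightarrow> real \<Rightarrow> real"
  assumes f: "\<And>i. unit_kernel (f i)"
  shows "integrable lborel (\<lambda>x. tensor f (x - a))" "(LINT x|lborel. tensor f (x - a)) = 1"
    "bounded {x. tensor f (x - a) \<noteq> 0}" "continuous_on UNIV (\<lambda>x. tensor f (x - a))"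
proof -
  show b: "bounded {x. tensor f (x - a) \<noteq> 0}"
    using bounded_support_affine[OF tensor_bounded_support[of f, OF f], of 1 "- a"] by simp
  show c: "continuous_on UNIV (\<lambda>x. tensor f (x - a))"
    by (rule continuous_on_compose2[OF tensor_continuous[of f, OF f]]) (auto intro: continuous_intros)
  show "integrable lborel (\<lambda>x. tensor f (x - a))" by (rule integrable_bounded_support[OF c b])
  show "(LINT x|lborel. tensor f (x - a)) = 1"
    using lborel_integral_translate[OF borel_measurable_continuous_onI[OF tensor_continuous[of f, OF f]], of "- a"] tensor_integral[of f, OF f] by simp
qed

abbreviation \<beta> :: "real^'n \<Rightarrow> real" where "\<beta> \<equiv> tensor (\<lambda>i. Bs)"

text \<open>Lets a factor that depends on one coordinate be absorbed into a coordinatewise product;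
  moment sums then factorise by \<open>sum_int_box_prod\<close>.\<close>

lemma prod_if_eq:
  fixes a :: "'n::finite \<Rightarrow> 'b::comm_monoid_mult"
  shows "(\<Prod>l\<in>UNIV. if l = i then a l else 1) = a i"
  by (simp add: prod.delta)

lemma \<beta>_first_moment:
  assumes N: "\<And>i. \<bar>x $ i\<bar> + 3 \<le> real N"
  shows "(\<Sum>\<gamma>\<in>int_box N. \<beta> (x - lattice_vec \<gamma>) * (lattice_vec \<gamma> - x) $ i) = 0"
proof -
  have "(\<Sum>\<gamma>\<in>int_box N. \<beta> (x - lattice_vec \<gamma>) * (lattice_vec \<gamma> - x) $ i)
    = (\<Sum>\<gamma>\<in>int_box N. \<Prod>l\<in>UNIV. Bs (x $ l - of_int (\<gamma> $ l)) * (if l = i then of_int (\<gamma> $ l) - x $ l else 1))"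
    unfolding tensor_def prod.distrib prod_if_eq by simp
  also have "\<dots> = (\<Prod>l\<in>UNIV. \<Sum>k\<in>{- int N..int N}. Bs (x $ l - of_int k) * (if l = i then of_int k - x $ l else 1))"
    by (rule sum_int_box_prod)
  also have "\<dots> = 0"
    by (rule prod_zero, simp, rule bexI[of _ i]) (use Bs_moments(1)[OF N[of i]] in simp_all)
  finally show ?thesis .
qed

text \<open>Off the diagonal the product contains a one-dimensional first moment, which is 0; on the
  diagonal one factor is the second moment and all others are 1.\<close>

lemma \<beta>_second_moment:
  assumes N: "\<And>i. \<bar>x $ i\<bar> + 3 \<le> real N"
  shows "(\<Sum>\<gamma>\<in>int_box N. \<beta> (x - lattice_vec \<gamma>) * ((lattice_vec \<gamma> - x) $ i * (lattice_vec \<gamma> - x) $ j)) = (if i = j then 1 / 3 else 0)"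
proof -
  let ?w = "\<lambda>i l k. if l = i then of_int k - x $ l else 1"
  have "(\<Sum>\<gamma>\<in>int_box N. \<beta> (x - lattice_vec \<gamma>) * ((lattice_vec \<gamma> - x) $ i * (lattice_vec \<gamma> - x) $ j))
    = (\<Sum>\<gamma>\<in>int_box N. \<Prod>l\<in>UNIV. Bs (x $ l - of_int (\<gamma> $ l)) * (?w i l (\<gamma> $ l) * ?w j l (\<gamma> $ l)))"
    unfolding tensor_def prod.distrib prod_if_eq by simp
  also have "\<dots> = (\<Prod>l\<in>UNIV. \<Sum>k\<in>{- int N..int N}. Bs (x $ l - of_int k) * (?w i l k * ?w j l k))"
    by (rule sum_int_box_prod)
  also have "\<dots> = (if i = j then 1 / 3 else 0)"
  proof (cases "i = j")
    case True
    have "(\<Sum>k\<in>{- int N..int N}. Bs (x $ l - of_int k) * (?w i l k * ?w j l k)) = (if l = i then 1 / 3 else 1)" for l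
      using True Bs_moments(2)[OF N[of i]] unit_kernel_sum[OF unit_kernel_Bs N[of l]]
      by (cases "l = i") (auto simp: power2_eq_square)
    then show ?thesis using True by (simp only: prod_if_eq) simp
  next
    case False
    have "(\<Sum>k\<in>{- int N..int N}. Bs (x $ i - of_int k) * (?w i i k * ?w j i k)) = 0"
      using False Bs_moments(1)[OF N[of i]] by simp
    then have "\<exists>l\<in>UNIV. (\<Sum>k\<in>{- int N..int N}. Bs (x $ l - of_int k) * (?w i l k * ?w j l k)) = 0"
      by (rule bexI[of _ i]) simp
    from prod_zero[OF _ this] False show ?thesis by simp
  qed
  finally show ?thesis .
qed

section \<open>Nonnegative potentials with bounded derivatives\<close>

lemma sum_weighted_affine:
  fixes b d q :: "'a \<Rightarrow> real"
  shows "(\<Sum>\<gamma>\<in>S. b \<gamma> * (v + s * d \<gamma> + t * q \<gamma> + r))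
    = (v + r) * (\<Sum>\<gamma>\<in>S. b \<gamma>) + s * (\<Sum>\<gamma>\<in>S. b \<gamma> * d \<gamma>) + t * (\<Sum>\<gamma>\<in>S. b \<gamma> * q \<gamma>)"
  by (simp add: sum.distrib sum_distrib_left algebra_simps)

text \<open>To be used with the potential minus its minimum. One constant bounds the values and the
  second and third derivatives; first derivatives get the sharper
  \<open>gradient_bound\<close>.\<close>

locale bounded_potential =
  fixes V :: "real^'n \<Rightarrow> real" and K :: real
  assumes V3: "C_k (Suc (Suc (Suc 0))) V"
    and V_nonneg: "0 \<le> V x"
    and K0: "0 \<le> K"
    and V_bound: "V x \<le> K"
    and pd3_bound: "\<bar>pd i (pd j (pd k V)) x\<bar> \<le> K"
    and pd2_bound: "\<bar>pd i (pd j V) x\<bar> \<le> K"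
begin

lemma V_C2: "C_k (Suc (Suc 0)) V"
  by (rule C_k_SucD[OF V3])

lemma V_cont: "continuous_on UNIV V"
  using V3 by (rule C_k_continuous)

text \<open>A nonnegative function lies above its second order Taylor bound, so its discriminant is nonpositive.\<close>

lemma gradient_bound: "(pd i V x)\<^sup>2 \<le> 4 * K * V x"
proof -
  have "(pd i V x / 2)\<^sup>2 \<le> V x * K"
  proof (rule discriminant_le)
    fix t :: real
    have "\<bar>V (x + axis i t) - V x - dird (axis i t) V x\<bar> \<le> (\<Sum>k\<in>UNIV. \<bar>axis i t $ k\<bar>)\<^sup>2 * K"
      by (rule Taylor2_bound) (use V_C2 pd2_bound in \<open>simp_all add: numeral_2_eq_2\<close>)
    moreover have "(\<Sum>k\<in>UNIV. \<bar>axis i t $ k\<bar>) = \<bar>t\<bar>" by (simp add: axis_def if_distrib[of abs] cong: if_cong)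
    ultimately show "0 \<le> V x + 2 * t * (pd i V x / 2) + t\<^sup>2 * K"
      using V_nonneg[of "x + axis i t"] by (simp add: dird_axis)
  qed (use V_nonneg K0 in auto)
  then show ?thesis by (simp add: power_divide mult_ac)
qed

lemma Taylor3:
  "\<bar>V (x + z) - V x - dird z V x - (\<Sum>i\<in>UNIV. \<Sum>j\<in>UNIV. z $ i * z $ j * pd i (pd j V) x) / 2\<bar>
    \<le> (\<Sum>i\<in>UNIV. \<bar>z $ i\<bar>)^3 * K"
  by (rule Taylor3_bound) (use V3 pd3_bound in \<open>simp_all add: numeral_3_eq_3\<close>)

section \<open>The discrete bottom is at most the continuous one\<close>

text \<open>Taylor expansion of every sample at \<open>h *\<^sub>R x\<close>, summed with the spline
  weights: mass 1, first moments 0, second moments 1/3 on the diagonal. The \<open>1 / 6\<close> is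
  this 1/3 times the Taylor factor 1/2, and \<open>2 * CARD('n)\<close> bounds the l1 norm on the
  support of \<open>\<beta>\<close>.\<close>

lemma quasi_interpolant_bound:
  assumes N: "\<And>i. \<bar>x $ i\<bar> + 3 \<le> real N" and h: "0 < h"
  shows "(\<Sum>\<gamma>\<in>int_box N. \<beta> (x - lattice_vec \<gamma>) * V (h *\<^sub>R lattice_vec \<gamma>))
    \<le> V (h *\<^sub>R x) + h\<^sup>2 / 6 * (\<Sum>i\<in>UNIV. pd i (pd i V) (h *\<^sub>R x)) + (2 * real CARD('n))^3 * K * h^3"
proof -
  let ?b = "\<lambda>\<gamma>. \<beta> (x - lattice_vec \<gamma>)" and ?z = "\<lambda>\<gamma>. lattice_vec \<gamma> - x" and ?y = "h *\<^sub>R x"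
  have b0: "0 \<le> ?b \<gamma>" for \<gamma> by (intro tensor_nonneg unit_kernel_Bs)
  define R where "R = (2 * real CARD('n))^3 * K * h^3"
  have V: "?b \<gamma> * V (h *\<^sub>R lattice_vec \<gamma>) \<le> ?b \<gamma> * (V ?y + h * dird (?z \<gamma>) V ?y + h\<^sup>2 / 2 * (\<Sum>i\<in>UNIV. \<Sum>j\<in>UNIV. ?z \<gamma> $ i * ?z \<gamma> $ j * pd i (pd j V) ?y) + R)" for \<gamma>
  proof (cases "\<exists>i. 2 \<le> \<bar>?z \<gamma> $ i\<bar>")
    case True
    then have "?b \<gamma> = 0" using tensor_outside[OF unit_kernel_Bs, of "x - lattice_vec \<gamma>"] by (auto simp: abs_minus_commute)
    then show ?thesis by simp
  next
    case False
    let ?w = "h *\<^sub>R ?z \<gamma>"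
    have "(\<Sum>i\<in>UNIV. \<bar>?w $ i\<bar>) \<le> (\<Sum>i\<in>(UNIV::'n set). h * 2)"
      using False h by (intro sum_mono) (auto simp: abs_mult not_le intro: less_imp_le)
    then have "(\<Sum>i\<in>UNIV. \<bar>?w $ i\<bar>)^3 \<le> (2 * real CARD('n) * h)^3"
      by (intro power_mono) (auto simp: sum_nonneg algebra_simps)
    then have "(\<Sum>i\<in>UNIV. \<bar>?w $ i\<bar>)^3 * K \<le> R"
      using K0 mult_right_mono by (fastforce simp: R_def power_mult_distrib algebra_simps)
    moreover have "?y + ?w = h *\<^sub>R lattice_vec \<gamma>" by (simp add: algebra_simps)
    moreover have "dird ?w V ?y = h * dird (?z \<gamma>) V ?y" by (simp add: dird_def sum_distrib_left mult.assoc)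
    moreover have "(\<Sum>i\<in>UNIV. \<Sum>j\<in>UNIV. ?w $ i * ?w $ j * pd i (pd j V) ?y) = h\<^sup>2 * (\<Sum>i\<in>UNIV. \<Sum>j\<in>UNIV. ?z \<gamma> $ i * ?z \<gamma> $ j * pd i (pd j V) ?y)"
      unfolding sum_distrib_left by (intro sum.cong refl) (simp add: power2_eq_square)
    ultimately have "V (h *\<^sub>R lattice_vec \<gamma>) \<le> V ?y + h * dird (?z \<gamma>) V ?y + h\<^sup>2 / 2 * (\<Sum>i\<in>UNIV. \<Sum>j\<in>UNIV. ?z \<gamma> $ i * ?z \<gamma> $ j * pd i (pd j V) ?y) + R"
      using Taylor3[of ?y ?w] by simp
    then show ?thesis using b0 by (intro mult_left_mono)
  qed
  have s1: "(\<Sum>\<gamma>\<in>int_box N. ?b \<gamma>) = 1" using N by (intro tensor_sum_eq_1 unit_kernel_Bs)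
  have s2: "(\<Sum>\<gamma>\<in>int_box N. ?b \<gamma> * dird (?z \<gamma>) V ?y) = 0"
  proof -
    have "(\<Sum>\<gamma>\<in>int_box N. ?b \<gamma> * dird (?z \<gamma>) V ?y) = (\<Sum>i\<in>UNIV. pd i V ?y * (\<Sum>\<gamma>\<in>int_box N. ?b \<gamma> * ?z \<gamma> $ i))"
      unfolding dird_def sum_distrib_left by (subst sum.swap) (intro sum.cong refl, simp)
    then show ?thesis by (simp only: \<beta>_first_moment[OF N]) simp
  qed
  have s3: "(\<Sum>\<gamma>\<in>int_box N. ?b \<gamma> * (\<Sum>i\<in>UNIV. \<Sum>j\<in>UNIV. ?z \<gamma> $ i * ?z \<gamma> $ j * pd i (pd j V) ?y)) = (\<Sum>i\<in>UNIV. pd i (pd i V) ?y) / 3"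
  proof -
    have "(\<Sum>\<gamma>\<in>int_box N. ?b \<gamma> * (\<Sum>i\<in>UNIV. \<Sum>j\<in>UNIV. ?z \<gamma> $ i * ?z \<gamma> $ j * pd i (pd j V) ?y))
      = (\<Sum>\<gamma>\<in>int_box N. \<Sum>i\<in>UNIV. \<Sum>j\<in>UNIV. pd i (pd j V) ?y * (?b \<gamma> * (?z \<gamma> $ i * ?z \<gamma> $ j)))"
      unfolding sum_distrib_left by (intro sum.cong refl) simp
    also have "\<dots> = (\<Sum>i\<in>UNIV. \<Sum>j\<in>UNIV. pd i (pd j V) ?y * (\<Sum>\<gamma>\<in>int_box N. ?b \<gamma> * (?z \<gamma> $ i * ?z \<gamma> $ j)))"
      unfolding sum_distrib_left
      by (subst sum.swap, rule sum.cong[OF refl], subst sum.swap, rule refl)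
    also have "\<dots> = (\<Sum>i\<in>UNIV. \<Sum>j\<in>UNIV. pd i (pd j V) ?y * (if i = j then 1 / 3 else 0))"
      by (simp only: \<beta>_second_moment[OF N])
    also have "\<dots> = (\<Sum>i\<in>UNIV. pd i (pd i V) ?y / 3)"
      by (intro sum.cong refl) (simp add: if_distrib[of "\<lambda>c. _ * c"] cong: if_cong)
    finally show ?thesis by (simp add: sum_divide_distrib)
  qed
  have "(\<Sum>\<gamma>\<in>int_box N. ?b \<gamma> * V (h *\<^sub>R lattice_vec \<gamma>))
    \<le> (\<Sum>\<gamma>\<in>int_box N. ?b \<gamma> * (V ?y + h * dird (?z \<gamma>) V ?y + h\<^sup>2 / 2 * (\<Sum>i\<in>UNIV. \<Sum>j\<in>UNIV. ?z \<gamma> $ i * ?z \<gamma> $ j * pd i (pd j V) ?y) + R))"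
    by (intro sum_mono V)
  also have "\<dots> = (V ?y + R) * (\<Sum>\<gamma>\<in>int_box N. ?b \<gamma>) + h * (\<Sum>\<gamma>\<in>int_box N. ?b \<gamma> * dird (?z \<gamma>) V ?y)
    + h\<^sup>2 / 2 * (\<Sum>\<gamma>\<in>int_box N. ?b \<gamma> * (\<Sum>i\<in>UNIV. \<Sum>j\<in>UNIV. ?z \<gamma> $ i * ?z \<gamma> $ j * pd i (pd j V) ?y))"
    by (rule sum_weighted_affine)
  also have "\<dots> = V ?y + R + h\<^sup>2 / 6 * (\<Sum>i\<in>UNIV. pd i (pd i V) ?y)"
    unfolding s1 s2 s3 by simp
  finally show ?thesis by (simp add: R_def)
qed

lemma scaled_cont: "continuous_on UNIV (\<lambda>x. V (h *\<^sub>R x))"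
  by (rule continuous_on_compose2[OF V_cont]) (auto intro: continuous_intros)

text \<open>One integration by parts moves a derivative from \<open>V\<close> to the square of
  \<open>u\<close>, at the price of one power of \<open>h\<close>. The resulting product of
  \<open>\<partial>V\<close>, \<open>u\<close> and \<open>\<partial>u\<close> is split by the
  arithmetic-geometric inequality, and \<open>gradient_bound\<close> turns the square of
  \<open>\<partial>V\<close> into \<open>V\<close>. So an error that looks like
  \<open>h\<^sup>2\<close> times the norm is only \<open>h\<close> times the energy.\<close>

lemma second_order_term:
  assumes u: "u \<in> C2c" and h: "0 < h"
  shows "h\<^sup>2 * \<bar>LINT x|lborel. pd i (pd i V) (h *\<^sub>R x) * (u x)\<^sup>2\<bar>
    \<le> h * (4 * K * (LINT x|lborel. V (h *\<^sub>R x) * (u x)\<^sup>2) + (LINT x|lborel. (pd i u x)\<^sup>2))"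
proof -
  let ?G = "\<lambda>x. pd i V (h *\<^sub>R x)"
  have u2: "C_k (Suc (Suc 0)) u" "bounded {x. u x \<noteq> 0}" using u by (auto simp: C2c_def)
  note u1 = C_k_SucD[OF u2(1)]
  have GC: "C_k (Suc 0) ?G" using C_k_affine[OF C_k_pd[OF V_C2], of i 0 h] by simp
  have pdG: "pd i ?G x = h * pd i (pd i V) (h *\<^sub>R x)" for x using pd_affine[OF C_k_pd[OF V_C2], of i i 0 h x] by simp
  have usq: "C_k (Suc 0) (\<lambda>x. (u x)\<^sup>2)" unfolding power2_eq_square by (intro C_k_mult u1)
  have pdu: "pd i (\<lambda>x. (u x)\<^sup>2) x = 2 * u x * pd i u x" for x
    unfolding power2_eq_square using pd_mult[OF u1 u1] by simp
  have bs: "bounded {x. (u x)\<^sup>2 \<noteq> 0}" using u2(2) by simp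
  have uc: "continuous_on UNIV u" "continuous_on UNIV (pd i u)" "continuous_on UNIV ?G"
    using C_k_continuous[OF u1] C_k_continuous[OF C_k_pd[OF u2(1)]] C_k_continuous[OF GC] by auto
  note I = C2c_integrable[OF u scaled_cont[of h]]
  have "(LINT x|lborel. ?G x * pd i (\<lambda>x. (u x)\<^sup>2) x) = - (LINT x|lborel. pd i ?G x * (u x)\<^sup>2)"
    by (rule integral_by_parts[OF bounded_bilinear_mult GC usq disjI2[OF bs]])
  then have "h * (LINT x|lborel. pd i (pd i V) (h *\<^sub>R x) * (u x)\<^sup>2) = - (LINT x|lborel. ?G x * (2 * u x * pd i u x))"
    unfolding pdG pdu by (simp add: mult.assoc)
  then have "\<bar>h * (LINT x|lborel. pd i (pd i V) (h *\<^sub>R x) * (u x)\<^sup>2)\<bar> = \<bar>LINT x|lborel. ?G x * (2 * u x * pd i u x)\<bar>"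
    by (simp only: abs_minus_cancel)
  then have "h * \<bar>LINT x|lborel. pd i (pd i V) (h *\<^sub>R x) * (u x)\<^sup>2\<bar> = \<bar>LINT x|lborel. ?G x * (2 * u x * pd i u x)\<bar>"
    using h by (simp only: abs_mult abs_of_pos)
  also have "\<dots> \<le> (LINT x|lborel. \<bar>?G x * (2 * u x * pd i u x)\<bar>)" by (rule integral_abs_bound)
  also have "\<dots> \<le> (LINT x|lborel. 4 * K * (V (h *\<^sub>R x) * (u x)\<^sup>2) + (pd i u x)\<^sup>2)"
  proof (rule integral_mono)
    show "integrable lborel (\<lambda>x. \<bar>?G x * (2 * u x * pd i u x)\<bar>)"
      by (rule integrable_bounded_support)
        (use uc u2(2) in \<open>auto intro!: continuous_intros elim!: bounded_subset\<close>)
    show "integrable lborel (\<lambda>x. 4 * K * (V (h *\<^sub>R x) * (u x)\<^sup>2) + (pd i u x)\<^sup>2)" using I by auto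
    fix x
    have "\<bar>?G x * (2 * u x * pd i u x)\<bar> = 2 * \<bar>?G x * u x\<bar> * \<bar>pd i u x\<bar>" by (simp add: abs_mult)
    also have "\<dots> \<le> (?G x)\<^sup>2 * (u x)\<^sup>2 + (pd i u x)\<^sup>2"
      using sum_squares_bound[of "\<bar>?G x * u x\<bar>" "\<bar>pd i u x\<bar>"] by (simp add: power_mult_distrib)
    also have "(?G x)\<^sup>2 * (u x)\<^sup>2 \<le> 4 * K * V (h *\<^sub>R x) * (u x)\<^sup>2"
      by (intro mult_right_mono gradient_bound) simp
    finally show "\<bar>?G x * (2 * u x * pd i u x)\<bar> \<le> 4 * K * (V (h *\<^sub>R x) * (u x)\<^sup>2) + (pd i u x)\<^sup>2" by (simp add: mult.assoc)
  qed
  also have "\<dots> = 4 * K * (LINT x|lborel. V (h *\<^sub>R x) * (u x)\<^sup>2) + (LINT x|lborel. (pd i u x)\<^sup>2)" using I by simp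
  finally show ?thesis using h by (simp add: power2_eq_square mult.assoc)
qed

end

text \<open>Splitting the unit step into equal parts and applying Cauchy-Schwarz bounds the left
  side by the squared norm of a difference quotient with arbitrarily small step. The constant 1
  matters: a larger factor would spoil the limit 1 of the quotient of the bottoms.\<close>

lemma translate_diff_le_pd:
  fixes u :: "real^'n \<Rightarrow> real"
  assumes u: "C_k (Suc 0) u" and supp: "bounded {x. u x \<noteq> 0}"
  shows "(LINT x|lborel. (u (x + axis i 1) - u x)\<^sup>2) \<le> (LINT x|lborel. (pd i u x)\<^sup>2)"
proof -
  let ?e = "axis i 1 :: real^'n"
  define s where "s n x = real (Suc n) *\<^sub>R (u (x + (1 / real (Suc n)) *\<^sub>R ?e) - u x)" for n x
  obtain B R where B: "B \<ge> 0" "\<And>n x. norm (s n x) \<le> B * indicator (cball 0 R) x"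
    using difference_quotient_bound[OF u supp, of i] unfolding s_def by blast
  have uc: "continuous_on UNIV u" using u by (rule C_k_continuous)
  note [measurable] = C_k_measurable[OF u] C_k_measurable[OF C_k_pd[OF u, of i]]
  have tc: "continuous_on UNIV (\<lambda>x. u (x + a))" for a :: "real^'n"
    by (rule continuous_on_compose2[OF uc]) (auto intro: continuous_intros)
  have tb: "bounded {x. u (x + a) \<noteq> 0}" for a using bounded_support_affine[OF supp, of 1 a] by (simp add: add.commute)
  have ti: "integrable lborel (\<lambda>x. (u (x + a) - u (x + b))\<^sup>2)" for a b
  proof (rule integrable_bounded_support)
    show "continuous_on UNIV (\<lambda>x. (u (x + a) - u (x + b))\<^sup>2)" by (intro continuous_intros tc)
    show "bounded {x. (u (x + a) - u (x + b))\<^sup>2 \<noteq> 0}"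
      by (rule bounded_subset[OF bounded_Un[THEN iffD2, OF conjI[OF tb[of a] tb[of b]]]]) auto
  qed
  have bound: "(LINT x|lborel. (u (x + ?e) - u x)\<^sup>2) \<le> (LINT x|lborel. (s n x)\<^sup>2)" for n
  proof -
    let ?m = "real (Suc n)" and ?c = "\<lambda>k. (real k / real (Suc n)) *\<^sub>R ?e"
    have "(LINT x|lborel. (u (x + ?e) - u x)\<^sup>2) \<le> (LINT x|lborel. (\<Sum>k<Suc n. ?m * (u (x + ?c (Suc k)) - u (x + ?c k))\<^sup>2))"
    proof (rule integral_mono)
      show "integrable lborel (\<lambda>x. (u (x + ?e) - u x)\<^sup>2)" using ti[of ?e 0] by simp
      show "integrable lborel (\<lambda>x. \<Sum>k<Suc n. ?m * (u (x + ?c (Suc k)) - u (x + ?c k))\<^sup>2)"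
        by (intro Bochner_Integration.integrable_sum integrable_mult_right ti)
      fix x
      have "u (x + ?e) - u x = (\<Sum>k<Suc n. u (x + ?c (Suc k)) - u (x + ?c k))"
        using sum_lessThan_telescope[of "\<lambda>k. u (x + ?c k)" "Suc n"] by (simp del: sum.lessThan_Suc)
      then have "(u (x + ?e) - u x)\<^sup>2 = (\<Sum>k<Suc n. (u (x + ?c (Suc k)) - u (x + ?c k)) * 1)\<^sup>2" by (simp only: mult_1_right)
      also have "\<dots> \<le> (\<Sum>k<Suc n. (u (x + ?c (Suc k)) - u (x + ?c k))\<^sup>2) * (\<Sum>k<Suc n. 1\<^sup>2)"
        by (rule Cauchy_Schwarz_ineq_sum)
      also have "\<dots> = (\<Sum>k<Suc n. ?m * (u (x + ?c (Suc k)) - u (x + ?c k))\<^sup>2)"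
        by (subst mult.commute) (simp add: sum_distrib_left del: sum.lessThan_Suc)
      finally show "(u (x + ?e) - u x)\<^sup>2 \<le> (\<Sum>k<Suc n. ?m * (u (x + ?c (Suc k)) - u (x + ?c k))\<^sup>2)" .
    qed
    also have "\<dots> = (\<Sum>k<Suc n. ?m * (LINT x|lborel. (u (x + ?c (Suc k)) - u (x + ?c k))\<^sup>2))"
      using ti by (subst Bochner_Integration.integral_sum) auto
    also have "\<dots> = (\<Sum>k<Suc n. ?m * (LINT x|lborel. (u (x + (1 / ?m) *\<^sub>R ?e) - u x)\<^sup>2))"
    proof (intro sum.cong refl arg_cong[where f = "\<lambda>t. ?m * t"])
      fix k
      have "?c (Suc k) = ?c k + (1 / ?m) *\<^sub>R ?e" by (simp add: add_divide_distrib algebra_simps)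
      then have "(LINT x|lborel. (u (x + ?c (Suc k)) - u (x + ?c k))\<^sup>2) = (LINT x|lborel. (u ((?c k + x) + (1 / ?m) *\<^sub>R ?e) - u (?c k + x))\<^sup>2)"
        by (simp only: add_ac)
      also have "\<dots> = (LINT x|lborel. (u (x + (1 / ?m) *\<^sub>R ?e) - u x)\<^sup>2)"
        by (rule lborel_integral_translate) measurable
      finally show "(LINT x|lborel. (u (x + ?c (Suc k)) - u (x + ?c k))\<^sup>2) = (LINT x|lborel. (u (x + (1 / ?m) *\<^sub>R ?e) - u x)\<^sup>2)" .
    qed
    also have "\<dots> = (LINT x|lborel. (s n x)\<^sup>2)"
      by (simp add: s_def power_mult_distrib power2_eq_square[of "real (Suc n)"] del: of_nat_Suc)
    finally show ?thesis .
  qed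
  have "(\<lambda>n. LINT x|lborel. (s n x)\<^sup>2) \<longlonglongrightarrow> (LINT x|lborel. (pd i u x)\<^sup>2)"
  proof (rule integral_dominated_convergence[where w = "\<lambda>x. B\<^sup>2 * indicator (cball 0 R) x"])
    show "AE x in lborel. (\<lambda>n. (s n x)\<^sup>2) \<longlonglongrightarrow> (pd i u x)\<^sup>2"
      unfolding s_def by (intro AE_I2 tendsto_power difference_quotient_tendsto u)
    show "AE x in lborel. norm ((s n x)\<^sup>2) \<le> B\<^sup>2 * indicator (cball 0 R) x" for n
    proof (rule AE_I2)
      fix x
      have "\<bar>s n x\<bar>\<^sup>2 \<le> (B * indicator (cball 0 R) x)\<^sup>2" using B(2)[of n x] by (intro power_mono) auto
      then show "norm ((s n x)\<^sup>2) \<le> B\<^sup>2 * indicator (cball 0 R) x" by (auto simp: indicator_def split: if_splits)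
    qed
    show "integrable lborel (\<lambda>x. B\<^sup>2 * indicator (cball 0 R) (x :: real^'n) :: real)"
      by (intro integrable_mult_right integrable_real_indicator emeasure_lborel_cball_finite) auto
  qed (auto simp: s_def)
  then show ?thesis by (rule LIMSEQ_le_const) (use bound in auto)
qed

context bounded_potential
begin

text \<open>Averaging over all shifts makes the norm exact: after the substitution
  \<open>x = lattice_vec \<gamma> + s\<close> the weights sum to 1 wherever \<open>u\<close> is
  nonzero. The potential is sampled at \<open>h *\<^sub>R lattice_vec \<gamma>\<close>, not at the
  shifted point, and this mismatch is what \<open>quasi_interpolant_bound\<close> estimates.\<close>

theorem discrete_le_continuous:
  assumes u: "u \<in> C2c" and h: "0 < h"
    and lam: "\<And>v. finite {\<gamma>. v \<gamma> \<noteq> 0} \<Longrightarrow> lam * (LINT \<gamma>|count. (v \<gamma>)\<^sup>2) \<le> discrete_energy (\<lambda>\<gamma>. V (h *\<^sub>R lattice_vec \<gamma>)) v"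
  shows "lam * (LINT x|lborel. (u x)\<^sup>2) \<le> (1 + (4 * K * real CARD('n) + 1) * h) * energy (\<lambda>x. V (h *\<^sub>R x)) u
    + (2 * real CARD('n))^3 * K * h^3 * (LINT x|lborel. (u x)\<^sup>2)"
proof -
  let ?W = "\<lambda>x. V (h *\<^sub>R x)" and ?U = "\<lambda>\<gamma>. V (h *\<^sub>R lattice_vec \<gamma>)"
  define C where "C = (2 * real CARD('n))^3 * K"
  have u2: "C_k (Suc (Suc 0)) u" "bounded {x. u x \<noteq> 0}" using u by (auto simp: C2c_def)
  note u1 = C_k_SucD[OF u2(1)]
  have uc: "continuous_on UNIV u" using C_k_continuous[OF u1] .
  obtain R where R: "R > 0" "\<And>x. R \<le> norm x \<Longrightarrow> u x = 0" using u2(2) by (auto simp: bounded_support_iff)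
  \<comment> \<open>Room for the support of \<open>u\<close>, for \<open>s\<close> in the support of
    \<open>\<beta>\<close> together with a unit step, and for the margin 3 in the partition of
    unity.\<close>
  obtain N where N: "R + 5 \<le> real N" using real_arch_simple by blast
  let ?S = "int_box N :: (int^'n) set"
  have unz: "\<bar>x $ i\<bar> \<le> R" if "u x \<noteq> 0" for x i
    using R(2)[of x] that component_le_norm_cart[of x i] by linarith
  have unz3: "\<bar>x $ i\<bar> + 3 \<le> real N" if "u x \<noteq> 0" for x i
    using unz[OF that, of i] N by linarith
  have b0: "0 \<le> \<beta> s" for s :: "real^'n" by (intro tensor_nonneg unit_kernel_Bs)
  have bnz: "\<bar>s $ i\<bar> \<le> 2" if "\<beta> s \<noteq> 0" for s :: "real^'n" and i
    using tensor_outside[OF unit_kernel_Bs, of s i] that by force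
  have in_S: "\<gamma> \<in> ?S" if "u (lattice_vec \<gamma> + s) \<noteq> 0" "\<And>i. \<bar>s $ i\<bar> \<le> 4" for \<gamma> and s :: "real^'n"
  proof -
    have "\<bar>of_int (\<gamma> $ i) :: real\<bar> \<le> real N" for i
      using unz[OF that(1), of i] that(2)[of i] N by simp
    then have "- int N \<le> \<gamma> $ i \<and> \<gamma> $ i \<le> int N" for i by (smt (verit) of_int_le_iff of_int_minus of_int_of_nat_eq)
    then show ?thesis by (simp add: int_box_def)
  qed
  text \<open>Sampling on the lattice shifted by \<open>s\<close>, and averaging over \<open>s\<close> with weight \<open>\<beta>\<close>.\<close>
  have pointwise: "lam * (\<Sum>\<gamma>\<in>?S. \<beta> s * (u (lattice_vec \<gamma> + s))\<^sup>2)
    \<le> (\<Sum>j\<in>UNIV. \<Sum>\<gamma>\<in>?S. \<beta> s * (u (lattice_vec \<gamma> + s + axis j 1) - u (lattice_vec \<gamma> + s))\<^sup>2)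
      + (\<Sum>\<gamma>\<in>?S. \<beta> s * (?U \<gamma> * (u (lattice_vec \<gamma> + s))\<^sup>2))" for s
  proof (cases "\<beta> s = 0")
    case False
    define v where "v \<gamma> = u (lattice_vec \<gamma> + s)" for \<gamma>
    have vS: "\<gamma> \<in> ?S" if "v \<gamma> \<noteq> 0" for \<gamma>
    proof (rule in_S)
      show "\<bar>s $ i\<bar> \<le> 4" for i using bnz[OF False, of i] by simp
    qed (use that in \<open>simp add: v_def\<close>)
    have vS': "\<gamma> \<in> ?S" if "v (\<gamma> + axis j 1) \<noteq> 0" for \<gamma> j
    proof (rule in_S)
      show "\<bar>(s + axis j 1) $ i\<bar> \<le> 4" for i using bnz[OF False, of i] by (auto simp: axis_def abs_le_iff)
    qed (use that in \<open>simp add: v_def lattice_vec_add lattice_vec_axis add_ac\<close>)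
    have fin: "finite {\<gamma>. v \<gamma> \<noteq> 0}" by (rule finite_subset[OF _ finite_int_box[of N]]) (use vS in auto)
    have sumS: "(LINT \<gamma>|count. f \<gamma>) = (\<Sum>\<gamma>\<in>?S. f \<gamma>)" if "\<And>\<gamma>. f \<gamma> \<noteq> 0 \<Longrightarrow> \<gamma> \<in> ?S" for f :: "int^'n \<Rightarrow> real"
    proof -
      have f: "finite {\<gamma>. f \<gamma> \<noteq> 0}" by (rule finite_subset[OF _ finite_int_box[of N]]) (use that in auto)
      then have "(LINT \<gamma>|count. f \<gamma>) = (\<Sum>\<gamma> | f \<gamma> \<noteq> 0. f \<gamma>)"
        using lebesgue_integral_count_space_finite_support[of UNIV f] by simp
      also have "\<dots> = (\<Sum>\<gamma>\<in>?S. f \<gamma>)" by (rule sum.mono_neutral_left) (use that finite_int_box in auto)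
      finally show ?thesis .
    qed
    have d: "(LINT \<gamma>|count. (v (\<gamma> + axis j 1) - v \<gamma>)\<^sup>2) = (\<Sum>\<gamma>\<in>?S. (v (\<gamma> + axis j 1) - v \<gamma>)\<^sup>2)" for j
      by (rule sumS) (use vS vS' in force)
    have "lam * (\<Sum>\<gamma>\<in>?S. (v \<gamma>)\<^sup>2) \<le> (\<Sum>j\<in>UNIV. \<Sum>\<gamma>\<in>?S. (v (\<gamma> + axis j 1) - v \<gamma>)\<^sup>2) + (\<Sum>\<gamma>\<in>?S. ?U \<gamma> * (v \<gamma>)\<^sup>2)"
      using lam[OF fin] sumS[of "\<lambda>\<gamma>. (v \<gamma>)\<^sup>2"] sumS[of "\<lambda>\<gamma>. ?U \<gamma> * (v \<gamma>)\<^sup>2"] vS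
      unfolding discrete_energy_def d by simp
    from mult_left_mono[OF this b0[of s]] show ?thesis
      by (simp add: v_def lattice_vec_add lattice_vec_axis add_ac sum_distrib_left distrib_left mult.left_commute)
  qed simp
  \<comment> \<open>The substitution \<open>x = lattice_vec \<gamma> + s\<close>, carried out for
    each lattice point separately.\<close>
  have tr: "(LINT s|lborel. \<beta> s * g (lattice_vec \<gamma> + s)) = (LINT x|lborel. \<beta> (x - lattice_vec \<gamma>) * g x)"
    and tri: "integrable lborel (\<lambda>s. \<beta> s * g (lattice_vec \<gamma> + s))"
    and tri': "integrable lborel (\<lambda>x. \<beta> (x - lattice_vec \<gamma>) * g x)"
    if g: "continuous_on UNIV g" for g :: "real^'n \<Rightarrow> real" and \<gamma>
  proof -
    note bc = tensor_continuous[of "\<lambda>i::'n. Bs", OF unit_kernel_Bs] and bb = tensor_bounded_support[of "\<lambda>i::'n. Bs", OF unit_kernel_Bs]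
    note bt = tensor_translate[of "\<lambda>i::'n. Bs", OF unit_kernel_Bs]
    have c: "continuous_on UNIV (\<lambda>s. \<beta> s * g (lattice_vec \<gamma> + s))"
      by (intro continuous_on_mult bc continuous_on_compose2[OF g]) (auto intro: continuous_intros)
    show "integrable lborel (\<lambda>s. \<beta> s * g (lattice_vec \<gamma> + s))"
      by (rule integrable_bounded_support[OF c bounded_subset[OF bb]]) auto
    show "integrable lborel (\<lambda>x. \<beta> (x - lattice_vec \<gamma>) * g x)"
      by (rule integrable_bounded_support[OF continuous_on_mult[OF bt(4) g] bounded_subset[OF bt(3)]]) auto
    show "(LINT s|lborel. \<beta> s * g (lattice_vec \<gamma> + s)) = (LINT x|lborel. \<beta> (x - lattice_vec \<gamma>) * g x)"
      using lborel_integral_translate[OF borel_measurable_continuous_onI[OF c], of "- lattice_vec \<gamma>"] by simp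
  qed
  have uc': "continuous_on UNIV (\<lambda>x. u (x + axis j 1))" for j
    by (rule continuous_on_compose2[OF uc]) (auto intro: continuous_intros)
  have g1: "continuous_on UNIV (\<lambda>x. (u x)\<^sup>2)" and g2: "continuous_on UNIV (\<lambda>x. (u (x + axis j 1) - u x)\<^sup>2)"
    and g3: "continuous_on UNIV (\<lambda>x. c * (u x)\<^sup>2)" for j c
    by (intro continuous_intros uc uc')+
  have tb: "bounded {x. u (x + axis j 1) \<noteq> 0}" for j
    using bounded_support_affine[OF u2(2), of 1 "axis j 1"] by (simp add: add.commute)
  have g2i: "integrable lborel (\<lambda>x. (u (x + axis j 1) - u x)\<^sup>2)" for j
    by (rule integrable_bounded_support[OF g2 bounded_subset[OF bounded_Un[THEN iffD2, OF conjI[OF tb[of j] u2(2)]]]]) auto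
  have "(LINT s|lborel. lam * (\<Sum>\<gamma>\<in>?S. \<beta> s * (u (lattice_vec \<gamma> + s))\<^sup>2)) \<le>
    (LINT s|lborel. (\<Sum>j\<in>UNIV. \<Sum>\<gamma>\<in>?S. \<beta> s * (u (lattice_vec \<gamma> + s + axis j 1) - u (lattice_vec \<gamma> + s))\<^sup>2)
      + (\<Sum>\<gamma>\<in>?S. \<beta> s * (?U \<gamma> * (u (lattice_vec \<gamma> + s))\<^sup>2)))"
    using tri[OF g1] tri[OF g2] tri[OF g3]
    by (intro integral_mono pointwise integrable_mult_right Bochner_Integration.integrable_add Bochner_Integration.integrable_sum)
  also have "(LINT s|lborel. lam * (\<Sum>\<gamma>\<in>?S. \<beta> s * (u (lattice_vec \<gamma> + s))\<^sup>2)) = lam * (LINT x|lborel. (\<Sum>\<gamma>\<in>?S. \<beta> (x - lattice_vec \<gamma>) * (u x)\<^sup>2))"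
    using tri[OF g1] tri'[OF g1] tr[OF g1] by (simp add: Bochner_Integration.integral_sum)
  also have "(LINT x|lborel. (\<Sum>\<gamma>\<in>?S. \<beta> (x - lattice_vec \<gamma>) * (u x)\<^sup>2)) = (LINT x|lborel. (u x)\<^sup>2)"
  proof (rule Bochner_Integration.integral_cong[OF refl])
    fix x
    show "(\<Sum>\<gamma>\<in>?S. \<beta> (x - lattice_vec \<gamma>) * (u x)\<^sup>2) = (u x)\<^sup>2"
    proof (cases "u x = 0")
      case False
      have "(\<Sum>\<gamma>\<in>?S. \<beta> (x - lattice_vec \<gamma>)) = 1"
        by (intro tensor_sum_eq_1 unit_kernel_Bs unz3[OF False])
      then show ?thesis by (simp add: sum_distrib_right[symmetric])
    qed simp
  qed
  also have "(LINT s|lborel. (\<Sum>j\<in>UNIV. \<Sum>\<gamma>\<in>?S. \<beta> s * (u (lattice_vec \<gamma> + s + axis j 1) - u (lattice_vec \<gamma> + s))\<^sup>2)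
      + (\<Sum>\<gamma>\<in>?S. \<beta> s * (?U \<gamma> * (u (lattice_vec \<gamma> + s))\<^sup>2)))
    = (\<Sum>j\<in>UNIV. (LINT x|lborel. (\<Sum>\<gamma>\<in>?S. \<beta> (x - lattice_vec \<gamma>) * (u (x + axis j 1) - u x)\<^sup>2)))
      + (LINT x|lborel. (\<Sum>\<gamma>\<in>?S. \<beta> (x - lattice_vec \<gamma>) * (?U \<gamma> * (u x)\<^sup>2)))"
    using tri[OF g2] tri'[OF g2] tri[OF g3] tri'[OF g3] tr[OF g2] tr[OF g3]
    by (simp add: Bochner_Integration.integral_sum Bochner_Integration.integrable_sum)
  also have "(\<Sum>j\<in>UNIV. (LINT x|lborel. (\<Sum>\<gamma>\<in>?S. \<beta> (x - lattice_vec \<gamma>) * (u (x + axis j 1) - u x)\<^sup>2)))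
    \<le> (\<Sum>j\<in>UNIV. LINT x|lborel. (pd j u x)\<^sup>2)"
  proof (rule sum_mono)
    fix j
    have "(LINT x|lborel. (\<Sum>\<gamma>\<in>?S. \<beta> (x - lattice_vec \<gamma>) * (u (x + axis j 1) - u x)\<^sup>2)) \<le> (LINT x|lborel. (u (x + axis j 1) - u x)\<^sup>2)"
    proof (intro integral_mono g2i Bochner_Integration.integrable_sum tri' g2)
      fix x
      show "(\<Sum>\<gamma>\<in>?S. \<beta> (x - lattice_vec \<gamma>) * (u (x + axis j 1) - u x)\<^sup>2) \<le> (u (x + axis j 1) - u x)\<^sup>2"
        unfolding sum_distrib_right[symmetric]
        using mult_right_mono[OF tensor_sum_le_1[of "\<lambda>i. Bs", OF unit_kernel_Bs finite_int_box], of "(u (x + axis j 1) - u x)\<^sup>2"] by simp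
    qed
    also have "\<dots> \<le> (LINT x|lborel. (pd j u x)\<^sup>2)" by (rule translate_diff_le_pd[OF u1 u2(2)])
    finally show "(LINT x|lborel. (\<Sum>\<gamma>\<in>?S. \<beta> (x - lattice_vec \<gamma>) * (u (x + axis j 1) - u x)\<^sup>2)) \<le> (LINT x|lborel. (pd j u x)\<^sup>2)" .
  qed
  also have "(LINT x|lborel. (\<Sum>\<gamma>\<in>?S. \<beta> (x - lattice_vec \<gamma>) * (?U \<gamma> * (u x)\<^sup>2)))
    \<le> (LINT x|lborel. ?W x * (u x)\<^sup>2 + h\<^sup>2 / 6 * (\<Sum>i\<in>UNIV. pd i (pd i V) (h *\<^sub>R x) * (u x)\<^sup>2) + C * h^3 * (u x)\<^sup>2)"
  proof (intro integral_mono Bochner_Integration.integrable_sum tri' g3)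
    have "continuous_on UNIV (\<lambda>x. pd i (pd i V) (h *\<^sub>R x))" for i
      by (rule continuous_on_compose2[OF C_k_continuous[OF C_k_pd[OF C_k_pd[OF V3]]]]) (auto intro: continuous_intros)
    from C2c_integrable(2)[OF u this] C2c_integrable(2)[OF u scaled_cont[of h]] C2c_integrable(2)[OF u, of "\<lambda>x. 1"]
    show "integrable lborel (\<lambda>x. ?W x * (u x)\<^sup>2 + h\<^sup>2 / 6 * (\<Sum>i\<in>UNIV. pd i (pd i V) (h *\<^sub>R x) * (u x)\<^sup>2) + C * h^3 * (u x)\<^sup>2)"
      by auto
    fix x
    show "(\<Sum>\<gamma>\<in>?S. \<beta> (x - lattice_vec \<gamma>) * (?U \<gamma> * (u x)\<^sup>2)) \<le> ?W x * (u x)\<^sup>2 + h\<^sup>2 / 6 * (\<Sum>i\<in>UNIV. pd i (pd i V) (h *\<^sub>R x) * (u x)\<^sup>2) + C * h^3 * (u x)\<^sup>2"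
    proof (cases "u x = 0")
      case False
      have "(\<Sum>\<gamma>\<in>?S. \<beta> (x - lattice_vec \<gamma>) * ?U \<gamma>) \<le> ?W x + h\<^sup>2 / 6 * (\<Sum>i\<in>UNIV. pd i (pd i V) (h *\<^sub>R x)) + C * h^3"
        unfolding C_def by (intro quasi_interpolant_bound unz3[OF False] h)
      from mult_right_mono[OF this, of "(u x)\<^sup>2"] show ?thesis
        by (simp add: sum_distrib_right distrib_right mult.assoc)
    qed simp
  qed
  also have "\<dots> = (LINT x|lborel. ?W x * (u x)\<^sup>2) + h\<^sup>2 / 6 * (\<Sum>i\<in>UNIV. LINT x|lborel. pd i (pd i V) (h *\<^sub>R x) * (u x)\<^sup>2) + C * h^3 * (LINT x|lborel. (u x)\<^sup>2)"
  proof -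
    have "continuous_on UNIV (\<lambda>x. pd i (pd i V) (h *\<^sub>R x))" for i
      by (rule continuous_on_compose2[OF C_k_continuous[OF C_k_pd[OF C_k_pd[OF V3]]]]) (auto intro: continuous_intros)
    from C2c_integrable(2)[OF u this] C2c_integrable(2)[OF u scaled_cont[of h]] C2c_integrable(2)[OF u, of "\<lambda>x. 1"]
    show ?thesis by simp
  qed
  \<comment> \<open>\<open>second_order_term\<close> summed over the coordinates; kinetic and
    potential parts are both bounded by the full energy, and the factor 1/6 is given away.\<close>
  also have "h\<^sup>2 / 6 * (\<Sum>i\<in>UNIV. LINT x|lborel. pd i (pd i V) (h *\<^sub>R x) * (u x)\<^sup>2) \<le> (4 * K * real CARD('n) + 1) * h * energy ?W u"
  proof -
    define P where "P = (LINT x|lborel. ?W x * (u x)\<^sup>2)"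
    define D where "D = (\<Sum>i\<in>UNIV. LINT x|lborel. (pd i u x)\<^sup>2)"
    have P0: "P \<ge> 0" unfolding P_def using V_nonneg by (intro integral_nonneg_AE) auto
    have D0: "D \<ge> 0" unfolding D_def by (intro sum_nonneg integral_nonneg_AE) auto
    have "h\<^sup>2 * (\<Sum>i\<in>UNIV. LINT x|lborel. pd i (pd i V) (h *\<^sub>R x) * (u x)\<^sup>2) \<le> (\<Sum>i\<in>UNIV. h * (4 * K * P + (LINT x|lborel. (pd i u x)\<^sup>2)))"
      unfolding sum_distrib_left
    proof (rule sum_mono)
      fix i
      have "h\<^sup>2 * (LINT x|lborel. pd i (pd i V) (h *\<^sub>R x) * (u x)\<^sup>2) \<le> h\<^sup>2 * \<bar>LINT x|lborel. pd i (pd i V) (h *\<^sub>R x) * (u x)\<^sup>2\<bar>"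
        by (intro mult_left_mono) auto
      also have "\<dots> \<le> h * (4 * K * P + (LINT x|lborel. (pd i u x)\<^sup>2))"
        unfolding P_def by (rule second_order_term[OF u h])
      finally show "h\<^sup>2 * (LINT x|lborel. pd i (pd i V) (h *\<^sub>R x) * (u x)\<^sup>2) \<le> h * (4 * K * P + (LINT x|lborel. (pd i u x)\<^sup>2))" .
    qed
    also have "\<dots> = h * (4 * K * real CARD('n) * P + D)"
      by (simp add: D_def sum.distrib sum_distrib_left[symmetric] algebra_simps)
    also have "\<dots> \<le> h * ((4 * K * real CARD('n) + 1) * (D + P))"
    proof (rule mult_left_mono)
      have "0 \<le> 4 * K * real CARD('n) * D" using K0 D0 by simp
      then show "4 * K * real CARD('n) * P + D \<le> (4 * K * real CARD('n) + 1) * (D + P)"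
        using P0 by (simp add: algebra_simps)
    qed (use h in simp)
    finally have "h\<^sup>2 * (\<Sum>i\<in>UNIV. LINT x|lborel. pd i (pd i V) (h *\<^sub>R x) * (u x)\<^sup>2) \<le> (4 * K * real CARD('n) + 1) * h * energy ?W u"
      by (simp add: energy_def P_def D_def mult_ac)
    moreover have "0 \<le> (4 * K * real CARD('n) + 1) * h * energy ?W u"
      using K0 h P0 D0 by (simp add: energy_def P_def[symmetric] D_def[symmetric])
    ultimately show ?thesis by simp
  qed
  finally have "lam * (LINT x|lborel. (u x)\<^sup>2) \<le> (\<Sum>j\<in>UNIV. LINT x|lborel. (pd j u x)\<^sup>2) + ((LINT x|lborel. ?W x * (u x)\<^sup>2)
    + (4 * K * real CARD('n) + 1) * h * energy ?W u + C * h^3 * (LINT x|lborel. (u x)\<^sup>2))" by simp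
  then show ?thesis by (simp add: energy_def C_def distrib_right)
qed

end

section \<open>The continuous bottom is at most the discrete one\<close>

definition dir_energy :: "(int^'n \<Rightarrow> real) \<Rightarrow> real" where
  "dir_energy v = (\<Sum>j\<in>UNIV. LINT \<gamma>|count. (v (\<gamma> + axis j 1) - v \<gamma>)\<^sup>2)"

lemma discrete_energy_eq: "discrete_energy U v = dir_energy v + (LINT \<gamma>|count. U \<gamma> * (v \<gamma>)\<^sup>2)"
  by (simp add: discrete_energy_def dir_energy_def)

lemma finite_support_shift:
  assumes "finite {\<gamma>::int^'n. v \<gamma> \<noteq> 0}"
  shows "finite {\<gamma>. v (\<gamma> + a) \<noteq> 0}"
proof -
  have "{\<gamma>. v (\<gamma> + a) \<noteq> 0} \<subseteq> (\<lambda>\<gamma>. \<gamma> - a) ` {\<gamma>. v \<gamma> \<noteq> 0}" by (auto intro!: image_eqI[of _ _ "_ + a"])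
  then show ?thesis using assms finite_surj by blast
qed

lemma integrable_diff_square:
  fixes v :: "int^'n \<Rightarrow> real"
  assumes "finite {\<gamma>. v \<gamma> \<noteq> 0}"
  shows "integrable count (\<lambda>\<gamma>. (v (\<gamma> + a) - v (\<gamma> + b))\<^sup>2)"
  by (rule integrable_finite_support, rule finite_subset[of _ "{\<gamma>. v (\<gamma> + a) \<noteq> 0} \<union> {\<gamma>. v (\<gamma> + b) \<noteq> 0}"])
    (use finite_support_shift[OF assms] in auto)

text \<open>The shifts with such a bound include the signed unit vectors and are closed under
  addition, hence are all lattice vectors. The constant depends on \<open>\<kappa>\<close>, which is
  harmless because only finitely many shifts are used later.\<close>

lemma shift_difference_bound:
  fixes \<kappa> :: "int^'n"
  shows "\<exists>C\<ge>0. \<forall>v. finite {\<gamma>. v \<gamma> \<noteq> 0} \<longrightarrow> (LINT \<gamma>|count. (v (\<gamma> + \<kappa>) - v \<gamma>)\<^sup>2) \<le> C * dir_energy v" (is "?P \<kappa>")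
proof -
  have P0: "?P 0" by (intro exI[of _ 0]) simp
  have Padd: "?P (\<kappa> + \<kappa>')" if k: "?P \<kappa>" and k': "?P \<kappa>'" for \<kappa> \<kappa>'
  proof -
    obtain C C' where C: "C \<ge> 0" "\<And>v. finite {\<gamma>. v \<gamma> \<noteq> 0} \<Longrightarrow> (LINT \<gamma>|count. (v (\<gamma> + \<kappa>) - v \<gamma>)\<^sup>2) \<le> C * dir_energy v"
      and C': "C' \<ge> 0" "\<And>v. finite {\<gamma>. v \<gamma> \<noteq> 0} \<Longrightarrow> (LINT \<gamma>|count. (v (\<gamma> + \<kappa>') - v \<gamma>)\<^sup>2) \<le> C' * dir_energy v"
      using k k' by blast
    have "(LINT \<gamma>|count. (v (\<gamma> + (\<kappa> + \<kappa>')) - v \<gamma>)\<^sup>2) \<le> (2 * C + 2 * C') * dir_energy v" if fin: "finite {\<gamma>. v \<gamma> \<noteq> 0}" for v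
    proof -
      have "(LINT \<gamma>|count. (v (\<gamma> + (\<kappa> + \<kappa>')) - v \<gamma>)\<^sup>2) \<le> (LINT \<gamma>|count. 2 * (v (\<gamma> + (\<kappa> + \<kappa>')) - v (\<gamma> + \<kappa>'))\<^sup>2 + 2 * (v (\<gamma> + \<kappa>') - v (\<gamma> + 0))\<^sup>2)"
      proof (rule integral_mono)
        show "integrable count (\<lambda>\<gamma>. (v (\<gamma> + (\<kappa> + \<kappa>')) - v \<gamma>)\<^sup>2)" using integrable_diff_square[OF fin, of _ 0] by simp
        show "integrable count (\<lambda>\<gamma>. 2 * (v (\<gamma> + (\<kappa> + \<kappa>')) - v (\<gamma> + \<kappa>'))\<^sup>2 + 2 * (v (\<gamma> + \<kappa>') - v (\<gamma> + 0))\<^sup>2)"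
          by (intro Bochner_Integration.integrable_add integrable_mult_right integrable_diff_square fin)
        show "(v (\<gamma> + (\<kappa> + \<kappa>')) - v \<gamma>)\<^sup>2 \<le> 2 * (v (\<gamma> + (\<kappa> + \<kappa>')) - v (\<gamma> + \<kappa>'))\<^sup>2 + 2 * (v (\<gamma> + \<kappa>') - v (\<gamma> + 0))\<^sup>2" for \<gamma>
          using norm_add_square_le[of "v (\<gamma> + (\<kappa> + \<kappa>')) - v (\<gamma> + \<kappa>')" "v (\<gamma> + \<kappa>') - v \<gamma>"] by simp
      qed
      also have "\<dots> = 2 * (LINT \<gamma>|count. (v (\<gamma> + (\<kappa> + \<kappa>')) - v (\<gamma> + \<kappa>'))\<^sup>2) + 2 * (LINT \<gamma>|count. (v (\<gamma> + \<kappa>') - v \<gamma>)\<^sup>2)"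
        using integrable_diff_square[OF fin, of "\<kappa> + \<kappa>'" \<kappa>'] integrable_diff_square[OF fin, of \<kappa>' 0] by simp
      also have "(LINT \<gamma>|count. (v (\<gamma> + (\<kappa> + \<kappa>')) - v (\<gamma> + \<kappa>'))\<^sup>2) = (LINT \<gamma>|count. (v (\<gamma> + \<kappa>) - v \<gamma>)\<^sup>2)"
        using integral_count_shift(1)[of "\<lambda>\<gamma>. (v (\<gamma> + \<kappa>) - v \<gamma>)\<^sup>2" \<kappa>'] by (simp add: add_ac)
      finally show ?thesis using C(2)[OF fin] C'(2)[OF fin] by (simp add: algebra_simps)
    qed
    with C(1) C'(1) show ?thesis by (intro exI[of _ "2 * C + 2 * C'"]) auto
  qed
  have D1: "(LINT \<gamma>|count. (v (\<gamma> + axis j 1) - v \<gamma>)\<^sup>2) \<le> 1 * dir_energy v" for j and v :: "int^'n \<Rightarrow> real"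
    unfolding dir_energy_def mult_1
    by (rule member_le_sum[of j UNIV "\<lambda>j. LINT \<gamma>|count. (v (\<gamma> + axis j 1) - v \<gamma>)\<^sup>2"]) auto
  have P1: "?P (axis j 1)" for j using D1 by (intro exI[of _ 1]) auto
  have P1': "?P (axis j (- 1))" for j
  proof (intro exI[of _ 1] conjI allI impI)
    fix v :: "int^'n \<Rightarrow> real"
    have "- axis j (1::int) = axis j (- 1)" by (simp add: vec_eq_iff axis_def)
    then have "(LINT \<gamma>|count. (v (\<gamma> + axis j (- 1)) - v \<gamma>)\<^sup>2) = (LINT \<gamma>|count. (v (\<gamma> + axis j 1) - v \<gamma>)\<^sup>2)"
      using integral_count_shift(1)[of "\<lambda>\<gamma>. (v (\<gamma> + axis j 1) - v \<gamma>)\<^sup>2" "axis j (- 1)"]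
      by (simp add: add.assoc power2_commute flip: \<open>- axis j (1::int) = axis j (- 1)\<close>)
    then show "(LINT \<gamma>|count. (v (\<gamma> + axis j (- 1)) - v \<gamma>)\<^sup>2) \<le> 1 * dir_energy v" using D1 by simp
  qed simp
  have ax: "axis j (a + b) = axis j a + axis j b" for j and a b :: int by (simp add: vec_eq_iff axis_def)
  have Pk: "?P (axis j k)" for j k
  proof (induction k rule: int_induct[where k = 0])
    case base
    have "axis j 0 = (0 :: int^'n)" by (simp add: vec_eq_iff axis_def)
    show ?case unfolding \<open>axis j 0 = (0 :: int^'n)\<close> by (rule P0)
  next
    case (step1 i)
    from Padd[OF step1(2) P1] show ?case by (simp only: ax)
  next
    case (step2 i)
    have "axis j (i - 1) = axis j i + axis j (- 1)" using ax[of j i "- 1"] by simp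
    then show ?case using Padd[OF step2(2) P1'] by simp
  qed
  have PJ: "?P (\<Sum>j\<in>J. axis j (\<kappa> $ j))" for J
    by (induction J rule: infinite_finite_induct) (use P0 Padd[OF Pk] in simp_all)
  have "(\<Sum>j\<in>UNIV. axis j (\<kappa> $ j)) = \<kappa>"
    by (simp add: vec_eq_iff axis_def)
  then show ?thesis using PJ[of UNIV] by (simp only:)
qed

text \<open>Jensen's inequality for weights of total mass at most one.\<close>

lemma weighted_square_le:
  fixes w \<kappa> :: "'a \<Rightarrow> real"
  assumes "\<And>x. x \<in> T \<Longrightarrow> 0 \<le> \<kappa> x" "(\<Sum>x\<in>T. \<kappa> x) \<le> 1"
  shows "(\<Sum>x\<in>T. w x * \<kappa> x)\<^sup>2 \<le> (\<Sum>x\<in>T. (w x)\<^sup>2 * \<kappa> x)"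
proof -
  have "(\<Sum>x\<in>T. w x * \<kappa> x)\<^sup>2 = (\<Sum>x\<in>T. (w x * sqrt (\<kappa> x)) * sqrt (\<kappa> x))\<^sup>2"
    using assms(1) by (intro arg_cong[where f = "\<lambda>t. t\<^sup>2"] sum.cong) (auto simp: mult.assoc)
  also have "\<dots> \<le> (\<Sum>x\<in>T. (w x * sqrt (\<kappa> x))\<^sup>2) * (\<Sum>x\<in>T. (sqrt (\<kappa> x))\<^sup>2)"
    by (rule Cauchy_Schwarz_ineq_sum)
  also have "\<dots> = (\<Sum>x\<in>T. (w x)\<^sup>2 * \<kappa> x) * (\<Sum>x\<in>T. \<kappa> x)"
    using assms(1) by (intro arg_cong2[where f = "(*)"] sum.cong) (auto simp: power_mult_distrib)
  also have "\<dots> \<le> (\<Sum>x\<in>T. (w x)\<^sup>2 * \<kappa> x) * 1"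
    using assms by (intro mult_left_mono sum_nonneg) auto
  finally show ?thesis by simp
qed

lemma sum_support_subset:
  fixes w :: "'a \<Rightarrow> real"
  shows "{x. (\<Sum>\<gamma>\<in>T. w \<gamma> * f \<gamma> x) \<noteq> 0} \<subseteq> (\<Union>\<gamma>\<in>T. {x. f \<gamma> x \<noteq> 0})"
proof
  fix x assume "x \<in> {x. (\<Sum>\<gamma>\<in>T. w \<gamma> * f \<gamma> x) \<noteq> 0}"
  then obtain \<gamma> where "\<gamma> \<in> T" "w \<gamma> * f \<gamma> x \<noteq> 0" by (auto elim: sum.not_neutral_contains_not_neutral)
  then show "x \<in> (\<Union>\<gamma>\<in>T. {x. f \<gamma> x \<noteq> 0})" by auto
qed

text \<open>Jensen at each point, then integration, where every kernel has mass 1. No constant is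
  lost.\<close>

lemma interpolation_square_integral:
  fixes f :: "'n::finite \<Rightarrow> real \<Rightarrow> real" and w :: "int^'n \<Rightarrow> real"
  assumes f: "\<And>i. unit_kernel (f i)" and T: "finite T"
  shows "(LINT x|lborel. (\<Sum>\<gamma>\<in>T. w \<gamma> * tensor f (x - lattice_vec \<gamma>))\<^sup>2) \<le> (\<Sum>\<gamma>\<in>T. (w \<gamma>)\<^sup>2)"
proof -
  note tt = tensor_translate[of f, OF f]
  have "(LINT x|lborel. (\<Sum>\<gamma>\<in>T. w \<gamma> * tensor f (x - lattice_vec \<gamma>))\<^sup>2) \<le> (LINT x|lborel. (\<Sum>\<gamma>\<in>T. (w \<gamma>)\<^sup>2 * tensor f (x - lattice_vec \<gamma>)))"
  proof (rule integral_mono)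
    have "bounded {x. (\<Sum>\<gamma>\<in>T. w \<gamma> * tensor f (x - lattice_vec \<gamma>))\<^sup>2 \<noteq> 0}"
    proof (rule bounded_subset)
      show "bounded (\<Union>\<gamma>\<in>T. {x. tensor f (x - lattice_vec \<gamma>) \<noteq> 0})" using T tt(3) by (intro bounded_UN) auto
      show "{x. (\<Sum>\<gamma>\<in>T. w \<gamma> * tensor f (x - lattice_vec \<gamma>))\<^sup>2 \<noteq> 0} \<subseteq> (\<Union>\<gamma>\<in>T. {x. tensor f (x - lattice_vec \<gamma>) \<noteq> 0})"
        using sum_support_subset[where T = T and w = w and f = "\<lambda>\<gamma> x. tensor f (x - lattice_vec \<gamma>)"] by simp
    qed
    then show "integrable lborel (\<lambda>x. (\<Sum>\<gamma>\<in>T. w \<gamma> * tensor f (x - lattice_vec \<gamma>))\<^sup>2)"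
      by (intro integrable_bounded_support continuous_intros tt(4))
    show "integrable lborel (\<lambda>x. \<Sum>\<gamma>\<in>T. (w \<gamma>)\<^sup>2 * tensor f (x - lattice_vec \<gamma>))"
      by (intro Bochner_Integration.integrable_sum integrable_mult_right tt(1))
    show "(\<Sum>\<gamma>\<in>T. w \<gamma> * tensor f (x - lattice_vec \<gamma>))\<^sup>2 \<le> (\<Sum>\<gamma>\<in>T. (w \<gamma>)\<^sup>2 * tensor f (x - lattice_vec \<gamma>))" for x
      using tensor_sum_le_1[of f, OF f T] tensor_nonneg[of f, OF f] by (intro weighted_square_le) auto
  qed
  also have "\<dots> = (\<Sum>\<gamma>\<in>T. (w \<gamma>)\<^sup>2)" using tt(1,2) by (simp add: Bochner_Integration.integral_sum)
  finally show ?thesis .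
qed

section \<open>Spline functions with given lattice coefficients\<close>

lemma pd_prod_other:
  fixes f :: "'n::finite \<Rightarrow> real \<Rightarrow> real"
  assumes "k \<notin> J" "\<And>i. i \<in> J \<Longrightarrow> C_k (Suc 0) (\<lambda>x::real^'n. f i (x $ i))"
    and "\<And>i t. i \<in> J \<Longrightarrow> \<exists>D. (f i has_real_derivative D) (at t)"
  shows "pd k (\<lambda>x::real^'n. \<Prod>i\<in>J. f i (x $ i)) x = 0"
  using assms
proof (induction J arbitrary: x rule: infinite_finite_induct)
  case (insert i J)
  obtain D where "(f i has_real_derivative D) (at (x $ i))" using insert.prems(3)[of i] by blast
  from pd_coord[OF this, of k] have "pd k (\<lambda>x. f i (x $ i)) x = 0" using insert.prems(1) by auto
  moreover have "pd k (\<lambda>x::real^'n. \<Prod>i\<in>J. f i (x $ i)) x = 0" using insert by auto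
  moreover have "C_k (Suc 0) (\<lambda>x::real^'n. \<Prod>i\<in>J. f i (x $ i))" using insert.prems by (intro C_k_prod) auto
  ultimately show ?case
    using insert.hyps pd_mult[of "\<lambda>x. f i (x $ i)" "\<lambda>x. \<Prod>i\<in>J. f i (x $ i)" k x] insert.prems(2)[of i] by simp
qed (simp_all add: pd_zero)

lemma C2_\<beta>: "C_k (Suc (Suc 0)) (\<beta> :: real^'n \<Rightarrow> real)"
  unfolding tensor_def[abs_def] by (intro C_k_prod C2_Bs)

definition \<beta>' :: "'n::finite \<Rightarrow> real^'n \<Rightarrow> real" where
  "\<beta>' j = tensor (\<lambda>i. if i = j then bq else Bs)"

text \<open>Only the \<open>j\<close>-th factor is differentiated, and \<open>Bs\<close> has
  derivative \<open>bq t - bq (t - 1)\<close>. The integer distance allows the difference to be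
  moved onto lattice coefficients.\<close>

lemma pd_\<beta>: "pd j \<beta> x = \<beta>' j x - \<beta>' j (x - axis j 1)"
proof -
  let ?P = "\<lambda>x. \<Prod>i\<in>UNIV - {j}. Bs (x $ i)"
  have C1: "C_k (Suc 0) (\<lambda>x. Bs (x $ i))" for i by (rule C_k_SucD[OF C2_Bs])
  have split: "tensor f = (\<lambda>x. f j (x $ j) * (\<Prod>i\<in>UNIV - {j}. f i (x $ i)))" for f
    unfolding tensor_def by (intro ext prod.remove) auto
  have "pd j \<beta> x = Bs (x $ j) * pd j ?P x + pd j (\<lambda>x. Bs (x $ j)) x * ?P x"
    unfolding split[of "\<lambda>i. Bs"] by (intro pd_mult C1 C_k_prod)
  also have "pd j ?P x = 0"
    by (rule pd_prod_other) (use C1 Bs_deriv in auto)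
  also have "pd j (\<lambda>x. Bs (x $ j)) x = bq (x $ j) - bq (x $ j - 1)"
    using pd_coord[OF Bs_deriv, where j = j] by simp
  finally have "pd j \<beta> x = bq (x $ j) * ?P x - bq (x $ j - 1) * ?P x" by (simp add: left_diff_distrib)
  moreover have B: "\<beta>' j y = bq (y $ j) * ?P y" for y :: "real^'a"
    unfolding \<beta>'_def split by (intro arg_cong2[where f = "(*)"] prod.cong) auto
  moreover have "?P (x - axis j 1) = ?P x" by (intro prod.cong) (auto simp: axis_def)
  moreover have "(x - axis j 1) $ j = x $ j - 1" by (simp add: axis_def)
  ultimately show ?thesis by (simp only: B)
qed

lemma unit_kernel_\<beta>': "unit_kernel (if i = j then bq else Bs)"
  by (simp add: unit_kernel_Bs unit_kernel_bq)

text \<open>Interpolation in a loose sense: \<open>interp v\<close> is a local average of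
  \<open>v\<close> and need not equal \<open>v\<close> at lattice points. Summing over the support
  makes it a finite sum for the functions considered.\<close>

definition interp :: "(int^'n \<Rightarrow> real) \<Rightarrow> real^'n \<Rightarrow> real" where
  "interp v x = (\<Sum>\<gamma> | v \<gamma> \<noteq> 0. v \<gamma> * \<beta> (x - lattice_vec \<gamma>))"

lemma C2_\<beta>_translate: "C_k (Suc (Suc 0)) (\<lambda>x. \<beta> (x - a))"
  using C_k_affine[OF C2_\<beta>, of "- a" 1] by simp

lemma pd_\<beta>_translate: "pd j (\<lambda>x. \<beta> (x - a)) x = pd j \<beta> (x - a)"
  using pd_affine[OF C_k_SucD[OF C2_\<beta>], of j "- a" 1 x] by simp

lemma interp_C2c:
  assumes "finite {\<gamma>. v \<gamma> \<noteq> 0}"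
  shows "interp v \<in> C2c"
proof -
  have "C_k (Suc (Suc 0)) (interp v)"
    unfolding interp_def[abs_def] by (intro C_k_sum C_k_mult C_k_const C2_\<beta>_translate)
  moreover have "bounded {x. interp v x \<noteq> 0}"
  proof (rule bounded_subset)
    show "bounded (\<Union>\<gamma>\<in>{\<gamma>. v \<gamma> \<noteq> 0}. {x. \<beta> (x - lattice_vec \<gamma>) \<noteq> 0})"
      using assms tensor_translate(3)[of "\<lambda>i. Bs", OF unit_kernel_Bs] by (intro bounded_UN) auto
    show "{x. interp v x \<noteq> 0} \<subseteq> (\<Union>\<gamma>\<in>{\<gamma>. v \<gamma> \<noteq> 0}. {x. \<beta> (x - lattice_vec \<gamma>) \<noteq> 0})"
      unfolding interp_def by (rule sum_support_subset)
  qed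
  ultimately show ?thesis by (simp add: C2c_def)
qed

text \<open>Summation by parts moves the difference from \<open>\<beta>' j\<close> to the
  coefficients, so the derivative is the spline function with kernel \<open>\<beta>' j\<close> and
  coefficients \<open>v \<gamma> - v (\<gamma> - axis j 1)\<close>; Jensen then gives the constant
  1.\<close>

lemma interp_kinetic:
  assumes fin: "finite {\<gamma>. v \<gamma> \<noteq> 0}"
  shows "(LINT x|lborel. (pd j (interp v) x)\<^sup>2) \<le> (LINT \<gamma>|count. (v (\<gamma> + axis j 1) - v \<gamma>)\<^sup>2)"
proof -
  let ?S = "{\<gamma>. v \<gamma> \<noteq> 0}" and ?e = "axis j 1 :: int^'a"
  \<comment> \<open>Contains every lattice point where \<open>v\<close> or its shift by
    \<open>?e\<close> is nonzero, so both sums can be taken over the same set.\<close>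
  define T where "T = ?S \<union> (\<lambda>\<gamma>. \<gamma> + ?e) ` ?S"
  have T: "finite T" using fin by (simp add: T_def)
  have S'_iff: "\<gamma> \<in> (\<lambda>\<gamma>. \<gamma> + ?e) ` ?S \<longleftrightarrow> v (\<gamma> - ?e) \<noteq> 0" for \<gamma>
    by (metis (mono_tags, lifting) add_diff_cancel diff_add_cancel image_iff mem_Collect_eq)
  then have T_iff: "\<gamma> \<in> T \<longleftrightarrow> v \<gamma> \<noteq> 0 \<or> v (\<gamma> - ?e) \<noteq> 0" for \<gamma>
    by (simp add: T_def)
  have "pd j (interp v) x = (\<Sum>\<gamma>\<in>T. (v \<gamma> - v (\<gamma> - ?e)) * \<beta>' j (x - lattice_vec \<gamma>))" for x
  proof -
    have "pd j (interp v) x = (\<Sum>\<gamma>\<in>?S. pd j (\<lambda>x. v \<gamma> * \<beta> (x - lattice_vec \<gamma>)) x)"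
      unfolding interp_def[abs_def] by (intro pd_sum C_k_mult C_k_const C_k_SucD[OF C2_\<beta>_translate])
    also have "\<dots> = (\<Sum>\<gamma>\<in>?S. v \<gamma> * \<beta>' j (x - lattice_vec \<gamma>)) - (\<Sum>\<gamma>\<in>?S. v \<gamma> * \<beta>' j (x - lattice_vec (\<gamma> + ?e)))"
    proof -
      have "pd j (\<lambda>x. v \<gamma> * \<beta> (x - lattice_vec \<gamma>)) x = v \<gamma> * \<beta>' j (x - lattice_vec \<gamma>) - v \<gamma> * \<beta>' j (x - lattice_vec (\<gamma> + ?e))" for \<gamma>
        using pd_mult[OF C_k_const C_k_SucD[OF C2_\<beta>_translate], of j "v \<gamma>" "lattice_vec \<gamma>" x]
        by (simp add: pd_zero pd_\<beta>_translate pd_\<beta> lattice_vec_add lattice_vec_axis right_diff_distrib diff_diff_eq)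
      then show ?thesis by (simp add: sum_subtractf)
    qed
    also have "(\<Sum>\<gamma>\<in>?S. v \<gamma> * \<beta>' j (x - lattice_vec \<gamma>)) = (\<Sum>\<gamma>\<in>T. v \<gamma> * \<beta>' j (x - lattice_vec \<gamma>))"
      by (rule sum.mono_neutral_left[OF T]) (auto simp: T_iff)
    also have "(\<Sum>\<gamma>\<in>?S. v \<gamma> * \<beta>' j (x - lattice_vec (\<gamma> + ?e))) = (\<Sum>\<gamma>\<in>(\<lambda>\<gamma>. \<gamma> + ?e) ` ?S. v (\<gamma> - ?e) * \<beta>' j (x - lattice_vec \<gamma>))"
      by (subst sum.reindex) (auto simp: inj_on_def)
    also have "\<dots> = (\<Sum>\<gamma>\<in>T. v (\<gamma> - ?e) * \<beta>' j (x - lattice_vec \<gamma>))"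
      by (rule sum.mono_neutral_left[OF T]) (simp_all add: T_def S'_iff)
    finally show ?thesis by (simp add: sum_subtractf left_diff_distrib)
  qed
  then have "(LINT x|lborel. (pd j (interp v) x)\<^sup>2) \<le> (\<Sum>\<gamma>\<in>T. (v \<gamma> - v (\<gamma> - ?e))\<^sup>2)"
    using interpolation_square_integral[of "\<lambda>i. if i = j then bq else Bs", OF unit_kernel_\<beta>' T, of "\<lambda>\<gamma>. v \<gamma> - v (\<gamma> - ?e)"]
    by (simp add: \<beta>'_def)
  also have "\<dots> = (LINT \<gamma>|count. (v \<gamma> - v (\<gamma> - ?e))\<^sup>2)"
  proof -
    have sub: "{\<gamma>. (v \<gamma> - v (\<gamma> - ?e))\<^sup>2 \<noteq> 0} \<subseteq> T" by (auto simp: T_iff)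
    from finite_subset[OF this T] have "(LINT \<gamma>|count. (v \<gamma> - v (\<gamma> - ?e))\<^sup>2) = (\<Sum>\<gamma> | (v \<gamma> - v (\<gamma> - ?e))\<^sup>2 \<noteq> 0. (v \<gamma> - v (\<gamma> - ?e))\<^sup>2)"
      using lebesgue_integral_count_space_finite_support[of UNIV "\<lambda>\<gamma>. (v \<gamma> - v (\<gamma> - ?e))\<^sup>2"] by simp
    also have "\<dots> = (\<Sum>\<gamma>\<in>T. (v \<gamma> - v (\<gamma> - ?e))\<^sup>2)" by (rule sum.mono_neutral_left[OF T sub]) auto
    finally show ?thesis ..
  qed
  also have "\<dots> = (LINT \<gamma>|count. (v (\<gamma> + ?e) - v \<gamma>)\<^sup>2)"
    using integral_count_shift(1)[of "\<lambda>\<gamma>. (v \<gamma> - v (\<gamma> - ?e))\<^sup>2" ?e] by simp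
  finally show ?thesis .
qed

text \<open>For weights of mass one, the mean of the squares minus the square of the mean is half
  the double sum of \<open>(v \<gamma> - v \<delta>)\<^sup>2\<close> with product weights. Two
  weights overlap only if \<open>\<delta> - \<gamma>\<close> lies in \<open>int_box 4\<close>, so
  finitely many shifts bound the loss by the kinetic energy.\<close>

lemma interp_norm_loss:
  "\<exists>C\<ge>0. \<forall>v::int^'n \<Rightarrow> real. finite {\<gamma>. v \<gamma> \<noteq> 0} \<longrightarrow>
    (LINT \<gamma>|count. (v \<gamma>)\<^sup>2) - C * dir_energy v \<le> (LINT x|lborel. (interp v x)\<^sup>2)"
proof -
  have "\<forall>\<kappa>::int^'n. \<exists>C\<ge>0. \<forall>v. finite {\<gamma>. v \<gamma> \<noteq> 0} \<longrightarrow> (LINT \<gamma>|count. (v (\<gamma> + \<kappa>) - v \<gamma>)\<^sup>2) \<le> C * dir_energy v"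
    using shift_difference_bound by blast
  then obtain c where c: "\<And>\<kappa>::int^'n. c \<kappa> \<ge> 0" "\<And>\<kappa> v. finite {\<gamma>. v \<gamma> \<noteq> 0} \<Longrightarrow> (LINT \<gamma>|count. (v (\<gamma> + \<kappa>) - v \<gamma>)\<^sup>2) \<le> c \<kappa> * dir_energy v"
    unfolding choice_iff by blast
  let ?B = "int_box 4 :: (int^'n) set"
  define C where "C = (\<Sum>\<kappa>\<in>?B. c \<kappa>)"
  have "(LINT \<gamma>|count. (v \<gamma>)\<^sup>2) - C * dir_energy v \<le> (LINT x|lborel. (interp v x)\<^sup>2)" if fin: "finite {\<gamma>. v \<gamma> \<noteq> 0}" for v :: "int^'n \<Rightarrow> real"
  proof -
    obtain N0 where N0: "{\<gamma>. v \<gamma> \<noteq> 0} \<subseteq> int_box N0" using finite_subset_int_box[OF fin] by blast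
    \<comment> \<open>Near the support of \<open>v\<close> the partition of unity needs the box
      enlarged by 2, the radius of the kernel, and by the margin 3.\<close>
    define T where "T = (int_box (N0 + 5) :: (int^'n) set)"
    have T: "finite T" unfolding T_def by (rule finite_int_box)
    have ST: "{\<gamma>. v \<gamma> \<noteq> 0} \<subseteq> T" using N0 int_box_mono[of N0 "N0 + 5"] by (auto simp: T_def)
    let ?b = "\<lambda>\<gamma> (x::real^'n). \<beta> (x - lattice_vec \<gamma>)"
    note bt = tensor_translate[of "\<lambda>i::'n. Bs", OF unit_kernel_Bs]
    have b0: "0 \<le> ?b \<gamma> x" for \<gamma> x by (intro tensor_nonneg unit_kernel_Bs)
    have b1: "?b \<gamma> x \<le> 1" for \<gamma> and x :: "real^'n"
      using tensor_sum_le_1[of "\<lambda>i. Bs" "{\<gamma>}" x, OF unit_kernel_Bs] by simp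
    have iT: "interp v x = (\<Sum>\<gamma>\<in>T. v \<gamma> * ?b \<gamma> x)" for x
      unfolding interp_def by (rule sum.mono_neutral_left[OF T ST]) auto
    \<comment> \<open>Twice the Jensen gap near the support of \<open>v\<close>; the factor 2 is
      given away.\<close>
    define g :: "real^'n \<Rightarrow> real" where "g x = (\<Sum>\<gamma>\<in>T. \<Sum>\<delta>\<in>T. (v \<gamma> - v \<delta>)\<^sup>2 * (?b \<gamma> x * ?b \<delta> x))" for x
    \<comment> \<open>Far from the support the weights over \<open>T\<close> need not sum to 1, but
      there both terms on the left vanish.\<close>
    have pw: "(\<Sum>\<gamma>\<in>T. (v \<gamma>)\<^sup>2 * ?b \<gamma> x) - (interp v x)\<^sup>2 \<le> g x" for x
    proof (cases "\<exists>\<gamma>. v \<gamma> * ?b \<gamma> x \<noteq> 0")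
      case True
      then obtain \<gamma> where \<gamma>: "v \<gamma> \<noteq> 0" "?b \<gamma> x \<noteq> 0" by auto
      have "\<bar>x $ i\<bar> + 3 \<le> real (N0 + 5)" for i
      proof -
        have "\<bar>(x - lattice_vec \<gamma>) $ i\<bar> < 2" using tensor_outside[of "\<lambda>i. Bs" "x - lattice_vec \<gamma>" i, OF unit_kernel_Bs] \<gamma>(2) by force
        moreover have "- int N0 \<le> \<gamma> $ i" "\<gamma> $ i \<le> int N0" using N0 \<gamma>(1) by (auto simp: int_box_def)
        then have "- real N0 \<le> of_int (\<gamma> $ i)" "of_int (\<gamma> $ i) \<le> real N0" by linarith+
        ultimately show ?thesis by (simp add: abs_less_iff abs_le_iff)
      qed
      then have one: "(\<Sum>\<gamma>\<in>T. ?b \<gamma> x) = 1" unfolding T_def by (intro tensor_sum_eq_1 unit_kernel_Bs)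
      have "g x = (\<Sum>\<gamma>\<in>T. \<Sum>\<delta>\<in>T. ((v \<gamma>)\<^sup>2 * ?b \<gamma> x) * ?b \<delta> x) + (\<Sum>\<gamma>\<in>T. \<Sum>\<delta>\<in>T. ?b \<gamma> x * ((v \<delta>)\<^sup>2 * ?b \<delta> x)) - 2 * (\<Sum>\<gamma>\<in>T. \<Sum>\<delta>\<in>T. (v \<gamma> * ?b \<gamma> x) * (v \<delta> * ?b \<delta> x))"
        unfolding g_def by (simp add: sum.distrib[symmetric] sum_subtractf[symmetric] sum_distrib_left power2_eq_square algebra_simps)
      also have "\<dots> = 2 * ((\<Sum>\<gamma>\<in>T. (v \<gamma>)\<^sup>2 * ?b \<gamma> x) - (interp v x)\<^sup>2)"
        unfolding sum_product[symmetric] one iT by (simp add: power2_eq_square)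
      finally have "g x = 2 * ((\<Sum>\<gamma>\<in>T. (v \<gamma>)\<^sup>2 * ?b \<gamma> x) - (interp v x)\<^sup>2)" .
      moreover have "g x \<ge> 0" unfolding g_def using b0 by (intro sum_nonneg) auto
      moreover have "a = 2 * b \<Longrightarrow> 0 \<le> a \<Longrightarrow> b \<le> a" for a b :: real by simp
      ultimately show ?thesis by blast
    next
      case False
      then have "(\<Sum>\<gamma>\<in>T. (v \<gamma>)\<^sup>2 * ?b \<gamma> x) = 0" by (intro sum.neutral) auto
      moreover have "interp v x = 0" unfolding iT by (rule sum.neutral) (use False in auto)
      moreover have "g x \<ge> 0" unfolding g_def using b0 by (intro sum_nonneg) auto
      ultimately show ?thesis by simp
    qed
    have bbi: "integrable lborel (\<lambda>x. ?b \<gamma> x * ?b \<delta> x)" for \<gamma> \<delta>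
      by (rule integrable_bounded_support[OF continuous_on_mult[OF bt(4) bt(4)] bounded_subset[OF bt(3)[of "lattice_vec \<gamma>"]]]) auto
    have bb: "(LINT x|lborel. ?b \<gamma> x * ?b \<delta> x) \<le> (if \<delta> - \<gamma> \<in> ?B then 1 else 0)" for \<gamma> \<delta> :: "int^'n"
    proof (cases "\<delta> - \<gamma> \<in> ?B")
      case True
      have "(LINT x|lborel. ?b \<gamma> x * ?b \<delta> x) \<le> (LINT x|lborel. ?b \<gamma> x)"
        by (intro integral_mono bbi bt(1)) (use b0 b1 in \<open>auto intro: mult_left_le\<close>)
      with True show ?thesis by (simp add: bt(2))
    next
      case False
      then obtain i where i: "\<not> (- 4 \<le> \<delta> $ i - \<gamma> $ i \<and> \<delta> $ i - \<gamma> $ i \<le> 4)" by (auto simp: int_box_def)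
      have z: "?b \<gamma> x * ?b \<delta> x = 0" for x
      proof (rule ccontr)
        assume "?b \<gamma> x * ?b \<delta> x \<noteq> 0"
        then have "\<bar>(x - lattice_vec \<gamma>) $ i\<bar> < 2" "\<bar>(x - lattice_vec \<delta>) $ i\<bar> < 2"
          using tensor_outside[of "\<lambda>i. Bs" "x - lattice_vec \<gamma>" i, OF unit_kernel_Bs] tensor_outside[of "\<lambda>i. Bs" "x - lattice_vec \<delta>" i, OF unit_kernel_Bs] by force+
        then have "- 4 < real_of_int (\<delta> $ i - \<gamma> $ i) \<and> real_of_int (\<delta> $ i - \<gamma> $ i) < 4" by (auto simp: abs_less_iff)
        with i show False by linarith
      qed
      have "(LINT x|lborel. ?b \<gamma> x * ?b \<delta> x) = (LINT x|(lborel::(real^'n) measure). 0)"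
        by (rule Bochner_Integration.integral_cong[OF refl z])
      with False show ?thesis by (simp only: lebesgue_integral_const) simp
    qed
    have gi: "integrable lborel g" unfolding g_def[abs_def] by (intro Bochner_Integration.integrable_sum integrable_mult_right bbi)
    have "(LINT x|lborel. g x) = (\<Sum>\<gamma>\<in>T. \<Sum>\<delta>\<in>T. (v \<gamma> - v \<delta>)\<^sup>2 * (LINT x|lborel. ?b \<gamma> x * ?b \<delta> x))"
      unfolding g_def using bbi by (simp add: Bochner_Integration.integral_sum Bochner_Integration.integrable_sum)
    also have "\<dots> \<le> (\<Sum>\<gamma>\<in>T. \<Sum>\<delta>\<in>T. (v \<gamma> - v \<delta>)\<^sup>2 * (if \<delta> - \<gamma> \<in> ?B then 1 else 0))"
      by (intro sum_mono mult_left_mono bb) simp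
    also have "\<dots> \<le> (\<Sum>\<gamma>\<in>T. \<Sum>\<kappa>\<in>?B. (v (\<gamma> + \<kappa>) - v \<gamma>)\<^sup>2)"
    proof (rule sum_mono)
      fix \<gamma>
      have "(\<Sum>\<delta>\<in>T. (v \<gamma> - v \<delta>)\<^sup>2 * (if \<delta> - \<gamma> \<in> ?B then 1 else 0)) = (\<Sum>\<delta>\<in>{\<delta>\<in>T. \<delta> - \<gamma> \<in> ?B}. (v \<gamma> - v \<delta>)\<^sup>2)"
        using T by (intro sum.mono_neutral_cong_right) auto
      also have "\<dots> = (\<Sum>\<kappa>\<in>(\<lambda>\<delta>. \<delta> - \<gamma>) ` {\<delta>\<in>T. \<delta> - \<gamma> \<in> ?B}. (v (\<gamma> + \<kappa>) - v \<gamma>)\<^sup>2)"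
        by (subst sum.reindex) (auto simp: inj_on_def power2_commute)
      also have "\<dots> \<le> (\<Sum>\<kappa>\<in>?B. (v (\<gamma> + \<kappa>) - v \<gamma>)\<^sup>2)"
        by (rule sum_mono2[OF finite_int_box]) auto
      finally show "(\<Sum>\<delta>\<in>T. (v \<gamma> - v \<delta>)\<^sup>2 * (if \<delta> - \<gamma> \<in> ?B then 1 else 0)) \<le> (\<Sum>\<kappa>\<in>?B. (v (\<gamma> + \<kappa>) - v \<gamma>)\<^sup>2)" .
    qed
    also have "\<dots> = (\<Sum>\<kappa>\<in>?B. \<Sum>\<gamma>\<in>T. (v (\<gamma> + \<kappa>) - v \<gamma>)\<^sup>2)" by (rule sum.swap)
    also have "\<dots> \<le> (\<Sum>\<kappa>\<in>?B. c \<kappa> * dir_energy v)"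
    proof (rule sum_mono)
      fix \<kappa>
      have i: "integrable count (\<lambda>\<gamma>. (v (\<gamma> + \<kappa>) - v \<gamma>)\<^sup>2)" using integrable_diff_square[OF fin, of \<kappa> 0] by simp
      have "(\<Sum>\<gamma>\<in>T. (v (\<gamma> + \<kappa>) - v \<gamma>)\<^sup>2) = (LINT \<gamma>|count. (v (\<gamma> + \<kappa>) - v \<gamma>)\<^sup>2 * indicator T \<gamma>)"
      proof -
        have "finite {\<gamma>. (v (\<gamma> + \<kappa>) - v \<gamma>)\<^sup>2 * indicator T \<gamma> \<noteq> (0::real)}"
          by (rule finite_subset[OF _ T]) (auto simp: indicator_def split: if_splits)
        then have "(LINT \<gamma>|count. (v (\<gamma> + \<kappa>) - v \<gamma>)\<^sup>2 * indicator T \<gamma>) = (\<Sum>\<gamma> | (v (\<gamma> + \<kappa>) - v \<gamma>)\<^sup>2 * indicator T \<gamma> \<noteq> (0::real). (v (\<gamma> + \<kappa>) - v \<gamma>)\<^sup>2 * indicator T \<gamma>)"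
          using lebesgue_integral_count_space_finite_support[of UNIV "\<lambda>\<gamma>. (v (\<gamma> + \<kappa>) - v \<gamma>)\<^sup>2 * indicator T \<gamma>"] by simp
        also have "\<dots> = (\<Sum>\<gamma>\<in>T. (v (\<gamma> + \<kappa>) - v \<gamma>)\<^sup>2)"
          by (rule sum.mono_neutral_cong_left[OF T]) (auto simp: indicator_def split: if_splits)
        finally show ?thesis ..
      qed
      also have "\<dots> \<le> (LINT \<gamma>|count. (v (\<gamma> + \<kappa>) - v \<gamma>)\<^sup>2)"
        by (rule integral_mono[OF integrable_finite_support i]) (use T in \<open>auto simp: indicator_def intro: finite_subset\<close>)
      also have "\<dots> \<le> c \<kappa> * dir_energy v" by (rule c(2)[OF fin])
      finally show "(\<Sum>\<gamma>\<in>T. (v (\<gamma> + \<kappa>) - v \<gamma>)\<^sup>2) \<le> c \<kappa> * dir_energy v" .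
    qed
    also have "\<dots> = C * dir_energy v" by (simp add: C_def sum_distrib_right)
    finally have gC: "(LINT x|lborel. g x) \<le> C * dir_energy v" .
    have ii: "integrable lborel (\<lambda>x. (interp v x)\<^sup>2)"
      using C2c_integrable(2)[OF interp_C2c[OF fin], of "\<lambda>x. 1"] by simp
    have si: "integrable lborel (\<lambda>x. \<Sum>\<gamma>\<in>T. (v \<gamma>)\<^sup>2 * ?b \<gamma> x)"
      by (intro Bochner_Integration.integrable_sum integrable_mult_right bt(1))
    have "(LINT x|lborel. (\<Sum>\<gamma>\<in>T. (v \<gamma>)\<^sup>2 * ?b \<gamma> x) - (interp v x)\<^sup>2) \<le> (LINT x|lborel. g x)"
      by (intro integral_mono gi Bochner_Integration.integrable_diff ii si pw)
    then have "(\<Sum>\<gamma>\<in>T. (v \<gamma>)\<^sup>2) - (LINT x|lborel. (interp v x)\<^sup>2) \<le> (LINT x|lborel. g x)"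
      using ii si bt(1,2) by (simp add: Bochner_Integration.integral_sum)
    moreover have "(LINT \<gamma>|count. (v \<gamma>)\<^sup>2) = (\<Sum>\<gamma>\<in>T. (v \<gamma>)\<^sup>2)"
    proof -
      have "(LINT \<gamma>|count. (v \<gamma>)\<^sup>2) = (\<Sum>\<gamma> | v \<gamma> \<noteq> 0. (v \<gamma>)\<^sup>2)"
        using lebesgue_integral_count_space_finite_support[of UNIV "\<lambda>\<gamma>. (v \<gamma>)\<^sup>2"] fin by simp
      also have "\<dots> = (\<Sum>\<gamma>\<in>T. (v \<gamma>)\<^sup>2)" by (rule sum.mono_neutral_left[OF T ST]) auto
      finally show ?thesis .
    qed
    ultimately show ?thesis using gC by linarith
  qed
  moreover have "C \<ge> 0" unfolding C_def using c(1) by (intro sum_nonneg)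
  ultimately show ?thesis by blast
qed

section \<open>Potential energy of spline functions\<close>

lemma count_integral_eq_sum:
  fixes f v :: "'a \<Rightarrow> real"
  assumes "finite {\<gamma>. v \<gamma> \<noteq> 0}"
  shows "(LINT \<gamma>|count_space UNIV. f \<gamma> * (v \<gamma>)\<^sup>2) = (\<Sum>\<gamma> | v \<gamma> \<noteq> 0. f \<gamma> * (v \<gamma>)\<^sup>2)"
proof -
  have fin: "finite {\<gamma>. f \<gamma> * (v \<gamma>)\<^sup>2 \<noteq> 0}" by (rule finite_subset[OF _ assms]) auto
  then have "(LINT \<gamma>|count_space UNIV. f \<gamma> * (v \<gamma>)\<^sup>2) = (\<Sum>\<gamma> | f \<gamma> * (v \<gamma>)\<^sup>2 \<noteq> 0. f \<gamma> * (v \<gamma>)\<^sup>2)"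
    using lebesgue_integral_count_space_finite_support[of UNIV "\<lambda>\<gamma>. f \<gamma> * (v \<gamma>)\<^sup>2"] by simp
  also have "\<dots> = (\<Sum>\<gamma> | v \<gamma> \<noteq> 0. f \<gamma> * (v \<gamma>)\<^sup>2)" by (rule sum.mono_neutral_left[OF assms]) auto
  finally show ?thesis .
qed

text \<open>The integrand is odd, because \<open>\<beta>\<close> inherits evenness from
  \<open>Bs\<close>.\<close>

lemma \<beta>_linear_moment: "(LINT z|lborel. \<beta> z * (z $ i)) = 0" for i :: "'n::finite"
proof -
  have b: "continuous_on UNIV (\<beta> :: real^'n \<Rightarrow> real)" by (intro tensor_continuous unit_kernel_Bs)
  have e: "\<beta> (- z) = \<beta> z" for z :: "real^'n" by (simp add: tensor_def Bs_even)
  have c: "continuous_on UNIV (\<lambda>z::real^'n. \<beta> z * (z $ i))" by (intro continuous_intros b)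
  have "(LINT z|lborel. \<beta> z * (z $ i)) = (LINT z|lborel. \<beta> (0 + (- 1) *\<^sub>R z) * ((0 + (- 1) *\<^sub>R z) $ i))"
    using lborel_integral_affine[of "\<lambda>z::real^'n. \<beta> z * (z $ i)" "- 1" 0] borel_measurable_continuous_onI[OF c] by simp
  also have "\<dots> = - (LINT z|lborel. \<beta> z * (z $ i))" by (simp add: e)
  finally show ?thesis by simp
qed

lemma sum_affine_weighted:
  fixes a b c w :: "'a \<Rightarrow> real"
  shows "(\<Sum>x\<in>S. (a x + s * b x + t * c x + r) * w x)
    = (\<Sum>x\<in>S. a x * w x) + s * (\<Sum>x\<in>S. b x * w x) + t * (\<Sum>x\<in>S. c x * w x) + r * (\<Sum>x\<in>S. w x)"
  by (simp add: sum.distrib sum_distrib_left algebra_simps)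

context bounded_potential begin

text \<open>Discrete counterpart of \<open>second_order_term\<close>. Up to an error
  \<open>h\<^sup>2 * K\<close>, \<open>h\<close> times the second derivative at a lattice point is a
  difference of first derivatives at neighbouring points, and summation by parts moves this
  difference onto the square of \<open>v\<close>. The Taylor error is the source of the last
  term.\<close>

lemma discrete_second_order_term:
  fixes v :: "int^'n \<Rightarrow> real"
  assumes fin: "finite {\<gamma>. v \<gamma> \<noteq> 0}" and h: "0 < h"
  shows "h\<^sup>2 * \<bar>\<Sum>\<gamma> | v \<gamma> \<noteq> 0. pd i (pd j V) (h *\<^sub>R lattice_vec \<gamma>) * (v \<gamma>)\<^sup>2\<bar>
    \<le> h * ((4 * K + 1) * discrete_energy (\<lambda>\<gamma>. V (h *\<^sub>R lattice_vec \<gamma>)) v) + K * h^3 * (LINT \<gamma>|count. (v \<gamma>)\<^sup>2)"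
proof -
  let ?S = "{\<gamma>. v \<gamma> \<noteq> 0}" and ?e = "axis i 1 :: int^'n"
  define G where "G \<gamma> = pd j V (h *\<^sub>R lattice_vec \<gamma>)" for \<gamma> :: "int^'n"
  define U where "U \<gamma> = V (h *\<^sub>R lattice_vec \<gamma>)" for \<gamma> :: "int^'n"
  define Q where "Q \<gamma> = pd i (pd j V) (h *\<^sub>R lattice_vec \<gamma>)" for \<gamma> :: "int^'n"
  define D where "D = (LINT \<gamma>|count. (v (\<gamma> + ?e) - v \<gamma>)\<^sup>2)"
  define P where "P = (LINT \<gamma>|count. U \<gamma> * (v \<gamma>)\<^sup>2)"
  have fin': "finite {\<gamma>. v (\<gamma> + ?e) \<noteq> 0}" by (rule finite_support_shift[OF fin])
  have ic: "integrable count (\<lambda>\<gamma>. f \<gamma> * (v \<gamma>)\<^sup>2)" "integrable count (\<lambda>\<gamma>. f \<gamma> * (v (\<gamma> + ?e))\<^sup>2)" for f :: "int^'n \<Rightarrow> real"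
    by (rule integrable_finite_support, rule finite_subset[OF _ fin], force)
      (rule integrable_finite_support, rule finite_subset[OF _ fin'], force)
  have id: "integrable count (\<lambda>\<gamma>. (v (\<gamma> + ?e) - v \<gamma>)\<^sup>2)" using integrable_diff_square[OF fin, of ?e 0] by simp
  have T: "\<bar>G (\<gamma> + ?e) - G \<gamma> - h * Q \<gamma>\<bar> \<le> h\<^sup>2 * K" for \<gamma>
  proof -
    have "\<bar>pd j V (h *\<^sub>R lattice_vec \<gamma> + axis i h) - pd j V (h *\<^sub>R lattice_vec \<gamma>) - dird (axis i h) (pd j V) (h *\<^sub>R lattice_vec \<gamma>)\<bar> \<le> (\<Sum>k\<in>UNIV. \<bar>axis i h $ k\<bar>)\<^sup>2 * K"
      by (rule Taylor2_bound) (use C_k_pd[OF V3] pd3_bound in \<open>simp_all add: numeral_2_eq_2\<close>)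
    moreover have "(\<Sum>k\<in>UNIV. \<bar>axis i h $ k\<bar>) = \<bar>h\<bar>" by (simp add: axis_def if_distrib[of abs] cong: if_cong)
    moreover have "h *\<^sub>R axis i 1 = axis i h" by (simp add: vec_eq_iff axis_def)
    ultimately show ?thesis by (simp add: G_def Q_def dird_axis lattice_vec_add lattice_vec_axis algebra_simps)
  qed
  have G2: "(G \<gamma>)\<^sup>2 \<le> 4 * K * U \<gamma>" for \<gamma> unfolding G_def U_def by (rule gradient_bound)
  have G1: "\<bar>G \<gamma>\<bar> \<le> 2 * K" for \<gamma>
  proof (rule abs_le_square_iff[THEN iffD2, of "G \<gamma>" "2 * K", simplified abs_of_nonneg, THEN order_trans])
    have "4 * K * U \<gamma> \<le> 4 * K * K" unfolding U_def using K0 V_bound by (intro mult_left_mono) auto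
    then show "(G \<gamma>)\<^sup>2 \<le> (2 * K)\<^sup>2" using G2[of \<gamma>] by (simp add: power2_eq_square)
  qed (use K0 in simp)
  \<comment> \<open>With \<open>g = G (\<gamma> + ?e)\<close>, \<open>w = v (\<gamma> + ?e)\<close>
    and \<open>d = w - v \<gamma>\<close>, the difference is
    \<open>g * d\<^sup>2 - 2 * g * w * d\<close>. The first term needs only that \<open>g\<close> is
    bounded; in the second, \<open>gradient_bound\<close> turns \<open>g\<^sup>2\<close> into the
    potential.\<close>
  have pw: "\<bar>G (\<gamma> + ?e) * (v \<gamma>)\<^sup>2 - G (\<gamma> + ?e) * (v (\<gamma> + ?e))\<^sup>2\<bar> \<le> (2 * K + 1) * (v (\<gamma> + ?e) - v \<gamma>)\<^sup>2 + 4 * K * (U (\<gamma> + ?e) * (v (\<gamma> + ?e))\<^sup>2)" for \<gamma>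
  proof -
    define g where "g = G (\<gamma> + ?e)"
    define w where "w = v (\<gamma> + ?e)"
    define d where "d = v (\<gamma> + ?e) - v \<gamma>"
    have "g * (v \<gamma>)\<^sup>2 - g * w\<^sup>2 = g * d\<^sup>2 - 2 * ((g * w) * d)"
      by (simp add: w_def d_def power2_eq_square algebra_simps)
    moreover have "\<bar>g * d\<^sup>2\<bar> \<le> 2 * K * d\<^sup>2" unfolding abs_mult g_def by (simp add: mult_right_mono G1)
    moreover have "\<bar>2 * ((g * w) * d)\<bar> \<le> g\<^sup>2 * w\<^sup>2 + d\<^sup>2"
      using sum_squares_bound[of "g * w" d] sum_squares_bound[of "- (g * w)" d] by (simp add: power_mult_distrib abs_le_iff)
    moreover have "g\<^sup>2 * w\<^sup>2 \<le> 4 * K * U (\<gamma> + ?e) * w\<^sup>2" unfolding g_def by (intro mult_right_mono G2) simp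
    ultimately have "\<bar>g * (v \<gamma>)\<^sup>2 - g * w\<^sup>2\<bar> \<le> (2 * K + 1) * d\<^sup>2 + 4 * K * U (\<gamma> + ?e) * w\<^sup>2"
      by (simp only: distrib_right mult_1)
    then show ?thesis by (simp add: g_def w_def d_def mult.assoc)
  qed
  have "(LINT \<gamma>|count. (G (\<gamma> + ?e) - G \<gamma>) * (v \<gamma>)\<^sup>2) = (LINT \<gamma>|count. G (\<gamma> + ?e) * (v \<gamma>)\<^sup>2) - (LINT \<gamma>|count. G \<gamma> * (v \<gamma>)\<^sup>2)"
    using ic(1)[of "\<lambda>\<gamma>. G (\<gamma> + ?e)"] ic(1)[of G] by (simp add: left_diff_distrib)
  also have "(LINT \<gamma>|count. G \<gamma> * (v \<gamma>)\<^sup>2) = (LINT \<gamma>|count. G (\<gamma> + ?e) * (v (\<gamma> + ?e))\<^sup>2)"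
    using integral_count_shift(1)[of "\<lambda>\<gamma>. G \<gamma> * (v \<gamma>)\<^sup>2" ?e] by simp
  also have "(LINT \<gamma>|count. G (\<gamma> + ?e) * (v \<gamma>)\<^sup>2) - \<dots> = (LINT \<gamma>|count. G (\<gamma> + ?e) * (v \<gamma>)\<^sup>2 - G (\<gamma> + ?e) * (v (\<gamma> + ?e))\<^sup>2)"
    using ic(1)[of "\<lambda>\<gamma>. G (\<gamma> + ?e)"] ic(2)[of "\<lambda>\<gamma>. G (\<gamma> + ?e)"] by simp
  finally have eq: "(LINT \<gamma>|count. (G (\<gamma> + ?e) - G \<gamma>) * (v \<gamma>)\<^sup>2) = \<dots>" .
  have "\<bar>LINT \<gamma>|count. (G (\<gamma> + ?e) - G \<gamma>) * (v \<gamma>)\<^sup>2\<bar> \<le> (LINT \<gamma>|count. (2 * K + 1) * (v (\<gamma> + ?e) - v \<gamma>)\<^sup>2 + 4 * K * (U (\<gamma> + ?e) * (v (\<gamma> + ?e))\<^sup>2))"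
    unfolding eq
  proof (rule order_trans[OF integral_abs_bound integral_mono])
    show "integrable count (\<lambda>\<gamma>. \<bar>G (\<gamma> + ?e) * (v \<gamma>)\<^sup>2 - G (\<gamma> + ?e) * (v (\<gamma> + ?e))\<^sup>2\<bar>)"
      by (intro integrable_abs Bochner_Integration.integrable_diff ic)
    show "integrable count (\<lambda>\<gamma>. (2 * K + 1) * (v (\<gamma> + ?e) - v \<gamma>)\<^sup>2 + 4 * K * (U (\<gamma> + ?e) * (v (\<gamma> + ?e))\<^sup>2))"
      by (intro Bochner_Integration.integrable_add integrable_mult_right id ic)
  qed (rule pw)
  also have "\<dots> = (2 * K + 1) * D + 4 * K * (LINT \<gamma>|count. U (\<gamma> + ?e) * (v (\<gamma> + ?e))\<^sup>2)"
    unfolding D_def using id ic(2)[of "\<lambda>\<gamma>. U (\<gamma> + ?e)"] by simp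
  also have "(LINT \<gamma>|count. U (\<gamma> + ?e) * (v (\<gamma> + ?e))\<^sup>2) = P"
    unfolding P_def using integral_count_shift(1)[of "\<lambda>\<gamma>. U \<gamma> * (v \<gamma>)\<^sup>2" ?e] by simp
  also have "(2 * K + 1) * D + 4 * K * P \<le> (4 * K + 1) * discrete_energy U v"
  proof -
    have "D \<le> dir_energy v" unfolding D_def dir_energy_def
      by (rule member_le_sum[of i UNIV "\<lambda>j. LINT \<gamma>|count. (v (\<gamma> + axis j 1) - v \<gamma>)\<^sup>2"]) auto
    moreover have P0: "0 \<le> P" unfolding P_def U_def using V_nonneg by (intro integral_nonneg_AE) auto
    moreover have D0: "0 \<le> D" unfolding D_def by (intro integral_nonneg_AE) auto
    ultimately have "(4 * K + 1) * (D + P) \<le> (4 * K + 1) * discrete_energy U v"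
      unfolding discrete_energy_eq P_def[symmetric] using K0 by (intro mult_left_mono) auto
    moreover have "(4 * K + 1) * (D + P) = (2 * K + 1) * D + 4 * K * P + (2 * (K * D) + P)" by (simp add: algebra_simps)
    moreover have "0 \<le> K * D" using K0 D0 by simp
    ultimately show ?thesis using P0 by linarith
  qed
  finally have A: "\<bar>LINT \<gamma>|count. (G (\<gamma> + ?e) - G \<gamma>) * (v \<gamma>)\<^sup>2\<bar> \<le> (4 * K + 1) * discrete_energy U v" .
  have B: "\<bar>LINT \<gamma>|count. (h * Q \<gamma> - (G (\<gamma> + ?e) - G \<gamma>)) * (v \<gamma>)\<^sup>2\<bar> \<le> (LINT \<gamma>|count. h\<^sup>2 * K * (v \<gamma>)\<^sup>2)"
  proof (rule order_trans[OF integral_abs_bound integral_mono])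
    show "integrable count (\<lambda>\<gamma>. \<bar>(h * Q \<gamma> - (G (\<gamma> + ?e) - G \<gamma>)) * (v \<gamma>)\<^sup>2\<bar>)" by (intro integrable_abs ic)
    show "\<bar>(h * Q \<gamma> - (G (\<gamma> + ?e) - G \<gamma>)) * (v \<gamma>)\<^sup>2\<bar> \<le> h\<^sup>2 * K * (v \<gamma>)\<^sup>2" for \<gamma>
      unfolding abs_mult abs_power2 using T[of \<gamma>] by (intro mult_right_mono zero_le_power2) linarith
  qed (rule ic)
  have "h * (LINT \<gamma>|count. Q \<gamma> * (v \<gamma>)\<^sup>2) = (LINT \<gamma>|count. (h * Q \<gamma> - (G (\<gamma> + ?e) - G \<gamma>)) * (v \<gamma>)\<^sup>2 + (G (\<gamma> + ?e) - G \<gamma>) * (v \<gamma>)\<^sup>2)"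
    by (simp add: left_diff_distrib mult.assoc)
  also have "\<dots> = (LINT \<gamma>|count. (h * Q \<gamma> - (G (\<gamma> + ?e) - G \<gamma>)) * (v \<gamma>)\<^sup>2) + (LINT \<gamma>|count. (G (\<gamma> + ?e) - G \<gamma>) * (v \<gamma>)\<^sup>2)"
    by (rule Bochner_Integration.integral_add[OF ic(1) ic(1)])
  finally have "\<bar>h * (LINT \<gamma>|count. Q \<gamma> * (v \<gamma>)\<^sup>2)\<bar> \<le> (LINT \<gamma>|count. h\<^sup>2 * K * (v \<gamma>)\<^sup>2) + (4 * K + 1) * discrete_energy U v"
    using A B by linarith
  then have "h * \<bar>LINT \<gamma>|count. Q \<gamma> * (v \<gamma>)\<^sup>2\<bar> \<le> h\<^sup>2 * K * (LINT \<gamma>|count. (v \<gamma>)\<^sup>2) + (4 * K + 1) * discrete_energy U v"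
    using h by (simp add: abs_mult)
  from mult_left_mono[OF this, of h] show ?thesis
    using h unfolding count_integral_eq_sum[OF fin] Q_def U_def[abs_def]
    by (simp add: power2_eq_square power3_eq_cube algebra_simps)
qed

text \<open>Jensen replaces the squared spline function by a weighted sum of the
  \<open>(v \<gamma>)\<^sup>2\<close>. After the substitution
  \<open>x = lattice_vec \<gamma> + z\<close>, for fixed \<open>z\<close>, \<open>V\<close> is
  expanded at the lattice points, so derivatives are summed against
  \<open>(v \<gamma>)\<^sup>2\<close> and summation by parts applies. The term linear in
  \<open>z\<close> survives until the integration over \<open>z\<close>, where evenness of
  \<open>\<beta>\<close> removes it.\<close>

lemma interp_potential:
  fixes v :: "int^'n \<Rightarrow> real"
  assumes fin: "finite {\<gamma>. v \<gamma> \<noteq> 0}" and h: "0 < h"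
  defines "U \<equiv> \<lambda>\<gamma>. V (h *\<^sub>R lattice_vec \<gamma>)"
  shows "(LINT x|lborel. V (h *\<^sub>R x) * (interp v x)\<^sup>2) \<le> (LINT \<gamma>|count. U \<gamma> * (v \<gamma>)\<^sup>2)
    + 2 * (real CARD('n))\<^sup>2 * (h * ((4 * K + 1) * discrete_energy U v) + K * h^3 * (LINT \<gamma>|count. (v \<gamma>)\<^sup>2))
    + (2 * real CARD('n))^3 * K * h^3 * (LINT \<gamma>|count. (v \<gamma>)\<^sup>2)"
proof -
  let ?S = "{\<gamma>. v \<gamma> \<noteq> 0}" and ?n = "real CARD('n)" and ?x = "\<lambda>\<gamma>. h *\<^sub>R lattice_vec \<gamma> :: real^'n"
  define N where "N = (\<Sum>\<gamma>\<in>?S. (v \<gamma>)\<^sup>2)"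
  define P where "P = (\<Sum>\<gamma>\<in>?S. U \<gamma> * (v \<gamma>)\<^sup>2)"
  define E where "E = h * ((4 * K + 1) * discrete_energy U v) + K * h^3 * N"
  define A where "A i = (\<Sum>\<gamma>\<in>?S. pd i V (?x \<gamma>) * (v \<gamma>)\<^sup>2)" for i
  define Q where "Q i j = (\<Sum>\<gamma>\<in>?S. pd i (pd j V) (?x \<gamma>) * (v \<gamma>)\<^sup>2)" for i j
  have N: "(LINT \<gamma>|count. (v \<gamma>)\<^sup>2) = N" using count_integral_eq_sum[OF fin, of "\<lambda>_. 1"] by (simp add: N_def)
  have P: "(LINT \<gamma>|count. U \<gamma> * (v \<gamma>)\<^sup>2) = P" unfolding P_def by (rule count_integral_eq_sum[OF fin])
  have N0: "0 \<le> N" unfolding N_def by (intro sum_nonneg) auto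
  have Q: "h\<^sup>2 * \<bar>Q i j\<bar> \<le> E" for i j
    using discrete_second_order_term[OF fin h, of i j] unfolding Q_def E_def N U_def .
  note bc = tensor_continuous[of "\<lambda>i::'n. Bs", OF unit_kernel_Bs] and bb = tensor_bounded_support[of "\<lambda>i::'n. Bs", OF unit_kernel_Bs]
  note bt = tensor_translate[of "\<lambda>i::'n. Bs", OF unit_kernel_Bs]
  have b0: "0 \<le> \<beta> z" for z :: "real^'n" by (intro tensor_nonneg unit_kernel_Bs)
  have bi: "integrable lborel (\<lambda>z. \<beta> z * g z)" if g: "continuous_on UNIV g" for g :: "real^'n \<Rightarrow> real"
    by (rule integrable_bounded_support[OF continuous_on_mult[OF bc g] bounded_subset[OF bb]]) auto
  have Vc: "continuous_on UNIV (\<lambda>z. V (a + h *\<^sub>R z))" for a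
    by (intro continuous_on_compose2[OF V_cont] continuous_on_add continuous_on_const continuous_on_scaleR continuous_on_id) auto
  define R where "R = (2 * ?n)^3 * K * h^3"
  \<comment> \<open>On the support of \<open>\<beta>\<close> each product
    \<open>z $ i * z $ j\<close> is at most 4 in absolute value, so each of the pairs
    \<open>i\<close>, \<open>j\<close> contributes at most
    \<open>h\<^sup>2 / 2 * 4 * \<bar>Q i j\<bar> \<le> 2 * E\<close>.\<close>
  have pw: "(\<Sum>\<gamma>\<in>?S. V (?x \<gamma> + h *\<^sub>R z) * (v \<gamma>)\<^sup>2) \<le> P + h * (\<Sum>i\<in>UNIV. z $ i * A i) + 2 * ?n\<^sup>2 * E + R * N" if z: "\<And>i. \<bar>z $ i\<bar> \<le> 2" for z :: "real^'n"
  proof -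
    have "V (?x \<gamma> + h *\<^sub>R z) \<le> U \<gamma> + h * (\<Sum>i\<in>UNIV. z $ i * pd i V (?x \<gamma>)) + h\<^sup>2 / 2 * (\<Sum>i\<in>UNIV. \<Sum>j\<in>UNIV. z $ i * z $ j * pd i (pd j V) (?x \<gamma>)) + R" for \<gamma>
    proof -
      let ?w = "h *\<^sub>R z"
      have "(\<Sum>i\<in>UNIV. \<bar>?w $ i\<bar>) \<le> (\<Sum>i\<in>(UNIV::'n set). h * 2)"
        using z h by (intro sum_mono) (auto simp: abs_mult)
      then have "(\<Sum>i\<in>UNIV. \<bar>?w $ i\<bar>)^3 \<le> (2 * ?n * h)^3"
        by (intro power_mono) (auto simp: sum_nonneg algebra_simps)
      then have "(\<Sum>i\<in>UNIV. \<bar>?w $ i\<bar>)^3 * K \<le> R"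
        using K0 mult_right_mono by (fastforce simp: R_def power_mult_distrib algebra_simps)
      moreover have "dird ?w V (?x \<gamma>) = h * (\<Sum>i\<in>UNIV. z $ i * pd i V (?x \<gamma>))" by (simp add: dird_def sum_distrib_left mult.assoc)
      moreover have "(\<Sum>i\<in>UNIV. \<Sum>j\<in>UNIV. ?w $ i * ?w $ j * pd i (pd j V) (?x \<gamma>)) = h\<^sup>2 * (\<Sum>i\<in>UNIV. \<Sum>j\<in>UNIV. z $ i * z $ j * pd i (pd j V) (?x \<gamma>))"
        unfolding sum_distrib_left by (intro sum.cong refl) (simp add: power2_eq_square)
      ultimately show ?thesis using Taylor3[of "?x \<gamma>" ?w] by (simp add: U_def)
    qed
    then have "(\<Sum>\<gamma>\<in>?S. V (?x \<gamma> + h *\<^sub>R z) * (v \<gamma>)\<^sup>2) \<le> (\<Sum>\<gamma>\<in>?S. (U \<gamma> + h * (\<Sum>i\<in>UNIV. z $ i * pd i V (?x \<gamma>)) + h\<^sup>2 / 2 * (\<Sum>i\<in>UNIV. \<Sum>j\<in>UNIV. z $ i * z $ j * pd i (pd j V) (?x \<gamma>)) + R) * (v \<gamma>)\<^sup>2)"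
      by (intro sum_mono mult_right_mono) auto
    also have "\<dots> = P + h * (\<Sum>\<gamma>\<in>?S. (\<Sum>i\<in>UNIV. z $ i * pd i V (?x \<gamma>)) * (v \<gamma>)\<^sup>2)
       + h\<^sup>2 / 2 * (\<Sum>\<gamma>\<in>?S. (\<Sum>i\<in>UNIV. \<Sum>j\<in>UNIV. z $ i * z $ j * pd i (pd j V) (?x \<gamma>)) * (v \<gamma>)\<^sup>2) + R * N"
      unfolding P_def N_def by (rule sum_affine_weighted)
    also have "(\<Sum>\<gamma>\<in>?S. (\<Sum>i\<in>UNIV. z $ i * pd i V (?x \<gamma>)) * (v \<gamma>)\<^sup>2) = (\<Sum>i\<in>UNIV. z $ i * A i)"
      unfolding A_def sum_distrib_left sum_distrib_right by (subst sum.swap) (intro sum.cong refl, simp)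
    also have "(\<Sum>\<gamma>\<in>?S. (\<Sum>i\<in>UNIV. \<Sum>j\<in>UNIV. z $ i * z $ j * pd i (pd j V) (?x \<gamma>)) * (v \<gamma>)\<^sup>2) = (\<Sum>i\<in>UNIV. \<Sum>j\<in>UNIV. z $ i * z $ j * Q i j)"
      unfolding Q_def sum_distrib_left sum_distrib_right
      by (subst sum.swap, rule sum.cong[OF refl], subst sum.swap, intro sum.cong refl, simp)
    also have "h\<^sup>2 / 2 * (\<Sum>i\<in>UNIV. \<Sum>j\<in>UNIV. z $ i * z $ j * Q i j) \<le> (\<Sum>i\<in>(UNIV::'n set). \<Sum>j\<in>(UNIV::'n set). 2 * E)"
      unfolding sum_distrib_left
    proof (intro sum_mono)
      fix i j
      have "\<bar>z $ i * z $ j\<bar> \<le> 2 * 2" unfolding abs_mult by (intro mult_mono z) auto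
      have "h\<^sup>2 / 2 * (z $ i * z $ j * Q i j) \<le> h\<^sup>2 / 2 * (\<bar>z $ i * z $ j\<bar> * \<bar>Q i j\<bar>)"
        unfolding abs_mult[symmetric] by (intro mult_left_mono) auto
      also have "\<dots> \<le> h\<^sup>2 / 2 * ((2 * 2) * \<bar>Q i j\<bar>)"
        using \<open>\<bar>z $ i * z $ j\<bar> \<le> 2 * 2\<close> by (intro mult_left_mono mult_right_mono) auto
      also have "\<dots> \<le> 2 * E" using Q[of i j] by (simp add: mult.commute)
      finally show "h\<^sup>2 / 2 * (z $ i * z $ j * Q i j) \<le> 2 * E" .
    qed
    finally show ?thesis by (simp add: power2_eq_square mult_ac)
  qed
  have "(LINT x|lborel. V (h *\<^sub>R x) * (interp v x)\<^sup>2) \<le> (LINT x|lborel. (\<Sum>\<gamma>\<in>?S. (v \<gamma>)\<^sup>2 * (\<beta> (x - lattice_vec \<gamma>) * V (h *\<^sub>R x))))"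
  proof (rule integral_mono)
    show "integrable lborel (\<lambda>x. V (h *\<^sub>R x) * (interp v x)\<^sup>2)"
      by (rule C2c_integrable(2)[OF interp_C2c[OF fin] scaled_cont])
    show "integrable lborel (\<lambda>x. \<Sum>\<gamma>\<in>?S. (v \<gamma>)\<^sup>2 * (\<beta> (x - lattice_vec \<gamma>) * V (h *\<^sub>R x)))"
      by (intro Bochner_Integration.integrable_sum integrable_mult_right)
        (rule integrable_bounded_support[OF continuous_on_mult[OF bt(4) scaled_cont] bounded_subset[OF bt(3)]], auto)
    fix x
    have "(interp v x)\<^sup>2 \<le> (\<Sum>\<gamma>\<in>?S. (v \<gamma>)\<^sup>2 * \<beta> (x - lattice_vec \<gamma>))"
      unfolding interp_def
      by (rule weighted_square_le[OF b0 tensor_sum_le_1[of "\<lambda>i. Bs", OF unit_kernel_Bs fin]])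
    from mult_left_mono[OF this V_nonneg[of "h *\<^sub>R x"]]
    show "V (h *\<^sub>R x) * (interp v x)\<^sup>2 \<le> (\<Sum>\<gamma>\<in>?S. (v \<gamma>)\<^sup>2 * (\<beta> (x - lattice_vec \<gamma>) * V (h *\<^sub>R x)))"
      by (simp add: sum_distrib_left mult_ac)
  qed
  also have "\<dots> = (\<Sum>\<gamma>\<in>?S. (v \<gamma>)\<^sup>2 * (LINT x|lborel. \<beta> (x - lattice_vec \<gamma>) * V (h *\<^sub>R x)))"
    using integrable_bounded_support[OF continuous_on_mult[OF bt(4) scaled_cont] bounded_subset[OF bt(3)]]
    by (subst Bochner_Integration.integral_sum) auto
  also have "\<dots> = (\<Sum>\<gamma>\<in>?S. (v \<gamma>)\<^sup>2 * (LINT z|lborel. \<beta> z * V (?x \<gamma> + h *\<^sub>R z)))"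
  proof (intro sum.cong refl arg_cong2[where f = "(*)"])
    fix \<gamma>
    have "(\<lambda>x. \<beta> (x - lattice_vec \<gamma>) * V (h *\<^sub>R x)) \<in> borel_measurable borel"
      by (intro borel_measurable_continuous_onI continuous_on_mult bt(4) scaled_cont)
    then show "(LINT x|lborel. \<beta> (x - lattice_vec \<gamma>) * V (h *\<^sub>R x)) = (LINT z|lborel. \<beta> z * V (?x \<gamma> + h *\<^sub>R z))"
      using lborel_integral_translate[of "\<lambda>x. \<beta> (x - lattice_vec \<gamma>) * V (h *\<^sub>R x)" "lattice_vec \<gamma>"] by (simp add: scaleR_right_distrib)
  qed
  also have "\<dots> = (LINT z|lborel. \<beta> z * (\<Sum>\<gamma>\<in>?S. V (?x \<gamma> + h *\<^sub>R z) * (v \<gamma>)\<^sup>2))"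
    using bi[OF Vc] by (simp add: sum_distrib_left mult.left_commute[of "\<beta> _"] mult.commute[of _ "(v _)\<^sup>2"] Bochner_Integration.integral_sum)
  also have "\<dots> \<le> (LINT z|lborel. \<beta> z * (P + 2 * ?n\<^sup>2 * E + R * N) + h * (\<Sum>i\<in>UNIV. A i * (\<beta> z * z $ i)))"
  proof (rule integral_mono)
    show "integrable lborel (\<lambda>z. \<beta> z * (\<Sum>\<gamma>\<in>?S. V (?x \<gamma> + h *\<^sub>R z) * (v \<gamma>)\<^sup>2))"
      by (intro bi continuous_on_sum continuous_on_mult Vc continuous_on_const)
    show "integrable lborel (\<lambda>z. \<beta> z * (P + 2 * ?n\<^sup>2 * E + R * N) + h * (\<Sum>i\<in>UNIV. A i * (\<beta> z * z $ i)))"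
      by (intro Bochner_Integration.integrable_add Bochner_Integration.integrable_sum integrable_mult_right bi continuous_on_const continuous_on_component continuous_on_id)
    fix z :: "real^'n"
    show "\<beta> z * (\<Sum>\<gamma>\<in>?S. V (?x \<gamma> + h *\<^sub>R z) * (v \<gamma>)\<^sup>2) \<le> \<beta> z * (P + 2 * ?n\<^sup>2 * E + R * N) + h * (\<Sum>i\<in>UNIV. A i * (\<beta> z * z $ i))"
    proof (cases "\<exists>i. 2 \<le> \<bar>z $ i\<bar>")
      case True
      then have "\<beta> z = 0" using tensor_outside[OF unit_kernel_Bs] by auto
      then show ?thesis by simp
    next
      case False
      then have "\<bar>z $ i\<bar> \<le> 2" for i by (auto simp: not_le intro: less_imp_le)
      from mult_left_mono[OF pw[OF this] b0[of z]] show ?thesis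
        by (simp add: distrib_left sum_distrib_left mult_ac add_ac)
    qed
  qed
  also have "\<dots> = P + 2 * ?n\<^sup>2 * E + R * N"
  proof -
    have i: "integrable lborel (\<lambda>z. \<beta> z * z $ i)" for i :: 'n by (intro bi continuous_on_component continuous_on_id)
    have "integrable lborel (\<beta> :: real^'n \<Rightarrow> real)" using bt(1)[of 0] by simp
    moreover have "(LINT z|lborel. \<beta> (z::real^'n)) = 1" using bt(2)[of 0] by simp
    ultimately show ?thesis using i by (simp add: Bochner_Integration.integral_sum \<beta>_linear_moment)
  qed
  finally show ?thesis unfolding N P E_def R_def by (simp add: mult_ac)
qed

text \<open>The trial function \<open>interp v\<close> has a squared norm at least that of
  \<open>v\<close> minus a multiple of the discrete energy, which is why \<open>lam\<close> is
  multiplied by a difference on the left. One constant has to serve all \<open>h\<close> and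
  \<open>lam\<close> at once, because later \<open>lam\<close> is the continuous bottom, which
  depends on \<open>h\<close>.\<close>

theorem continuous_le_discrete:
  "\<exists>C\<ge>0. \<forall>h v lam. 0 < h \<longrightarrow> finite {\<gamma>. v \<gamma> \<noteq> 0} \<longrightarrow> 0 \<le> lam \<longrightarrow>
    (\<forall>u\<in>C2c. lam * (LINT x|lborel. (u x)\<^sup>2) \<le> energy (\<lambda>x. V (h *\<^sub>R x)) u) \<longrightarrow>
    lam * ((LINT \<gamma>|count. (v \<gamma>)\<^sup>2) - C * discrete_energy (\<lambda>\<gamma>. V (h *\<^sub>R lattice_vec \<gamma>)) v)
      \<le> (1 + C * h) * discrete_energy (\<lambda>\<gamma>. V (h *\<^sub>R lattice_vec \<gamma>)) v + C * h^3 * (LINT \<gamma>|count. (v \<gamma>)\<^sup>2)"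
proof -
  obtain C0 where C0: "C0 \<ge> 0" and loss: "\<And>v::int^'n \<Rightarrow> real. finite {\<gamma>. v \<gamma> \<noteq> 0} \<Longrightarrow>
    (LINT \<gamma>|count. (v \<gamma>)\<^sup>2) - C0 * dir_energy v \<le> (LINT x|lborel. (interp v x)\<^sup>2)"
    using interp_norm_loss by blast
  let ?n = "real CARD('n)"
  \<comment> \<open>\<open>C1\<close> collects the second order terms proportional to the energy,
    \<open>C2\<close> the two cubic errors proportional to the squared norm; adding the norm loss
    \<open>C0\<close> gives a constant that covers all three.\<close>
  define C1 where "C1 = 2 * ?n\<^sup>2 * (4 * K + 1)"
  define C2 where "C2 = 2 * ?n\<^sup>2 * K + (2 * ?n)^3 * K"
  have C12: "0 \<le> C1" "0 \<le> C2" using K0 by (auto simp: C1_def C2_def)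
  have main: "lam * ((LINT \<gamma>|count. (v \<gamma>)\<^sup>2) - (C0 + C1 + C2) * discrete_energy (\<lambda>\<gamma>. V (h *\<^sub>R lattice_vec \<gamma>)) v)
      \<le> (1 + (C0 + C1 + C2) * h) * discrete_energy (\<lambda>\<gamma>. V (h *\<^sub>R lattice_vec \<gamma>)) v + (C0 + C1 + C2) * h^3 * (LINT \<gamma>|count. (v \<gamma>)\<^sup>2)"
    if h: "0 < h" and fin: "finite {\<gamma>. v \<gamma> \<noteq> 0}" and lam: "0 \<le> lam"
      and ge: "\<And>u. u \<in> C2c \<Longrightarrow> lam * (LINT x|lborel. (u x)\<^sup>2) \<le> energy (\<lambda>x. V (h *\<^sub>R x)) u" for h lam and v :: "int^'n \<Rightarrow> real"
  proof -
    define U where "U \<gamma> = V (h *\<^sub>R lattice_vec \<gamma>)" for \<gamma> :: "int^'n"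
    define N where "N = (LINT \<gamma>|count. (v \<gamma>)\<^sup>2)"
    define P where "P = (LINT \<gamma>|count. U \<gamma> * (v \<gamma>)\<^sup>2)"
    define D where "D = dir_energy v"
    have E: "discrete_energy U v = D + P" by (simp add: discrete_energy_eq P_def D_def)
    have P0: "0 \<le> P" unfolding P_def U_def using V_nonneg by (intro integral_nonneg_AE) auto
    have D0: "0 \<le> D" unfolding D_def dir_energy_def by (intro sum_nonneg integral_nonneg_AE) auto
    have N0: "0 \<le> N" unfolding N_def by (intro integral_nonneg_AE) auto
    have "lam * (N - C0 * D) \<le> lam * (LINT x|lborel. (interp v x)\<^sup>2)"
      unfolding N_def D_def by (intro mult_left_mono loss fin lam)
    also have "\<dots> \<le> energy (\<lambda>x. V (h *\<^sub>R x)) (interp v)" by (rule ge[OF interp_C2c[OF fin]])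
    also have "\<dots> \<le> D + (LINT x|lborel. V (h *\<^sub>R x) * (interp v x)\<^sup>2)"
      unfolding energy_def D_def dir_energy_def by (intro add_mono sum_mono interp_kinetic fin) simp
    also have "\<dots> \<le> D + (P + 2 * ?n\<^sup>2 * (h * ((4 * K + 1) * discrete_energy U v) + K * h^3 * N) + (2 * ?n)^3 * K * h^3 * N)"
      using interp_potential[OF fin h] unfolding N_def P_def U_def[abs_def] by linarith
    also have "\<dots> = (1 + C1 * h) * (D + P) + C2 * h^3 * N"
      unfolding E C1_def C2_def by (simp add: algebra_simps)
    finally have a: "lam * (N - C0 * D) \<le> (1 + C1 * h) * (D + P) + C2 * h^3 * N" .
    have "C0 * D \<le> (C0 + C1 + C2) * (D + P)" using C0 C12 D0 P0 by (intro mult_mono) auto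
    then have b: "lam * (N - (C0 + C1 + C2) * (D + P)) \<le> lam * (N - C0 * D)" using lam by (intro mult_left_mono) auto
    have c: "(1 + C1 * h) * (D + P) \<le> (1 + (C0 + C1 + C2) * h) * (D + P)" using C0 C12 D0 P0 h by (intro mult_right_mono add_left_mono) auto
    have d: "C2 * h^3 * N \<le> (C0 + C1 + C2) * h^3 * N" using C0 C12 N0 h by (intro mult_right_mono) auto
    show ?thesis using a b c d unfolding E[unfolded U_def[abs_def]] N_def[symmetric] by linarith
  qed
  show ?thesis
    by (rule exI[of _ "C0 + C1 + C2"], intro conjI allI impI main) (use C0 C12 in auto)
qed

end

section \<open>Periodic potentials\<close>

lemma lattice_translate_into_box: "\<exists>\<gamma>. x + lattice_vec \<gamma> \<in> cbox 0 (\<chi> i. 1)"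
proof
  have "0 \<le> x $ i - of_int \<lfloor>x $ i\<rfloor>" "x $ i - of_int \<lfloor>x $ i\<rfloor> \<le> 1" for i by linarith+
  then show "x + lattice_vec (\<chi> i. - \<lfloor>x $ i\<rfloor>) \<in> cbox 0 (\<chi> i. 1)"
    by (simp add: mem_box_cart)
qed

lemma periodic_bounded:
  fixes f :: "real^'n \<Rightarrow> real"
  assumes "continuous_on UNIV f" "lattice_periodic f"
  shows "\<exists>B\<ge>0. \<forall>x. norm (f x) \<le> B"
proof -
  have "compact (f ` cbox 0 (\<chi> i. 1))"
    by (intro compact_continuous_image continuous_on_subset[OF assms(1)]) auto
  then obtain B where B: "B > 0" "\<And>y. y \<in> f ` cbox 0 (\<chi> i. 1) \<Longrightarrow> norm y \<le> B"
    using compact_imp_bounded[THEN bounded_pos[THEN iffD1]] by (meson that)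
  have "norm (f x) \<le> B" for x
  proof -
    obtain \<gamma> where "x + lattice_vec \<gamma> \<in> cbox 0 (\<chi> i. 1)" using lattice_translate_into_box by blast
    then have "norm (f (x + lattice_vec \<gamma>)) \<le> B" using B(2) by blast
    then show ?thesis using assms(2) by (simp add: lattice_periodic_def)
  qed
  with B(1) show ?thesis by (intro exI[of _ B]) auto
qed

lemma periodic_attains_min:
  fixes f :: "real^'n \<Rightarrow> real"
  assumes "continuous_on UNIV f" "lattice_periodic f"
  shows "\<exists>x0. \<forall>x. f x0 \<le> f x"
proof -
  have "(0::real^'n) \<in> cbox 0 (\<chi> i. 1)" by (simp add: mem_box_cart)
  then have "cbox 0 (\<chi> i. 1) \<noteq> ({} :: (real^'n) set)" by blast
  from continuous_attains_inf[OF compact_cbox this continuous_on_subset[OF assms(1) subset_UNIV]]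
  obtain x0 where x0: "\<forall>y\<in>cbox 0 (\<chi> i. 1). f x0 \<le> f y" by blast
  have "f x0 \<le> f x" for x
  proof -
    obtain \<gamma> where "x + lattice_vec \<gamma> \<in> cbox 0 (\<chi> i. 1)" using lattice_translate_into_box by blast
    then have "f x0 \<le> f (x + lattice_vec \<gamma>)" using x0 by blast
    then show ?thesis using assms(2) by (simp add: lattice_periodic_def)
  qed
  then show ?thesis by blast
qed

lemma periodic_pd:
  assumes "C_k (Suc 0) f" "lattice_periodic f"
  shows "lattice_periodic (pd i f)"
  unfolding lattice_periodic_def
proof (intro allI)
  fix x \<gamma>
  have "(\<lambda>x. f (lattice_vec \<gamma> + 1 *\<^sub>R x)) = f" using assms(2) by (auto simp: lattice_periodic_def add.commute)
  then show "pd i f (x + lattice_vec \<gamma>) = pd i f x"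
    using pd_affine[OF assms(1), of i "lattice_vec \<gamma>" 1 x] by (simp add: add.commute)
qed

text \<open>Iterated partial derivatives are again continuous and periodic, hence bounded; as there
  are finitely many of each order, the bounds can be added up.\<close>

lemma periodic_bounded_potential:
  fixes f :: "real^'n \<Rightarrow> real"
  assumes f: "smooth f" "lattice_periodic f" and nonneg: "\<And>x. 0 \<le> f x"
  shows "\<exists>K. bounded_potential f K"
proof -
  have pp: "\<exists>B\<ge>0. \<forall>x. norm (g x) \<le> B" if "smooth g" "lattice_periodic g" for g :: "real^'n \<Rightarrow> real"
    by (rule periodic_bounded[OF C_k_continuous[OF smooth_C_k[OF that(1)]] that(2)])
  have pdp: "smooth (pd i g) \<and> lattice_periodic (pd i g)" if "smooth g \<and> lattice_periodic g" for g :: "real^'n \<Rightarrow> real" and i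
    using that smooth_pd periodic_pd smooth_C_k by blast
  obtain B0 where B0: "B0 \<ge> 0" "\<And>x. norm (f x) \<le> B0" using pp f by blast
  have "\<exists>B\<ge>0. \<forall>(p::'n \<times> 'n) x. norm ((case p of (i, j) \<Rightarrow> pd i (pd j f)) x) \<le> B"
  proof (rule uniform_bound)
    fix p :: "'n \<times> 'n"
    obtain i j where "p = (i, j)" by fastforce
    then show "\<exists>B\<ge>0. \<forall>x. norm ((case p of (i, j) \<Rightarrow> pd i (pd j f)) x) \<le> B"
      using pp pdp[OF pdp, of f i j] f by simp
  qed
  then obtain B2 where B2: "B2 \<ge> 0" "\<And>i j x. norm (pd i (pd j f) x) \<le> B2" by auto
  have "\<exists>B\<ge>0. \<forall>(p::'n \<times> 'n \<times> 'n) x. norm ((case p of (i, j, k) \<Rightarrow> pd i (pd j (pd k f))) x) \<le> B"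
  proof (rule uniform_bound)
    fix p :: "'n \<times> 'n \<times> 'n"
    obtain i j k where "p = (i, j, k)" by (cases p) auto
    then show "\<exists>B\<ge>0. \<forall>x. norm ((case p of (i, j, k) \<Rightarrow> pd i (pd j (pd k f))) x) \<le> B"
      using pp pdp[OF pdp[OF pdp], of f i j k] f by simp
  qed
  then obtain B3 where B3: "B3 \<ge> 0" "\<And>i j k x. norm (pd i (pd j (pd k f)) x) \<le> B3" by auto
  have "bounded_potential f (B0 + B2 + B3)"
  proof
    show "f x \<le> B0 + B2 + B3" for x using B0(2)[of x] B2(1) B3(1) by simp
    show "\<bar>pd i (pd j (pd k f)) x\<bar> \<le> B0 + B2 + B3" for i j k x using B3(2)[of i j k x] B2(1) B0(1) by simp
    show "\<bar>pd i (pd j f) x\<bar> \<le> B0 + B2 + B3" for i j x using B2(2)[of i j x] B3(1) B0(1) by simp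
  qed (use smooth_C_k[OF f(1)] nonneg B0(1) B2(1) B3(1) in auto)
  then show ?thesis by blast
qed

text \<open>By connectedness only the empty set and the whole space have empty frontier. The
  translates of the first do not cover, those of the second have overlapping interiors.\<close>

lemma frontier_fundamental_domain:
  assumes "fundamental_domain (F :: (real^'n) set)"
  shows "frontier F \<noteq> {}"
proof
  assume "frontier F = {}"
  then consider "F = {}" | "F = UNIV" using frontier_eq_empty by auto
  then show False
  proof cases
    case 1
    then show False using assms by (simp add: fundamental_domain_def)
  next
    case 2
    have "(+) (lattice_vec 0) ` interior F \<inter> (+) (lattice_vec (\<chi> i. 1)) ` interior F = {}"
      using assms unfolding fundamental_domain_def by (metis (lifting) one_vec_def zero_neq_one)
    with 2 show False by simp
  qed
qed

section \<open>A lower bound for the continuous bottom\<close>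

text \<open>Dilating by \<open>t\<close> turns the shift into a unit step; \<open>t = 0\<close> is
  separate because the dilation degenerates.\<close>

lemma axis_shift_difference:
  fixes u :: "real^'n \<Rightarrow> real"
  assumes u: "C_k (Suc 0) u" and supp: "bounded {x. u x \<noteq> 0}"
  shows "(LINT x|lborel. (u (x + axis i t) - u x)\<^sup>2) \<le> t\<^sup>2 * (LINT x|lborel. (pd i u x)\<^sup>2)"
proof (cases "t = 0")
  case True
  have "axis i 0 = (0 :: real^'n)" by (simp add: vec_eq_iff axis_def)
  show ?thesis unfolding True \<open>axis i 0 = (0 :: real^'n)\<close> by simp
next
  case False
  define w where "w x = u (0 + t *\<^sub>R x)" for x
  have w: "C_k (Suc 0) w" "bounded {x. w x \<noteq> 0}" unfolding w_def[abs_def]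
    using C_k_affine[OF u] bounded_support_affine[OF supp False] by blast+
  have uc: "continuous_on UNIV u" and pc: "continuous_on UNIV (pd i u)"
    using C_k_continuous[OF u] u by (auto simp: C_k_Suc)
  have sc: "continuous_on UNIV (\<lambda>x. u (x + axis i t))"
    by (intro continuous_on_compose2[OF uc] continuous_on_add continuous_on_id continuous_on_const) auto
  have m: "(\<lambda>x. (u (x + axis i t) - u x)\<^sup>2) \<in> borel_measurable borel" "(\<lambda>x. (pd i u x)\<^sup>2) \<in> borel_measurable borel"
    by (intro borel_measurable_continuous_onI continuous_intros uc pc sc)+
  have ax: "t *\<^sub>R axis i 1 = axis i t" by (simp add: vec_eq_iff axis_def)
  have "(LINT x|lborel. (u (x + axis i t) - u x)\<^sup>2) = \<bar>t\<bar>^CARD('n) *\<^sub>R (LINT x|lborel. (w (x + axis i 1) - w x)\<^sup>2)"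
    using lborel_integral_affine[OF m(1) False, of 0] by (simp add: w_def scaleR_right_distrib ax)
  also have "\<dots> \<le> \<bar>t\<bar>^CARD('n) *\<^sub>R (LINT x|lborel. (pd i w x)\<^sup>2)"
    by (intro scaleR_left_mono translate_diff_le_pd w) auto
  also have "\<dots> = t\<^sup>2 * (\<bar>t\<bar>^CARD('n) *\<^sub>R (LINT x|lborel. (pd i u (0 + t *\<^sub>R x))\<^sup>2))"
    unfolding w_def[abs_def] pd_affine[OF u] by (simp add: power_mult_distrib)
  also have "\<bar>t\<bar>^CARD('n) *\<^sub>R (LINT x|lborel. (pd i u (0 + t *\<^sub>R x))\<^sup>2) = (LINT x|lborel. (pd i u x)\<^sup>2)"
    using lborel_integral_affine[OF m(2) False, of 0] by simp
  finally show ?thesis .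
qed

lemma shift_difference_integrable:
  fixes u :: "real^'n \<Rightarrow> real"
  assumes u: "continuous_on UNIV u" and supp: "bounded {x. u x \<noteq> 0}"
  shows "integrable lborel (\<lambda>x. (u (x + a) - u (x + b))\<^sup>2)"
proof (rule integrable_bounded_support)
  have tb: "bounded {x. u (x + a) \<noteq> 0}" for a using bounded_support_affine[OF supp, of 1 a] by (simp add: add.commute)
  have "continuous_on UNIV (\<lambda>x. u (x + a))" for a
    by (intro continuous_on_compose2[OF u] continuous_on_add continuous_on_id continuous_on_const) auto
  then show "continuous_on UNIV (\<lambda>x. (u (x + a) - u (x + b))\<^sup>2)" by (intro continuous_intros)
  show "bounded {x. (u (x + a) - u (x + b))\<^sup>2 \<noteq> 0}"
    by (rule bounded_subset[OF bounded_Un[THEN iffD2, OF conjI[OF tb[of a] tb[of b]]]]) auto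
qed

text \<open>The shift is carried out one coordinate at a time. Splitting a square costs a factor 2
  in each step, and \<open>2 + 2 * 4^k \<le> 4^(k + 1)\<close> yields the power of 4.\<close>

lemma shift_difference_energy:
  fixes u :: "real^'n \<Rightarrow> real"
  assumes u: "C_k (Suc 0) u" and supp: "bounded {x. u x \<noteq> 0}" and z: "\<And>i. \<bar>z $ i\<bar> \<le> T"
  shows "(LINT x|lborel. (u (x + z) - u x)\<^sup>2) \<le> 4^CARD('n) * T\<^sup>2 * (\<Sum>i\<in>UNIV. LINT x|lborel. (pd i u x)\<^sup>2)"
proof -
  define D where "D = (\<Sum>i\<in>UNIV. LINT x|lborel. (pd i u x)\<^sup>2)"
  have D0: "D \<ge> 0" unfolding D_def by (intro sum_nonneg integral_nonneg_AE) auto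
  have Di: "(LINT x|lborel. (pd i u x)\<^sup>2) \<le> D" for i unfolding D_def
    by (rule member_le_sum[of i UNIV "\<lambda>i. LINT x|lborel. (pd i u x)\<^sup>2"]) auto
  have uc: "continuous_on UNIV u" using u by (rule C_k_continuous)
  note I = shift_difference_integrable[OF uc supp]
  have "(LINT x|lborel. (u (x + (\<Sum>i\<in>J. axis i (z $ i))) - u x)\<^sup>2) \<le> 4^card J * T\<^sup>2 * D" if "finite J" for J :: "'n set"
    using that
  proof (induction J)
    case empty
    show ?case using D0 by simp
  next
    case (insert j J)
    let ?y = "\<Sum>i\<in>J. axis i (z $ i)" and ?a = "axis j (z $ j)"
    have sq: "(z $ j)\<^sup>2 \<le> T\<^sup>2" using z[of j] by (simp add: abs_le_square_iff[symmetric])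
    have "(LINT x|lborel. (u (x + (?a + ?y)) - u x)\<^sup>2) \<le> (LINT x|lborel. 2 * (u (x + (?a + ?y)) - u (x + ?y))\<^sup>2 + 2 * (u (x + ?y) - u (x + 0))\<^sup>2)"
    proof (rule integral_mono)
      show "integrable lborel (\<lambda>x. (u (x + (?a + ?y)) - u x)\<^sup>2)" using I[of "?a + ?y" 0] by simp
      show "integrable lborel (\<lambda>x. 2 * (u (x + (?a + ?y)) - u (x + ?y))\<^sup>2 + 2 * (u (x + ?y) - u (x + 0))\<^sup>2)"
        by (intro Bochner_Integration.integrable_add integrable_mult_right I)
      show "(u (x + (?a + ?y)) - u x)\<^sup>2 \<le> 2 * (u (x + (?a + ?y)) - u (x + ?y))\<^sup>2 + 2 * (u (x + ?y) - u (x + 0))\<^sup>2" for x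
        using norm_add_square_le[of "u (x + (?a + ?y)) - u (x + ?y)" "u (x + ?y) - u x"] by simp
    qed
    also have "\<dots> = 2 * (LINT x|lborel. (u (x + (?a + ?y)) - u (x + ?y))\<^sup>2) + 2 * (LINT x|lborel. (u (x + ?y) - u x)\<^sup>2)"
      using I[of "?a + ?y" ?y] I[of ?y 0] by simp
    also have "(LINT x|lborel. (u (x + (?a + ?y)) - u (x + ?y))\<^sup>2) = (LINT x|lborel. (u (x + ?a) - u x)\<^sup>2)"
    proof -
      have "integrable lborel (\<lambda>x. (u (x + ?a) - u x)\<^sup>2)" using I[of ?a 0] by simp
      from lborel_integral_translate[of "\<lambda>x. (u (x + ?a) - u x)\<^sup>2" ?y] borel_measurable_integrable[OF this]
      show ?thesis by (simp add: add_ac)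
    qed
    also have "\<dots> \<le> (z $ j)\<^sup>2 * (LINT x|lborel. (pd j u x)\<^sup>2)" by (rule axis_shift_difference[OF u supp])
    also have "\<dots> \<le> T\<^sup>2 * D" using sq Di by (intro mult_mono) auto
    finally have "(LINT x|lborel. (u (x + (?a + ?y)) - u x)\<^sup>2) \<le> 2 * (T\<^sup>2 * D) + 2 * (4^card J * T\<^sup>2 * D)"
      using insert.IH by linarith
    also have "\<dots> \<le> 4^card (insert j J) * T\<^sup>2 * D"
    proof -
      have "1 * (T\<^sup>2 * D) \<le> 4^card J * (T\<^sup>2 * D)" using D0 by (intro mult_right_mono) auto
      then show ?thesis using insert.hyps by (simp add: mult_ac)
    qed
    finally show ?case using insert.hyps by simp
  qed
  from this[of UNIV] have "(LINT x|lborel. (u (x + (\<Sum>i\<in>UNIV. axis i (z $ i))) - u x)\<^sup>2) \<le> 4^CARD('n) * T\<^sup>2 * D" by simp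
  moreover have "(\<Sum>i\<in>UNIV. axis i (z $ i)) = z" by (simp add: vec_eq_iff axis_def)
  ultimately show ?thesis by (simp add: D_def)
qed

text \<open>The open sets where a translate of \<open>f\<close> exceeds \<open>c\<close> cover the
  compact unit cell, since a suitable shift takes any point to \<open>x1\<close>; a finite subcover
  works everywhere by periodicity.\<close>

lemma periodic_finite_shifts:
  fixes f :: "real^'n \<Rightarrow> real"
  assumes f: "continuous_on UNIV f" "lattice_periodic f" and c: "c < f x1"
  shows "\<exists>A. finite A \<and> (\<forall>y. \<exists>s\<in>A. c < f (y + s))"
proof -
  let ?Q = "cbox 0 (\<chi> i. 1) :: (real^'n) set"
  have op: "open {y. c < f (y + s)}" for s
  proof -
    have "continuous_on UNIV (\<lambda>y. f (y + s))"
      by (intro continuous_on_compose2[OF f(1)] continuous_on_add continuous_on_id continuous_on_const) auto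
    then show ?thesis using open_Collect_less[OF continuous_on_const] by blast
  qed
  have "?Q \<subseteq> (\<Union>s\<in>UNIV. {y. c < f (y + s)})"
  proof
    fix y
    have "y \<in> {y. c < f (y + (x1 - y))}" for y using c by simp
    then show "y \<in> (\<Union>s\<in>UNIV. {y. c < f (y + s)})" using c by (auto intro!: exI[of _ "x1 - y"])
  qed
  then obtain A where A: "finite A" "?Q \<subseteq> (\<Union>s\<in>A. {y. c < f (y + s)})"
    using compactE_image[OF compact_cbox, of UNIV "\<lambda>s. {y. c < f (y + s)}"] op by (metis (lifting))
  have "\<exists>s\<in>A. c < f (y + s)" for y
  proof -
    obtain \<gamma> where "y + lattice_vec \<gamma> \<in> ?Q" using lattice_translate_into_box by blast
    then obtain s where s: "s \<in> A" "c < f (y + lattice_vec \<gamma> + s)" using A(2) by auto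
    have "f (y + lattice_vec \<gamma> + s) = f (y + s + lattice_vec \<gamma>)" by (simp add: add_ac)
    also have "\<dots> = f (y + s)" using f(2) by (simp add: lattice_periodic_def)
    finally show ?thesis using s by auto
  qed
  with A(1) show ?thesis by blast
qed

context bounded_potential begin

lemma energy_nonneg: "0 \<le> energy (\<lambda>x. V (h *\<^sub>R x)) u"
  unfolding energy_def using V_nonneg by (intro add_nonneg_nonneg sum_nonneg integral_nonneg_AE) auto

lemma discrete_energy_nonneg: "0 \<le> discrete_energy (\<lambda>\<gamma>. V (h *\<^sub>R lattice_vec \<gamma>)) v"
  unfolding discrete_energy_def using V_nonneg by (intro add_nonneg_nonneg sum_nonneg integral_nonneg_AE) auto

text \<open>Finitely many translates of \<open>V\<close> add up to a function bounded below, and translating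
  \<open>u\<close> by \<open>s / h\<close> costs at most a multiple of \<open>h\<^sup>-\<^sup>2\<close> times the kinetic energy.\<close>

lemma energy_lower_bound:
  assumes per: "lattice_periodic V" and x1: "0 < V x1"
  shows "\<exists>c>0. \<forall>h u. 0 < h \<longrightarrow> h \<le> 1 \<longrightarrow> u \<in> C2c \<longrightarrow> c * h\<^sup>2 * (LINT x|lborel. (u x)\<^sup>2) \<le> energy (\<lambda>x. V (h *\<^sub>R x)) u"
proof -
  \<comment> \<open>Strictly below \<open>V x1\<close>, as the open cover in
    \<open>periodic_finite_shifts\<close> requires.\<close>
  define c0 where "c0 = V x1 / 2"
  have c0: "0 < c0" "c0 < V x1" using x1 by (auto simp: c0_def)
  obtain A where A: "finite A" "\<And>y. \<exists>s\<in>A. c0 < V (y + s)"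
    using periodic_finite_shifts[OF V_cont per c0(2)] by blast
  have sumA: "c0 \<le> (\<Sum>s\<in>A. V (y + s))" for y
  proof -
    obtain s where "s \<in> A" "c0 < V (y + s)" using A(2) by blast
    moreover have "V (y + s) \<le> (\<Sum>s\<in>A. V (y + s))" using A(1) \<open>s \<in> A\<close> V_nonneg by (intro member_le_sum) auto
    ultimately show ?thesis by linarith
  qed
  define T where "T = (\<Sum>s\<in>A. norm s)"
  have T: "\<bar>s $ i\<bar> \<le> T" if "s \<in> A" for s i
    using component_le_norm_cart[of s i] member_le_sum[of s A norm] that A(1) by (simp add: T_def)
  \<comment> \<open>The first summand is the cost of the shifts after multiplication by
    \<open>h\<^sup>2\<close>; the 2 takes care of \<open>2 * (h\<^sup>2 * P)\<close>, where
    \<open>h \<le> 1\<close>.\<close>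
  define M where "M = 2 * K * 4^CARD('n) * T\<^sup>2 + 2"
  have M0: "0 < M" using K0 by (simp add: M_def add_nonneg_pos)
  have main: "c0 * h\<^sup>2 * (LINT x|lborel. (u x)\<^sup>2) \<le> real (card A) * M * energy (\<lambda>x. V (h *\<^sub>R x)) u"
    if h: "0 < h" "h \<le> 1" and u: "u \<in> C2c" for h u
  proof -
    have u2: "C_k (Suc (Suc 0)) u" "bounded {x. u x \<noteq> 0}" using u by (auto simp: C2c_def)
    note u1 = C_k_SucD[OF u2(1)]
    have uc: "continuous_on UNIV u" using u1 by (rule C_k_continuous)
    define P where "P = (LINT x|lborel. V (h *\<^sub>R x) * (u x)\<^sup>2)"
    define D where "D = (\<Sum>i\<in>UNIV. LINT x|lborel. (pd i u x)\<^sup>2)"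
    have P0: "0 \<le> P" unfolding P_def using V_nonneg by (intro integral_nonneg_AE) auto
    have D0: "0 \<le> D" unfolding D_def by (intro sum_nonneg integral_nonneg_AE) auto
    have Vs: "continuous_on UNIV (\<lambda>x. V (h *\<^sub>R x + s))" for s
      by (intro continuous_on_compose2[OF V_cont] continuous_on_add continuous_on_const continuous_on_scaleR continuous_on_id) auto
    have i1: "integrable lborel (\<lambda>x. V (h *\<^sub>R x + s) * (u x)\<^sup>2)" for s by (rule C2c_integrable(2)[OF u Vs])
    have iP: "integrable lborel (\<lambda>x. V (h *\<^sub>R x) * (u x)\<^sup>2)" by (rule C2c_integrable(2)[OF u scaled_cont])
    have mP: "(\<lambda>x. V (h *\<^sub>R x) * (u x)\<^sup>2) \<in> borel_measurable borel"
      by (intro borel_measurable_continuous_onI continuous_intros scaled_cont uc)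
    \<comment> \<open>Split \<open>u x\<close> into \<open>u (x + ?z)\<close> and a difference: the
      first part meets \<open>V\<close> at \<open>h *\<^sub>R (?z + x) = h *\<^sub>R x + s\<close>
      and integrates to \<open>P\<close>, the second is bounded by the kinetic energy.\<close>
    have shift: "(LINT x|lborel. V (h *\<^sub>R x + s) * (u x)\<^sup>2) \<le> 2 * P + 2 * K * (4^CARD('n) * (T / h)\<^sup>2 * D)" if s: "s \<in> A" for s
    proof -
      let ?z = "(1 / h) *\<^sub>R s"
      have hz: "h *\<^sub>R (?z + x) = h *\<^sub>R x + s" for x using h by (simp add: scaleR_right_distrib add.commute)
      have ish: "integrable lborel (\<lambda>x. V (h *\<^sub>R (?z + x)) * (u (?z + x))\<^sup>2)"
        using lborel_integrable_affine[OF mP _ iP, of 1 ?z] by simp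
      have d: "integrable lborel (\<lambda>x. (u (x + ?z) - u x)\<^sup>2)" using shift_difference_integrable[OF uc u2(2), of ?z 0] by simp
      have "(LINT x|lborel. V (h *\<^sub>R x + s) * (u x)\<^sup>2) \<le> (LINT x|lborel. 2 * (V (h *\<^sub>R (?z + x)) * (u (?z + x))\<^sup>2) + 2 * K * (u (x + ?z) - u x)\<^sup>2)"
      proof (rule integral_mono)
        show "integrable lborel (\<lambda>x. 2 * (V (h *\<^sub>R (?z + x)) * (u (?z + x))\<^sup>2) + 2 * K * (u (x + ?z) - u x)\<^sup>2)"
          by (intro Bochner_Integration.integrable_add integrable_mult_right ish d)
        fix x
        have "(u x)\<^sup>2 \<le> 2 * (u (?z + x))\<^sup>2 + 2 * (u (x + ?z) - u x)\<^sup>2"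
          using norm_add_square_le[of "u (?z + x)" "- (u (x + ?z) - u x)"] by (simp add: add.commute power2_commute)
        then have "V (h *\<^sub>R x + s) * (u x)\<^sup>2 \<le> V (h *\<^sub>R x + s) * (2 * (u (?z + x))\<^sup>2 + 2 * (u (x + ?z) - u x)\<^sup>2)"
          using V_nonneg by (intro mult_left_mono) auto
        also have "\<dots> = 2 * (V (h *\<^sub>R x + s) * (u (?z + x))\<^sup>2) + V (h *\<^sub>R x + s) * (2 * (u (x + ?z) - u x)\<^sup>2)"
          by (simp add: distrib_left)
        also have "V (h *\<^sub>R x + s) * (2 * (u (x + ?z) - u x)\<^sup>2) \<le> K * (2 * (u (x + ?z) - u x)\<^sup>2)"
          using V_bound by (intro mult_right_mono) auto
        finally show "V (h *\<^sub>R x + s) * (u x)\<^sup>2 \<le> 2 * (V (h *\<^sub>R (?z + x)) * (u (?z + x))\<^sup>2) + 2 * K * (u (x + ?z) - u x)\<^sup>2"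
          unfolding hz by simp
      qed (rule i1)
      also have "\<dots> = 2 * (LINT x|lborel. V (h *\<^sub>R (?z + x)) * (u (?z + x))\<^sup>2) + 2 * K * (LINT x|lborel. (u (x + ?z) - u x)\<^sup>2)"
        using ish d by simp
      also have "(LINT x|lborel. V (h *\<^sub>R (?z + x)) * (u (?z + x))\<^sup>2) = P"
        unfolding P_def using lborel_integral_translate[of "\<lambda>x. V (h *\<^sub>R x) * (u x)\<^sup>2" ?z] mP by simp
      also have "(LINT x|lborel. (u (x + ?z) - u x)\<^sup>2) \<le> 4^CARD('n) * (T / h)\<^sup>2 * D"
        unfolding D_def by (rule shift_difference_energy[OF u1 u2(2)]) (use T[OF s] h in \<open>simp add: abs_mult divide_right_mono\<close>)
      finally show ?thesis using K0 mult_left_mono[of _ _ "2 * K"] by simp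
    qed
    have "c0 * (LINT x|lborel. (u x)\<^sup>2) = (LINT x|lborel. c0 * (u x)\<^sup>2)" by simp
    also have "\<dots> \<le> (LINT x|lborel. (\<Sum>s\<in>A. V (h *\<^sub>R x + s) * (u x)\<^sup>2))"
    proof (rule integral_mono)
      show "integrable lborel (\<lambda>x. c0 * (u x)\<^sup>2)" by (rule C2c_integrable(2)[OF u continuous_on_const])
      show "integrable lborel (\<lambda>x. \<Sum>s\<in>A. V (h *\<^sub>R x + s) * (u x)\<^sup>2)" by (intro Bochner_Integration.integrable_sum i1)
      show "c0 * (u x)\<^sup>2 \<le> (\<Sum>s\<in>A. V (h *\<^sub>R x + s) * (u x)\<^sup>2)" for x
        unfolding sum_distrib_right[symmetric] by (intro mult_right_mono sumA) simp
    qed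
    also have "\<dots> = (\<Sum>s\<in>A. LINT x|lborel. V (h *\<^sub>R x + s) * (u x)\<^sup>2)" by (rule Bochner_Integration.integral_sum[OF i1])
    also have "\<dots> \<le> (\<Sum>s\<in>A. 2 * P + 2 * K * (4^CARD('n) * (T / h)\<^sup>2 * D))" by (intro sum_mono shift)
    also have "\<dots> = real (card A) * (2 * P + 2 * K * (4^CARD('n) * (T / h)\<^sup>2 * D))" by simp
    finally have "h\<^sup>2 * (c0 * (LINT x|lborel. (u x)\<^sup>2)) \<le> h\<^sup>2 * (real (card A) * (2 * P + 2 * K * (4^CARD('n) * (T / h)\<^sup>2 * D)))"
      by (intro mult_left_mono) auto
    also have "\<dots> = real (card A) * (2 * (h\<^sup>2 * P) + (2 * K * 4^CARD('n) * T\<^sup>2) * D)"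
      using h by (simp add: power_divide field_simps)
    also have "\<dots> \<le> real (card A) * (M * (D + P))"
    proof (intro mult_left_mono)
      have "h\<^sup>2 \<le> 1" using h by (simp add: power_le_one)
      then have "h\<^sup>2 * P \<le> 1 * P" using P0 by (intro mult_right_mono) auto
      moreover have "0 \<le> (2 * K * 4^CARD('n) * T\<^sup>2) * P" using K0 P0 by (intro mult_nonneg_nonneg) auto
      moreover have "M * (D + P) = (2 * K * 4^CARD('n) * T\<^sup>2) * D + (2 * K * 4^CARD('n) * T\<^sup>2) * P + 2 * D + 2 * P"
        unfolding M_def by (simp only: distrib_left distrib_right add_ac)
      ultimately show "2 * (h\<^sup>2 * P) + (2 * K * 4^CARD('n) * T\<^sup>2) * D \<le> M * (D + P)" using D0 by linarith
    qed simp
    finally show ?thesis by (simp add: energy_def D_def P_def mult_ac)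
  qed
  have A0: "0 < card A" using A by (metis card_gt_0_iff empty_iff)
  have "c0 / (real (card A) * M) * h\<^sup>2 * (LINT x|lborel. (u x)\<^sup>2) \<le> energy (\<lambda>x. V (h *\<^sub>R x)) u"
    if h: "0 < h" "h \<le> 1" "u \<in> C2c" for h u
    using main[OF h] M0 A0 by (simp add: field_simps)
  then show ?thesis using c0 M0 A0 by (intro exI[of _ "c0 / (real (card A) * M)"]) auto
qed

end

section \<open>Comparison of the two bottoms\<close>

lemma \<beta>_square_pos: "0 < (LINT x|lborel. (\<beta> (x::real^'n))\<^sup>2)"
proof -
  have c: "continuous_on UNIV (\<beta> :: real^'n \<Rightarrow> real)" by (intro tensor_continuous unit_kernel_Bs)
  have "bounded {x::real^'n. (\<beta> x)\<^sup>2 \<noteq> 0}"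
    using tensor_bounded_support[of "\<lambda>i::'n. Bs", OF unit_kernel_Bs] by simp
  then have i: "integrable lborel (\<lambda>x::real^'n. (\<beta> x)\<^sup>2)"
    by (intro integrable_bounded_support continuous_on_power c)
  have False if "(LINT x|lborel. (\<beta> (x::real^'n))\<^sup>2) = 0"
  proof -
    have "AE x::real^'n in lborel. (\<beta> x)\<^sup>2 = 0"
      using integral_nonneg_eq_0_iff_AE[OF i] that by simp
    then have "(LINT x|lborel. \<beta> (x::real^'n)) = (LINT x|(lborel :: (real^'n) measure). 0)"
      by (intro integral_cong_AE) (use borel_measurable_continuous_onI[OF c] in auto)
    then show False using tensor_integral[of "\<lambda>i::'n. Bs", OF unit_kernel_Bs] by simp
  qed
  moreover have "0 \<le> (LINT x|lborel. (\<beta> (x::real^'n))\<^sup>2)" by (intro integral_nonneg_AE) auto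
  ultimately show ?thesis unfolding less_le by metis
qed

lemma \<beta>_C2c: "\<beta> \<in> (C2c :: (real^'n \<Rightarrow> real) set)"
  unfolding C2c_def using C2_\<beta> tensor_bounded_support[of "\<lambda>i::'n. Bs", OF unit_kernel_Bs] by blast

text \<open>The supremum of the admissible constants is itself admissible, as comparison with each
  quotient \<open>Q a / N a\<close> shows. The element \<open>a0\<close> keeps the set of constants
  bounded above, and 0 belongs to it.\<close>

lemma sharp_constant:
  fixes N Q :: "'a \<Rightarrow> real"
  assumes N: "\<And>a. a \<in> A \<Longrightarrow> 0 \<le> N a" and Q: "\<And>a. a \<in> A \<Longrightarrow> 0 \<le> Q a" and a0: "a0 \<in> A" "0 < N a0"
  shows "\<exists>E. (\<forall>a\<in>A. E * N a \<le> Q a) \<and> (\<forall>c. (\<forall>a\<in>A. c * N a \<le> Q a) \<longrightarrow> c \<le> E)"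
proof -
  let ?S = "{c. \<forall>a\<in>A. c * N a \<le> Q a}"
  have S0: "0 \<in> ?S" using Q by simp
  have bd: "c \<le> Q a / N a" if "c \<in> ?S" "a \<in> A" "0 < N a" for c a
    using that by (simp add: field_simps)
  then have bdd: "bdd_above ?S" using a0 by (intro bdd_aboveI[of _ "Q a0 / N a0"]) blast
  have "Sup ?S * N a \<le> Q a" if a: "a \<in> A" for a
  proof (cases "N a = 0")
    case True
    then show ?thesis using Q[OF a] by simp
  next
    case False
    then have p: "0 < N a" using N[OF a] by simp
    have "?S \<noteq> {}" using S0 by blast
    then have "Sup ?S \<le> Q a / N a" by (rule cSup_least) (rule bd[OF _ a p])
    then show ?thesis using p by (simp add: field_simps)
  qed
  moreover have "c \<le> Sup ?S" if "\<forall>a\<in>A. c * N a \<le> Q a" for c using that bdd by (intro cSup_upper) auto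
  ultimately show ?thesis by blast
qed

context bounded_potential begin

lemma ex_continuous_bottom:
  "\<exists>E. (\<forall>u\<in>C2c. E * (LINT x|lborel. (u x)\<^sup>2) \<le> energy (\<lambda>x. V (h *\<^sub>R x)) u) \<and>
    (\<forall>c. (\<forall>u\<in>C2c. c * (LINT x|lborel. (u x)\<^sup>2) \<le> energy (\<lambda>x. V (h *\<^sub>R x)) u) \<longrightarrow> c \<le> E)"
  by (rule sharp_constant[where N = "\<lambda>u. LINT x|lborel. (u x)\<^sup>2", OF _ energy_nonneg \<beta>_C2c \<beta>_square_pos]) simp

lemma ex_discrete_bottom:
  "\<exists>E. (\<forall>v\<in>{v. finite {\<gamma>. v \<gamma> \<noteq> 0}}. E * (LINT \<gamma>|count. (v \<gamma>)\<^sup>2) \<le> discrete_energy (\<lambda>\<gamma>. V (h *\<^sub>R lattice_vec \<gamma>)) v) \<and>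
    (\<forall>c. (\<forall>v\<in>{v. finite {\<gamma>. v \<gamma> \<noteq> 0}}. c * (LINT \<gamma>|count. (v \<gamma>)\<^sup>2) \<le> discrete_energy (\<lambda>\<gamma>. V (h *\<^sub>R lattice_vec \<gamma>)) v) \<longrightarrow> c \<le> E)"
proof (rule sharp_constant[where N = "\<lambda>v. LINT \<gamma>|count. (v \<gamma>)\<^sup>2", OF _ discrete_energy_nonneg])
  let ?v = "\<lambda>\<gamma>::int^'n. if \<gamma> = 0 then 1 else 0 :: real"
  show v: "?v \<in> {v. finite {\<gamma>. v \<gamma> \<noteq> 0}}" by simp
  show "0 < (LINT \<gamma>|count. (?v \<gamma>)\<^sup>2)"
    using count_integral_eq_sum[of ?v "\<lambda>_. 1"] v by simp
qed simp

text \<open>The trial function is \<open>\<beta>\<close> centred at \<open>x0 / h\<close> and spread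
  over the length \<open>1 / sqrt h\<close>. This scale balances both energies: the kinetic part
  gains a factor \<open>h\<close>, and so does the potential part, since \<open>V\<close> vanishes
  to second order at its zero \<open>x0\<close>.\<close>

lemma trial_bound:
  assumes x0: "V x0 = 0" and h: "0 < h"
    and ge: "\<And>u. u \<in> C2c \<Longrightarrow> E * (LINT x|lborel. (u x)\<^sup>2) \<le> energy (\<lambda>x. V (h *\<^sub>R x)) u"
  shows "E * (LINT y|lborel. (\<beta> (y::real^'n))\<^sup>2)
    \<le> h * ((\<Sum>i\<in>UNIV. LINT y|lborel. (pd i \<beta> (y::real^'n))\<^sup>2) + (2 * real CARD('n))\<^sup>2 * K * (LINT y|lborel. (\<beta> (y::real^'n))\<^sup>2))"
proof -
  define s where "s = sqrt h"
  have s: "0 < s" "s * s = h" "s\<^sup>2 = h" using h by (auto simp: s_def)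
  \<comment> \<open>Makes \<open>h *\<^sub>R x = x0 + s *\<^sub>R (a + s *\<^sub>R x)\<close>, so
    the substitution \<open>y = a + s *\<^sub>R x\<close> centres \<open>V\<close> at
    \<open>x0\<close>.\<close>
  define a where "a = - (1 / s) *\<^sub>R x0"
  define u where "u x = \<beta> (a + s *\<^sub>R x)" for x
  let ?S = "\<bar>s\<bar>^CARD('n)"
  have b: "C_k (Suc (Suc 0)) (\<beta> :: real^'n \<Rightarrow> real)" "bounded {x::real^'n. \<beta> x \<noteq> 0}" using \<beta>_C2c by (auto simp: C2c_def)
  have u: "u \<in> C2c" unfolding C2c_def u_def[abs_def] using C_k_affine[OF b(1)] bounded_support_affine[OF b(2)] s by auto
  have pdu: "pd i u x = s * pd i \<beta> (a + s *\<^sub>R x)" for i x unfolding u_def[abs_def] using pd_affine[OF C_k_SucD[OF b(1)]] by simp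
  have bc: "continuous_on UNIV (\<beta> :: real^'n \<Rightarrow> real)" "continuous_on UNIV (pd i \<beta> :: real^'n \<Rightarrow> real)" for i
    by (rule C_k_continuous[OF b(1)]) (rule C_k_continuous[OF C_k_pd[OF b(1)]])
  have Vc: "continuous_on UNIV (\<lambda>y. V (x0 + s *\<^sub>R y))"
    by (intro continuous_on_compose2[OF V_cont] continuous_on_add continuous_on_const continuous_on_scaleR continuous_on_id) auto
  have "V (h *\<^sub>R x) = V (x0 + s *\<^sub>R (a + s *\<^sub>R x))" for x
    using s by (simp add: a_def scaleR_right_diff_distrib)
  then have eV: "?S * (LINT x|lborel. V (h *\<^sub>R x) * (u x)\<^sup>2) = (LINT y|lborel. V (x0 + s *\<^sub>R y) * (\<beta> y)\<^sup>2)"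
    using lborel_integral_affine[of "\<lambda>y. V (x0 + s *\<^sub>R y) * (\<beta> y)\<^sup>2" s a] s
      borel_measurable_continuous_onI[OF continuous_on_mult[OF Vc continuous_on_power[OF bc(1)]]] by (simp add: u_def)
  have eN: "?S * (LINT x|lborel. (u x)\<^sup>2) = (LINT y|lborel. (\<beta> (y::real^'n))\<^sup>2)"
    using lborel_integral_affine[of "\<lambda>y::real^'n. (\<beta> y)\<^sup>2" s a] s
      borel_measurable_continuous_onI[OF continuous_on_power[OF bc(1)]] by (simp add: u_def)
  have eK: "?S * (LINT x|lborel. (pd i u x)\<^sup>2) = h * (LINT y|lborel. (pd i \<beta> (y::real^'n))\<^sup>2)" for i
    using lborel_integral_affine[of "\<lambda>y::real^'n. (pd i \<beta> y)\<^sup>2" s a] s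
      borel_measurable_continuous_onI[OF continuous_on_power[OF bc(2)]] by (simp add: pdu power_mult_distrib)
  have g0: "pd i V x0 = 0" for i using gradient_bound[of i x0] x0 by simp
  have q: "V (x0 + s *\<^sub>R y) * (\<beta> y)\<^sup>2 \<le> h * (2 * real CARD('n))\<^sup>2 * K * (\<beta> y)\<^sup>2" for y
  proof (cases "\<exists>i. 2 \<le> \<bar>y $ i\<bar>")
    case True
    then have "\<beta> y = 0" using tensor_outside[OF unit_kernel_Bs] by auto
    then show ?thesis by simp
  next
    case False
    have "(\<Sum>i\<in>UNIV. \<bar>(s *\<^sub>R y) $ i\<bar>) \<le> (\<Sum>i\<in>(UNIV::'n set). s * 2)"
      using False s by (intro sum_mono) (auto simp: abs_mult not_le intro: less_imp_le)
    then have "(\<Sum>i\<in>UNIV. \<bar>(s *\<^sub>R y) $ i\<bar>)\<^sup>2 \<le> (s * (2 * real CARD('n)))\<^sup>2"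
      by (intro power_mono) (auto simp: sum_nonneg algebra_simps)
    then have "(\<Sum>i\<in>UNIV. \<bar>(s *\<^sub>R y) $ i\<bar>)\<^sup>2 * K \<le> h * (2 * real CARD('n))\<^sup>2 * K"
      using K0 s by (intro mult_right_mono) (auto simp: power_mult_distrib)
    moreover have "\<bar>V (x0 + s *\<^sub>R y) - V x0 - dird (s *\<^sub>R y) V x0\<bar> \<le> (\<Sum>i\<in>UNIV. \<bar>(s *\<^sub>R y) $ i\<bar>)\<^sup>2 * K"
      by (rule Taylor2_bound) (use V_C2 pd2_bound in \<open>simp_all add: numeral_2_eq_2\<close>)
    moreover have "dird (s *\<^sub>R y) V x0 = 0" by (simp add: dird_def g0)
    ultimately have "V (x0 + s *\<^sub>R y) \<le> h * (2 * real CARD('n))\<^sup>2 * K" using x0 by linarith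
    then show ?thesis by (intro mult_right_mono) auto
  qed
  have "(LINT y|lborel. V (x0 + s *\<^sub>R y) * (\<beta> y)\<^sup>2) \<le> (LINT y|lborel. h * (2 * real CARD('n))\<^sup>2 * K * (\<beta> (y::real^'n))\<^sup>2)"
    by (intro integral_mono q C2c_integrable(2)[OF \<beta>_C2c] Vc continuous_on_const)
  also have "\<dots> = h * (2 * real CARD('n))\<^sup>2 * K * (LINT y|lborel. (\<beta> (y::real^'n))\<^sup>2)" by simp
  finally have V: "(LINT y|lborel. V (x0 + s *\<^sub>R y) * (\<beta> y)\<^sup>2) \<le> h * (2 * real CARD('n))\<^sup>2 * K * (LINT y|lborel. (\<beta> (y::real^'n))\<^sup>2)" .
  have "E * (LINT y|lborel. (\<beta> (y::real^'n))\<^sup>2) = ?S * (E * (LINT x|lborel. (u x)\<^sup>2))" unfolding eN[symmetric] by simp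
  also have "\<dots> \<le> ?S * energy (\<lambda>x. V (h *\<^sub>R x)) u" by (intro mult_left_mono ge u) simp
  also have "\<dots> = (\<Sum>i\<in>UNIV. h * (LINT y|lborel. (pd i \<beta> (y::real^'n))\<^sup>2)) + (LINT y|lborel. V (x0 + s *\<^sub>R y) * (\<beta> y)\<^sup>2)"
    unfolding energy_def distrib_left sum_distrib_left eV eK ..
  finally show ?thesis using V by (simp add: sum_distrib_left[symmetric] distrib_left mult.assoc)
qed

text \<open>All errors are made relative: \<open>a \<ge> c * h\<^sup>2\<close> converts
  \<open>h^3\<close> into \<open>h * a / c\<close>, and \<open>a \<le> C3 * h\<close> converts the
  product \<open>a * b\<close> into \<open>h\<close> times \<open>b\<close>. The bound on
  \<open>a\<close> is repeated in the conclusion to keep the denominator away from 0 when the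
  minimum of the original potential is nonzero.\<close>

theorem bottoms_close:
  assumes per: "lattice_periodic V" and x0: "V x0 = 0" and x1: "0 < V x1"
  shows "\<exists>C\<ge>0. \<forall>h a b. 0 < h \<longrightarrow> h \<le> 1 \<longrightarrow>
    (\<forall>u\<in>C2c. a * (LINT x|lborel. (u x)\<^sup>2) \<le> energy (\<lambda>x. V (h *\<^sub>R x)) u) \<longrightarrow>
    (\<forall>c. (\<forall>u\<in>C2c. c * (LINT x|lborel. (u x)\<^sup>2) \<le> energy (\<lambda>x. V (h *\<^sub>R x)) u) \<longrightarrow> c \<le> a) \<longrightarrow>
    (\<forall>v\<in>{v. finite {\<gamma>. v \<gamma> \<noteq> 0}}. b * (LINT \<gamma>|count. (v \<gamma>)\<^sup>2) \<le> discrete_energy (\<lambda>\<gamma>. V (h *\<^sub>R lattice_vec \<gamma>)) v) \<longrightarrow>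
    (\<forall>c. (\<forall>v\<in>{v. finite {\<gamma>. v \<gamma> \<noteq> 0}}. c * (LINT \<gamma>|count. (v \<gamma>)\<^sup>2) \<le> discrete_energy (\<lambda>\<gamma>. V (h *\<^sub>R lattice_vec \<gamma>)) v) \<longrightarrow> c \<le> b) \<longrightarrow>
    0 < a \<and> a \<le> C * h \<and> \<bar>b - a\<bar> \<le> C * h * a"
proof -
  obtain c where c: "0 < c" and low: "\<And>h u. 0 < h \<Longrightarrow> h \<le> 1 \<Longrightarrow> u \<in> C2c \<Longrightarrow> c * h\<^sup>2 * (LINT x|lborel. (u x)\<^sup>2) \<le> energy (\<lambda>x. V (h *\<^sub>R x)) u"
    using energy_lower_bound[OF per x1] by blast
  obtain C4 where C4: "0 \<le> C4" and L: "\<And>h v lam. 0 < h \<Longrightarrow> finite {\<gamma>. v \<gamma> \<noteq> 0} \<Longrightarrow> 0 \<le> lam \<Longrightarrow>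
    (\<forall>u\<in>C2c. lam * (LINT x|lborel. (u x)\<^sup>2) \<le> energy (\<lambda>x. V (h *\<^sub>R x)) u) \<Longrightarrow>
    lam * ((LINT \<gamma>|count. (v \<gamma>)\<^sup>2) - C4 * discrete_energy (\<lambda>\<gamma>. V (h *\<^sub>R lattice_vec \<gamma>)) v)
      \<le> (1 + C4 * h) * discrete_energy (\<lambda>\<gamma>. V (h *\<^sub>R lattice_vec \<gamma>)) v + C4 * h^3 * (LINT \<gamma>|count. (v \<gamma>)\<^sup>2)"
    using continuous_le_discrete by blast
  define C1 where "C1 = 4 * K * real CARD('n) + 1"
  define C2 where "C2 = (2 * real CARD('n))^3 * K"
  define NB where "NB = (LINT y|lborel. (\<beta> (y::real^'n))\<^sup>2)"
  define C3 where "C3 = ((\<Sum>i\<in>UNIV. LINT y|lborel. (pd i \<beta> (y::real^'n))\<^sup>2) + (2 * real CARD('n))\<^sup>2 * K * NB) / NB"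
  have NB: "0 < NB" unfolding NB_def by (rule \<beta>_square_pos)
  have C12: "0 \<le> C1" "0 \<le> C2" using K0 by (auto simp: C1_def C2_def)
  have "0 \<le> (\<Sum>i\<in>UNIV. LINT y|lborel. (pd i \<beta> (y::real^'n))\<^sup>2)" by (intro sum_nonneg integral_nonneg_AE) auto
  then have C3: "0 \<le> C3" unfolding C3_def using K0 NB by (intro divide_nonneg_pos add_nonneg_nonneg mult_nonneg_nonneg) auto
  \<comment> \<open>\<open>M\<close> bounds the quotient of \<open>b\<close> and \<open>a\<close>,
    which lets errors proportional to \<open>b\<close> be expressed through \<open>a\<close>.
    \<open>C5\<close> then adds the relative errors of the two one-sided estimates.\<close>
  define M where "M = 1 + C1 + C2 / c"
  define C5 where "C5 = (C1 + C2 / c) + (C4 / c + C4 * (1 + C3) * M)"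
  have M0: "0 \<le> M" using C12 c by (simp add: M_def)
  have C5: "0 \<le> C5" "C1 + C2 / c \<le> C5" "C4 / c + C4 * (1 + C3) * M \<le> C5"
    using C12 C3 C4 c M0 by (simp_all add: C5_def)
  have "0 < a \<and> a \<le> (C3 + C5) * h \<and> \<bar>b - a\<bar> \<le> (C3 + C5) * h * a"
    if h: "0 < h" "h \<le> 1"
      and a1: "\<forall>u\<in>C2c. a * (LINT x|lborel. (u x)\<^sup>2) \<le> energy (\<lambda>x. V (h *\<^sub>R x)) u"
      and a2: "\<And>c. (\<forall>u\<in>C2c. c * (LINT x|lborel. (u x)\<^sup>2) \<le> energy (\<lambda>x. V (h *\<^sub>R x)) u) \<Longrightarrow> c \<le> a"
      and b1: "\<forall>v\<in>{v. finite {\<gamma>. v \<gamma> \<noteq> 0}}. b * (LINT \<gamma>|count. (v \<gamma>)\<^sup>2) \<le> discrete_energy (\<lambda>\<gamma>. V (h *\<^sub>R lattice_vec \<gamma>)) v"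
      and b2: "\<And>c. (\<forall>v\<in>{v. finite {\<gamma>. v \<gamma> \<noteq> 0}}. c * (LINT \<gamma>|count. (v \<gamma>)\<^sup>2) \<le> discrete_energy (\<lambda>\<gamma>. V (h *\<^sub>R lattice_vec \<gamma>)) v) \<Longrightarrow> c \<le> b"
    for h a b
  proof -
    have ah: "c * h\<^sup>2 \<le> a" using low[OF h] by (intro a2) blast
    then have a0: "0 < a" using c h by (smt (verit) mult_pos_pos zero_less_power)
    have "a * NB \<le> h * (C3 * NB)"
      using trial_bound[OF x0 h(1)] a1 NB unfolding NB_def[symmetric] C3_def by simp
    then have aC: "a \<le> C3 * h" using NB by (simp add: mult_ac)
    have "h^3 = h * h\<^sup>2" by (simp add: power2_eq_square power3_eq_cube)
    also have "\<dots> \<le> h * (a / c)" using ah c h by (intro mult_left_mono) (auto simp: field_simps)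
    finally have h3: "h^3 \<le> h * a / c" by simp
    have up: "b \<le> (1 + C1 * h) * a + C2 * h^3"
    proof -
      have p: "0 < 1 + C1 * h" using C12 h by (simp add: add_pos_nonneg)
      \<comment> \<open>The comparison holds for every \<open>u\<close>, so this quotient is an
        admissible constant for the continuous form, and sharpness of \<open>a\<close> applies. The
        lower estimate uses sharpness of \<open>b\<close> in the same way.\<close>
      have "(b - C2 * h^3) / (1 + C1 * h) \<le> a"
      proof (intro a2 ballI)
        fix u :: "real^'n \<Rightarrow> real" assume u: "u \<in> C2c"
        have "b * (LINT x|lborel. (u x)\<^sup>2) \<le> (1 + C1 * h) * energy (\<lambda>x. V (h *\<^sub>R x)) u + C2 * h^3 * (LINT x|lborel. (u x)\<^sup>2)"
          unfolding C1_def C2_def by (rule discrete_le_continuous[OF u h(1)]) (use b1 in simp)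
        then have "(b - C2 * h^3) * (LINT x|lborel. (u x)\<^sup>2) \<le> (1 + C1 * h) * energy (\<lambda>x. V (h *\<^sub>R x)) u"
          by (simp add: left_diff_distrib)
        then show "(b - C2 * h^3) / (1 + C1 * h) * (LINT x|lborel. (u x)\<^sup>2) \<le> energy (\<lambda>x. V (h *\<^sub>R x)) u"
          using p by (simp add: pos_divide_le_eq mult.commute)
      qed
      then show ?thesis using p by (simp add: pos_divide_le_eq mult.commute)
    qed
    have lo: "a - C4 * h^3 \<le> (1 + C4 * h + C4 * a) * b"
    proof -
      have p: "0 < 1 + C4 * h + C4 * a" using C4 h a0 by (simp add: add_pos_nonneg)
      have "(a - C4 * h^3) / (1 + C4 * h + C4 * a) \<le> b"
      proof (intro b2 ballI)
        fix v :: "int^'n \<Rightarrow> real" assume v: "v \<in> {v. finite {\<gamma>. v \<gamma> \<noteq> 0}}"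
        define q where "q = discrete_energy (\<lambda>\<gamma>. V (h *\<^sub>R lattice_vec \<gamma>)) v"
        define n where "n = (LINT \<gamma>|count. (v \<gamma>)\<^sup>2)"
        have "a * (n - C4 * q) \<le> (1 + C4 * h) * q + C4 * h^3 * n"
          unfolding n_def q_def using v a0 by (intro L h a1) auto
        then have "(a - C4 * h^3) * n \<le> (1 + C4 * h + C4 * a) * q" by (simp add: algebra_simps)
        then have "(a - C4 * h^3) / (1 + C4 * h + C4 * a) * n \<le> q"
          using p by (simp add: pos_divide_le_eq mult.commute)
        then show "(a - C4 * h^3) / (1 + C4 * h + C4 * a) * (LINT \<gamma>|count. (v \<gamma>)\<^sup>2) \<le> discrete_energy (\<lambda>\<gamma>. V (h *\<^sub>R lattice_vec \<gamma>)) v"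
          by (simp add: n_def q_def)
      qed
      then show ?thesis using p by (simp add: pos_divide_le_eq mult.commute)
    qed
    have b0: "0 \<le> b" using discrete_energy_nonneg by (intro b2) auto
    have k2: "C2 * h^3 \<le> C2 / c * h * a" using mult_left_mono[OF h3 C12(2)] by (simp add: mult_ac)
    have k4: "C4 * h^3 \<le> C4 / c * h * a" using mult_left_mono[OF h3 C4] by (simp add: mult_ac)
    have ba: "b - a \<le> (C1 + C2 / c) * h * a" using up k2 by (simp add: algebra_simps)
    have bM: "b \<le> M * a"
    proof -
      have "(C1 + C2 / c) * h * a \<le> (C1 + C2 / c) * 1 * a" using h a0 C12 c by (intro mult_right_mono mult_left_mono) auto
      with ba show ?thesis by (simp add: M_def algebra_simps)
    qed
    \<comment> \<open>The cross term \<open>C4 * (h + a) * b\<close> is handled with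
      \<open>a \<le> C3 * h\<close> and \<open>b \<le> M * a\<close>.\<close>
    have ab: "a - b \<le> (C4 / c + C4 * (1 + C3) * M) * h * a"
    proof -
      have "a - b \<le> C4 * h^3 + C4 * (h + a) * b" using lo by (simp add: algebra_simps)
      also have "C4 * (h + a) * b \<le> C4 * ((1 + C3) * h) * (M * a)"
        using C4 C3 aC bM b0 h a0 by (intro mult_mono mult_left_mono) (auto simp: distrib_right)
      finally show ?thesis using k4 by (simp add: algebra_simps)
    qed
    have "(C1 + C2 / c) * h * a \<le> (C3 + C5) * h * a" "(C4 / c + C4 * (1 + C3) * M) * h * a \<le> (C3 + C5) * h * a"
      using C5 C3 h a0 by (auto intro!: mult_right_mono)
    moreover have "C3 * h \<le> (C3 + C5) * h" using C5 h by (intro mult_right_mono) auto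
    ultimately show ?thesis using a0 aC ab ba by (intro conjI) linarith+
  qed
  moreover have "0 \<le> C3 + C5" using C3 C5 by simp
  ultimately show ?thesis by blast
qed

end

section \<open>Restoring the minimum of the potential and forming the quotient\<close>

lemma energy_add_const:
  assumes W: "continuous_on UNIV W" and u: "u \<in> C2c"
  shows "energy (\<lambda>x. m + W x) u = m * (LINT x|lborel. (u x)\<^sup>2) + energy W u"
proof -
  have "(LINT x|lborel. (m + W x) * (u x)\<^sup>2) = m * (LINT x|lborel. (u x)\<^sup>2) + (LINT x|lborel. W x * (u x)\<^sup>2)"
    using C2c_integrable(2)[OF u W] C2c_integrable(2)[OF u continuous_on_const[of UNIV m]] by (simp add: distrib_right)
  then show ?thesis by (simp add: energy_def)
qed

lemma discrete_energy_add_const: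
  assumes v: "finite {\<gamma>. v \<gamma> \<noteq> 0}"
  shows "discrete_energy (\<lambda>\<gamma>. m + U \<gamma>) v = m * (LINT \<gamma>|count. (v \<gamma>)\<^sup>2) + discrete_energy U v"
proof -
  have "integrable count (\<lambda>\<gamma>. f \<gamma> * (v \<gamma>)\<^sup>2)" for f
    by (rule integrable_finite_support, rule finite_subset[OF _ v]) auto
  from this[of U] this[of "\<lambda>_. m"]
  have "(LINT \<gamma>|count. (m + U \<gamma>) * (v \<gamma>)\<^sup>2) = m * (LINT \<gamma>|count. (v \<gamma>)\<^sup>2) + (LINT \<gamma>|count. U \<gamma> * (v \<gamma>)\<^sup>2)"
    by (simp add: distrib_right)
  then show ?thesis by (simp add: discrete_energy_def)
qed

context bounded_potential begin

lemma min_spec_c_shifted: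
  assumes ge: "\<forall>u\<in>C2c. E * (LINT x|lborel. (u x)\<^sup>2) \<le> energy (\<lambda>x. V (h *\<^sub>R x)) u"
    and sharp: "\<And>c. (\<forall>u\<in>C2c. c * (LINT x|lborel. (u x)\<^sup>2) \<le> energy (\<lambda>x. V (h *\<^sub>R x)) u) \<Longrightarrow> c \<le> E"
  shows "min_spec_c (\<lambda>x. m + V x) h = m + E"
proof -
  have P: "P_c (\<lambda>x. m + V x) h = (\<lambda>u x. - laplacian u x + complex_of_real (m + V (h *\<^sub>R x)) * u x)"
    by (intro ext) (simp add: P_c_def)
  show ?thesis unfolding min_spec_c_def P
  proof (rule min_spec_Schroedinger)
    show "continuous_on UNIV (\<lambda>x. m + V (h *\<^sub>R x))" by (intro continuous_intros scaled_cont)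
    show "\<bar>m + V (h *\<^sub>R x)\<bar> \<le> \<bar>m\<bar> + K" for x using V_nonneg[of "h *\<^sub>R x"] V_bound[of "h *\<^sub>R x"] by linarith
    show "(m + E) * (LINT x|lborel. (u x)\<^sup>2) \<le> energy (\<lambda>x. m + V (h *\<^sub>R x)) u" if "u \<in> C2c" for u
      using bspec[OF ge that] by (simp add: energy_add_const[OF scaled_cont that] distrib_right)
    show "c \<le> m + E" if "\<And>u. u \<in> C2c \<Longrightarrow> c * (LINT x|lborel. (u x)\<^sup>2) \<le> energy (\<lambda>x. m + V (h *\<^sub>R x)) u" for c
    proof -
      have "c - m \<le> E"
      proof (intro sharp ballI)
        fix u :: "real^'n \<Rightarrow> real" assume u: "u \<in> C2c"
        show "(c - m) * (LINT x|lborel. (u x)\<^sup>2) \<le> energy (\<lambda>x. V (h *\<^sub>R x)) u"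
          using that[OF u] by (simp add: energy_add_const[OF scaled_cont u] left_diff_distrib)
      qed
      then show ?thesis by simp
    qed
  qed
qed

lemma min_spec_d_shifted:
  assumes ge: "\<forall>v\<in>{v. finite {\<gamma>. v \<gamma> \<noteq> 0}}. E * (LINT \<gamma>|count. (v \<gamma>)\<^sup>2) \<le> discrete_energy (\<lambda>\<gamma>. V (h *\<^sub>R lattice_vec \<gamma>)) v"
    and sharp: "\<And>c. (\<forall>v\<in>{v. finite {\<gamma>. v \<gamma> \<noteq> 0}}. c * (LINT \<gamma>|count. (v \<gamma>)\<^sup>2) \<le> discrete_energy (\<lambda>\<gamma>. V (h *\<^sub>R lattice_vec \<gamma>)) v) \<Longrightarrow> c \<le> E"
  shows "min_spec_d (\<lambda>x. m + V x) h = m + E"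
proof -
  have P: "P_d (\<lambda>x. m + V x) h = (\<lambda>v \<gamma>. (\<Sum>j\<in>UNIV. 2 * v \<gamma> - v (\<gamma> + axis j 1) - v (\<gamma> - axis j 1)) + complex_of_real (m + V (h *\<^sub>R lattice_vec \<gamma>)) * v \<gamma>)"
    by (intro ext) (simp add: P_d_def)
  show ?thesis unfolding min_spec_d_def P
  proof (rule min_spec_discrete)
    show "\<bar>m + V (h *\<^sub>R lattice_vec \<gamma>)\<bar> \<le> \<bar>m\<bar> + K" for \<gamma> using V_nonneg[of "h *\<^sub>R lattice_vec \<gamma>"] V_bound[of "h *\<^sub>R lattice_vec \<gamma>"] by linarith
    show "(m + E) * (LINT \<gamma>|count. (v \<gamma>)\<^sup>2) \<le> discrete_energy (\<lambda>\<gamma>. m + V (h *\<^sub>R lattice_vec \<gamma>)) v" if "finite {\<gamma>. v \<gamma> \<noteq> 0}" for v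
      using bspec[OF ge, of v] that by (simp add: discrete_energy_add_const[OF that] distrib_right)
    show "c \<le> m + E" if "\<And>v. finite {\<gamma>. v \<gamma> \<noteq> 0} \<Longrightarrow> c * (LINT \<gamma>|count. (v \<gamma>)\<^sup>2) \<le> discrete_energy (\<lambda>\<gamma>. m + V (h *\<^sub>R lattice_vec \<gamma>)) v" for c
    proof -
      have "c - m \<le> E"
      proof (intro sharp ballI)
        fix v :: "int^'n \<Rightarrow> real" assume "v \<in> {v. finite {\<gamma>. v \<gamma> \<noteq> 0}}"
        then have v: "finite {\<gamma>. v \<gamma> \<noteq> 0}" by simp
        show "(c - m) * (LINT \<gamma>|count. (v \<gamma>)\<^sup>2) \<le> discrete_energy (\<lambda>\<gamma>. V (h *\<^sub>R lattice_vec \<gamma>)) v"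
          using that[OF v] by (simp add: discrete_energy_add_const[OF v] left_diff_distrib)
      qed
      then show ?thesis by simp
    qed
  qed
qed

end

theorem mainTheorem1:
  fixes V :: "real^'n \<Rightarrow> real"
  assumes "smooth V"
    and "lattice_periodic V"
    and "\<exists>F. fundamental_domain F \<and> (\<forall>x\<in>frontier F. V x > (LEAST m. m \<in> range V))"
  shows "\<exists>C>0. \<exists>h\<^sub>0>0. \<forall>h. 0 < h \<and> h < h\<^sub>0 \<longrightarrow>
           \<bar>min_spec_d V h / min_spec_c V h - 1\<bar> \<le> C * h"
proof -
  obtain x0 where x0: "\<And>x. V x0 \<le> V x"
    using periodic_attains_min[OF C_k_continuous[OF smooth_C_k[OF assms(1)]] assms(2)] by blast
  have least: "(LEAST m. m \<in> range V) = V x0" by (rule Least_equality) (use x0 in auto)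
  obtain x1 where x1: "V x0 < V x1" using assms(3) frontier_fundamental_domain unfolding least by blast
  define m where "m = V x0"
  define V0 where "V0 x = V x - m" for x
  have "smooth V0" unfolding V0_def[abs_def] smooth_def by (intro allI C_k_diff C_k_const smooth_C_k assms(1))
  moreover have per: "lattice_periodic V0" using assms(2) by (simp add: lattice_periodic_def V0_def)
  moreover have "0 \<le> V0 x" for x using x0 by (simp add: V0_def m_def)
  ultimately obtain K where "bounded_potential V0 K" using periodic_bounded_potential by blast
  then interpret bounded_potential V0 K .
  have "V0 x0 = 0" "0 < V0 x1" using x1 by (auto simp: V0_def m_def)
  from bottoms_close[OF per this] obtain C where C: "0 \<le> C" and close: "\<And>h a b. 0 < h \<Longrightarrow> h \<le> 1 \<Longrightarrow>
    (\<forall>u\<in>C2c. a * (LINT x|lborel. (u x)\<^sup>2) \<le> energy (\<lambda>x. V0 (h *\<^sub>R x)) u) \<Longrightarrow>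
    (\<forall>c. (\<forall>u\<in>C2c. c * (LINT x|lborel. (u x)\<^sup>2) \<le> energy (\<lambda>x. V0 (h *\<^sub>R x)) u) \<longrightarrow> c \<le> a) \<Longrightarrow>
    (\<forall>v\<in>{v. finite {\<gamma>. v \<gamma> \<noteq> 0}}. b * (LINT \<gamma>|count. (v \<gamma>)\<^sup>2) \<le> discrete_energy (\<lambda>\<gamma>. V0 (h *\<^sub>R lattice_vec \<gamma>)) v) \<Longrightarrow>
    (\<forall>c. (\<forall>v\<in>{v. finite {\<gamma>. v \<gamma> \<noteq> 0}}. c * (LINT \<gamma>|count. (v \<gamma>)\<^sup>2) \<le> discrete_energy (\<lambda>\<gamma>. V0 (h *\<^sub>R lattice_vec \<gamma>)) v) \<longrightarrow> c \<le> b) \<Longrightarrow>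
    0 < a \<and> a \<le> C * h \<and> \<bar>b - a\<bar> \<le> C * h * a" by blast
  have V: "V = (\<lambda>x. m + V0 x)" by (simp add: V0_def fun_eq_iff)
  have bound: "\<exists>a b. min_spec_c V h = m + a \<and> min_spec_d V h = m + b \<and> 0 < a \<and> a \<le> C * h \<and> \<bar>b - a\<bar> \<le> C * h * a"
    if h: "0 < h" "h \<le> 1" for h
  proof -
    obtain a where a: "\<forall>u\<in>C2c. a * (LINT x|lborel. (u x)\<^sup>2) \<le> energy (\<lambda>x. V0 (h *\<^sub>R x)) u"
      "\<forall>c. (\<forall>u\<in>C2c. c * (LINT x|lborel. (u x)\<^sup>2) \<le> energy (\<lambda>x. V0 (h *\<^sub>R x)) u) \<longrightarrow> c \<le> a"
      using ex_continuous_bottom[of h] by (elim exE conjE)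
    obtain b where b: "\<forall>v\<in>{v. finite {\<gamma>. v \<gamma> \<noteq> 0}}. b * (LINT \<gamma>|count. (v \<gamma>)\<^sup>2) \<le> discrete_energy (\<lambda>\<gamma>. V0 (h *\<^sub>R lattice_vec \<gamma>)) v"
      "\<forall>c. (\<forall>v\<in>{v. finite {\<gamma>. v \<gamma> \<noteq> 0}}. c * (LINT \<gamma>|count. (v \<gamma>)\<^sup>2) \<le> discrete_energy (\<lambda>\<gamma>. V0 (h *\<^sub>R lattice_vec \<gamma>)) v) \<longrightarrow> c \<le> b"
      using ex_discrete_bottom[of h] by (elim exE conjE)
    have "min_spec_c V h = m + a" unfolding V by (rule min_spec_c_shifted[OF a(1) mp[OF spec[OF a(2)]]])
    moreover have "min_spec_d V h = m + b" unfolding V by (rule min_spec_d_shifted[OF b(1) mp[OF spec[OF b(2)]]])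
    ultimately show ?thesis using close[OF h a b] by blast
  qed
  define C' where "C' = C + 1"
  \<comment> \<open>For \<open>m \<noteq> 0\<close> this makes
    \<open>a \<le> \<bar>m\<bar> / 2\<close>, so that \<open>m + a\<close> stays away from 0 even
    for negative \<open>m\<close>; the summand 1 avoids division by 0 when
    \<open>C = 0\<close>.\<close>
  define h0 where "h0 = (if m = 0 then 1 else min 1 (\<bar>m\<bar> / (2 * C + 1)))"
  have "\<bar>min_spec_d V h / min_spec_c V h - 1\<bar> \<le> C' * h" if h: "0 < h" "h < h0" for h
  proof -
    have h1: "h \<le> 1" using h by (auto simp: h0_def split: if_splits)
    obtain a b where ab: "min_spec_c V h = m + a" "min_spec_d V h = m + b" "0 < a" "a \<le> C * h" "\<bar>b - a\<bar> \<le> C * h * a"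
      using bound[OF h(1) h1] by blast
    show ?thesis
    proof (cases "m = 0")
      case True
      \<comment> \<open>With minimum 0 the denominator itself tends to 0, and the relative form of
        the estimate is used at full strength.\<close>
      have "\<bar>b / a - 1\<bar> = \<bar>b - a\<bar> / a" using ab(3) by (simp add: divide_simps abs_if)
      also have "\<dots> \<le> C * h" using ab(3,5) by (simp add: pos_divide_le_eq)
      also have "\<dots> \<le> C' * h" using True h by (simp add: C'_def)
      finally show ?thesis using True ab by simp
    next
      case False
      then have "h < \<bar>m\<bar> / (2 * C + 1)" using h by (simp add: h0_def)
      then have "h * (2 * C + 1) < \<bar>m\<bar>" using C by (simp add: pos_less_divide_eq)
      then have "2 * (C * h) < \<bar>m\<bar>" using h by (simp add: algebra_simps)
      then have ma: "\<bar>m\<bar> / 2 \<le> \<bar>m + a\<bar>" "a \<le> \<bar>m\<bar> / 2" using ab(3,4) by (auto simp: abs_if)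
      have p: "0 < \<bar>m\<bar>" "m + a \<noteq> 0" using False ma(1) by auto
      have eq: "(m + b) / (m + a) - 1 = (b - a) / (m + a)"
        using p(2) by (simp add: field_simps)
      have "\<bar>(m + b) / (m + a) - 1\<bar> = \<bar>b - a\<bar> / \<bar>m + a\<bar>"
        unfolding eq by (rule abs_divide)
      \<comment> \<open>The numerator is at most
        \<open>C * h * a \<le> C * h * (\<bar>m\<bar> / 2)\<close>, and the denominator is at least
        \<open>\<bar>m\<bar> / 2\<close>.\<close>
      also have "\<dots> \<le> (C * h * (\<bar>m\<bar> / 2)) / (\<bar>m\<bar> / 2)"
        using ab(5) ma p C h mult_left_mono[OF ma(2), of "C * h"] by (intro frac_le) auto
      also have "\<dots> = C * h" using p by simp
      also have "\<dots> \<le> C' * h" using h C by (intro mult_right_mono) (auto simp: C'_def)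
      finally show ?thesis using ab by simp
    qed
  qed
  moreover have "0 < h0" using C by (simp add: h0_def)
  moreover have "0 < C'" using C by (simp add: C'_def add_pos_nonneg)
  ultimately show ?thesis by blast
qed

end
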